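(* Let $n,N$ be positive integers and let $A\in L^\infty(\mathbf R^n,\mathcal L(\mathbf C^N\oplus\mathbf C^{nN}))$ be such that, for some $\kappa>0$, $$\mathrm{Re}\left(A\begin{bmatrix}f\\ \nabla_x g\end{bmatrix},\begin{bmatrix}f\\ \nabla_x g\end{bmatrix}\right)\ge\kappa\big(\|f\|^2+\|\nabla_x g\|^2\big)\qquad\text{for all } f\in L^2(\mathbf R^n,\mathbf C^N),\ g\in\dot H^1(\mathbf R^n,\mathbf C^N).$$ Assume in addition that $A$ is self-adjoint. Then the Neumann problem for the system $\mathrm{div}_{t,x}A(x)\nabla_{t,x}F(t,x)=0$ on $\mathbf R^{1+n}_+$ is well-posed in the $L^\infty(L^2)$ sense.
   Context: $\mathbf R^{1+n}_+=\{(t,x): t>0,\ x\in\mathbf R^n\}$, $\mathbf R_+=(0,\infty)$; $(\cdot,\cdot)$ and $\|\cdot\|$ are the $L^2(\mathbf R^n)$ hermitian product and norm. The coefficients $A=A(x)$ do not depend on $t$; write $A=(A_{ij})_{0\le i,j\le n}$ with $A_{ij}(x)\in\mathcal L(\mathbf C^N)$, index $0$ corresponding to the variable $t$. Functions $U$ with values in $\mathbf C^N\oplus\mathbf C^{nN}$ are written $U=(U_0,\mathbf U)$, $U_0$ being $\mathbf C^N$-valued; $U$ plays the role of $\nabla_{t,x}F$. "Well-posed in the $L^\infty(L^2)$ sense" means: given any $w\in L^2(\mathbf R^n,\mathbf C^N)$ there exists a unique function $U\in C^1(\mathbf R_+,L^2(\mathbf R^n,\mathbf C^N\oplus\mathbf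 C^{nN}))$ which satisfies $$\mathrm{div}_{t,x}A(x)U(t,x)=0,\qquad \mathrm{curl}_{t,x}U(t,x)=0$$ on $\mathbf R^{1+n}_+$, as well as $\lim_{t\to\infty}U(t,\cdot)=0$ and $\lim_{t\to0}U(t,\cdot)=u$ in the $L^2$ sense, where $(Au)_0=\sum_{j=0}^nA_{0,j}u_j=w$ on $\mathbf R^n$. (Differential equations are understood in the distributional sense; $\mathrm{curl}_{t,x}U=0$ means $\partial_iU_j=\partial_jU_i$ for $0\le i,j\le n$, $\partial_0=\partial_t$.) *)

theory Defs
  imports "HOL-Analysis.Analysis"
begin

text \<open>
  Elements of \<open>L\<^sup>2\<close>, \<open>L\<^sup>\<infinity>\<close> and of the homogeneous Sobolev space are
  represented by functions; two functions stand for the same element iff they agree almost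
  everywhere. The index type \<open>'n option\<close> is \<open>{0, 1, ..., n}\<close>: \<open>None\<close> is the index 0 of the
  variable \<open>t\<close> and \<open>Some j\<close> is the index of \<open>x\<^sub>j\<close>. Thus
  \<open>(complex^'N)^('n option)\<close> is \<open>C\<^sup>N \<oplus> C\<^sup>n\<^sup>N\<close>.
\<close>

definition L2 :: "('a::euclidean_space \<Rightarrow> 'b::euclidean_space) set" where
  "L2 = {f \<in> borel_measurable lebesgue. integrable lebesgue (\<lambda>x. (norm (f x))\<^sup>2)}"

definition L2_norm :: "('a::euclidean_space \<Rightarrow> 'b::euclidean_space) \<Rightarrow> real" where
  "L2_norm f = sqrt (LINT x|lebesgue. (norm (f x))\<^sup>2)"

definition Linfty :: "('a::euclidean_space \<Rightarrow> 'b::euclidean_space) set" where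
  "Linfty = {f \<in> borel_measurable lebesgue. \<exists>C. AE x in lebesgue. norm (f x) \<le> C}"

definition locally_integrable :: "('a::euclidean_space \<Rightarrow> 'b::euclidean_space) \<Rightarrow> bool" where
  "locally_integrable f \<longleftrightarrow> (\<forall>K. compact K \<longrightarrow> set_integrable lebesgue K f)"

definition hermitian :: "(complex^'N)^'i \<Rightarrow> (complex^'N)^'i \<Rightarrow> complex" where
  "hermitian u v = (\<Sum>i\<in>UNIV. \<Sum>\<alpha>\<in>UNIV. u $ i $ \<alpha> * cnj (v $ i $ \<alpha>))"

definition L2_inner ::
  "('a::euclidean_space \<Rightarrow> (complex^'N)^'i) \<Rightarrow> ('a \<Rightarrow> (complex^'N)^'i) \<Rightarrow> complex" where
  "L2_inner f g = (LINT x|lebesgue. hermitian (f x) (g x))"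

text \<open>A block matrix \<open>M = (M\<^sub>i\<^sub>j)\<close> with entries \<open>M\<^sub>i\<^sub>j\<close> in
  \<open>L(C\<^sup>N)\<close>, acting on \<open>u = (u\<^sub>j)\<close>.\<close>

definition block_mult ::
  "((complex^'N^'N)^'i)^'i \<Rightarrow> (complex^'N)^'i \<Rightarrow> (complex^'N)^'i" where
  "block_mult M u = (\<chi> i. \<Sum>j\<in>UNIV. (M $ i $ j) *v (u $ j))"

definition self_adjoint_block :: "((complex^'N^'N)^'i)^'i \<Rightarrow> bool" where
  "self_adjoint_block M \<longleftrightarrow>
     (\<forall>u v. hermitian (block_mult M u) v = hermitian u (block_mult M v))"

definition join :: "complex^'N \<Rightarrow> (complex^'N)^'n \<Rightarrow> (complex^'N)^('n option)" where
  "join f G = (\<chi> i. case i of None \<Rightarrow> f | Some j \<Rightarrow> G $ j)"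


subsection \<open>Test functions\<close>

fun Ck :: "nat \<Rightarrow> ('a::euclidean_space \<Rightarrow> 'b::real_normed_vector) \<Rightarrow> bool" where
  "Ck 0 f \<longleftrightarrow> continuous_on UNIV f"
| "Ck (Suc k) f \<longleftrightarrow> f differentiable_on UNIV \<and>
     (\<forall>b\<in>Basis. Ck k (\<lambda>x. frechet_derivative f (at x) b))"

definition test_function :: "'a::euclidean_space set \<Rightarrow> ('a \<Rightarrow> complex) \<Rightarrow> bool" where
  "test_function \<Omega> \<phi> \<longleftrightarrow>
     (\<forall>k. Ck k \<phi>) \<and> (\<exists>K. compact K \<and> K \<subseteq> \<Omega> \<and> (\<forall>z. z \<notin> K \<longrightarrow> \<phi> z = 0))"


subsection \<open>The homogeneous Sobolev space on \<open>R\<^sup>n\<close>\<close>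

definition weak_gradient ::
  "(real^'n \<Rightarrow> complex^'N) \<Rightarrow> (real^'n \<Rightarrow> (complex^'N)^'n) \<Rightarrow> bool" where
  "weak_gradient g G \<longleftrightarrow> locally_integrable g \<and> locally_integrable G \<and>
     (\<forall>\<phi> j \<alpha>. test_function UNIV \<phi> \<longrightarrow>
        (LINT x|lebesgue. g x $ \<alpha> * frechet_derivative \<phi> (at x) (axis j 1))
        = - (LINT x|lebesgue. G x $ j $ \<alpha> * \<phi> x))"

text \<open>All distributions with gradient in \<open>L\<^sup>2\<close> are locally integrable functions. Elements
  of the homogeneous space are usually taken modulo constants; only gradients are used below, so
  no quotient is formed.\<close>

definition Hdot1 :: "(real^'n \<Rightarrow> complex^'N) set" where
  "Hdot1 = {g. \<exists>G\<in>L2. weak_gradient g G}"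


subsection \<open>The differential equations on the half-space\<close>

definition half_space :: "(real \<times> (real^'n)) set" where
  "half_space = {0<..} \<times> UNIV"

definition pderiv_tx ::
  "'n option \<Rightarrow> (real \<times> (real^'n) \<Rightarrow> complex) \<Rightarrow> real \<Rightarrow> real^'n \<Rightarrow> complex" where
  "pderiv_tx i \<phi> t x = frechet_derivative \<phi> (at (t, x))
     (case i of None \<Rightarrow> (1, 0) | Some j \<Rightarrow> (0, axis j 1))"

text \<open>Distributional equations for functions \<open>U\<close> of \<open>t > 0\<close> that are continuous with values in
  \<open>L\<^sup>2\<close>. The distribution given by such a function is defined by an iterated integral: the
  inner integral is a continuous function of \<open>t\<close> with compact support in \<open>{0<..}\<close>, and does not
  depend on the representatives chosen for the single \<open>U t\<close>, so that no joint measurability of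
  the representatives is needed.\<close>

definition div_free :: "(real \<Rightarrow> real^'n \<Rightarrow> (complex^'N)^('n option)) \<Rightarrow> bool" where
  "div_free V \<longleftrightarrow> (\<forall>\<phi> \<alpha>. test_function half_space \<phi> \<longrightarrow>
     (LINT t:{0<..}|lebesgue. (LINT x|lebesgue.
        (\<Sum>i\<in>UNIV. V t x $ i $ \<alpha> * pderiv_tx i \<phi> t x))) = 0)"

definition curl_free :: "(real \<Rightarrow> real^'n \<Rightarrow> (complex^'N)^('n option)) \<Rightarrow> bool" where
  "curl_free U \<longleftrightarrow> (\<forall>\<phi> i j \<alpha>. test_function half_space \<phi> \<longrightarrow>
     (LINT t:{0<..}|lebesgue. (LINT x|lebesgue. U t x $ j $ \<alpha> * pderiv_tx i \<phi> t x))
     = (LINT t:{0<..}|lebesgue. (LINT x|lebesgue. U t x $ i $ \<alpha> * pderiv_tx j \<phi> t x)))"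

text \<open>\<open>C\<^sup>1\<close> functions from \<open>(0,\<infinity>)\<close> to \<open>L\<^sup>2\<close>, with the derivative taken in the
  \<open>L\<^sup>2\<close> norm; values at \<open>t \<le> 0\<close> are irrelevant here and below.\<close>

definition C1_L2 :: "(real \<Rightarrow> 'a::euclidean_space \<Rightarrow> 'b::euclidean_space) \<Rightarrow> bool" where
  "C1_L2 U \<longleftrightarrow> (\<exists>U'. \<forall>t>0. U t \<in> L2 \<and> U' t \<in> L2 \<and>
     ((\<lambda>h. L2_norm (\<lambda>x. (U (t + h) x - U t x) /\<^sub>R h - U' t x)) \<longlongrightarrow> 0) (at 0) \<and>
     ((\<lambda>s. L2_norm (\<lambda>x. U' s x - U' t x)) \<longlongrightarrow> 0) (at t))"

definition neumann_solution ::
  "(real^'n \<Rightarrow> ((complex^'N^'N)^('n option))^('n option)) \<Rightarrow> (real^'n \<Rightarrow> complex^'N) \<Rightarrow>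
   (real \<Rightarrow> real^'n \<Rightarrow> (complex^'N)^('n option)) \<Rightarrow> bool" where
  "neumann_solution A w U \<longleftrightarrow>
     C1_L2 U \<and>
     div_free (\<lambda>t x. block_mult (A x) (U t x)) \<and> curl_free U \<and>
     ((\<lambda>t. L2_norm (U t)) \<longlongrightarrow> 0) at_top \<and>
     (\<exists>u\<in>L2. ((\<lambda>t. L2_norm (\<lambda>x. U t x - u x)) \<longlongrightarrow> 0) (at_right 0) \<and>
        (AE x in lebesgue. block_mult (A x) (u x) $ None = w x))"

text \<open>Well-posedness in the \<open>L\<^sup>\<infinity>(L\<^sup>2)\<close> sense; uniqueness is as a function from
  \<open>(0,\<infinity>)\<close> to \<open>L\<^sup>2\<close>.\<close>

definition neumann_well_posed ::
  "(real^'n \<Rightarrow> ((complex^'N^'N)^('n option))^('n option)) \<Rightarrow> bool" where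
  "neumann_well_posed A \<longleftrightarrow> (\<forall>w\<in>L2.
     (\<exists>U. neumann_solution A w U) \<and>
     (\<forall>U V. neumann_solution A w U \<and> neumann_solution A w V \<longrightarrow>
        (\<forall>t>0. AE x in lebesgue. U t x = V t x)))"

end

theory Submission
  imports Defs
begin

text \<open>
  Let \<open>\<H> = L\<^sup>2(R\<^sup>n, C\<^sup>N) \<times> L\<^sup>2(R\<^sup>n, C\<^sup>n\<^sup>N)\<close>, viewed as a real Hilbert space, let \<open>G\<close> be the graph of the
  closed operator \<open>\<nabla>\<^sub>x\<close> and let \<open>A\<close> act on \<open>\<H>\<close> by multiplication. Write \<open>u = (u\<^sub>0, u\<^sub>1)\<close>,
  \<open>w u = (A u)\<^sub>0\<close> and \<open>q u = (A u)\<^sub>1\<close>. Since \<open>A\<close> does not depend on \<open>t\<close>, the equations for a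
  \<open>C\<^sup>1\<close> curve \<open>U\<close> with derivative \<open>V\<close> are, at every time, the linear relation \<open>(U t, V t) \<in> flow\<close>:
  \<open>(U\<^sub>0, V\<^sub>1) \<in> G\<close> (the part of the curl equation that contains a \<open>t\<close>-derivative) and
  \<open>\<langle>w V, g\<rangle> = \<langle>q U, y\<rangle>\<close> for all \<open>(g, y) \<in> G\<close> (the divergence equation). The remaining part of the
  curl equation says that \<open>U\<^sub>1\<close> is tangentially curl free; it follows because \<open>U\<^sub>1\<close> lies in the
  closed range of the gradient. Only these structural facts enter the analysis, so that it takes
  place in an abstract locale (\<open>first_order_system\<close>).

  Self-adjointness enters through the Rellich identity. The symmetric form
  \<open>\<langle>R u, v\<rangle> = \<langle>A (u\<^sub>0, 0), (v\<^sub>0, 0)\<rangle> - \<langle>A (0, u\<^sub>1), (0, v\<^sub>1)\<rangle>\<close> satisfies \<open>\<langle>R u, v\<rangle> = 0\<close> on \<open>flow\<close>, hence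
  \<open>\<langle>R (U t), U t\<rangle>\<close> is constant, and it vanishes since \<open>U\<close> tends to zero. As
  \<open>\<langle>A u, u\<rangle> + \<langle>R u, u\<rangle> = 2 \<langle>w u, u\<^sub>0\<rangle>\<close>, coercivity gives that \<open>\<parallel>U t\<parallel>\<close> is comparable both to the Neumann
  datum \<open>w (U t)\<close> and to the Dirichlet datum \<open>U\<^sub>0 t\<close> (\<open>rellich_estimate\<close>).

  Uniqueness (\<open>neumann_unique\<close>): a solution with \<open>w u = 0\<close> has \<open>u = 0\<close> by the Rellich estimate. With
  the potential \<open>F t = \<integral>\<^sub>0\<^sup>t U\<^sub>0\<close>, the energy flux \<open>\<langle>w, F\<rangle>\<close> of a difference of two translates of \<open>U\<close>
  is nondecreasing, nonnegative at \<open>0\<close> and tends to zero at infinity. Hence the energy density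
  of the difference vanishes, \<open>U\<close> is constant, and therefore zero.

  Existence (\<open>neumann_exists\<close>): minimising the energy over compactly supported potentials with given
  initial value and smoothing in \<open>t\<close> produces decaying solutions whose potentials have initial values
  dense in \<open>L\<^sup>2\<close> (\<open>dirichlet_problem\<close>). The point is to pass from this class to arbitrary Neumann
  data. A potential \<open>\<Phi>\<close> with \<open>\<Phi>' = U\<^sub>0\<close> satisfies \<open>\<parallel>\<Phi> t\<parallel> \<le> K \<parallel>\<Phi> 0\<parallel>\<close> and \<open>t \<parallel>U t\<parallel> \<le> K \<parallel>\<Phi> 0\<parallel>\<close>
  (\<open>bound_by_initial_value\<close>, \<open>derivative_bound_by_initial_value\<close>); these follow from monotone
  quantities built with the energy flux, from Green's formula and from the Rellich identity.
  Applied to \<open>U\<^sub>0\<close> as the potential of \<open>V\<close>, they bound \<open>\<parallel>U t\<parallel>\<close> and \<open>t \<parallel>V t\<parallel>\<close> by \<open>\<parallel>w (U 0)\<parallel>\<close>. Since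
  the data \<open>w (U 0)\<close> are dense (\<open>conormal_data_dense\<close>), solutions for arbitrary data are obtained as
  uniform limits.

  Concretely, \<open>L\<^sup>2\<close> is made into a Hilbert space, \<open>\<nabla>\<^sub>x\<close> is shown to be closed, injective and densely
  defined with the test functions as a core (\<open>grad_graph_extend\<close>), and the distributional equations on
  the half-space are shown to be equivalent to \<open>flow\<close> (\<open>weak_evolution\<close>, \<open>neumann_solution_iff\<close>).
\<close>

section \<open>Hilbert space preliminaries\<close>

text \<open>Cauchy-Schwarz for a nonnegative form that may be degenerate; no inner product is at hand when the form is the energy
  restricted to a line of competitors.\<close>

lemma quadratic_form_bound:
  fixes a b c :: real
  assumes nonneg: "\<And>s. 0 \<le> c + 2 * s * b + s\<^sup>2 * a" and a: "0 \<le> a"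
  shows "b\<^sup>2 \<le> a * c"
proof (cases "a = 0")
  case True
  have "b = 0"
  proof (rule ccontr)
    assume "b \<noteq> 0"
    then have "c + 2 * (- (c + 1) / (2 * b)) * b = - 1" by (simp add: field_simps)
    with nonneg[of "- (c + 1) / (2 * b)"] True show False by simp
  qed
  then show ?thesis using True by simp
next
  case False
  then have "a > 0" using a by simp
  have "0 \<le> c + 2 * (- b / a) * b + (- b / a)\<^sup>2 * a" by (rule nonneg)
  also have "\<dots> = c - b\<^sup>2 / a" using False by (simp add: power2_eq_square field_simps)
  finally show ?thesis using \<open>a > 0\<close> by (simp add: field_simps)
qed

text \<open>A minimising sequence for the distance to \<open>S\<close> is Cauchy by the parallelogram law.\<close>

lemma closed_subspace_projection:
  fixes S :: "'a::{real_inner,banach} set"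
  assumes "closed S" "subspace S"
  shows "\<exists>z\<in>S. \<forall>v\<in>S. inner (x - z) v = 0"
proof -
  define \<delta> where "\<delta> = Inf ((\<lambda>s. (norm (x - s))\<^sup>2) ` S)"
  have S0: "0 \<in> S" using assms(2) by (rule subspace_0)
  have bdd: "bdd_below ((\<lambda>s. (norm (x - s))\<^sup>2) ` S)" by (rule bdd_belowI[of _ 0]) auto
  have lower: "\<delta> \<le> (norm (x - s))\<^sup>2" if "s \<in> S" for s
    unfolding \<delta>_def by (rule cInf_lower[OF _ bdd]) (use that in auto)
  have "\<exists>s\<in>S. (norm (x - s))\<^sup>2 < \<delta> + inverse (real (Suc m))" for m
  proof -
    have "Inf ((\<lambda>s. (norm (x - s))\<^sup>2) ` S) < \<delta> + inverse (real (Suc m))"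
      unfolding \<delta>_def by simp
    then show ?thesis using S0 bdd by (subst (asm) cInf_less_iff) auto
  qed
  then obtain s where s: "\<And>m. s m \<in> S" "\<And>m. (norm (x - s m))\<^sup>2 < \<delta> + inverse (real (Suc m))"
    by metis
  have dist: "(norm (s m - s l))\<^sup>2 \<le> 2 * inverse (real (Suc m)) + 2 * inverse (real (Suc l))" for m l
  proof -
    have "(1/2) *\<^sub>R (s m + s l) \<in> S" using s(1) assms(2) by (meson subspace_add subspace_scale)
    then have "\<delta> \<le> (norm (x - (1/2) *\<^sub>R (s m + s l)))\<^sup>2" by (rule lower)
    moreover have "(norm (s m - s l))\<^sup>2 = 2 * (norm (x - s m))\<^sup>2 + 2 * (norm (x - s l))\<^sup>2
        - 4 * (norm (x - (1/2) *\<^sub>R (s m + s l)))\<^sup>2"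
      by (simp add: power2_norm_eq_inner inner_diff inner_add inner_commute algebra_simps)
    ultimately show ?thesis using s(2)[of m] s(2)[of l] by linarith
  qed
  have "Cauchy s"
  proof (rule metric_CauchyI)
    fix e :: real assume "e > 0"
    obtain M where M: "inverse (real (Suc M)) < e\<^sup>2 / 4"
      using reals_Archimedean[of "e\<^sup>2/4"] \<open>e > 0\<close> by auto
    have "dist (s m) (s l) < e" if "m \<ge> M" "l \<ge> M" for m l
    proof -
      have "inverse (real (Suc m)) \<le> inverse (real (Suc M))" "inverse (real (Suc l)) \<le> inverse (real (Suc M))"
        using that by (auto intro!: le_imp_inverse_le)
      then have "(norm (s m - s l))\<^sup>2 < e\<^sup>2" using dist[of m l] M by linarith
      then show ?thesis using \<open>e > 0\<close> by (simp add: dist_norm power_less_imp_less_base)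
    qed
    then show "\<exists>M. \<forall>m\<ge>M. \<forall>n\<ge>M. dist (s m) (s n) < e" by blast
  qed
  then obtain z where z: "s \<longlonglongrightarrow> z" using Cauchy_convergent_iff convergent_def by blast
  have zS: "z \<in> S" using closed_sequentially[OF assms(1) _ z] s(1) by blast
  have "(\<lambda>m. (norm (x - s m))\<^sup>2) \<longlonglongrightarrow> (norm (x - z))\<^sup>2" by (intro tendsto_intros z)
  moreover have "(\<lambda>m. \<delta> + inverse (real (Suc m))) \<longlonglongrightarrow> \<delta> + 0"
    by (intro tendsto_intros LIMSEQ_inverse_real_of_nat)
  ultimately have min: "(norm (x - z))\<^sup>2 \<le> \<delta>"
    using s(2) by (intro tendsto_le[OF _ _ \<open>(\<lambda>m. (norm (x - s m))\<^sup>2) \<longlonglongrightarrow> (norm (x - z))\<^sup>2\<close>, of "\<lambda>m. \<delta> + inverse (real (Suc m))"])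
      (auto intro!: always_eventually less_imp_le)
  have orth: "inner (x - z) v = 0" if "v \<in> S" for v
  proof -
    have "0 \<le> 0 + 2 * t * inner (x - z) v + t\<^sup>2 * (norm v)\<^sup>2" for t
    proof -
      have "z - t *\<^sub>R v \<in> S" using zS that assms(2) by (simp add: subspace_diff subspace_scale)
      then have "(norm (x - z))\<^sup>2 \<le> (norm (x - (z - t *\<^sub>R v)))\<^sup>2" by (meson lower min order_trans)
      also have "\<dots> = (norm (x - z))\<^sup>2 + 2 * t * inner (x - z) v + t\<^sup>2 * (norm v)\<^sup>2"
        by (simp only: power2_norm_eq_inner) (simp add: inner_diff inner_add inner_commute algebra_simps power2_eq_square)
      finally show ?thesis by simp
    qed
    from quadratic_form_bound[OF this] show ?thesis by simp
  qed
  then show ?thesis using zS by blast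
qed

lemma closed_subspace_separation:
  fixes S :: "'a::{real_inner,banach} set"
  assumes "closed S" "subspace S" "x \<notin> S"
  shows "\<exists>y. (\<forall>s\<in>S. inner y s = 0) \<and> inner y x \<noteq> 0"
proof -
  obtain z where z: "z \<in> S" "\<forall>v\<in>S. inner (x - z) v = 0"
    using closed_subspace_projection[OF assms(1,2)] by blast
  then have "inner (x - z) x = inner (x - z) (x - z)" by (simp add: inner_diff_right)
  moreover have "x - z \<noteq> 0" using z(1) assms(3) by auto
  ultimately show ?thesis using z(2) by (intro exI[of _ "x - z"]) auto
qed

lemma subspace_closure':
  fixes S :: "'a::real_normed_vector set"
  assumes "subspace S" shows "subspace (closure S)"
proof (rule subspaceI)
  show "0 \<in> closure S" using subspace_0[OF assms] closure_subset by blast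
  show "x + y \<in> closure S" if "x \<in> closure S" "y \<in> closure S" for x y
  proof -
    obtain f g where "\<And>n. f n \<in> S" "f \<longlonglongrightarrow> x" "\<And>n. g n \<in> S" "g \<longlonglongrightarrow> y"
      using \<open>x \<in> closure S\<close> \<open>y \<in> closure S\<close> unfolding closure_sequential by blast
    then show ?thesis unfolding closure_sequential
      by (intro exI[of _ "\<lambda>n. f n + g n"]) (auto intro: subspace_add[OF assms] tendsto_add)
  qed
  show "c *\<^sub>R x \<in> closure S" if "x \<in> closure S" for c x
  proof -
    obtain f where "\<And>n. f n \<in> S" "f \<longlonglongrightarrow> x"
      using \<open>x \<in> closure S\<close> unfolding closure_sequential by blast
    then show ?thesis unfolding closure_sequential
      by (intro exI[of _ "\<lambda>n. c *\<^sub>R f n"]) (auto intro: subspace_scale[OF assms] tendsto_intros)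
  qed
qed

lemma dense_if_orthogonal_trivial:
  fixes S :: "'a::{real_inner,banach} set"
  assumes "subspace S" "\<And>y. (\<And>s. s \<in> S \<Longrightarrow> inner y s = 0) \<Longrightarrow> y = 0"
  shows "closure S = UNIV"
proof (rule ccontr)
  assume "closure S \<noteq> UNIV"
  then obtain x where "x \<notin> closure S" by auto
  then obtain y where y: "\<forall>s\<in>closure S. inner y s = 0" "inner y x \<noteq> 0"
    using closed_subspace_separation[of "closure S" x] assms(1)
    by (metis closed_closure subspace_closure')
  then have "y = 0" using assms(2) closure_subset by blast
  then show False using y(2) by simp
qed

section \<open>Calculus of Hilbert space valued functions on an interval\<close>

lemma nondecreasing_if_derivative_nonneg:
  fixes f :: "real \<Rightarrow> real"
  assumes der: "\<And>t. t \<in> S \<Longrightarrow> (f has_vector_derivative f' t) (at t within S)"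
    and nonneg: "\<And>t. t \<in> S \<Longrightarrow> 0 \<le> f' t" and "{a..b} \<subseteq> S" "a \<le> b"
  shows "f a \<le> f b"
proof -
  have "\<exists>x\<in>{a..b}. f b - f a = (b - a) *\<^sub>R f' x"
    by (rule mvt_very_simple[OF \<open>a \<le> b\<close>, where f' = "\<lambda>x h. h *\<^sub>R f' x"], rule has_vector_derivative_within_subset[OF der, unfolded has_vector_derivative_def])
      (use assms(3) in auto)
  then obtain x where "x \<in> {a..b}" "f b - f a = (b - a) * f' x" by auto
  then show ?thesis using assms(3,4) nonneg[of x] by (smt (verit) mult_nonneg_nonneg subsetD)
qed

lemma constant_if_derivative_zero:
  fixes f :: "real \<Rightarrow> real"
  assumes der: "\<And>t. t \<in> S \<Longrightarrow> (f has_vector_derivative 0) (at t within S)"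
    and "{a..b} \<subseteq> S" "a \<le> b"
  shows "f a = f b"
proof (rule antisym)
  show "f a \<le> f b" by (rule nondecreasing_if_derivative_nonneg[OF der _ assms(2,3)]) auto
  have "- f a \<le> - f b"
    by (rule nondecreasing_if_derivative_nonneg[of S "\<lambda>t. - f t" "\<lambda>_. 0", OF _ _ assms(2,3)])
      (auto intro: derivative_eq_intros der)
  then show "f b \<le> f a" by simp
qed

lemma continuous_on_halfline_if_vector_derivative:
  "(\<And>t. t \<in> S \<Longrightarrow> (f has_vector_derivative f' t) (at t within S)) \<Longrightarrow> continuous_on S f"
  by (meson continuous_on_eq_continuous_within has_vector_derivative_continuous)

lemma bounded_linear_of_integral:
  assumes "bounded_linear h" "f integrable_on S"
  shows "h (integral S f) = integral S (\<lambda>x. h (f x))"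
  using integral_linear[OF assms(2,1)] by (simp add: o_def)

lemma integral_in_closed_subspace:
  fixes X :: "'b::euclidean_space \<Rightarrow> 'a::{real_inner,banach}"
  assumes "closed S" "subspace S" "X integrable_on D" "\<And>t. t \<in> D \<Longrightarrow> X t \<in> S"
  shows "integral D X \<in> S"
proof (rule ccontr)
  assume "integral D X \<notin> S"
  then obtain y where y: "\<forall>s\<in>S. inner y s = 0" "inner y (integral D X) \<noteq> 0"
    using closed_subspace_separation[OF assms(1,2)] by blast
  have "inner y (integral D X) = integral D (\<lambda>t. inner y (X t))"
    by (rule bounded_linear_of_integral[OF bounded_linear_inner_right assms(3)])
  also have "\<dots> = integral D (\<lambda>t. 0)" by (rule integral_cong) (use y assms(4) in auto)
  finally show False using y by simp
qed

lemma halfline_integral_derivative: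
  fixes X :: "real \<Rightarrow> 'a::banach"
  assumes "continuous_on {0..} X" "0 \<le> t"
  shows "((\<lambda>t. integral {0..t} X) has_vector_derivative X t) (at t within {0..})"
proof -
  have "((\<lambda>t. integral {0..t} X) has_vector_derivative X t) (at t within {0..t+1})"
    by (rule integral_has_vector_derivative) (use assms in \<open>auto intro: continuous_on_subset\<close>)
  moreover have "at t within {0..t+1} = at t within {0..}"
    by (rule at_within_nhd[of t "{..<t+1}"]) auto
  ultimately show ?thesis by simp
qed

text \<open>Steklov averages and increments: averaging a solution gains one derivative, since \<open>(avg h X)\<close> has
  derivative \<open>incr h X\<close>. The averages are not divided by \<open>h\<close>.\<close>

definition avg :: "real \<Rightarrow> (real \<Rightarrow> 'a::banach) \<Rightarrow> real \<Rightarrow> 'a" where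
  "avg h X t = integral {t..t+h} X"

definition incr :: "real \<Rightarrow> (real \<Rightarrow> 'a::ab_group_add) \<Rightarrow> real \<Rightarrow> 'a" where
  "incr h X t = X (t + h) - X t"

lemma avg_eq_primitive:
  fixes X :: "real \<Rightarrow> 'a::banach"
  assumes "continuous_on {0..} X" "0 \<le> t" "0 \<le> h"
  shows "avg h X t = integral {0..t+h} X - integral {0..t} X"
  unfolding avg_def
  using Henstock_Kurzweil_Integration.integral_combine[of 0 t "t+h" X] assms
  by (simp add: integrable_continuous_interval[OF continuous_on_subset[OF assms(1)]] eq_diff_eq add.commute)

lemma halfline_continuous_at_right:
  fixes f :: "real \<Rightarrow> 'a::topological_space"
  assumes "continuous_on {0..} f" shows "(f \<longlongrightarrow> f 0) (at_right 0)"
  using assms unfolding continuous_on_def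
  by (metis at_within_Ici_at_right atLeast_iff order_refl)

lemma shift_derivative:
  assumes "\<And>t. 0 \<le> t \<Longrightarrow> (X has_vector_derivative X' t) (at t within {0..})" "0 \<le> t" "0 \<le> h"
  shows "((\<lambda>t. X (t + h)) has_vector_derivative X' (t + h)) (at t within {0..})"
proof -
  have "((X \<circ> (\<lambda>t. t + h)) has_vector_derivative (1 *\<^sub>R X' (t + h))) (at t within {0..})"
  proof (rule vector_diff_chain_within)
    show "((\<lambda>t. t + h) has_vector_derivative 1) (at t within {0..})"
      by (auto intro!: derivative_eq_intros)
    show "(X has_vector_derivative X' (t + h)) (at (t + h) within (\<lambda>t. t + h) ` {0..})"
      by (rule has_vector_derivative_within_subset[OF assms(1)]) (use assms in auto)
  qed
  then show ?thesis by (simp add: o_def)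
qed

lemma shift_derivative_at:
  assumes "(f has_vector_derivative f') (at (t + h))"
  shows "((\<lambda>s. f (s + h)) has_vector_derivative f') (at t)"
proof -
  have "((f \<circ> (\<lambda>s. s + h)) has_vector_derivative 1 *\<^sub>R f') (at t)"
    by (rule vector_diff_chain_at[where f = "\<lambda>s. s + h" and x = t, OF _ assms]) (auto intro!: derivative_eq_intros)
  then show ?thesis by (simp add: o_def)
qed

lemma avg_derivative:
  fixes X :: "real \<Rightarrow> 'a::banach"
  assumes "continuous_on {0..} X" "0 \<le> t" "0 \<le> h"
  shows "(avg h X has_vector_derivative incr h X t) (at t within {0..})"
proof -
  have "((\<lambda>t. integral {0..t+h} X - integral {0..t} X) has_vector_derivative incr h X t) (at t within {0..})"
    unfolding incr_def
    by (intro has_vector_derivative_diff halfline_integral_derivative assms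
        shift_derivative[of "\<lambda>t. integral {0..t} X" X])
  then show ?thesis
    by (rule has_vector_derivative_transform[rotated 2]) (use assms avg_eq_primitive in auto)
qed

lemma halfline_integral_of_derivative:
  fixes X :: "real \<Rightarrow> 'a::banach"
  assumes "\<And>t. 0 \<le> t \<Longrightarrow> (X has_vector_derivative X' t) (at t within {0..})" "0 \<le> t" "0 \<le> h"
  shows "(X' has_integral incr h X t) {t..t+h}"
  unfolding incr_def
  by (rule fundamental_theorem_of_calculus)
    (use assms in \<open>auto intro!: has_vector_derivative_within_subset[OF assms(1)]\<close>)

lemma avg_of_derivative:
  fixes X :: "real \<Rightarrow> 'a::banach"
  assumes "\<And>t. 0 \<le> t \<Longrightarrow> (X has_vector_derivative X' t) (at t within {0..})" "0 \<le> t" "0 \<le> h"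
  shows "avg h X' t = incr h X t"
  using halfline_integral_of_derivative[OF assms] unfolding avg_def by (rule integral_unique)

lemma continuous_avg:
  fixes X :: "real \<Rightarrow> 'a::banach"
  assumes "continuous_on {0..} X" "0 \<le> h"
  shows "continuous_on {0..} (avg h X)"
  by (rule continuous_on_halfline_if_vector_derivative[OF avg_derivative]) (use assms in auto)

lemma avg_bounded_linear:
  fixes X :: "real \<Rightarrow> 'a::banach" and f :: "'a \<Rightarrow> 'b::banach"
  assumes "bounded_linear f" "continuous_on {0..} X" "0 \<le> t"
  shows "f (avg h X t) = avg h (\<lambda>t. f (X t)) t"
  unfolding avg_def
  by (rule bounded_linear_of_integral[OF assms(1)])
    (use assms in \<open>auto intro!: integrable_continuous_interval continuous_on_subset[OF assms(2)]\<close>)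

lemma norm_avg_le:
  fixes X :: "real \<Rightarrow> 'a::banach"
  assumes "continuous_on {0..} X" "0 \<le> t" "0 \<le> h" "\<And>s. t \<le> s \<Longrightarrow> s \<le> t + h \<Longrightarrow> norm (X s) \<le> C"
  shows "norm (avg h X t) \<le> h * C"
proof -
  have "norm (integral {t..t+h} X) \<le> C * (t + h - t)"
    by (rule integral_bound) (use assms in \<open>auto intro: continuous_on_subset\<close>)
  then show ?thesis by (simp add: avg_def mult.commute)
qed

text \<open>By continuity, \<open>avg h X t / h\<close> tends to \<open>X t\<close>; this removes the averages used for
  smoothing.\<close>

lemma orthogonal_to_averages:
  fixes X :: "real \<Rightarrow> 'a::{real_inner,banach}"
  assumes "continuous_on {0..} X" "0 \<le> t" "\<And>h. 0 < h \<Longrightarrow> inner \<phi> (avg h X t) = 0"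
  shows "inner \<phi> (X t) = 0"
proof -
  have 1: "((\<lambda>s. integral {0..s} X) has_vector_derivative X t) (at t within {0..})"
    by (rule halfline_integral_derivative[OF assms(1,2)])
  have 2: "((\<lambda>s. inner \<phi> (integral {0..s} X)) has_vector_derivative inner \<phi> (X t)) (at t within {t..})"
    by (rule has_vector_derivative_within_subset[OF bounded_linear.has_vector_derivative[OF bounded_linear_inner_right 1]])
      (use assms in auto)
  have "((\<lambda>s. inner \<phi> (integral {0..s} X)) has_vector_derivative 0) (at t within {t..})"
  proof (rule has_vector_derivative_transform[of _ _ _ "\<lambda>_. inner \<phi> (integral {0..t} X)"])
    fix s assume s: "s \<in> {t..}"
    have "inner \<phi> (avg (s - t) X t) = 0"
      using assms(3)[of "s - t"] s by (cases "s = t") (auto simp: avg_def)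
    then show "inner \<phi> (integral {0..s} X) = inner \<phi> (integral {0..t} X)"
      using avg_eq_primitive[OF assms(1,2), of "s - t"] s by (simp add: inner_diff_right)
  qed auto
  with 2 show ?thesis
    by (intro vector_derivative_unique_within[of t "{t..}"]) (simp_all add: at_within_Ici_at_right)
qed

lemma ln_unbounded:
  fixes a b :: real
  assumes "0 < a" shows "\<exists>t\<ge>c. a * ln (1 + t) > b \<and> t \<ge> 0"
proof -
  define t where "t = exp (\<bar>b\<bar> / a + 1) + \<bar>c\<bar>"
  have "\<bar>b\<bar> / a + 1 \<le> ln (1 + t)" unfolding t_def by (subst ln_ge_iff) (auto simp: add_pos_nonneg add_nonneg_pos)
  then have "a * (\<bar>b\<bar> / a + 1) \<le> a * ln (1 + t)" using assms by (intro mult_left_mono) auto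
  moreover have "a * (\<bar>b\<bar> / a + 1) = \<bar>b\<bar> + a" using assms by (simp add: field_simps)
  ultimately show ?thesis using assms by (intro exI[of _ t]) (auto simp: t_def add_nonneg_pos intro: order_trans[of _ "\<bar>c\<bar>"])
qed

section \<open>The abstract first order system\<close>

text \<open>\<open>G\<close> is the graph of a closed, densely defined, injective operator, to be thought of as
  \<open>\<nabla>\<^sub>x\<close>. Coercivity is required on \<open>H \<times> ran \<nabla>\<^sub>x\<close> only, which is weaker
  than pointwise accretivity of the coefficients.\<close>

locale first_order_system =
  fixes G :: "('a::{real_inner,banach} \<times> 'b::{real_inner,banach}) set"
    and A :: "'a \<times> 'b \<Rightarrow> 'a \<times> 'b" and \<kappa> M :: real
  assumes closed_G: "closed G" and subspace_G: "subspace G"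
    and dense_domain: "closure (fst ` G) = UNIV"
    and injective: "(x, 0) \<in> G \<Longrightarrow> x = 0"
    and linear_A: "linear A"
    and bounded_A: "norm (A u) \<le> M * norm u" and M_pos: "0 < M"
    and self_adjoint: "inner (A u) v = inner u (A v)"
    and \<kappa>_pos: "0 < \<kappa>"
    and coercive: "(g, y) \<in> G \<Longrightarrow> \<kappa> * (norm (x, y))\<^sup>2 \<le> inner (A (x, y)) (x, y)"
begin

lemma bounded_linear_A: "bounded_linear A"
  using linear_A bounded_A by (intro bounded_linear.intro bounded_linear_axioms.intro) (auto simp: mult.commute)

abbreviation w :: "'a \<times> 'b \<Rightarrow> 'a" where "w u \<equiv> fst (A u)"
abbreviation q :: "'a \<times> 'b \<Rightarrow> 'b" where "q u \<equiv> snd (A u)"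

lemma bounded_linear_w: "bounded_linear w"
  by (rule bounded_linear_fst_comp[OF bounded_linear_A])

lemma bounded_linear_q: "bounded_linear q"
  by (rule bounded_linear_snd_comp[OF bounded_linear_A])

lemmas A_linear = linear_add[OF linear_A] linear_diff[OF linear_A] linear_scale[OF linear_A] linear_0[OF linear_A]

lemma A_split: "A (x, y) = A (x, 0) + A (0, y)"
  using linear_add[OF linear_A, of "(x,0)" "(0,y)"] by simp

lemma w_bound: "norm (w u) \<le> M * norm u"
  using bounded_A[of u] norm_fst_le[of "fst (A u)" "snd (A u)"] by simp

lemma norm_fst_le': "norm (fst u) \<le> norm u" and norm_snd_le': "norm (snd u) \<le> norm u"
  using norm_fst_le[of "fst u" "snd u"] norm_snd_le[of "snd u" "fst u"] by simp_all

text \<open>The differential equations at a fixed time, for a curve with value \<open>u\<close> and \<open>t\<close>-derivative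
  \<open>v\<close>: \<open>v\<^sub>1 = \<nabla>\<^sub>x u\<^sub>0\<close> and, tested weakly, \<open>(A v)\<^sub>0 = - div\<^sub>x
  (A u)\<^sub>1\<close>.\<close>

definition flow :: "(('a \<times> 'b) \<times> ('a \<times> 'b)) set" where
  "flow = {(u, v). (fst u, snd v) \<in> G \<and> (\<forall>(g, y)\<in>G. inner (w v) g = inner (q u) y)}"

lemma flow_gradient: "(u, v) \<in> flow \<Longrightarrow> (fst u, snd v) \<in> G"
  by (auto simp: flow_def)

lemma flow_divergence: "(u, v) \<in> flow \<Longrightarrow> (g, y) \<in> G \<Longrightarrow> inner (w v) g = inner (q u) y"
  by (auto simp: flow_def)

lemma subspace_flow: "subspace flow"
proof -
  have iff: "p \<in> flow \<longleftrightarrow> (fst (fst p), snd (snd p)) \<in> G \<and>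
      (\<forall>z\<in>G. inner (w (snd p)) (fst z) = inner (q (fst p)) (snd z))" for p
    by (cases p) (force simp: flow_def)
  show ?thesis
  proof (rule subspaceI)
    show "0 \<in> flow" using subspace_0[OF subspace_G] by (simp add: iff A_linear zero_prod_def[symmetric])
    show "x + y \<in> flow" if "x \<in> flow" "y \<in> flow" for x y
      using that subspace_add[OF subspace_G, of "(fst (fst x), snd (snd x))" "(fst (fst y), snd (snd y))"]
      by (simp add: iff A_linear inner_add_left)
    show "c *\<^sub>R x \<in> flow" if "x \<in> flow" for c x
      using that subspace_scale[OF subspace_G, of "(fst (fst x), snd (snd x))" c] by (simp add: iff A_linear)
  qed
qed

lemma closed_flow: "closed flow"
proof -
  have cA: "continuous_on UNIV (\<lambda>p. A (f p))" if "continuous_on UNIV f" for f :: "('a \<times> 'b) \<times> ('a \<times> 'b) \<Rightarrow> 'a \<times> 'b"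
    by (rule bounded_linear.continuous_on[OF bounded_linear_A that])
  have "closed {p :: ('a \<times> 'b) \<times> ('a \<times> 'b). (fst (fst p), snd (snd p)) \<in> G}" (is "closed ?S")
  proof -
    have "closed ((\<lambda>p::('a \<times> 'b) \<times> ('a \<times> 'b). (fst (fst p), snd (snd p))) -` G)"
      by (intro closed_vimage closed_G continuous_intros)
    then show ?thesis by (simp add: vimage_def)
  qed
  moreover have "closed {p. inner (w (snd p)) (fst z) = inner (q (fst p)) (snd z)}" for z
    by (intro closed_Collect_eq continuous_intros cA)
  then have "closed (\<Inter>z\<in>G. {p. inner (w (snd p)) (fst z) = inner (q (fst p)) (snd z)})"
    by (intro closed_INT) auto
  moreover have "flow = ?S \<inter> (\<Inter>z\<in>G. {p. inner (w (snd p)) (fst z) = inner (q (fst p)) (snd z)})"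
    by (force simp: flow_def)
  ultimately show ?thesis by (auto intro: closed_Int)
qed

lemma flow_diff: "(u, v) \<in> flow \<Longrightarrow> (u', v') \<in> flow \<Longrightarrow> (u - u', v - v') \<in> flow"
  using subspace_diff[OF subspace_flow, of "(u,v)" "(u',v')"] by simp

lemma A_inner_split: "inner (A u) v = inner (w u) (fst v) + inner (q u) (snd v)"
  by (simp add: inner_prod_def)

text \<open>Coercivity extends to the closure of the range by continuity.\<close>

lemma coercive': "snd u \<in> closure (snd ` G) \<Longrightarrow> \<kappa> * (norm u)\<^sup>2 \<le> inner (A u) u"
proof -
  assume a: "snd u \<in> closure (snd ` G)"
  have "closed {y. \<kappa> * (norm (fst u, y))\<^sup>2 \<le> inner (A (fst u, y)) (fst u, y)}"
    by (intro closed_Collect_le continuous_intros bounded_linear.continuous_on[OF bounded_linear_A])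
  moreover have "snd ` G \<subseteq> {y. \<kappa> * (norm (fst u, y))\<^sup>2 \<le> inner (A (fst u, y)) (fst u, y)}"
    using coercive by force
  ultimately have "closure (snd ` G) \<subseteq> {y. \<kappa> * (norm (fst u, y))\<^sup>2 \<le> inner (A (fst u, y)) (fst u, y)}"
    by (rule closure_minimal[rotated])
  with a show ?thesis by auto
qed

lemma rangeI: "(g, y) \<in> G \<Longrightarrow> y \<in> closure (snd ` G)"
  using closure_subset by force

subsection \<open>The Rellich form\<close>

text \<open>The form \<open>\<langle>R u, v\<rangle>\<close> is the difference of the normal and the tangential energy; it is the
  quantity in the Rellich identity, which is conserved when \<open>A\<close> is self-adjoint.\<close>

definition R :: "'a \<times> 'b \<Rightarrow> 'a \<times> 'b" where
  "R u = (w (fst u, 0), - q (0, snd u))"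

lemma bounded_linear_R: "bounded_linear R"
  unfolding R_def
  by (intro bounded_linear_Pair bounded_linear_minus
      bounded_linear_compose[OF bounded_linear_w] bounded_linear_compose[OF bounded_linear_q]
      bounded_linear_fst bounded_linear_snd bounded_linear_zero)

lemma A_cross: "inner (w (x, 0)) x' = inner (w (x', 0)) x" "inner (q (0, y)) y' = inner (q (0, y')) y"
  "inner (q (x, 0)) y = inner (w (0, y)) x"
  using self_adjoint[of "(x,0)" "(x',0)"] self_adjoint[of "(0,y)" "(0,y')"] self_adjoint[of "(x,0)" "(0,y)"]
  by (simp_all add: inner_prod_def inner_commute)

lemma R_symmetric: "inner (R u) v = inner u (R v)"
  unfolding R_def using A_cross(1)[of "fst u" "fst v"] A_cross(2)[of "snd u" "snd v"]
  by (simp add: inner_prod_def inner_commute)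

lemma A_Pair_split: "A u = A (fst u, 0) + A (0, snd u)"
  using A_split[of "fst u" "snd u"] by simp

text \<open>Take \<open>(u\<^sub>0, v\<^sub>1) \<in> G\<close> as the test pair in the divergence part; the terms with mixed
  entries of \<open>A\<close> cancel by self-adjointness.\<close>

lemma rellich_flow: assumes "(u, v) \<in> flow" shows "inner (R u) v = 0"
proof -
  have "inner (w v) (fst u) = inner (q u) (snd v)"
    by (rule flow_divergence[OF assms flow_gradient[OF assms]])
  then have "inner (w (fst v, 0)) (fst u) + inner (w (0, snd v)) (fst u)
     = inner (q (fst u, 0)) (snd v) + inner (q (0, snd u)) (snd v)"
    by (subst (asm) (1 2) A_Pair_split) (simp add: inner_add_left)
  then show ?thesis
    using A_cross(1)[of "fst u" "fst v"] A_cross(3)[of "fst u" "snd v"] by (simp add: R_def inner_prod_def)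
qed

lemma rellich_energy: "inner (A u) u + inner (R u) u = 2 * inner (w u) (fst u)"
proof -
  have 1: "w u = w (fst u, 0) + w (0, snd u)" "q u = q (fst u, 0) + q (0, snd u)"
    by (subst A_Pair_split, simp)+
  show ?thesis unfolding A_inner_split R_def using A_cross(3)[of "fst u" "snd u"]
    by (simp add: inner_prod_def 1 inner_add_left)
qed

text \<open>The derivative of \<open>\<langle>R U, U\<rangle>\<close> is \<open>2 \<langle>R U, V\<rangle> = 0\<close>; the
  constant is identified at infinity.\<close>

lemma rellich_invariant:
  assumes der: "\<And>t. t \<in> S \<Longrightarrow> (U has_vector_derivative V t) (at t within S)"
    and fl: "\<And>t. t \<in> S \<Longrightarrow> (U t, V t) \<in> flow"
    and up: "\<And>t s. t \<in> S \<Longrightarrow> t \<le> s \<Longrightarrow> s \<in> S"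
    and lim: "(U \<longlongrightarrow> 0) at_top" and t: "t \<in> S"
  shows "inner (R (U t)) (U t) = 0"
proof -
  have d: "((\<lambda>s. inner (R (U s)) (U s)) has_vector_derivative 0) (at s within S)" if "s \<in> S" for s
  proof -
    have "((\<lambda>s. inner (R (U s)) (U s)) has_vector_derivative
        inner (R (U s)) (V s) + inner (R (V s)) (U s)) (at s within S)"
      by (intro bounded_bilinear.has_vector_derivative[OF bounded_bilinear_inner] der that
        bounded_linear.has_vector_derivative[OF bounded_linear_R])
    moreover have "inner (R (U s)) (V s) + inner (R (V s)) (U s) = 0"
      using rellich_flow[OF fl[OF that]] R_symmetric[of "V s" "U s"] by (simp add: inner_commute)
    ultimately show ?thesis by simp
  qed
  have const: "inner (R (U t)) (U t) = inner (R (U s)) (U s)" if "t \<le> s" for s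
    by (rule constant_if_derivative_zero[OF d]) (use up t that in auto)
  have "((\<lambda>s. inner (R (U s)) (U s)) \<longlongrightarrow> inner (R 0) 0) at_top"
    by (intro tendsto_inner lim bounded_linear.tendsto[OF bounded_linear_R])
  moreover have "((\<lambda>s. inner (R (U s)) (U s)) \<longlongrightarrow> inner (R (U t)) (U t)) at_top"
    by (rule tendsto_eventually) (unfold eventually_at_top_linorder, use const in \<open>auto intro!: exI[of _ t]\<close>)
  ultimately have "inner (R (U t)) (U t) = inner (R 0) 0"
    by (intro tendsto_unique[OF trivial_limit_at_top_linorder])
  then show ?thesis by simp
qed

text \<open>With \<open>\<langle>R u, u\<rangle> = 0\<close> the energy density equals \<open>2 \<langle>w u,
  u\<^sub>0\<rangle>\<close>, so that either factor controls \<open>u\<close>.\<close>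

lemma rellich_estimate:
  assumes "inner (R u) u = 0" "snd u \<in> closure (snd ` G)"
  shows "\<kappa> * norm u \<le> 2 * norm (w u)" "\<kappa> * norm u \<le> 2 * M * norm (fst u)" "\<kappa> * (norm u)\<^sup>2 \<le> 2 * inner (w u) (fst u)"
proof -
  show e: "\<kappa> * (norm u)\<^sup>2 \<le> 2 * inner (w u) (fst u)"
    using coercive'[OF assms(2)] rellich_energy[of u] assms(1) by simp
  have cs: "inner (w u) (fst u) \<le> norm (w u) * norm (fst u)" by (rule norm_cauchy_schwarz)
  have "norm (w u) * norm (fst u) \<le> norm (w u) * norm u"
    by (intro mult_left_mono norm_fst_le') auto
  with e cs have "\<kappa> * norm u * norm u \<le> 2 * norm (w u) * norm u" by (simp add: power2_eq_square)
  then show "\<kappa> * norm u \<le> 2 * norm (w u)" by (cases "u = 0") auto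
  have "norm (w u) * norm (fst u) \<le> (M * norm u) * norm (fst u)"
    by (intro mult_right_mono w_bound) auto
  with e cs have "\<kappa> * norm u * norm u \<le> (2 * M * norm (fst u)) * norm u"
    by (simp add: power2_eq_square mult_ac)
  then show "\<kappa> * norm u \<le> 2 * M * norm (fst u)" using M_pos by (cases "u = 0") auto
qed

subsection \<open>Uniqueness\<close>

text \<open>The Rellich estimate at \<open>t = 0\<close> shows that the boundary value \<open>u\<close> vanishes. A potential of
  \<open>U\<close> may grow, so the flux of \<open>U\<close> itself need not vanish at infinity. The increments of the potential
  do tend to zero, and so the argument is applied to differences of translates.\<close>

theorem neumann_unique:
  assumes der: "\<And>t. 0 < t \<Longrightarrow> (U has_vector_derivative V t) (at t)"
    and fl: "\<And>t. 0 < t \<Longrightarrow> (U t, V t) \<in> flow"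
    and lim0: "(U \<longlongrightarrow> u) (at_right 0)" and lim: "(U \<longlongrightarrow> 0) at_top"
    and ran: "\<And>t. 0 < t \<Longrightarrow> snd (U t) \<in> closure (snd ` G)"
    and data: "w u = 0" and t: "0 < t"
  shows "U t = 0"
proof -
  have r0: "inner (R (U t)) (U t) = 0" if "0 < t" for t
    by (rule rellich_invariant[of "{0<..}" U V, OF _ _ _ lim])
      (use der fl that in \<open>auto intro: has_vector_derivative_at_within\<close>)
  have "((\<lambda>t. inner (R (U t)) (U t)) \<longlongrightarrow> inner (R u) u) (at_right 0)"
    by (intro tendsto_inner lim0 bounded_linear.tendsto[OF bounded_linear_R])
  moreover have "((\<lambda>t. inner (R (U t)) (U t)) \<longlongrightarrow> 0) (at_right 0)"
    by (rule tendsto_eventually) (use r0 in \<open>auto simp: eventually_at_right_less eventually_at_filter\<close>)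
  ultimately have ru: "inner (R u) u = 0" using tendsto_unique[OF trivial_limit_at_right_real] by blast
  have "snd u \<in> closure (snd ` G)"
    by (rule Lim_in_closed_set[OF closed_closure _ trivial_limit_at_right_real tendsto_snd[OF lim0]])
      (use ran in \<open>auto simp: eventually_at_filter\<close>)
  from rellich_estimate(1)[OF ru this] data \<kappa>_pos have u0: "u = 0" by (simp add: mult_le_0_iff)
  \<comment> \<open>From here on \<open>W\<close> is the solution, extended continuously to \<open>t = 0\<close>.\<close>
  define W where "W t = (if t \<le> 0 then 0 else U t)" for t
  have W: "W t = U t" if "0 < t" for t using that by (simp add: W_def)
  have Wder: "(W has_vector_derivative V t) (at t)" if "0 < t" for t
    by (rule has_vector_derivative_transform_within_open[OF der[OF that], of "{0<..}"]) (use that W in auto)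
  have Wcont: "continuous_on {0..} W"
  proof (unfold continuous_on_eq_continuous_within, intro ballI)
    fix t :: real assume "t \<in> {0..}"
    show "continuous (at t within {0..}) W"
    proof (cases "t = 0")
      case True
      have "(W \<longlongrightarrow> W 0) (at 0 within {0..})"
      proof -
        have "(W \<longlongrightarrow> 0) (at_right 0)"
          using lim0 u0 by (rule_tac Lim_transform_eventually) (auto simp: eventually_at_filter W)
        then show ?thesis unfolding at_within_Ici_at_right by (simp add: W_def)
      qed
      then show ?thesis using True by (simp add: continuous_within)
    next
      case False
      then show ?thesis using \<open>t \<in> {0..}\<close>
        by (auto intro!: continuous_at_imp_continuous_at_within has_vector_derivative_continuous[OF Wder])
    qed
  qed
  have Wfl: "(W t, V t) \<in> flow" if "0 < t" for t using fl[OF that] W that by simp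
  define F where "F t = integral {0..t} (\<lambda>s. fst (W s))" for t
  have Fder: "(F has_vector_derivative fst (W t)) (at t within {0..})" if "0 \<le> t" for t
    unfolding F_def by (rule halfline_integral_derivative) (use that Wcont in \<open>auto intro: continuous_intros\<close>)
  have Fder': "(F has_vector_derivative fst (W t)) (at t)" if "0 < t" for t
    using Fder[of t] that at_within_interior[of t "{0..}"] by simp
  have Fcont: "continuous_on {0..} F" by (rule continuous_on_halfline_if_vector_derivative[OF Fder]) auto
  have sndW: "((\<lambda>s. snd (W s)) has_vector_derivative snd (V t)) (at t)" if "0 < t" for t
    by (rule bounded_linear.has_vector_derivative[OF bounded_linear_snd Wder[OF that]])
  have incG: "(F t - F s, snd (W t) - snd (W s)) \<in> G" if "0 < s" "s \<le> t" for s t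
  proof -
    have "((\<lambda>s. (fst (W s), snd (V s))) has_integral (F t, snd (W t)) - (F s, snd (W s))) {s..t}"
    proof (rule fundamental_theorem_of_calculus[where f = "\<lambda>s. (F s, snd (W s))"])
      fix r assume "r \<in> {s..t}"
      then have "0 < r" using that by simp
      show "((\<lambda>s. (F s, snd (W s))) has_vector_derivative (fst (W r), snd (V r))) (at r within {s..t})"
        by (rule has_vector_derivative_at_within[OF has_vector_derivative_Pair[OF Fder'[OF \<open>0 < r\<close>] sndW[OF \<open>0 < r\<close>]]])
    qed (rule that)
    then have "(F t, snd (W t)) - (F s, snd (W s)) = integral {s..t} (\<lambda>s. (fst (W s), snd (V s)))"
       "(\<lambda>s. (fst (W s), snd (V s))) integrable_on {s..t}"
      by (auto simp: integral_unique)
    then have "(F t, snd (W t)) - (F s, snd (W s)) \<in> G"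
      using that by (auto intro!: integral_in_closed_subspace[OF closed_G subspace_G] flow_gradient Wfl)
    then show ?thesis by simp
  qed
  have G_mem: "(F t, snd (W t)) \<in> G" if "0 \<le> t" for t
  proof (cases "t = 0")
    case True
    then show ?thesis using subspace_0[OF subspace_G] by (simp add: F_def W_def zero_prod_def)
  next
    case False
    then have "0 < t" using that by simp
    have l: "((\<lambda>s. (F t - F s, snd (W t) - snd (W s))) \<longlongrightarrow> (F t - F 0, snd (W t) - snd (W 0))) (at_right 0)"
    proof -
      note halfline_continuous_at_right[OF Fcont] halfline_continuous_at_right[OF Wcont]
      then show ?thesis by (intro tendsto_intros)
    qed
    have "(F t - F 0, snd (W t) - snd (W 0)) \<in> G"
      by (rule Lim_in_closed_set[OF closed_G _ trivial_limit_at_right_real l])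
        (use \<open>0 < t\<close> incG in \<open>auto simp: eventually_at_right_field intro!: exI[of _ t]\<close>)
    then show ?thesis by (simp add: F_def W_def)
  qed
  \<comment> \<open>The energy flux \<open>w \<cdot> \<Phi>\<close> of a difference of translates is monotone and vanishes at infinity.\<close>
  have flux: "((\<lambda>s. inner (w (W s)) (F s)) has_vector_derivative inner (A (W s)) (W s)) (at s)" if "0 < s" for s
  proof -
    have "((\<lambda>s. inner (w (W s)) (F s)) has_vector_derivative inner (w (W s)) (fst (W s)) + inner (w (V s)) (F s)) (at s)"
      by (intro bounded_bilinear.has_vector_derivative[OF bounded_bilinear_inner] Fder' that Wder
        bounded_linear.has_vector_derivative[OF bounded_linear_w])
    then show ?thesis using flow_divergence[OF Wfl[OF that] G_mem[of s]] that by (simp add: A_inner_split)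
  qed
  have flux_nonneg: "0 \<le> inner (w (W h)) (F h)" if "0 < h" for h
  proof -
    have "((\<lambda>s. inner (w (W s)) (F s)) \<longlongrightarrow> inner (w (W 0)) (F 0)) (at_right 0)"
      by (intro tendsto_inner bounded_linear.tendsto[OF bounded_linear_w] halfline_continuous_at_right Fcont Wcont)
    then have l: "((\<lambda>s. inner (w (W s)) (F s)) \<longlongrightarrow> 0) (at_right 0)" by (simp add: F_def)
    have "inner (w (W s)) (F s) \<le> inner (w (W h)) (F h)" if "0 < s" "s < h" for s
    proof (rule nondecreasing_if_derivative_nonneg[of "{0<..}" "\<lambda>s. inner (w (W s)) (F s)" "\<lambda>s. inner (A (W s)) (W s)"])
      show "((\<lambda>s. inner (w (W s)) (F s)) has_vector_derivative inner (A (W s)) (W s)) (at s within {0<..})" if "s \<in> {0<..}" for s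
        using flux that by (auto intro: has_vector_derivative_at_within)
      show "0 \<le> inner (A (W s)) (W s)" if "s \<in> {0<..}" for s
        using coercive'[OF rangeI[OF G_mem[of s]]] that \<kappa>_pos by (smt (verit) greaterThan_iff mult_nonneg_nonneg zero_le_power2)
    qed (use that in auto)
    then have "eventually (\<lambda>s. inner (w (W s)) (F s) \<le> inner (w (W h)) (F h)) (at_right 0)"
      using \<open>0 < h\<close> by (auto simp: eventually_at_right_field)
    then show ?thesis by (rule tendsto_upperbound[OF l _ trivial_limit_at_right_real])
  qed
  have shift: "W (t + h) = W t" if "0 < h" "0 < t" for t h
  proof -
    define Y where "Y s = W (s + h) - W s" for s
    define g where "g s = F (s + h) - F s" for s
    define p where "p s = inner (w (Y s)) (g s)" for s
    have Yder: "(Y has_vector_derivative (V (s + h) - V s)) (at s)" if "0 < s" for s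
      unfolding Y_def
      using that \<open>0 < h\<close>
      by (intro has_vector_derivative_diff Wder)
        (auto intro!: shift_derivative_at Wder)
    have gder: "(g has_vector_derivative fst (Y s)) (at s)" if "0 < s" for s
      unfolding g_def Y_def fst_diff
      using that \<open>0 < h\<close>
      by (intro has_vector_derivative_diff Fder')
        (auto intro!: shift_derivative_at Fder')
    have gG: "(g s, snd (Y s)) \<in> G" if "0 < s" for s
      using incG[of s "s+h"] that \<open>0 < h\<close> by (simp add: g_def Y_def)
    have pder: "(p has_vector_derivative inner (A (Y s)) (Y s)) (at s)" if "0 < s" for s
    proof -
      have "(p has_vector_derivative inner (w (Y s)) (fst (Y s)) + inner (w (V (s + h) - V s)) (g s)) (at s)"
        unfolding p_def
        by (intro bounded_bilinear.has_vector_derivative[OF bounded_bilinear_inner] gder that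
          bounded_linear.has_vector_derivative[OF bounded_linear_w] Yder)
      moreover have "(Y s, V (s + h) - V s) \<in> flow"
        unfolding Y_def using that \<open>0 < h\<close> by (intro flow_diff Wfl) auto
      ultimately show ?thesis using flow_divergence[OF _ gG[OF that]] by (simp add: A_inner_split)
    qed
    have mono: "p s \<le> p r" if "0 < s" "s \<le> r" for s r
    proof (rule nondecreasing_if_derivative_nonneg[of "{0<..}" p "\<lambda>s. inner (A (Y s)) (Y s)"])
      show "(p has_vector_derivative inner (A (Y s)) (Y s)) (at s within {0<..})" if "s \<in> {0<..}" for s
        using pder that by (auto intro: has_vector_derivative_at_within)
      show "0 \<le> inner (A (Y s)) (Y s)" if "s \<in> {0<..}" for s
        using coercive'[OF rangeI[OF gG[of s]]] that \<kappa>_pos by (smt (verit) greaterThan_iff mult_nonneg_nonneg zero_le_power2)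
    qed (use that in auto)
    have Wlim: "(W \<longlongrightarrow> 0) at_top"
      using lim by (rule Lim_transform_eventually) (auto simp: W eventually_at_top_dense intro!: exI[of _ 0])
    have shl: "filterlim (\<lambda>s. s + h) at_top at_top"
      using filterlim_tendsto_add_at_top[OF tendsto_const[of h] filterlim_ident] by (simp add: add.commute)
    have Ylim: "(Y \<longlongrightarrow> 0) at_top"
      unfolding Y_def using tendsto_diff[OF filterlim_compose[OF Wlim shl] Wlim] by simp
    have glim: "(g \<longlongrightarrow> 0) at_top"
    proof (rule tendstoI)
      fix e :: real assume "e > 0"
      then have "eventually (\<lambda>s. dist (W s) 0 < e / (2 * h)) at_top" using Wlim \<open>0 < h\<close> by (intro tendstoD) auto
      then obtain N where N: "\<And>s. s \<ge> N \<Longrightarrow> norm (W s) < e / (2 * h)" by (auto simp: eventually_at_top_linorder)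
      have "norm (g s) < e" if "s \<ge> max N 1" for s
      proof -
        have "avg h (\<lambda>s. fst (W s)) s = g s"
          using avg_of_derivative[OF Fder, of s h] that \<open>0 < h\<close> by (simp add: g_def incr_def)
        moreover have "norm (avg h (\<lambda>s. fst (W s)) s) \<le> h * (e / (2 * h))"
          using that \<open>0 < h\<close> N
          by (intro norm_avg_le continuous_intros Wcont) (auto intro!: less_imp_le le_less_trans[OF norm_fst_le'])
        ultimately show ?thesis using \<open>0 < h\<close> \<open>0 < e\<close> by simp
      qed
      then show "eventually (\<lambda>s. dist (g s) 0 < e) at_top"
        unfolding eventually_at_top_linorder by (intro exI[of _ "max N 1"]) simp
    qed
    \<comment> \<open>\<open>p\<close> is nonnegative near \<open>0\<close>, nondecreasing and tends to zero, so it vanishes and so does its derivative, the energy of \<open>Y\<close>.\<close>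
    have plim: "(p \<longlongrightarrow> 0) at_top"
    proof -
      have "(p \<longlongrightarrow> inner (w 0) 0) at_top"
        unfolding p_def by (intro tendsto_inner glim bounded_linear.tendsto[OF bounded_linear_w] Ylim)
      then show ?thesis by simp
    qed
    have pnonpos: "p s \<le> 0" if "0 < s" for s
      by (rule tendsto_lowerbound[OF plim]) (use that mono in \<open>auto simp: eventually_at_top_linorder intro!: exI[of _ s]\<close>)
    have pnonneg: "0 \<le> p s" if "0 < s" for s
    proof -
      have shr: "filterlim (\<lambda>s. s + h) (at h within {0..}) (at_right 0)"
        using \<open>0 < h\<close> by (auto simp: filterlim_at eventually_at_filter intro!: tendsto_eq_intros)
      have lW: "((\<lambda>s. W (s + h)) \<longlongrightarrow> W h) (at_right 0)"
        by (rule filterlim_compose[OF _ shr]) (use Wcont \<open>0 < h\<close> in \<open>auto simp: continuous_on_def\<close>)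
      have lF: "((\<lambda>s. F (s + h)) \<longlongrightarrow> F h) (at_right 0)"
        by (rule filterlim_compose[OF _ shr]) (use Fcont \<open>0 < h\<close> in \<open>auto simp: continuous_on_def\<close>)
      have "(F \<longlongrightarrow> 0) (at_right 0)" "(W \<longlongrightarrow> 0) (at_right 0)"
        using halfline_continuous_at_right[OF Fcont] halfline_continuous_at_right[OF Wcont] by (simp_all add: F_def W_def)
      then have "(p \<longlongrightarrow> inner (w (W h - 0)) (F h - 0)) (at_right 0)"
        unfolding p_def Y_def g_def using lW lF
        by (intro tendsto_inner tendsto_diff bounded_linear.tendsto[OF bounded_linear_w])
      then have "inner (w (W h)) (F h) \<le> p s"
        by (intro tendsto_upperbound[of p _ "at_right 0"]) (use mono that in \<open>auto simp: eventually_at_right_field intro!: exI[of _ s]\<close>)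
      then show ?thesis using flux_nonneg[OF \<open>0 < h\<close>] by simp
    qed
    have "(p has_vector_derivative 0) (at t)"
      by (rule has_vector_derivative_transform_within_open[of "\<lambda>_. 0" _ _ "{0<..}"])
        (use pnonneg pnonpos \<open>0 < t\<close> in \<open>auto intro: antisym\<close>)
    with pder[OF \<open>0 < t\<close>] have "inner (A (Y t)) (Y t) = 0" by (rule vector_derivative_unique_at)
    with coercive'[OF rangeI[OF gG[OF \<open>0 < t\<close>]]] \<kappa>_pos have "Y t = 0"
      by (simp add: mult_le_0_iff)
    then show ?thesis by (simp add: Y_def)
  qed
  have "((\<lambda>s. U s) \<longlongrightarrow> U t) at_top"
    by (rule tendsto_eventually)
      (use shift[of "s - t" t for s] W t in \<open>auto simp: eventually_at_top_dense intro!: exI[of _ t]\<close>)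
  with lim show ?thesis using tendsto_unique[OF trivial_limit_at_top_linorder] by blast
qed

end

section \<open>Estimates for decaying solutions on the half-line\<close>

context first_order_system
begin

text \<open>Mild solutions: \<open>\<Phi>\<close> is the potential, \<open>U = (\<Phi>\<^sub>t, \<nabla>\<^sub>x \<Phi>)\<close>,
  and the divergence equation is integrated in \<open>t\<close>, so that \<open>U\<close> only has to be continuous. The bound on
  \<open>\<Phi>\<close> is what finite energy on the half-line provides; it is weak enough to be kept by all limits and strong
  enough for the logarithmic arguments below.\<close>

definition sol :: "(real \<Rightarrow> 'a) \<Rightarrow> (real \<Rightarrow> 'a \<times> 'b) \<Rightarrow> bool" where
  "sol \<Phi> U \<longleftrightarrow> continuous_on {0..} U \<and>
     (\<forall>t\<ge>0. (\<Phi> has_vector_derivative fst (U t)) (at t within {0..}) \<and> (\<Phi> t, snd (U t)) \<in> G) \<and>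
     (\<forall>t\<ge>0. \<forall>h\<ge>0. \<forall>g y. (g, y) \<in> G \<longrightarrow> inner (w (U (t + h)) - w (U t)) g = inner (q (avg h U t)) y) \<and>
     (\<exists>C. \<forall>t\<ge>0. (norm (\<Phi> t))\<^sup>2 \<le> C * (1 + t)) \<and> (U \<longlongrightarrow> 0) at_top"

text \<open>Differentiable solutions, for which the equations hold at every time.\<close>

definition regular :: "(real \<Rightarrow> 'a) \<Rightarrow> (real \<Rightarrow> 'a \<times> 'b) \<Rightarrow> (real \<Rightarrow> 'a \<times> 'b) \<Rightarrow> bool" where
  "regular \<Phi> U V \<longleftrightarrow> sol \<Phi> U \<and>
     (\<forall>t\<ge>0. (U has_vector_derivative V t) (at t within {0..}) \<and> (U t, V t) \<in> flow)"

lemma solD: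
  assumes "sol \<Phi> U"
  shows "continuous_on {0..} U" "continuous_on {0..} \<Phi>"
    "\<And>t. 0 \<le> t \<Longrightarrow> (\<Phi> has_vector_derivative fst (U t)) (at t within {0..})"
    "\<And>t. 0 \<le> t \<Longrightarrow> (\<Phi> t, snd (U t)) \<in> G"
    "\<And>t. 0 \<le> t \<Longrightarrow> snd (U t) \<in> closure (snd ` G)"
    "\<And>t h g y. 0 \<le> t \<Longrightarrow> 0 \<le> h \<Longrightarrow> (g, y) \<in> G \<Longrightarrow> inner (w (U (t + h)) - w (U t)) g = inner (q (avg h U t)) y"
    "\<exists>C>0. \<forall>t\<ge>0. (norm (\<Phi> t))\<^sup>2 \<le> C * (1 + t)"
    "(U \<longlongrightarrow> 0) at_top"
proof -
  show "\<And>t. 0 \<le> t \<Longrightarrow> (\<Phi> has_vector_derivative fst (U t)) (at t within {0..})"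
    using assms by (simp add: sol_def)
  then show "continuous_on {0..} \<Phi>" by (intro continuous_on_halfline_if_vector_derivative) auto
  show G: "\<And>t. 0 \<le> t \<Longrightarrow> (\<Phi> t, snd (U t)) \<in> G" using assms by (simp add: sol_def)
  show "\<And>t. 0 \<le> t \<Longrightarrow> snd (U t) \<in> closure (snd ` G)" by (rule rangeI[OF G])
  obtain C where C: "\<forall>t\<ge>0. (norm (\<Phi> t))\<^sup>2 \<le> C * (1 + t)" using assms by (auto simp: sol_def)
  have "C * (1 + t) \<le> (\<bar>C\<bar> + 1) * (1 + t)" if "0 \<le> t" for t
    using that by (intro mult_right_mono) auto
  with C have "\<forall>t\<ge>0. (norm (\<Phi> t))\<^sup>2 \<le> (\<bar>C\<bar> + 1) * (1 + t)" by (meson order_trans)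
  then show "\<exists>C>0. \<forall>t\<ge>0. (norm (\<Phi> t))\<^sup>2 \<le> C * (1 + t)" by (intro exI[of _ "\<bar>C\<bar> + 1"]) auto
qed (use assms in \<open>simp_all add: sol_def\<close>)

lemma regularD:
  assumes "regular \<Phi> U V"
  shows "sol \<Phi> U" "\<And>t. 0 \<le> t \<Longrightarrow> (U has_vector_derivative V t) (at t within {0..})"
    "\<And>t. 0 \<le> t \<Longrightarrow> (U t, V t) \<in> flow"
  using assms by (auto simp: regular_def)

lemma avg_lincomb:
  fixes X Y :: "real \<Rightarrow> 'c::banach"
  assumes "continuous_on {0..} X" "continuous_on {0..} Y" "0 \<le> t"
  shows "avg h (\<lambda>t. a *\<^sub>R X t + b *\<^sub>R Y t) t = a *\<^sub>R avg h X t + b *\<^sub>R avg h Y t"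
proof -
  have "X integrable_on {t..t+h}" "Y integrable_on {t..t+h}"
    using assms by (auto intro!: integrable_continuous_interval intro: continuous_on_subset)
  then show ?thesis unfolding avg_def by (simp add: integral_add integrable_cmul)
qed

lemma avg_shift:
  fixes X :: "real \<Rightarrow> 'c::banach"
  assumes "continuous_on {0..} X" "0 \<le> t" "0 \<le> h" "0 \<le> s"
  shows "avg h (\<lambda>t. X (t + s)) t = avg h X (t + s)"
proof -
  have "((\<lambda>r. integral {0..r} X) has_vector_derivative X r) (at r within {0..})" if "0 \<le> r" for r
    by (rule halfline_integral_derivative[OF assms(1) that])
  from shift_derivative[OF this _ assms(4)]
  have d: "((\<lambda>r. integral {0..r + s} X) has_vector_derivative X (r + s)) (at r within {0..})" if "0 \<le> r" for r
    using that by blast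
  have "avg h (\<lambda>t. X (t + s)) t = integral {0..t + h + s} X - integral {0..t + s} X"
    using avg_of_derivative[OF d assms(2,3)] by (simp add: incr_def)
  then show ?thesis using avg_eq_primitive[OF assms(1), of "t + s" h] assms by (simp add: add_ac)
qed

lemma G_lincomb: "(x, y) \<in> G \<Longrightarrow> (x', y') \<in> G \<Longrightarrow> (a *\<^sub>R x + b *\<^sub>R x', a *\<^sub>R y + b *\<^sub>R y') \<in> G"
  using subspace_add[OF subspace_G subspace_scale[OF subspace_G] subspace_scale[OF subspace_G], of "(x,y)" "(x',y')" a b]
  by simp

lemma flow_lincomb: "(x, y) \<in> flow \<Longrightarrow> (x', y') \<in> flow \<Longrightarrow> (a *\<^sub>R x + b *\<^sub>R x', a *\<^sub>R y + b *\<^sub>R y') \<in> flow"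
  using subspace_add[OF subspace_flow subspace_scale[OF subspace_flow] subspace_scale[OF subspace_flow], of "(x,y)" "(x',y')" a b]
  by simp

lemma vector_derivative_lincomb:
  "(f has_vector_derivative f') F \<Longrightarrow> (g has_vector_derivative g') F \<Longrightarrow>
   ((\<lambda>t. a *\<^sub>R f t + b *\<^sub>R g t) has_vector_derivative a *\<^sub>R f' + b *\<^sub>R g') F"
  by (intro has_vector_derivative_add bounded_linear.has_vector_derivative[OF bounded_linear_scaleR_right])

lemma sol_lincomb:
  assumes "sol \<Phi> U" "sol \<Psi> W"
  shows "sol (\<lambda>t. a *\<^sub>R \<Phi> t + b *\<^sub>R \<Psi> t) (\<lambda>t. a *\<^sub>R U t + b *\<^sub>R W t)"
proof -
  note 1 = solD[OF assms(1)] and 2 = solD[OF assms(2)]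
  have der: "((\<lambda>t. a *\<^sub>R \<Phi> t + b *\<^sub>R \<Psi> t) has_vector_derivative fst (a *\<^sub>R U t + b *\<^sub>R W t)) (at t within {0..})"
    if "0 \<le> t" for t
    using vector_derivative_lincomb[OF 1(3)[OF that] 2(3)[OF that], of a b] by simp
  have inG: "(a *\<^sub>R \<Phi> t + b *\<^sub>R \<Psi> t, snd (a *\<^sub>R U t + b *\<^sub>R W t)) \<in> G" if "0 \<le> t" for t
    using G_lincomb[OF 1(4)[OF that] 2(4)[OF that], of a b] by simp
  have eq: "inner (w (a *\<^sub>R U (t + h) + b *\<^sub>R W (t + h)) - w (a *\<^sub>R U t + b *\<^sub>R W t)) g
      = inner (q (avg h (\<lambda>t. a *\<^sub>R U t + b *\<^sub>R W t) t)) y" if "0 \<le> t" "0 \<le> h" "(g, y) \<in> G" for t h g y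
    using 1(6)[OF that] 2(6)[OF that] avg_lincomb[OF 1(1) 2(1) that(1), of h a b]
    by (simp add: A_linear inner_add_left inner_diff_left algebra_simps)
  obtain C D where C: "\<forall>t\<ge>0. (norm (\<Phi> t))\<^sup>2 \<le> C * (1 + t)" and D: "\<forall>t\<ge>0. (norm (\<Psi> t))\<^sup>2 \<le> D * (1 + t)"
    using 1(7) 2(7) by blast
  have gr: "(norm (a *\<^sub>R \<Phi> t + b *\<^sub>R \<Psi> t))\<^sup>2 \<le> (2 * a\<^sup>2 * C + 2 * b\<^sup>2 * D) * (1 + t)" if "0 \<le> t" for t
  proof -
    have "(norm (a *\<^sub>R \<Phi> t + b *\<^sub>R \<Psi> t))\<^sup>2 \<le> (\<bar>a\<bar> * norm (\<Phi> t) + \<bar>b\<bar> * norm (\<Psi> t))\<^sup>2"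
      by (intro power_mono norm_triangle_le) auto
    also have "\<dots> \<le> 2 * a\<^sup>2 * (norm (\<Phi> t))\<^sup>2 + 2 * b\<^sup>2 * (norm (\<Psi> t))\<^sup>2"
    proof -
      have "(x + y)\<^sup>2 \<le> 2 * x\<^sup>2 + 2 * y\<^sup>2" for x y :: real
        using zero_le_power2[of "x - y"] by (simp add: power2_eq_square algebra_simps)
      from this[of "\<bar>a\<bar> * norm (\<Phi> t)" "\<bar>b\<bar> * norm (\<Psi> t)"] show ?thesis by (simp add: power_mult_distrib)
    qed
    also have "\<dots> \<le> 2 * a\<^sup>2 * (C * (1 + t)) + 2 * b\<^sup>2 * (D * (1 + t))"
      using C D that by (intro add_mono mult_left_mono) auto
    finally show ?thesis by (simp add: algebra_simps)
  qed
  have "((\<lambda>t. a *\<^sub>R U t + b *\<^sub>R W t) \<longlongrightarrow> a *\<^sub>R 0 + b *\<^sub>R 0) at_top"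
    by (intro tendsto_intros 1 2)
  then show ?thesis unfolding sol_def using der inG eq gr
    by (auto intro!: continuous_intros 1 2)
qed

lemma regular_lincomb:
  assumes "regular \<Phi> U V" "regular \<Psi> W X"
  shows "regular (\<lambda>t. a *\<^sub>R \<Phi> t + b *\<^sub>R \<Psi> t) (\<lambda>t. a *\<^sub>R U t + b *\<^sub>R W t) (\<lambda>t. a *\<^sub>R V t + b *\<^sub>R X t)"
  unfolding regular_def
  using sol_lincomb[OF regularD(1)[OF assms(1)] regularD(1)[OF assms(2)]]
    flow_lincomb[OF regularD(3)[OF assms(1)] regularD(3)[OF assms(2)]]
    vector_derivative_lincomb[OF regularD(2)[OF assms(1)] regularD(2)[OF assms(2)]] by blast

lemma sol_shift:
  assumes "sol \<Phi> U" "0 \<le> s"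
  shows "sol (\<lambda>t. \<Phi> (t + s)) (\<lambda>t. U (t + s))"
proof -
  note 1 = solD[OF assms(1)]
  have eq: "inner (w (U (t + h + s)) - w (U (t + s))) g = inner (q (avg h (\<lambda>t. U (t + s)) t)) y"
    if "0 \<le> t" "0 \<le> h" "(g, y) \<in> G" for t h g y
    using 1(6)[of "t + s" h g y] that assms(2) avg_shift[OF 1(1) that(1,2) assms(2)] by (simp add: add_ac)
  obtain C where C: "C > 0" "\<forall>t\<ge>0. (norm (\<Phi> t))\<^sup>2 \<le> C * (1 + t)" using 1(7) by blast
  have gr: "(norm (\<Phi> (t + s)))\<^sup>2 \<le> (C * (1 + s)) * (1 + t)" if "0 \<le> t" for t
  proof -
    have "(norm (\<Phi> (t + s)))\<^sup>2 \<le> C * (1 + (t + s))" using C that assms(2) by simp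
    also have "\<dots> \<le> C * ((1 + s) * (1 + t))" using C(1) that assms(2) by (intro mult_left_mono) (auto simp: algebra_simps)
    finally show ?thesis by (simp add: mult_ac)
  qed
  have "filterlim (\<lambda>t. t + s) at_top at_top"
    using filterlim_tendsto_add_at_top[OF tendsto_const[of s] filterlim_ident] by (simp add: add.commute)
  then have "((\<lambda>t. U (t + s)) \<longlongrightarrow> 0) at_top" by (rule filterlim_compose[OF 1(8)])
  moreover have "continuous_on {0..} (\<lambda>t. U (t + s))"
    by (rule continuous_on_compose2[OF 1(1)]) (use assms(2) in \<open>auto intro!: continuous_intros\<close>)
  moreover have "(\<Phi> (t + s), snd (U (t + s))) \<in> G" if "0 \<le> t" for t
    using 1(4)[of "t + s"] that assms(2) by simp
  moreover have "((\<lambda>t. \<Phi> (t + s)) has_vector_derivative fst (U (t + s))) (at t within {0..})" if "0 \<le> t" for t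
    by (rule shift_derivative[OF 1(3) that assms(2)])
  moreover have "\<exists>C. \<forall>t\<ge>0. (norm (\<Phi> (t + s)))\<^sup>2 \<le> C * (1 + t)" using gr by blast
  ultimately show ?thesis unfolding sol_def using eq by blast
qed

lemma regular_shift:
  assumes "regular \<Phi> U V" "0 \<le> s"
  shows "regular (\<lambda>t. \<Phi> (t + s)) (\<lambda>t. U (t + s)) (\<lambda>t. V (t + s))"
  unfolding regular_def
  using sol_shift[OF regularD(1)[OF assms(1)] assms(2)] regularD(3)[OF assms(1)] assms(2)
    shift_derivative[OF regularD(2)[OF assms(1)] _ assms(2)] by simp

lemma regular_incr:
  assumes "regular \<Phi> U V" "0 \<le> h"
  shows "regular (incr h \<Phi>) (incr h U) (incr h V)"
  using regular_lincomb[OF regular_shift[OF assms] assms(1), of 1 "-1"] by (simp add: incr_def[abs_def])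

text \<open>The average of a mild solution is differentiable: the integrated divergence equation is exactly the divergence part of
  \<open>flow\<close> for \<open>(avg h U, incr h U)\<close>.\<close>

lemma regular_avg:
  assumes "sol \<Phi> U" "0 \<le> h"
  shows "regular (avg h \<Phi>) (avg h U) (incr h U)"
proof -
  note 1 = solD[OF assms(1)]
  have fstU: "fst (avg h U t) = incr h \<Phi> t" if "0 \<le> t" for t
    using avg_of_derivative[OF 1(3) that assms(2)] avg_bounded_linear[OF bounded_linear_fst 1(1) that] by simp
  have inG: "(avg h \<Phi> t, snd (avg h U t)) \<in> G" if "0 \<le> t" for t
  proof -
    have c: "continuous_on {0..} (\<lambda>t. (\<Phi> t, snd (U t)))" by (intro continuous_intros 1)
    have "avg h (\<lambda>t. (\<Phi> t, snd (U t))) t \<in> G" unfolding avg_def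
      by (rule integral_in_closed_subspace[OF closed_G subspace_G])
        (use that 1(4) in \<open>auto intro!: integrable_continuous_interval continuous_on_subset[OF c]\<close>)
    moreover have "avg h (\<lambda>t. (\<Phi> t, snd (U t))) t = (avg h \<Phi> t, snd (avg h U t))"
      using avg_bounded_linear[OF bounded_linear_fst c that, of h] avg_bounded_linear[OF bounded_linear_snd c that, of h]
        avg_bounded_linear[OF bounded_linear_snd 1(1) that, of h] by (simp add: prod_eq_iff)
    ultimately show ?thesis by simp
  qed
  have fl: "(avg h U t, incr h U t) \<in> flow" if t: "0 \<le> t" for t
  proof -
    have "(incr h \<Phi> t, snd (incr h U t)) \<in> G"
      using G_lincomb[OF 1(4)[of "t + h"] 1(4)[of t], of 1 "-1"] t assms(2) by (simp add: incr_def)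
    then show ?thesis using 1(6)[OF t assms(2)]
      by (auto simp: flow_def fstU[OF t] incr_def A_linear)
  qed
  have der: "(avg h U has_vector_derivative incr h U t) (at t within {0..})" if "0 \<le> t" for t
    by (rule avg_derivative[OF 1(1) that assms(2)])
  have eq: "inner (w (avg h U (t + s)) - w (avg h U t)) g = inner (q (avg s (avg h U) t)) y"
    if "0 \<le> t" "0 \<le> s" "(g, y) \<in> G" for t s g y
  proof -
    have c: "continuous_on {0..} (avg h U)" by (rule continuous_avg[OF 1(1) assms(2)])
    have bl: "bounded_linear (\<lambda>u. inner (w u) g)" "bounded_linear (\<lambda>u. inner (q u) y)"
      by (intro bounded_linear_compose[OF bounded_linear_inner_left] bounded_linear_w bounded_linear_q)+
    have "((\<lambda>t. inner (w (avg h U t)) g) has_vector_derivative inner (w (incr h U t)) g) (at t within {0..})" if "0 \<le> t" for t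
      by (rule bounded_linear.has_vector_derivative[OF bl(1) der[OF that]])
    from avg_of_derivative[OF this that(1,2)]
    have "inner (w (avg h U (t + s)) - w (avg h U t)) g = avg s (\<lambda>t. inner (w (incr h U t)) g) t"
      by (simp add: incr_def[where X = "\<lambda>t. inner (w (avg h U t)) g"] inner_diff_left)
    also have "\<dots> = avg s (\<lambda>t. inner (q (avg h U t)) y) t"
      unfolding avg_def[of s] by (rule integral_cong) (use flow_divergence[OF fl that(3)] that in auto)
    also have "\<dots> = inner (q (avg s (avg h U) t)) y"
      using avg_bounded_linear[OF bl(2) c that(1)] by simp
    finally show ?thesis .
  qed
  obtain C where C: "C > 0" "\<forall>t\<ge>0. (norm (\<Phi> t))\<^sup>2 \<le> C * (1 + t)" using 1(7) by blast
  have gr: "(norm (avg h \<Phi> t))\<^sup>2 \<le> (h\<^sup>2 * (C * (1 + h))) * (1 + t)" if "0 \<le> t" for t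
  proof -
    have "norm (\<Phi> s) \<le> sqrt (C * (1 + h) * (1 + t))" if "t \<le> s" "s \<le> t + h" for s
    proof (rule real_le_rsqrt)
      have "(norm (\<Phi> s))\<^sup>2 \<le> C * (1 + s)" using C \<open>0 \<le> t\<close> that by simp
      also have "\<dots> \<le> C * ((1 + h) * (1 + t))"
      proof (intro mult_left_mono)
        show "1 + s \<le> (1 + h) * (1 + t)"
          using that mult_nonneg_nonneg[OF assms(2) \<open>0 \<le> t\<close>] by (simp add: algebra_simps)
      qed (use C(1) in auto)
      finally show "(norm (\<Phi> s))\<^sup>2 \<le> C * (1 + h) * (1 + t)" by (simp add: mult_ac)
    qed
    then have "norm (avg h \<Phi> t) \<le> h * sqrt (C * (1 + h) * (1 + t))"
      using norm_avg_le[OF 1(2) that assms(2)] by blast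
    then have "(norm (avg h \<Phi> t))\<^sup>2 \<le> (h * sqrt (C * (1 + h) * (1 + t)))\<^sup>2" by (rule power_mono) simp
    also have "\<dots> = h\<^sup>2 * (C * (1 + h) * (1 + t))" using C(1) that assms(2) by (simp add: power_mult_distrib)
    finally show ?thesis by (simp add: mult_ac)
  qed
  have lim: "(avg h U \<longlongrightarrow> 0) at_top"
  proof (rule tendstoI)
    fix e :: real assume "e > 0"
    then have "eventually (\<lambda>s. dist (U s) 0 < e / (h + 1)) at_top" using 1(8) assms(2) by (intro tendstoD) auto
    then obtain N where N: "\<And>s. s \<ge> N \<Longrightarrow> norm (U s) < e / (h + 1)" by (auto simp: eventually_at_top_linorder)
    have "norm (avg h U s) < e" if "s \<ge> max N 0" for s
    proof -
      have "norm (avg h U s) \<le> h * (e / (h + 1))"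
        using that assms(2) N by (intro norm_avg_le 1) (auto intro!: less_imp_le)
      also have "\<dots> < e" using assms(2) \<open>e > 0\<close> by (simp add: field_simps)
      finally show ?thesis .
    qed
    then show "eventually (\<lambda>s. dist (avg h U s) 0 < e) at_top"
      unfolding eventually_at_top_linorder by (intro exI[of _ "max N 0"]) simp
  qed
  have "sol (avg h \<Phi>) (avg h U)"
    unfolding sol_def
    using continuous_avg[OF 1(1) assms(2)] avg_derivative[OF 1(2) _ assms(2)] fstU inG eq gr lim by (auto intro!: exI[of _ "h\<^sup>2 * (C * (1 + h))"])
  then show ?thesis using der fl by (simp add: regular_def)
qed

lemma rellich_regular: "regular \<Phi> U V \<Longrightarrow> 0 \<le> t \<Longrightarrow> inner (R (U t)) (U t) = 0"
  by (rule rellich_invariant[of "{0..}" U V]) (auto dest: regularD solD(8)[OF regularD(1)])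

subsection \<open>The energy flux\<close>

text \<open>The energy identity: the flux of \<open>U\<close> through the potential of a second solution has the mixed energy
  density as its derivative.\<close>

lemma flux_derivative:
  assumes "regular \<Phi> U V" "regular \<Psi> W X" "0 \<le> t"
  shows "((\<lambda>t. inner (w (U t)) (\<Psi> t)) has_vector_derivative inner (A (U t)) (W t)) (at t within {0..})"
proof -
  have "((\<lambda>t. inner (w (U t)) (\<Psi> t)) has_vector_derivative inner (w (U t)) (fst (W t)) + inner (w (V t)) (\<Psi> t)) (at t within {0..})"
    by (intro bounded_bilinear.has_vector_derivative[OF bounded_bilinear_inner]
        bounded_linear.has_vector_derivative[OF bounded_linear_w] regularD(2)[OF assms(1)] solD(3)[OF regularD(1)[OF assms(2)]] assms)
  then show ?thesis
    using flow_divergence[OF regularD(3)[OF assms(1,3)] solD(4)[OF regularD(1)[OF assms(2)] assms(3)]]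
    by (simp add: A_inner_split)
qed

lemma flux_bound: "\<bar>inner (w u) x\<bar> \<le> M * norm u * norm x"
  using Cauchy_Schwarz_ineq2[of "w u" x] mult_right_mono[OF w_bound[of u], of "norm x"] by simp

lemma energy_lower:
  assumes "regular \<Phi> U V" "0 \<le> t" shows "\<kappa> * (norm (U t))\<^sup>2 \<le> inner (A (U t)) (U t)"
  by (rule coercive'[OF solD(5)[OF regularD(1)[OF assms(1)] assms(2)]])

lemma flux_mono:
  assumes "regular \<Phi> U V" "0 \<le> s" "s \<le> t"
  shows "inner (w (U s)) (\<Phi> s) \<le> inner (w (U t)) (\<Phi> t)"
proof (rule nondecreasing_if_derivative_nonneg[of "{0..}" "\<lambda>t. inner (w (U t)) (\<Phi> t)" "\<lambda>t. inner (A (U t)) (U t)"])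
  show "0 \<le> inner (A (U t)) (U t)" if "t \<in> {0..}" for t
    using energy_lower[OF assms(1), of t] that \<kappa>_pos by (smt (verit) atLeast_iff mult_nonneg_nonneg zero_le_power2)
qed (use flux_derivative[OF assms(1) assms(1)] assms(2,3) in auto)

text \<open>The flux \<open>p\<close> is nondecreasing, with the energy density as derivative. The growth bound for
  \<open>\<Phi>\<close> gives \<open>c p\<^sup>2 \<le> (1 + t) p'\<close>. A positive value of \<open>p\<close> is then
  impossible: \<open>- 1 / p\<close> would increase at least like \<open>c ln (1 + t)\<close>, which is unbounded, while staying
  negative.\<close>

lemma flux_nonpos:
  assumes reg: "regular \<Phi> U V" and t0: "0 \<le> t0"
  shows "inner (w (U t0)) (\<Phi> t0) \<le> 0"
proof (rule ccontr)
  define p where "p t = inner (w (U t)) (\<Phi> t)" for t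
  assume "\<not> ?thesis"
  then have p0: "0 < p t0" by (simp add: p_def)
  have pos: "0 < p s" if "t0 \<le> s" for s using flux_mono[OF reg t0 that] p0 by (simp add: p_def)
  obtain C where C: "C > 0" "\<forall>t\<ge>0. (norm (\<Phi> t))\<^sup>2 \<le> C * (1 + t)" using solD(7)[OF regularD(1)[OF reg]] by blast
  define c where "c = \<kappa> / (M\<^sup>2 * C)"
  have c: "c > 0" using C(1) M_pos \<kappa>_pos by (simp add: c_def)
  have growth: "c * (p t)\<^sup>2 \<le> (1 + t) * inner (A (U t)) (U t)" if "0 \<le> t" for t
  proof -
    have "(p t)\<^sup>2 \<le> (M * norm (U t) * norm (\<Phi> t))\<^sup>2"
      unfolding p_def using flux_bound[of "U t" "\<Phi> t"] by (metis abs_ge_zero power2_abs power_mono)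
    also have "\<dots> = M\<^sup>2 * (norm (U t))\<^sup>2 * (norm (\<Phi> t))\<^sup>2" by (simp add: power_mult_distrib)
    also have "\<dots> \<le> M\<^sup>2 * (norm (U t))\<^sup>2 * (C * (1 + t))" using C(2) that by (intro mult_left_mono) auto
    finally have "c * (p t)\<^sup>2 \<le> c * (M\<^sup>2 * (norm (U t))\<^sup>2 * (C * (1 + t)))" using c by (intro mult_left_mono) auto
    also have "\<dots> = (1 + t) * (\<kappa> * (norm (U t))\<^sup>2)" using C(1) M_pos by (simp add: c_def field_simps)
    also have "\<dots> \<le> (1 + t) * inner (A (U t)) (U t)" using energy_lower[OF reg that] that by (intro mult_left_mono) auto
    finally show ?thesis .
  qed
  have der: "((\<lambda>t. - inverse (p t) - c * ln (1 + t)) has_vector_derivative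
      inner (A (U t)) (U t) / (p t)\<^sup>2 - c / (1 + t)) (at t within {t0..})" if "t \<in> {t0..}" for t
  proof -
    have "(p has_vector_derivative inner (A (U t)) (U t)) (at t within {t0..})"
      unfolding p_def by (rule has_vector_derivative_within_subset[OF flux_derivative[OF reg reg]]) (use t0 that in auto)
    then have pd: "(p has_real_derivative inner (A (U t)) (U t)) (at t within {t0..})"
      by (simp add: has_real_derivative_iff_has_vector_derivative)
    have "p t \<noteq> 0" using pos[of t] that by auto
    have "((\<lambda>t. - inverse (p t) - c * ln (1 + t)) has_real_derivative
      inner (A (U t)) (U t) / (p t)\<^sup>2 - c / (1 + t)) (at t within {t0..})"
      using that t0 \<open>p t \<noteq> 0\<close>
      by (auto intro!: derivative_eq_intros pd simp: power2_eq_square divide_inverse)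
    then show ?thesis by (simp add: has_real_derivative_iff_has_vector_derivative)
  qed
  have nn: "0 \<le> inner (A (U t)) (U t) / (p t)\<^sup>2 - c / (1 + t)" if "t \<in> {t0..}" for t
    using growth[of t] pos[of t] that t0 by (auto simp: field_simps)
  obtain t where t: "t \<ge> t0" "c * ln (1 + t) > inverse (p t0) + c * ln (1 + t0)"
    using ln_unbounded[OF c] by blast
  have "- inverse (p t0) - c * ln (1 + t0) \<le> - inverse (p t) - c * ln (1 + t)"
    by (rule nondecreasing_if_derivative_nonneg[OF der nn]) (use t in auto)
  then show False using t(2) pos[OF t(1)] by (smt (verit) inverse_nonnegative_iff_nonnegative)
qed

text \<open>The antisymmetric flux \<open>c\<close> is constant because \<open>A\<close> is self-adjoint. If \<open>c\<close> is
  not zero, the energy density is at least \<open>b / (1 + t)\<close>, which is not integrable, whereas the total energy is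
  bounded because the fluxes stay nonpositive.\<close>

lemma green:
  assumes r1: "regular \<Phi> U V" and r2: "regular \<Psi> W X"
  shows "inner (w (U 0)) (\<Psi> 0) = inner (w (W 0)) (\<Phi> 0)"
proof -
  define c where "c t = inner (w (U t)) (\<Psi> t) - inner (w (W t)) (\<Phi> t)" for t
  have "(c has_vector_derivative 0) (at t within {0..})" if "t \<in> {0..}" for t
    using has_vector_derivative_diff[OF flux_derivative[OF r1 r2] flux_derivative[OF r2 r1], of t] that
      self_adjoint[of "U t" "W t"] by (simp add: c_def[abs_def] inner_commute)
  then have const: "c t = c 0" if "0 \<le> t" for t
    using constant_if_derivative_zero[of "{0..}" c 0 t] that by auto
  obtain C where C: "C > 0" "\<forall>t\<ge>0. (norm (\<Phi> t))\<^sup>2 \<le> C * (1 + t)" using solD(7)[OF regularD(1)[OF r1]] by blast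
  obtain D where D: "D > 0" "\<forall>t\<ge>0. (norm (\<Psi> t))\<^sup>2 \<le> D * (1 + t)" using solD(7)[OF regularD(1)[OF r2]] by blast
  define L where "L = 2 * M\<^sup>2 * (C + D)"
  have L: "L > 0" using C(1) D(1) M_pos by (simp add: L_def)
  define e where "e t = inner (A (U t)) (U t) + inner (A (W t)) (W t)" for t
  have low: "\<kappa> * (c 0)\<^sup>2 / L / (1 + t) \<le> e t" if "0 \<le> t" for t
  proof -
    have "\<bar>c t\<bar> \<le> M * norm (U t) * norm (\<Psi> t) + M * norm (W t) * norm (\<Phi> t)"
      unfolding c_def using flux_bound[of "U t" "\<Psi> t"] flux_bound[of "W t" "\<Phi> t"] by linarith
    then have "(c t)\<^sup>2 \<le> (M * norm (U t) * norm (\<Psi> t) + M * norm (W t) * norm (\<Phi> t))\<^sup>2"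
      by (metis abs_ge_zero power2_abs power_mono)
    also have "\<dots> \<le> 2 * (M * norm (U t) * norm (\<Psi> t))\<^sup>2 + 2 * (M * norm (W t) * norm (\<Phi> t))\<^sup>2"
    proof -
      have "(x + y)\<^sup>2 \<le> 2 * x\<^sup>2 + 2 * y\<^sup>2" for x y :: real
        using zero_le_power2[of "x - y"] by (simp add: power2_eq_square algebra_simps)
      then show ?thesis by blast
    qed
    also have "\<dots> = 2 * M\<^sup>2 * ((norm (U t))\<^sup>2 * (norm (\<Psi> t))\<^sup>2 + (norm (W t))\<^sup>2 * (norm (\<Phi> t))\<^sup>2)"
      by (simp add: power_mult_distrib algebra_simps)
    also have "\<dots> \<le> 2 * M\<^sup>2 * ((norm (U t))\<^sup>2 * ((C + D) * (1 + t)) + (norm (W t))\<^sup>2 * ((C + D) * (1 + t)))"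
    proof -
      have "C * (1 + t) \<le> (C + D) * (1 + t)" "D * (1 + t) \<le> (C + D) * (1 + t)"
        using C(1) D(1) that by (auto intro!: mult_right_mono)
      then have "(norm (\<Phi> t))\<^sup>2 \<le> (C + D) * (1 + t)" "(norm (\<Psi> t))\<^sup>2 \<le> (C + D) * (1 + t)"
        using C(2) D(2) that by (meson order_trans)+
      then show ?thesis by (intro mult_left_mono add_mono) auto
    qed
    also have "\<dots> = L * (1 + t) * ((norm (U t))\<^sup>2 + (norm (W t))\<^sup>2)" by (simp add: L_def algebra_simps)
    finally have "\<kappa> * (c t)\<^sup>2 \<le> \<kappa> * (L * (1 + t) * ((norm (U t))\<^sup>2 + (norm (W t))\<^sup>2))"
      using \<kappa>_pos by (intro mult_left_mono) auto
    also have "\<dots> = L * (1 + t) * (\<kappa> * (norm (U t))\<^sup>2 + \<kappa> * (norm (W t))\<^sup>2)"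
      by (simp add: algebra_simps)
    also have "\<dots> \<le> L * (1 + t) * e t"
      unfolding e_def using L that energy_lower[OF r1 that] energy_lower[OF r2 that] by (intro mult_left_mono add_mono) auto
    finally have "\<kappa> * (c t)\<^sup>2 \<le> e t * (L * (1 + t))" by (simp add: mult_ac)
    moreover have "0 < L * (1 + t)" using L that by simp
    ultimately have "\<kappa> * (c t)\<^sup>2 / (L * (1 + t)) \<le> e t" by (simp only: pos_divide_le_eq)
    then show ?thesis using const[OF that] by simp
  qed
  have "c 0 = 0"
  proof (rule ccontr)
    assume "c 0 \<noteq> 0"
    define b where "b = \<kappa> * (c 0)\<^sup>2 / L"
    have b: "b > 0" using \<kappa>_pos L \<open>c 0 \<noteq> 0\<close> by (simp add: b_def)
    define p where "p t = inner (w (U t)) (\<Phi> t) + inner (w (W t)) (\<Psi> t)" for t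
    have der: "((\<lambda>t. p t - b * ln (1 + t)) has_vector_derivative e t - b / (1 + t)) (at t within {0..})" if "t \<in> {0..}" for t
    proof -
      have "(p has_vector_derivative e t) (at t within {0..})"
        unfolding p_def e_def using that by (intro has_vector_derivative_add flux_derivative[OF r1 r1] flux_derivative[OF r2 r2]) auto
      then have "(p has_real_derivative e t) (at t within {0..})"
        by (simp add: has_real_derivative_iff_has_vector_derivative)
      then have "((\<lambda>t. p t - b * ln (1 + t)) has_real_derivative e t - b / (1 + t)) (at t within {0..})"
        using that by (auto intro!: derivative_eq_intros)
      then show ?thesis by (simp add: has_real_derivative_iff_has_vector_derivative)
    qed
    obtain t where t: "t \<ge> 0" "b * ln (1 + t) > - p 0" using ln_unbounded[OF b] by blast
    have "p 0 - b * ln (1 + 0) \<le> p t - b * ln (1 + t)"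
      by (rule nondecreasing_if_derivative_nonneg[OF der]) (use t low in \<open>auto simp: b_def\<close>)
    moreover have "p t \<le> 0" using flux_nonpos[OF r1 t(1)] flux_nonpos[OF r2 t(1)] by (simp add: p_def)
    ultimately show False using t(2) by simp
  qed
  then show ?thesis by (simp add: c_def)
qed

subsection \<open>Bounds by the initial value\<close>

text \<open>The time integral \<open>Y\<close> of \<open>U\<close> satisfies the Rellich identity and \<open>Y\<^sub>0 = \<Phi> -
  \<Phi> 0\<close>. Inserting this into coercivity for \<open>(\<Phi>, Y\<^sub>1)\<close> bounds
  \<open>\<parallel>\<Phi>\<parallel>\<^sup>2\<close> by \<open>\<parallel>\<Phi> 0\<parallel>\<^sup>2\<close> plus the time
  derivative of the flux \<open>\<langle>w Y, g\<rangle>\<close>, where \<open>g\<close> is the time integral of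
  \<open>\<Phi>\<close>. This flux is nonpositive.\<close>

lemma integral_bound_by_initial_value:
  assumes reg: "regular \<Phi> U V" and T: "0 \<le> T"
  shows "\<kappa> * integral {0..T} (\<lambda>t. (norm (\<Phi> t))\<^sup>2) \<le> T * M * (norm (\<Phi> 0))\<^sup>2"
proof -
  note s = regularD(1)[OF reg] and 1 = solD[OF regularD(1)[OF reg]]
  define g where "g t = integral {0..t} \<Phi>" for t
  define Y where "Y t = integral {0..t} U" for t
  define N where "N t = integral {0..t} (\<lambda>t. (norm (\<Phi> t))\<^sup>2)" for t
  have reg': "regular (avg t \<Phi>) (avg t U) (incr t U)" if "0 \<le> t" for t by (rule regular_avg[OF s that])
  have at0: "avg t \<Phi> 0 = g t" "avg t U 0 = Y t" for t by (simp_all add: avg_def g_def Y_def)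
  have Y0: "fst (Y t) = \<Phi> t - \<Phi> 0" if "0 \<le> t" for t
    using avg_of_derivative[OF 1(3) _ that, of 0] avg_bounded_linear[OF bounded_linear_fst 1(1), of 0 t] at0(2)[of t]
    by (simp add: incr_def)
  have Y1: "snd (Y t) \<in> closure (snd ` G)" if "0 \<le> t" for t
    using solD(5)[OF regularD(1)[OF reg'[OF that]], of 0] at0(2)[of t] by simp
  have RY: "inner (R (Y t)) (Y t) = 0" if "0 \<le> t" for t
    using rellich_regular[OF reg'[OF that], of 0] at0(2)[of t] by simp
  have grn: "inner (w (U t)) (g t) = inner (w (Y t)) (\<Phi> t)" if "0 \<le> t" for t
    using green[OF regular_shift[OF reg that] reg'[OF that]] at0[of t] by simp
  have neg: "inner (w (Y t)) (g t) \<le> 0" if "0 \<le> t" for t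
    using flux_nonpos[OF reg'[OF that], of 0] at0[of t] by simp
  \<comment> \<open>The Rellich identity for \<open>Y\<close> replaces the tangential energy of \<open>Y\<close> by the normal one.\<close>
  have key: "\<kappa> * (norm (\<Phi> t))\<^sup>2 \<le> M * (norm (\<Phi> 0))\<^sup>2 + 2 * inner (w (Y t)) (\<Phi> t)" if "0 \<le> t" for t
  proof -
    define x x0 y where "x = \<Phi> t" and "x0 = \<Phi> 0" and "y = snd (Y t)"
    define a :: "'a \<Rightarrow> 'a" where "a x = w (x, 0)" for x
    have a_add: "a (u - v) = a u - a v" for u v
      using linear_diff[OF linear_A, of "(u,0)" "(v,0)"] by (simp add: a_def)
    have a_sym: "inner (a u) v = inner (a v) u" for u v using A_cross(1) by (simp add: a_def)
    have "\<kappa> * (norm x)\<^sup>2 \<le> \<kappa> * (norm (x, y))\<^sup>2" using \<kappa>_pos by (simp add: norm_prod_def)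
    also have "\<dots> \<le> inner (A (x, y)) (x, y)" by (rule coercive') (use Y1[OF that] in \<open>simp add: y_def\<close>)
    also have "\<dots> = inner (a x) x + 2 * inner (w (0, y)) x + inner (q (0, y)) y"
      by (subst A_split) (simp add: inner_prod_def inner_add_left A_cross(3) a_def)
    also have "inner (q (0, y)) y = inner (a (x - x0)) (x - x0)"
      using RY[OF that] Y0[OF that] by (simp add: R_def inner_prod_def a_def x_def x0_def y_def)
    also have "inner (a x) x + 2 * inner (w (0, y)) x + inner (a (x - x0)) (x - x0)
       = inner (a x0) x0 + 2 * inner (a (x - x0) + w (0, y)) x"
      using a_sym[of x x0] by (simp add: a_add inner_diff inner_add_left algebra_simps)
    also have "a (x - x0) + w (0, y) = w (Y t)"
      using A_Pair_split[of "Y t"] Y0[OF that] by (simp add: a_def y_def x_def x0_def)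
    also have "inner (a x0) x0 \<le> M * (norm x0)\<^sup>2"
      using flux_bound[of "(x0, 0)" x0] by (simp add: a_def power2_eq_square)
    finally show ?thesis by (simp add: x_def x0_def)
  qed
  have cont2: "continuous_on {0..} (\<lambda>t. (norm (\<Phi> t))\<^sup>2)" by (intro continuous_intros 1)
  have der: "((\<lambda>t. t * M * (norm (\<Phi> 0))\<^sup>2 + inner (w (Y t)) (g t) - \<kappa> * N t) has_vector_derivative
      M * (norm (\<Phi> 0))\<^sup>2 + (inner (w (Y t)) (\<Phi> t) + inner (w (U t)) (g t)) - \<kappa> * (norm (\<Phi> t))\<^sup>2) (at t within {0..})"
    if "t \<in> {0..}" for t
  proof -
    have t: "0 \<le> t" using that by simp
    have "((\<lambda>t. t * M * (norm (\<Phi> 0))\<^sup>2) has_vector_derivative M * (norm (\<Phi> 0))\<^sup>2) (at t within {0..})"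
      by (auto intro!: derivative_eq_intros simp flip: has_real_derivative_iff_has_vector_derivative)
    moreover have "((\<lambda>t. \<kappa> * N t) has_vector_derivative \<kappa> * (norm (\<Phi> t))\<^sup>2) (at t within {0..})"
      unfolding N_def
      by (rule bounded_linear.has_vector_derivative[OF bounded_linear_mult_right halfline_integral_derivative[OF cont2 t]])
    moreover have "((\<lambda>t. inner (w (Y t)) (g t)) has_vector_derivative inner (w (Y t)) (\<Phi> t) + inner (w (U t)) (g t)) (at t within {0..})"
      unfolding Y_def g_def
      by (intro bounded_bilinear.has_vector_derivative[OF bounded_bilinear_inner] bounded_linear.has_vector_derivative[OF bounded_linear_w]
          halfline_integral_derivative 1 t)
    ultimately show ?thesis by (intro has_vector_derivative_diff has_vector_derivative_add)
  qed
  have "0 * M * (norm (\<Phi> 0))\<^sup>2 + inner (w (Y 0)) (g 0) - \<kappa> * N 0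
      \<le> T * M * (norm (\<Phi> 0))\<^sup>2 + inner (w (Y T)) (g T) - \<kappa> * N T"
    by (rule nondecreasing_if_derivative_nonneg[OF der]) (use key grn T in force)+
  then show ?thesis using neg[OF T] by (simp add: N_def g_def)
qed

text \<open>The averaged bound becomes pointwise by monotonicity of \<open>E\<close>, in which the weighted energy flux absorbs
  the error terms.\<close>

lemma bound_by_initial_value:
  "\<exists>K\<ge>0. \<forall>\<Phi> U V. regular \<Phi> U V \<longrightarrow> (\<forall>t\<ge>0. norm (\<Phi> t) \<le> K * norm (\<Phi> 0))"
proof -
  define c where "c = 2 + 4 * M\<^sup>2 / \<kappa>\<^sup>2"
  define K where "K = sqrt (c * M / \<kappa>) + 1"
  have c0: "c > 0" "c * M / \<kappa> \<ge> 0" using \<kappa>_pos M_pos by (auto simp: c_def add_pos_nonneg)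
  have K0: "K \<ge> 1" using c0 by (simp add: K_def)
  have "norm (\<Phi> T) \<le> K * norm (\<Phi> 0)" if reg: "regular \<Phi> U V" and T: "0 \<le> T" for \<Phi> U V T
  proof (cases "T = 0")
    case True
    then show ?thesis using mult_right_mono[OF K0, of "norm (\<Phi> 0)"] by simp
  next
    case False
    then have T: "0 < T" using T by simp
    note 1 = solD[OF regularD(1)[OF reg]]
    define N where "N t = integral {0..t} (\<lambda>t. (norm (\<Phi> t))\<^sup>2)" for t
    define p where "p t = inner (w (U t)) (\<Phi> t)" for t
    define E where "E t = c * N t + (2 / \<kappa>) * (t\<^sup>2 * p t) - t * inner (\<Phi> t) (\<Phi> t)" for t
    define E' where "E' t = c * (norm (\<Phi> t))\<^sup>2 + (2 / \<kappa>) * (2 * t * p t + t\<^sup>2 * inner (A (U t)) (U t))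
        - (inner (\<Phi> t) (\<Phi> t) + 2 * t * inner (\<Phi> t) (fst (U t)))" for t
    have cont2: "continuous_on {0..} (\<lambda>t. (norm (\<Phi> t))\<^sup>2)" by (intro continuous_intros 1)
    have der: "(E has_vector_derivative E' t) (at t within {0..})" if "t \<in> {0..}" for t
    proof -
      have t: "0 \<le> t" using that by simp
      have Nd: "(N has_real_derivative (norm (\<Phi> t))\<^sup>2) (at t within {0..})"
        unfolding N_def has_real_derivative_iff_has_vector_derivative
        by (rule halfline_integral_derivative[OF cont2 t])
      have pd: "(p has_real_derivative inner (A (U t)) (U t)) (at t within {0..})"
        unfolding p_def has_real_derivative_iff_has_vector_derivative by (rule flux_derivative[OF reg reg t])
      have fd: "((\<lambda>t. inner (\<Phi> t) (\<Phi> t)) has_real_derivative inner (\<Phi> t) (fst (U t)) + inner (fst (U t)) (\<Phi> t)) (at t within {0..})"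
        unfolding has_real_derivative_iff_has_vector_derivative
        by (intro bounded_bilinear.has_vector_derivative[OF bounded_bilinear_inner] 1 t)
      show ?thesis unfolding E_def E'_def has_real_derivative_iff_has_vector_derivative[symmetric]
        using \<kappa>_pos by (auto intro!: derivative_eq_intros Nd pd fd simp: inner_commute field_simps power2_eq_square)
    qed
    have nn: "0 \<le> E' t" if "t \<in> {0..}" for t
    proof -
      have t: "0 \<le> t" using that by simp
      define a b where "a = norm (\<Phi> t)" and "b = norm (U t)"
      have "inner (\<Phi> t) (fst (U t)) \<le> norm (\<Phi> t) * norm (fst (U t))" by (rule norm_cauchy_schwarz)
      also have "\<dots> \<le> a * b" unfolding a_def b_def by (intro mult_left_mono norm_fst_le') auto
      finally have i1: "2 * t * inner (\<Phi> t) (fst (U t)) \<le> 2 * t * (a * b)" using t by (intro mult_left_mono) auto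
      have i2: "(2 / \<kappa>) * (2 * t * p t) \<ge> (2 / \<kappa>) * (2 * t * (- (M * b * a)))"
        using flux_bound[of "U t" "\<Phi> t"] t \<kappa>_pos unfolding p_def a_def b_def by (intro mult_left_mono) auto
      have i3: "(2 / \<kappa>) * (t\<^sup>2 * inner (A (U t)) (U t)) \<ge> (2 / \<kappa>) * (t\<^sup>2 * (\<kappa> * b\<^sup>2))"
        using energy_lower[OF reg t] \<kappa>_pos unfolding b_def by (intro mult_left_mono) auto
      \<comment> \<open>The constant \<open>c\<close> is chosen such that the lower bound for \<open>E'\<close> is this sum of squares.\<close>
    have "0 \<le> (a - t * b)\<^sup>2 + (t * b - 2 * M * a / \<kappa>)\<^sup>2" by simp
      also have "\<dots> = c * a\<^sup>2 + (2 / \<kappa>) * (2 * t * (- (M * b * a))) + (2 / \<kappa>) * (t\<^sup>2 * (\<kappa> * b\<^sup>2)) - (a\<^sup>2 + 2 * t * (a * b))"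
        using \<kappa>_pos by (simp add: c_def power2_eq_square field_simps)
      also have "\<dots> \<le> E' t" unfolding E'_def using i1 i2 i3
        by (simp add: power2_norm_eq_inner[symmetric] a_def[symmetric] distrib_left)
      finally show ?thesis .
    qed
    have "E 0 \<le> E T" by (rule nondecreasing_if_derivative_nonneg[OF der nn]) (use T in auto)
    then have "T * inner (\<Phi> T) (\<Phi> T) \<le> c * N T + (2 / \<kappa>) * (T\<^sup>2 * p T)" by (simp add: E_def N_def)
    also have "\<dots> \<le> c * N T" using flux_nonpos[OF reg, of T] T \<kappa>_pos
      by (simp add: p_def mult_nonneg_nonpos divide_nonpos_pos)
    also have "\<dots> \<le> c * (T * M * (norm (\<Phi> 0))\<^sup>2 / \<kappa>)"
      using integral_bound_by_initial_value[OF reg, of T] T \<kappa>_pos c0 by (intro mult_left_mono) (auto simp: N_def field_simps)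
    finally have "T * (norm (\<Phi> T))\<^sup>2 \<le> T * ((c * M / \<kappa>) * (norm (\<Phi> 0))\<^sup>2)"
      by (simp add: power2_norm_eq_inner mult_ac)
    then have "(norm (\<Phi> T))\<^sup>2 \<le> (c * M / \<kappa>) * (norm (\<Phi> 0))\<^sup>2" by (rule mult_left_le_imp_le) (rule T)
    also have "\<dots> = (sqrt (c * M / \<kappa>) * norm (\<Phi> 0))\<^sup>2" using c0 by (simp add: power_mult_distrib)
    finally have "norm (\<Phi> T) \<le> sqrt (c * M / \<kappa>) * norm (\<Phi> 0)" by (rule power2_le_imp_le) (use c0 in auto)
    also have "\<dots> \<le> K * norm (\<Phi> 0)" by (intro mult_right_mono) (auto simp: K_def)
    finally show ?thesis .
  qed
  then show ?thesis using K0 by (intro exI[of _ K]) auto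
qed

text \<open>The same method one derivative higher: \<open>U\<close> is weighted with \<open>t\<^sup>3\<close> and the energies of
  \<open>\<Phi>\<close> and of \<open>U\<^sub>0\<close> absorb the error terms.\<close>

lemma derivative_bound_by_initial_value:
  "\<exists>K\<ge>0. \<forall>\<Phi> U V \<Psi> W. regular \<Phi> U V \<longrightarrow> regular \<Psi> V W \<longrightarrow> (\<forall>t\<ge>0. \<Psi> t = fst (U t)) \<longrightarrow>
     (\<forall>t\<ge>0. t * norm (U t) \<le> K * norm (\<Phi> 0))"
proof -
  define L where "L = 4 + 16 * M\<^sup>2 / \<kappa>\<^sup>2"
  define c1 where "c1 = 2 * L / \<kappa>"
  define c2 where "c2 = 2 * c1 * M\<^sup>2 / \<kappa>"
  have L0: "L > 0" using \<kappa>_pos by (auto simp: L_def add_pos_nonneg)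
  then have c0: "c1 > 0" "c2 \<ge> 0" "c2 * M / \<kappa> \<ge> 0" using \<kappa>_pos M_pos by (auto simp: c1_def c2_def)
  have "T * norm (U T) \<le> sqrt (c2 * M / \<kappa>) * norm (\<Phi> 0)"
    if reg: "regular \<Phi> U V" and reg2: "regular \<Psi> V W" and eq: "\<forall>t\<ge>0. \<Psi> t = fst (U t)" and T: "0 \<le> T" for \<Phi> U V \<Psi> W T
  proof (cases "T = 0")
    case True
    then show ?thesis using c0 by simp
  next
    case False
    then have T: "0 < T" using T by simp
    note 1 = solD[OF regularD(1)[OF reg]] and 2 = solD[OF regularD(1)[OF reg2]]
    define N where "N t = integral {0..t} (\<lambda>t. (norm (\<Phi> t))\<^sup>2)" for t
    define p where "p t = inner (w (U t)) (\<Phi> t)" for t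
    define p2 where "p2 t = inner (w (V t)) (\<Psi> t)" for t
    define E where "E t = c2 * N t + c1 * (t\<^sup>2 * p t) + (2 / \<kappa>) * (t ^ 4 * p2 t) - t ^ 3 * inner (U t) (U t)" for t
    define E' where "E' t = c2 * (norm (\<Phi> t))\<^sup>2 + c1 * (2 * t * p t + t\<^sup>2 * inner (A (U t)) (U t))
        + (2 / \<kappa>) * (4 * t ^ 3 * p2 t + t ^ 4 * inner (A (V t)) (V t))
        - (3 * t\<^sup>2 * inner (U t) (U t) + 2 * t ^ 3 * inner (U t) (V t))" for t
    have cont2: "continuous_on {0..} (\<lambda>t. (norm (\<Phi> t))\<^sup>2)" by (intro continuous_intros 1)
    have der: "(E has_vector_derivative E' t) (at t within {0..})" if "t \<in> {0..}" for t
    proof -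
      have t: "0 \<le> t" using that by simp
      have Nd: "(N has_real_derivative (norm (\<Phi> t))\<^sup>2) (at t within {0..})"
        unfolding N_def has_real_derivative_iff_has_vector_derivative
        by (rule halfline_integral_derivative[OF cont2 t])
      have pd: "(p has_real_derivative inner (A (U t)) (U t)) (at t within {0..})"
        unfolding p_def has_real_derivative_iff_has_vector_derivative by (rule flux_derivative[OF reg reg t])
      have p2d: "(p2 has_real_derivative inner (A (V t)) (V t)) (at t within {0..})"
        unfolding p2_def has_real_derivative_iff_has_vector_derivative by (rule flux_derivative[OF reg2 reg2 t])
      have fd: "((\<lambda>t. inner (U t) (U t)) has_real_derivative inner (U t) (V t) + inner (V t) (U t)) (at t within {0..})"
        unfolding has_real_derivative_iff_has_vector_derivative
        by (intro bounded_bilinear.has_vector_derivative[OF bounded_bilinear_inner] regularD(2)[OF reg] t)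
      show ?thesis unfolding E_def E'_def has_real_derivative_iff_has_vector_derivative[symmetric]
        using \<kappa>_pos by (auto intro!: derivative_eq_intros Nd pd p2d fd simp: inner_commute field_simps power2_eq_square)
    qed
    have nn: "0 \<le> E' t" if "t \<in> {0..}" for t
    proof -
      have t: "0 \<le> t" using that by simp
      define a b v where "a = norm (\<Phi> t)" and "b = norm (U t)" and "v = norm (V t)"
      have i0: "2 * t ^ 3 * inner (U t) (V t) \<le> 2 * t ^ 3 * (b * v)"
        using norm_cauchy_schwarz[of "U t" "V t"] t unfolding b_def v_def by (intro mult_left_mono) auto
      have i1: "c1 * (2 * t * p t) \<ge> c1 * (2 * t * (- (M * b * a)))"
        using flux_bound[of "U t" "\<Phi> t"] t c0 unfolding p_def a_def b_def by (intro mult_left_mono) auto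
      have i2: "c1 * (t\<^sup>2 * inner (A (U t)) (U t)) \<ge> c1 * (t\<^sup>2 * (\<kappa> * b\<^sup>2))"
        using energy_lower[OF reg t] c0 unfolding b_def by (intro mult_left_mono) auto
      have "M * v * norm (\<Psi> t) \<le> M * v * b"
        using eq t norm_fst_le'[of "U t"] M_pos unfolding b_def v_def by (intro mult_left_mono) auto
      then have i3: "(2 / \<kappa>) * (4 * t ^ 3 * p2 t) \<ge> (2 / \<kappa>) * (4 * t ^ 3 * (- (M * v * b)))"
        using flux_bound[of "V t" "\<Psi> t"] t \<kappa>_pos unfolding p2_def v_def by (intro mult_left_mono) auto
      have i4: "(2 / \<kappa>) * (t ^ 4 * inner (A (V t)) (V t)) \<ge> (2 / \<kappa>) * (t ^ 4 * (\<kappa> * v\<^sup>2))"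
        using energy_lower[OF reg2 t] \<kappa>_pos unfolding v_def by (intro mult_left_mono) auto
      have "L * (L * (t * b)\<^sup>2 - 2 * c1 * M * t * a * b + c2 * a\<^sup>2) = (L * (t * b) - c1 * M * a)\<^sup>2"
        using \<kappa>_pos unfolding c2_def c1_def by (simp add: power2_eq_square field_simps)
      then have "0 \<le> L * (L * (t * b)\<^sup>2 - 2 * c1 * M * t * a * b + c2 * a\<^sup>2)" by simp
      then have j: "0 \<le> L * (t * b)\<^sup>2 - 2 * c1 * M * t * a * b + c2 * a\<^sup>2"
        using L0 by (simp add: zero_le_mult_iff)
      have "0 \<le> (t\<^sup>2 * v - t * b)\<^sup>2 + (t\<^sup>2 * v - (4 * M / \<kappa>) * (t * b))\<^sup>2
           + (L * (t * b)\<^sup>2 - 2 * c1 * M * t * a * b + c2 * a\<^sup>2)" using j by simp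
      also have "\<dots> = c2 * a\<^sup>2 + c1 * (2 * t * (- (M * b * a))) + 2 * L * (t\<^sup>2 * b\<^sup>2)
         + (2 / \<kappa>) * (4 * t ^ 3 * (- (M * v * b))) + 2 * (t ^ 4 * v\<^sup>2) - (3 * t\<^sup>2 * b\<^sup>2 + 2 * t ^ 3 * (b * v))"
        using \<kappa>_pos by (simp add: L_def power2_eq_square power3_eq_cube power4_eq_xxxx field_simps)
      also have "2 * L * (t\<^sup>2 * b\<^sup>2) = c1 * (t\<^sup>2 * (\<kappa> * b\<^sup>2))" using \<kappa>_pos by (simp add: c1_def)
      also have "2 * (t ^ 4 * v\<^sup>2) = (2 / \<kappa>) * (t ^ 4 * (\<kappa> * v\<^sup>2))" using \<kappa>_pos by simp
      finally have "0 \<le> c2 * a\<^sup>2 + c1 * (2 * t * (- (M * b * a))) + c1 * (t\<^sup>2 * (\<kappa> * b\<^sup>2))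
         + (2 / \<kappa>) * (4 * t ^ 3 * (- (M * v * b))) + (2 / \<kappa>) * (t ^ 4 * (\<kappa> * v\<^sup>2)) - (3 * t\<^sup>2 * b\<^sup>2 + 2 * t ^ 3 * (b * v))" .
      also have "\<dots> \<le> E' t" unfolding E'_def distrib_left power2_norm_eq_inner[symmetric] a_def[symmetric] b_def[symmetric]
        using i0 i1 i2 i3 i4 by linarith
      finally show ?thesis .
    qed
    have "E 0 \<le> E T" by (rule nondecreasing_if_derivative_nonneg[OF der nn]) (use T in auto)
    then have "T ^ 3 * inner (U T) (U T) \<le> c2 * N T + c1 * (T\<^sup>2 * p T) + (2 / \<kappa>) * (T ^ 4 * p2 T)" by (simp add: E_def N_def)
    also have "\<dots> \<le> c2 * N T"
    proof -
      have "c1 * (T\<^sup>2 * p T) \<le> 0" using flux_nonpos[OF reg, of T] T c0 by (simp add: p_def mult_nonneg_nonpos)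
      moreover have "(2 / \<kappa>) * (T ^ 4 * p2 T) \<le> 0" using flux_nonpos[OF reg2, of T] T \<kappa>_pos
        by (simp add: p2_def mult_nonneg_nonpos divide_nonpos_pos)
      ultimately show ?thesis by linarith
    qed
    also have "\<dots> \<le> c2 * (T * M * (norm (\<Phi> 0))\<^sup>2 / \<kappa>)"
      using integral_bound_by_initial_value[OF reg, of T] T \<kappa>_pos c0 by (intro mult_left_mono) (auto simp: N_def field_simps)
    finally have "T * (T * norm (U T))\<^sup>2 \<le> T * ((c2 * M / \<kappa>) * (norm (\<Phi> 0))\<^sup>2)"
      by (simp add: power2_norm_eq_inner[symmetric] power_mult_distrib power2_eq_square power3_eq_cube mult_ac)
    then have "(T * norm (U T))\<^sup>2 \<le> (c2 * M / \<kappa>) * (norm (\<Phi> 0))\<^sup>2" by (rule mult_left_le_imp_le) (rule T)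
    also have "\<dots> = (sqrt (c2 * M / \<kappa>) * norm (\<Phi> 0))\<^sup>2" using c0 by (simp add: power_mult_distrib)
    finally show ?thesis by (rule power2_le_imp_le) (use c0 in auto)
  qed
  then show ?thesis using c0 by (intro exI[of _ "sqrt (c2 * M / \<kappa>)"]) auto
qed

end

section \<open>Existence of decaying solutions by minimisation\<close>

subsection \<open>A smoothing kernel on the half-line\<close>

text \<open>A piecewise linear kernel of mass \<open>e\<^sup>2\<close> on \<open>[0, 2 e]\<close>, without normalisation, and its
  primitive. Both are continuous, which suffices for smoothing minimising sequences.\<close>

definition tent :: "real \<Rightarrow> real \<Rightarrow> real" where
  "tent e x = max 0 x - 2 * max 0 (x - e) + max 0 (x - 2 * e)"

definition step :: "real \<Rightarrow> real \<Rightarrow> real" where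
  "step e x = ((max 0 x)\<^sup>2 - 2 * (max 0 (x - e))\<^sup>2 + (max 0 (x - 2 * e))\<^sup>2) / 2"

lemma ramp_square_derivative: "((\<lambda>x. (max 0 x)\<^sup>2) has_real_derivative 2 * max 0 x) (at (x::real))"
proof (cases "x = 0")
  case True
  have "((\<lambda>h::real. (max 0 h)\<^sup>2 / h) \<longlongrightarrow> 0) (at 0)"
  proof (rule Lim_null_comparison[of _ "\<lambda>h. \<bar>h\<bar>"])
    show "\<forall>\<^sub>F h in at 0. norm ((max 0 h)\<^sup>2 / h) \<le> \<bar>h::real\<bar>"
      by (rule always_eventually) (auto simp: max_def power2_eq_square)
    show "((\<lambda>h. \<bar>h::real\<bar>) \<longlongrightarrow> 0) (at 0)" by (rule tendsto_rabs_zero[OF tendsto_ident_at])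
  qed
  then show ?thesis using True by (simp add: DERIV_def)
next
  case False
  then consider "x < 0" | "x > 0" by linarith
  then show ?thesis
  proof cases
    case 1
    have "((\<lambda>x. (max 0 x)\<^sup>2) has_real_derivative 0) (at x)"
      by (rule has_field_derivative_transform_within[of "\<lambda>_. 0" _ _ _ "- x"])
        (use 1 in \<open>auto simp: dist_real_def max_def\<close>)
    then show ?thesis using 1 by simp
  next
    case 2
    have "((\<lambda>x. (max 0 x)\<^sup>2) has_real_derivative 2 * x) (at x)"
      by (rule has_field_derivative_transform_within[of "\<lambda>x. x\<^sup>2" _ _ _ x])
        (use 2 in \<open>auto simp: dist_real_def max_def intro!: derivative_eq_intros\<close>)
    then show ?thesis using 2 by simp
  qed
qed

lemma step_derivative: "(step e has_real_derivative tent e x) (at x)"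
proof -
  have r: "((\<lambda>x. (max 0 (x - c))\<^sup>2) has_real_derivative 2 * max 0 (x - c)) (at x)" for c :: real
  proof -
    have "((\<lambda>x. x - c) has_real_derivative 1) (at x)" by (auto intro!: derivative_eq_intros)
    from DERIV_chain2[where f = "\<lambda>x. (max 0 x)\<^sup>2", OF ramp_square_derivative this] show ?thesis by simp
  qed
  have "((\<lambda>x. ((max 0 x)\<^sup>2 - 2 * (max 0 (x - e))\<^sup>2 + (max 0 (x - 2 * e))\<^sup>2) / 2)
     has_real_derivative (2 * max 0 x - 2 * (2 * max 0 (x - e)) + 2 * max 0 (x - 2 * e)) / 2) (at x)"
    by (intro DERIV_cdivide DERIV_add DERIV_diff DERIV_cmult r ramp_square_derivative)
  moreover have "(2 * max 0 x - 2 * (2 * max 0 (x - e)) + 2 * max 0 (x - 2 * e)) / 2 = tent e x"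
    by (simp add: tent_def)
  ultimately show ?thesis by (simp only: step_def[abs_def])
qed

lemma step_shift_derivative:
  "((\<lambda>s. step e (s - t)) has_real_derivative tent e (s - t)) (at s within S)"
  "((\<lambda>t. step e (s - t)) has_real_derivative - tent e (s - t)) (at t within S)"
proof -
  have "((\<lambda>s. step e (s - t)) has_real_derivative tent e (s - t) * 1) (at s within S)"
    by (rule DERIV_chain2[where f = "step e" and g = "\<lambda>s. s - t", OF step_derivative])
      (auto intro!: derivative_eq_intros)
  then show "((\<lambda>s. step e (s - t)) has_real_derivative tent e (s - t)) (at s within S)" by simp
  have "((\<lambda>t. step e (s - t)) has_real_derivative tent e (s - t) * (- 1)) (at t within S)"
    by (rule DERIV_chain2[where f = "step e" and g = "\<lambda>t. s - t", OF step_derivative])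
      (auto intro!: derivative_eq_intros)
  then show "((\<lambda>t. step e (s - t)) has_real_derivative - tent e (s - t)) (at t within S)" by simp
qed

lemma continuous_tent: "continuous_on S f \<Longrightarrow> continuous_on S (\<lambda>x. tent e (f x))"
  unfolding tent_def by (intro continuous_intros)

lemma continuous_step: "continuous_on S f \<Longrightarrow> continuous_on S (\<lambda>x. step e (f x))"
  unfolding step_def by (intro continuous_intros) auto

context
  fixes e :: real assumes e: "0 < e"
begin

lemma tent_bounds: "0 \<le> tent e x" "tent e x \<le> e"
  using e by (auto simp: tent_def max_def)

lemma tent_outside: "x \<le> 0 \<Longrightarrow> tent e x = 0" "2 * e \<le> x \<Longrightarrow> tent e x = 0"
  using e by (auto simp: tent_def max_def)

lemma step_left: "x \<le> 0 \<Longrightarrow> step e x = 0"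
  using e by (auto simp: step_def max_def)

lemma step_right: "2 * e \<le> x \<Longrightarrow> step e x = e\<^sup>2"
  using e by (auto simp: step_def max_def power2_eq_square algebra_simps)

end

text \<open>Continuity and compact support on \<open>[0, \<infinity>)\<close>.\<close>

definition cs :: "(real \<Rightarrow> 'a::real_normed_vector) \<Rightarrow> bool" where
  "cs X \<longleftrightarrow> continuous_on {0..} X \<and> (\<exists>T\<ge>0. \<forall>t\<ge>T. X t = 0)"

lemma cs_integral:
  fixes X :: "real \<Rightarrow> 'a::banach"
  assumes "continuous_on {0..} X" "0 \<le> T" "\<And>t. t \<ge> T \<Longrightarrow> X t = 0"
  shows "X integrable_on {0..}" "integral {0..} X = integral {0..T} X"
proof -
  have "(X has_integral integral {0..T} X) {0..T}"
    by (intro integrable_integral integrable_continuous_interval continuous_on_subset[OF assms(1)]) auto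
  then have "((\<lambda>x. if x \<in> {0..T} then X x else 0) has_integral integral {0..T} X) {0..}"
    by (subst has_integral_restrict_Int) (simp add: Int_absorb2 subset_iff)
  then have "(X has_integral integral {0..T} X) {0..}"
    by (rule has_integral_eq[rotated]) (use assms(3) in auto)
  then show "X integrable_on {0..}" "integral {0..} X = integral {0..T} X"
    by (auto simp: integral_unique)
qed

lemma cs_integrable: "cs X \<Longrightarrow> X integrable_on {0..}" for X :: "real \<Rightarrow> 'a::banach"
  unfolding cs_def using cs_integral(1) by blast

lemma cs_mult:
  assumes "cs X" "continuous_on {0..} Z" "\<And>t. 0 \<le> t \<Longrightarrow> X t = 0 \<Longrightarrow> Z t = 0"
  shows "cs Z"
  using assms unfolding cs_def by (meson order_trans)

lemma cs_lincomb: assumes "cs X" "cs Y" shows "cs (\<lambda>t. a *\<^sub>R X t + b *\<^sub>R Y t)"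
proof -
  obtain S T where "\<forall>t\<ge>S. X t = 0" "\<forall>t\<ge>T. Y t = 0" "S \<ge> 0" using assms by (auto simp: cs_def)
  then have "\<forall>t\<ge>max S T. a *\<^sub>R X t + b *\<^sub>R Y t = 0" "max S T \<ge> 0" by auto
  moreover have "continuous_on {0..} (\<lambda>t. a *\<^sub>R X t + b *\<^sub>R Y t)"
    using assms by (auto simp: cs_def intro!: continuous_intros)
  ultimately show ?thesis unfolding cs_def by blast
qed

lemma integral_Cauchy_Schwarz:
  fixes g X :: "'n::euclidean_space \<Rightarrow> real"
  assumes "(\<lambda>x. (g x)\<^sup>2) integrable_on S" "(\<lambda>x. (X x)\<^sup>2) integrable_on S" "(\<lambda>x. g x * X x) integrable_on S"
  shows "(integral S (\<lambda>x. g x * X x))\<^sup>2 \<le> integral S (\<lambda>x. (X x)\<^sup>2) * integral S (\<lambda>x. (g x)\<^sup>2)"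
proof (rule quadratic_form_bound)
  fix s :: real
  have i: "(\<lambda>x. 2 * s * (g x * X x)) integrable_on S" "(\<lambda>x. s\<^sup>2 * (X x)\<^sup>2) integrable_on S"
    using assms by (simp_all add: integrable_on_mult_right)
  have "0 \<le> integral S (\<lambda>x. ((g x)\<^sup>2 + 2 * s * (g x * X x)) + s\<^sup>2 * (X x)\<^sup>2)"
  proof (rule integral_nonneg)
    show "(\<lambda>x. ((g x)\<^sup>2 + 2 * s * (g x * X x)) + s\<^sup>2 * (X x)\<^sup>2) integrable_on S"
      by (intro integrable_add i assms)
    show "0 \<le> ((g x)\<^sup>2 + 2 * s * (g x * X x)) + s\<^sup>2 * (X x)\<^sup>2" for x
      using zero_le_power2[of "g x + s * X x"] by (simp add: power2_eq_square algebra_simps)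
  qed
  also have "\<dots> = integral S (\<lambda>x. (g x)\<^sup>2) + 2 * s * integral S (\<lambda>x. g x * X x) + s\<^sup>2 * integral S (\<lambda>x. (X x)\<^sup>2)"
    using assms i by (simp add: integral_add integrable_add)
  finally show "0 \<le> \<dots>" .
qed (intro integral_nonneg assms, simp)

text \<open>The squared norm in \<open>L\<^sup>2\<close> of the half-line with values in a Hilbert space.\<close>

definition n2 :: "(real \<Rightarrow> 'a::real_normed_vector) \<Rightarrow> real" where
  "n2 X = integral {0..} (\<lambda>t. (norm (X t))\<^sup>2)"

lemma cs_continuous: "cs X \<Longrightarrow> continuous_on {0..} X"
  by (simp add: cs_def)

lemma cs_norm2: "cs X \<Longrightarrow> cs (\<lambda>t. (norm (X t))\<^sup>2)"
  by (rule cs_mult[of X]) (auto intro!: continuous_intros cs_continuous[of X])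

lemma n2_nonneg: "cs X \<Longrightarrow> 0 \<le> n2 X"
  unfolding n2_def by (rule integral_nonneg[OF cs_integrable[OF cs_norm2]]) auto

text \<open>The kernel looks forward in time, so that values on \<open>[0, \<infinity>)\<close> suffice.\<close>

definition smooth :: "real \<Rightarrow> (real \<Rightarrow> 'a::banach) \<Rightarrow> real \<Rightarrow> 'a" where
  "smooth e X t = integral {0..} (\<lambda>s. tent e (s - t) *\<^sub>R X s)"

definition smooth_primitive :: "real \<Rightarrow> (real \<Rightarrow> 'a::banach) \<Rightarrow> real \<Rightarrow> 'a" where
  "smooth_primitive e X t = integral {0..} (\<lambda>s. step e (s - t) *\<^sub>R X s)"

lemma cs_tent_mult: "cs X \<Longrightarrow> cs (\<lambda>s. tent e (s - t) *\<^sub>R X s)"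
  by (rule cs_mult[of X]) (auto intro!: continuous_intros continuous_tent cs_continuous[of X])

lemma cs_step_mult: "cs X \<Longrightarrow> cs (\<lambda>s. step e (s - t) *\<^sub>R X s)"
  by (rule cs_mult[of X]) (auto intro!: continuous_intros continuous_step cs_continuous[of X])

lemma cs_tent_mult': "0 < e \<Longrightarrow> continuous_on {0..} X \<Longrightarrow> cs (\<lambda>s. tent e (s - t) *\<^sub>R X s)"
  unfolding cs_def
  by (auto intro!: continuous_intros continuous_tent exI[of _ "max 0 (t + 2 * e)"] tent_outside(2) disjI1)

lemma tent_mass:
  assumes "0 < e" "0 \<le> t"
  shows "integral {0..} (\<lambda>s. tent e (s - t)) = e\<^sup>2"
proof -
  have "integral {0..} (\<lambda>s. tent e (s - t)) = integral {0..t+2*e} (\<lambda>s. tent e (s - t))"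
    by (rule cs_integral(2)) (use assms in \<open>auto intro!: continuous_tent continuous_intros tent_outside(2)\<close>)
  also have "((\<lambda>s. tent e (s - t)) has_integral step e (t + 2 * e - t) - step e (0 - t)) {0..t+2*e}"
    by (rule fundamental_theorem_of_calculus[where f = "\<lambda>s. step e (s - t)"])
      (use assms in \<open>auto simp: step_shift_derivative simp flip: has_real_derivative_iff_has_vector_derivative\<close>)
  then have "integral {0..t+2*e} (\<lambda>s. tent e (s - t)) = step e (t + 2 * e - t) - step e (0 - t)"
    by (rule integral_unique)
  finally show ?thesis using assms by (simp add: step_left step_right)
qed

text \<open>Minimising sequences converge in \<open>L\<^sup>2\<close> in time only; smoothing makes the convergence
  uniform.\<close>

lemma norm_smooth_le:
  assumes "0 < e" "0 \<le> t" "cs X"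
  shows "(norm (smooth e X t))\<^sup>2 \<le> e ^ 3 * n2 X"
proof -
  have cX: "continuous_on {0..} X" using assms(3) by (simp add: cs_def)
  have i: "(\<lambda>s. tent e (s - t) * norm (X s)) integrable_on {0..}"
    by (rule cs_integrable, rule cs_mult[OF assms(3)])
      (auto intro!: continuous_intros continuous_tent cX)
  have i1: "(\<lambda>s. tent e (s - t)) integrable_on {0..}"
    using cs_integrable[OF cs_tent_mult'[OF assms(1), of "\<lambda>_. 1::real" t]] by simp
  have i2: "(\<lambda>s. (tent e (s - t))\<^sup>2) integrable_on {0..}"
    using cs_integrable[OF cs_tent_mult'[OF assms(1), of "\<lambda>s. tent e (s - t)" t]]
    by (simp add: power2_eq_square continuous_tent continuous_on_diff)
  have "norm (smooth e X t) \<le> integral {0..} (\<lambda>s. tent e (s - t) * norm (X s))"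
    unfolding smooth_def
    by (rule integral_norm_bound_integral[OF cs_integrable[OF cs_tent_mult[OF assms(3)]] i])
      (use tent_bounds[OF assms(1)] in simp)
  then have "(norm (smooth e X t))\<^sup>2 \<le> (integral {0..} (\<lambda>s. tent e (s - t) * norm (X s)))\<^sup>2"
    by (rule power_mono) simp
  also have "\<dots> \<le> n2 X * integral {0..} (\<lambda>s. (tent e (s - t))\<^sup>2)"
    unfolding n2_def by (rule integral_Cauchy_Schwarz[OF i2 cs_integrable[OF cs_norm2[OF assms(3)]] i])
  also have "\<dots> \<le> n2 X * integral {0..} (\<lambda>s. e * tent e (s - t))"
    using i1 i2 tent_bounds[OF assms(1)] n2_nonneg[OF assms(3)]
    by (intro mult_left_mono integral_le) (auto simp: power2_eq_square intro!: mult_right_mono integrable_on_mult_right)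
  also have "\<dots> = e ^ 3 * n2 X" using tent_mass[OF assms(1,2)] by (simp add: power2_eq_square power3_eq_cube)
  finally show ?thesis .
qed

lemma smooth_bounded_linear:
  fixes X :: "real \<Rightarrow> 'a::banach" and f :: "'a \<Rightarrow> 'b::banach"
  assumes "bounded_linear f" "cs X"
  shows "f (smooth e X t) = smooth e (\<lambda>s. f (X s)) t" "f (smooth_primitive e X t) = smooth_primitive e (\<lambda>s. f (X s)) t"
  unfolding smooth_def smooth_primitive_def
  using bounded_linear_of_integral[OF assms(1) cs_integrable[OF cs_tent_mult[OF assms(2)]]]
    bounded_linear_of_integral[OF assms(1) cs_integrable[OF cs_step_mult[OF assms(2)]]]
  by (simp_all add: linear_scale[OF bounded_linear.linear[OF assms(1)]])

lemma smooth_diff: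
  fixes X Y :: "real \<Rightarrow> 'a::banach"
  assumes "cs X" "cs Y"
  shows "smooth e (\<lambda>s. X s - Y s) t = smooth e X t - smooth e Y t"
  unfolding smooth_def
  using integral_diff[OF cs_integrable[OF cs_tent_mult[OF assms(1)]] cs_integrable[OF cs_tent_mult[OF assms(2)]]]
  by (simp add: scaleR_diff_right)

lemma smooth_primitive_derivative:
  fixes X :: "real \<Rightarrow> 'a::banach"
  assumes "cs X"
  shows "(smooth_primitive e X has_vector_derivative - smooth e X t) (at t)"
proof -
  obtain T where T: "T \<ge> 0" "\<forall>t\<ge>T. X t = 0" and cX: "continuous_on {0..} X" using assms by (auto simp: cs_def)
  have 1: "smooth_primitive e X = (\<lambda>t. integral (cbox 0 T) (\<lambda>s. step e (s - t) *\<^sub>R X s))"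
    unfolding smooth_primitive_def cbox_interval
    by (rule ext, rule cs_integral(2)) (use T cX in \<open>auto intro!: continuous_intros continuous_step\<close>)
  have 2: "- smooth e X t = integral (cbox 0 T) (\<lambda>s. - (tent e (s - t) *\<^sub>R X s))"
    unfolding smooth_def cbox_interval integral_neg
    by (rule arg_cong[of _ _ uminus], rule cs_integral(2)) (use T cX in \<open>auto intro!: continuous_intros continuous_tent\<close>)
  have cX': "continuous_on (UNIV \<times> cbox 0 T) (\<lambda>p::real \<times> real. X (snd p))"
    by (rule continuous_on_compose2[OF cX]) (auto intro!: continuous_intros)
  show ?thesis unfolding 1 2
  proof (rule leibniz_rule_vector_derivative[where U = UNIV])
    show "((\<lambda>x. step e (s - x) *\<^sub>R X s) has_vector_derivative - (tent e (s - x) *\<^sub>R X s)) (at x within UNIV)" for x s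
    proof -
      from has_vector_derivative_scaleR[OF step_shift_derivative(2)[of e s x UNIV] has_vector_derivative_const[of "X s"]] show ?thesis by simp
    qed
    show "(\<lambda>s. step e (s - x) *\<^sub>R X s) integrable_on cbox 0 T" for x
      unfolding cbox_interval
      by (intro integrable_continuous_interval continuous_intros continuous_step continuous_on_subset[OF cX]) auto
    show "continuous_on (UNIV \<times> cbox 0 T) (\<lambda>(x, s). - (tent e (s - x) *\<^sub>R X s))"
      unfolding split_beta by (intro continuous_intros continuous_tent cX')
  qed auto
qed

lemma continuous_smooth:
  fixes X :: "real \<Rightarrow> 'a::banach"
  assumes "cs X" "0 < e"
  shows "continuous_on {0..} (smooth e X)"
proof -
  obtain T where T: "T \<ge> 0" "\<forall>t\<ge>T. X t = 0" and cX: "continuous_on {0..} X" using assms by (auto simp: cs_def)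
  have 1: "smooth e X = (\<lambda>t. integral (cbox 0 T) (\<lambda>s. tent e (s - t) *\<^sub>R X s))"
    unfolding smooth_def cbox_interval
    by (rule ext, rule cs_integral(2)) (use T cX in \<open>auto intro!: continuous_intros continuous_tent\<close>)
  have cX': "continuous_on ({0..} \<times> cbox 0 T) (\<lambda>p::real \<times> real. X (snd p))"
    by (rule continuous_on_compose2[OF cX]) (auto intro!: continuous_intros)
  show ?thesis unfolding 1
    by (rule integral_continuous_on_param) (unfold split_beta, intro continuous_intros continuous_tent cX')
qed

lemma avg_smooth:
  fixes X :: "real \<Rightarrow> 'a::banach"
  assumes "cs X" "0 \<le> h"
  shows "avg h (smooth e X) t = smooth_primitive e X t - smooth_primitive e X (t + h)"
proof -
  have "((\<lambda>s. - smooth e X s) has_integral smooth_primitive e X (t + h) - smooth_primitive e X t) {t..t+h}"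
    by (rule fundamental_theorem_of_calculus)
      (use assms in \<open>auto intro!: has_vector_derivative_at_within smooth_primitive_derivative\<close>)
  from has_integral_neg[OF this] show ?thesis by (simp add: avg_def integral_unique)
qed

subsection \<open>The Dirichlet problem\<close>

context first_order_system
begin

text \<open>Potentials with compact support in \<open>t\<close> and initial value \<open>f\<close>, together with their
  gradients.\<close>

definition competitor :: "'a \<Rightarrow> (real \<Rightarrow> 'a) \<Rightarrow> (real \<Rightarrow> 'a \<times> 'b) \<Rightarrow> bool" where
  "competitor f F U \<longleftrightarrow> cs F \<and> cs U \<and> F 0 = f \<and>
     (\<forall>t\<ge>0. (F has_vector_derivative fst (U t)) (at t within {0..}) \<and> (F t, snd (U t)) \<in> G)"

definition energy :: "(real \<Rightarrow> 'a \<times> 'b) \<Rightarrow> (real \<Rightarrow> 'a \<times> 'b) \<Rightarrow> real" where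
  "energy U X = integral {0..} (\<lambda>t. inner (A (U t)) (X t))"

lemma cs_energy: assumes "cs U" "cs X" shows "cs (\<lambda>t. inner (A (U t)) (X t))"
  by (rule cs_mult[OF assms(2)])
    (use assms in \<open>auto simp: cs_def intro!: continuous_intros bounded_linear.continuous_on[OF bounded_linear_A]\<close>)

lemma competitor_lincomb:
  assumes "competitor f F U" "competitor g H X"
  shows "competitor (a *\<^sub>R f + b *\<^sub>R g) (\<lambda>t. a *\<^sub>R F t + b *\<^sub>R H t) (\<lambda>t. a *\<^sub>R U t + b *\<^sub>R X t)"
  using assms G_lincomb[of _ _ _ _ a b] vector_derivative_lincomb[of F _ _ H _ a b]
  unfolding competitor_def by (auto intro!: cs_lincomb)

lemma energy_square:
  assumes "cs U" "cs X"
  shows "energy (\<lambda>t. a *\<^sub>R U t + b *\<^sub>R X t) (\<lambda>t. a *\<^sub>R U t + b *\<^sub>R X t)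
    = a\<^sup>2 * energy U U + 2 * a * b * energy U X + b\<^sup>2 * energy X X"
proof -
  have pw: "inner (A (a *\<^sub>R u + b *\<^sub>R x)) (a *\<^sub>R u + b *\<^sub>R x)
     = (a\<^sup>2 * inner (A u) u + 2 * a * b * inner (A u) x) + b\<^sup>2 * inner (A x) x" for u x
    using self_adjoint[of x u]
    by (simp add: A_linear inner_add inner_commute power2_eq_square algebra_simps)
  note i = cs_integrable[OF cs_energy]
  have i': "(\<lambda>t. a\<^sup>2 * inner (A (U t)) (U t)) integrable_on {0..}"
    "(\<lambda>t. 2 * a * b * inner (A (U t)) (X t)) integrable_on {0..}"
    "(\<lambda>t. b\<^sup>2 * inner (A (X t)) (X t)) integrable_on {0..}"
    using i assms by (simp_all add: integrable_on_mult_right)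
  show ?thesis unfolding energy_def pw using i' by (simp add: integral_add integrable_add)
qed

lemma energy_lower_bound:
  assumes "competitor f F U" shows "\<kappa> * n2 U \<le> energy U U"
proof -
  have c: "cs U" using assms by (simp add: competitor_def)
  have "\<kappa> * n2 U = integral {0..} (\<lambda>t. \<kappa> * (norm (U t))\<^sup>2)" by (simp add: n2_def)
  also have "\<dots> \<le> energy U U" unfolding energy_def
  proof (rule integral_le)
    show "(\<lambda>t. \<kappa> * (norm (U t))\<^sup>2) integrable_on {0..}"
      using cs_integrable[OF cs_norm2[OF c]] by (rule integrable_on_mult_right)
    show "(\<lambda>t. inner (A (U t)) (U t)) integrable_on {0..}" by (rule cs_integrable[OF cs_energy[OF c c]])
    show "\<kappa> * (norm (U t))\<^sup>2 \<le> inner (A (U t)) (U t)" if "t \<in> {0..}" for t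
      using assms that by (intro coercive' rangeI[of "F t"]) (auto simp: competitor_def)
  qed
  finally show ?thesis .
qed

text \<open>Multiply \<open>f\<close> by a \<open>C\<^sup>1\<close> cut-off in time.\<close>

lemma competitor_exists:
  assumes "(f, y) \<in> G"
  shows "\<exists>F U. competitor f F U"
proof -
  define F where "F t = (max 0 (1 - t))\<^sup>2 *\<^sub>R f" for t :: real
  define U where "U t = ((- 2 * max 0 (1 - t)) *\<^sub>R f, (max 0 (1 - t))\<^sup>2 *\<^sub>R y)" for t :: real
  have "(F has_vector_derivative fst (U t)) (at t within {0..})" for t
  proof -
    have "((\<lambda>t. (max 0 (1 - t))\<^sup>2) has_real_derivative (2 * max 0 (1 - t)) * (- 1)) (at t within {0..})"
      by (rule DERIV_chain2[where f = "\<lambda>x. (max 0 x)\<^sup>2" and g = "\<lambda>t. 1 - t", OF ramp_square_derivative])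
        (auto intro!: derivative_eq_intros)
    from has_vector_derivative_scaleR[OF this has_vector_derivative_const[of f]]
    show ?thesis by (simp add: F_def[abs_def] U_def)
  qed
  moreover have "(F t, snd (U t)) \<in> G" for t
    using subspace_scale[OF subspace_G assms, of "(max 0 (1 - t))\<^sup>2"] by (simp add: F_def U_def)
  moreover have "cs F" "cs U"
    unfolding cs_def F_def U_def by (auto intro!: continuous_intros exI[of _ "1::real"] simp: zero_prod_def)
  moreover have "F 0 = f" by (simp add: F_def)
  ultimately show ?thesis unfolding competitor_def by blast
qed

text \<open>The parallelogram law for the energy makes a minimising sequence Cauchy, and nearly minimal energy makes the first
  variation small: this is the Euler-Lagrange equation in the limit. The limit itself is not formed, because the class of
  competitors is not complete.\<close>

lemma minimizing_sequence:
  assumes "(f, y) \<in> G"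
  shows "\<exists>F U D. (\<forall>m. competitor f (F m) (U m)) \<and> (\<forall>m. n2 (U m) \<le> D) \<and>
    (\<forall>m l. n2 (\<lambda>t. U m t - U l t) \<le> (2 / \<kappa>) * (inverse (real (Suc m)) + inverse (real (Suc l)))) \<and>
    (\<forall>m H X. competitor 0 H X \<longrightarrow> (energy (U m) X)\<^sup>2 \<le> energy X X * inverse (real (Suc m)))"
proof -
  define E where "E = {energy U U | F U. competitor f F U}"
  have bdd: "bdd_below E"
  proof (rule bdd_belowI[of _ 0])
    fix r assume "r \<in> E"
    then obtain F U where "competitor f F U" "r = energy U U" by (auto simp: E_def)
    moreover have "0 \<le> \<kappa> * n2 U"
      using \<open>competitor f F U\<close> n2_nonneg[of U] \<kappa>_pos by (simp add: competitor_def)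
    ultimately show "0 \<le> r" using energy_lower_bound[of f F U] by linarith
  qed
  have ne: "E \<noteq> {}" using competitor_exists[OF assms] by (auto simp: E_def)
  define \<delta> where "\<delta> = Inf E"
  have lower: "\<delta> \<le> energy U U" if "competitor f F U" for F U
    unfolding \<delta>_def by (rule cInf_lower[OF _ bdd]) (use that in \<open>auto simp: E_def\<close>)
  have "\<exists>F U. competitor f F U \<and> energy U U < \<delta> + inverse (real (Suc m))" for m
  proof -
    have "Inf E < \<delta> + inverse (real (Suc m))" by (simp add: \<delta>_def)
    then obtain r where "r \<in> E" "r < \<delta> + inverse (real (Suc m))" using cInf_less_iff[OF ne bdd] by blast
    then show ?thesis by (auto simp: E_def)
  qed
  then obtain F U where comp: "\<And>m. competitor f (F m) (U m)"
    and small: "\<And>m. energy (U m) (U m) < \<delta> + inverse (real (Suc m))" by metis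
  have csU: "cs (U m)" for m using comp[of m] by (simp add: competitor_def)
  have "n2 (U m) \<le> (\<delta> + 1) / \<kappa>" for m
  proof -
    have "inverse (real (Suc m)) \<le> 1" by (simp add: inverse_le_1_iff)
    then have "\<kappa> * n2 (U m) \<le> \<delta> + 1" using energy_lower_bound[OF comp[of m]] small[of m] by linarith
    then show ?thesis using \<kappa>_pos by (simp add: field_simps)
  qed
  moreover have "n2 (\<lambda>t. U m t - U l t) \<le> (2 / \<kappa>) * (inverse (real (Suc m)) + inverse (real (Suc l)))" for m l
  proof -
    have "\<delta> \<le> energy (\<lambda>t. (1/2) *\<^sub>R U m t + (1/2) *\<^sub>R U l t) (\<lambda>t. (1/2) *\<^sub>R U m t + (1/2) *\<^sub>R U l t)"
      using lower[of "\<lambda>t. (1/2) *\<^sub>R F m t + (1/2) *\<^sub>R F l t"] competitor_lincomb[OF comp[of m] comp[of l], of "1/2" "1/2"]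
      by (simp flip: scaleR_left_distrib)
    then have 1: "\<delta> \<le> energy (U m) (U m) / 4 + energy (U m) (U l) / 2 + energy (U l) (U l) / 4"
      unfolding energy_square[OF csU csU] by (simp add: power2_eq_square)
    have 2: "competitor 0 (\<lambda>t. F m t - F l t) (\<lambda>t. U m t - U l t)"
      using competitor_lincomb[OF comp[of m] comp[of l], of 1 "-1"] by simp
    have "\<kappa> * n2 (\<lambda>t. U m t - U l t) \<le> energy (U m) (U m) - 2 * energy (U m) (U l) + energy (U l) (U l)"
      using energy_lower_bound[OF 2] energy_square[OF csU[of m] csU[of l], of 1 "-1"] by simp
    also have "\<dots> \<le> 2 * (inverse (real (Suc m)) + inverse (real (Suc l)))"
    proof -
      have "a - 2 * b + c \<le> 2 * (i + j)" if "d \<le> a / 4 + b / 2 + c / 4" "a < d + i" "c < d + j" for a b c d i j :: real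
      proof -
        have "4 * d \<le> a + 2 * b + c" using that(1) by (simp add: field_simps)
        then show ?thesis using that(2,3) by (simp add: algebra_simps)
      qed
      from this[OF 1 small small] show ?thesis .
    qed
    finally have "n2 (\<lambda>t. U m t - U l t) \<le> 2 * (inverse (real (Suc m)) + inverse (real (Suc l))) / \<kappa>"
      by (simp only: pos_le_divide_eq[OF \<kappa>_pos] mult.commute)
    then show ?thesis by (simp only: times_divide_eq_left)
  qed
  moreover have "(energy (U m) X)\<^sup>2 \<le> energy X X * inverse (real (Suc m))" if X: "competitor 0 H X" for m H X
  proof (rule quadratic_form_bound)
    have csX: "cs X" using X by (simp add: competitor_def)
    have "0 \<le> \<kappa> * n2 X" using n2_nonneg[OF csX] \<kappa>_pos by simp
    then show "0 \<le> energy X X" using energy_lower_bound[OF X] by linarith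
    fix s
    have "\<delta> \<le> energy (U m) (U m) + 2 * s * energy (U m) X + s\<^sup>2 * energy X X"
      using lower[OF competitor_lincomb[OF comp[of m] X, of 1 s, simplified]] energy_square[OF csU[of m] csX, of 1 s] by simp
    then show "0 \<le> inverse (real (Suc m)) + 2 * s * energy (U m) X + s\<^sup>2 * energy X X"
      using small[of m] by linarith
  qed
  ultimately show ?thesis using comp by blast
qed

lemma competitor_initial_distance:
  assumes "competitor f F U" "0 \<le> s"
  shows "(norm (F s - f))\<^sup>2 \<le> s * n2 U"
proof -
  have c: "cs U" and cU: "continuous_on {0..} U" and F0: "F 0 = f"
    and der: "\<And>t. 0 \<le> t \<Longrightarrow> (F has_vector_derivative fst (U t)) (at t within {0..})"
    using assms by (auto simp: competitor_def cs_def)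
  have ci: "h integrable_on {0..s}" if "continuous_on {0..} h" for h :: "real \<Rightarrow> 'c::banach"
    by (intro integrable_continuous_interval continuous_on_subset[OF that]) auto
  have "F s - f = integral {0..s} (\<lambda>t. fst (U t))"
    using avg_of_derivative[OF der _ assms(2), of 0] F0 by (simp add: avg_def incr_def)
  also have "norm \<dots> \<le> integral {0..s} (\<lambda>t. 1 * norm (U t))"
    by (rule integral_norm_bound_integral) (auto intro!: ci continuous_intros cU norm_fst_le')
  finally have "(norm (F s - f))\<^sup>2 \<le> (integral {0..s} (\<lambda>t. 1 * norm (U t)))\<^sup>2" by (rule power_mono) simp
  also have "\<dots> \<le> integral {0..s} (\<lambda>t. (norm (U t))\<^sup>2) * integral {0..s} (\<lambda>t. 1\<^sup>2)"
    by (rule integral_Cauchy_Schwarz) (auto intro!: ci continuous_intros cU)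
  also have "\<dots> = s * integral {0..s} (\<lambda>t. (norm (U t))\<^sup>2)" using assms(2) by simp
  also have "\<dots> \<le> s * n2 U" unfolding n2_def
    by (intro mult_left_mono assms(2) integral_subset_le cs_integrable[OF cs_norm2[OF c]] ci continuous_intros cU) auto
  finally show ?thesis .
qed

lemma smooth_initial_distance:
  assumes "competitor f F U" "0 \<le> t" "0 < e"
  shows "norm (smooth e F t - e\<^sup>2 *\<^sub>R f) \<le> e\<^sup>2 * sqrt ((t + 2 * e) * n2 U)"
proof -
  have c: "cs U" "cs F" and cF: "continuous_on {0..} F" using assms by (auto simp: competitor_def cs_def)
  have cs1: "cs (\<lambda>s. tent e (s - t) *\<^sub>R f)" by (rule cs_tent_mult'[OF assms(3)]) (auto intro!: continuous_intros)
  have i1: "(\<lambda>s. tent e (s - t)) integrable_on {0..}"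
    using cs_integrable[OF cs_tent_mult'[OF assms(3), of "\<lambda>_. 1::real" t]] by simp
  have "smooth e F t - e\<^sup>2 *\<^sub>R f = integral {0..} (\<lambda>s. tent e (s - t) *\<^sub>R F s) - integral {0..} (\<lambda>s. tent e (s - t) *\<^sub>R f)"
    using tent_mass[OF assms(3,2)] bounded_linear_of_integral[OF bounded_linear_scaleR_left i1, of f] by (simp add: smooth_def)
  also have "\<dots> = integral {0..} (\<lambda>s. tent e (s - t) *\<^sub>R (F s - f))"
    using integral_diff[OF cs_integrable[OF cs_tent_mult[OF c(2)]] cs_integrable[OF cs1]] by (simp add: scaleR_diff_right)
  also have "norm \<dots> \<le> integral {0..} (\<lambda>s. tent e (s - t) * sqrt ((t + 2 * e) * n2 U))"
  proof (rule integral_norm_bound_integral)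
    show "(\<lambda>s. tent e (s - t) *\<^sub>R (F s - f)) integrable_on {0..}"
      by (rule cs_integrable[OF cs_tent_mult'[OF assms(3)]]) (intro continuous_intros cF)
    show "(\<lambda>s. tent e (s - t) * sqrt ((t + 2 * e) * n2 U)) integrable_on {0..}"
      using i1 by (rule integrable_on_mult_left)
    fix s :: real assume s: "s \<in> {0..}"
    show "norm (tent e (s - t) *\<^sub>R (F s - f)) \<le> tent e (s - t) * sqrt ((t + 2 * e) * n2 U)"
    proof (cases "s \<le> t + 2 * e")
      case True
      have "norm (F s - f) \<le> sqrt ((t + 2 * e) * n2 U)"
      proof (rule real_le_rsqrt)
        have "(norm (F s - f))\<^sup>2 \<le> s * n2 U" using competitor_initial_distance[OF assms(1)] s by simp
        also have "\<dots> \<le> (t + 2 * e) * n2 U" using True n2_nonneg[OF c(1)] by (rule mult_right_mono)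
        finally show "(norm (F s - f))\<^sup>2 \<le> (t + 2 * e) * n2 U" .
      qed
      then show ?thesis using tent_bounds[OF assms(3)] by (simp add: mult_left_mono)
    next
      case False
      then show ?thesis using tent_outside(2)[OF assms(3), of "s - t"] by simp
    qed
  qed
  also have "\<dots> = e\<^sup>2 * sqrt ((t + 2 * e) * n2 U)" using tent_mass[OF assms(3,2)] by simp
  finally show ?thesis .
qed

text \<open>Smoothing commutes with the closed relation \<open>G\<close> and with the time derivative. The value at \<open>t =
  0\<close> is the exception; it is controlled by the previous lemmas.\<close>

lemma smooth_competitor:
  assumes comp: "competitor f F U" and t: "0 \<le> t" and e: "0 < e"
  shows "(smooth e F has_vector_derivative fst (smooth e U t)) (at t within {0..})"
    and "(smooth e F t, snd (smooth e U t)) \<in> G"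
proof -
  have c: "cs U" "cs F" and cU: "continuous_on {0..} U" and cF: "continuous_on {0..} F"
    and der: "\<And>t. 0 \<le> t \<Longrightarrow> (F has_vector_derivative fst (U t)) (at t within {0..})"
    using comp by (auto simp: competitor_def cs_def)
  have cf: "cs (\<lambda>t. fst (U t))" by (rule cs_mult[OF c(1)]) (auto intro!: continuous_intros cU)
  have parts: "smooth e F t = - smooth_primitive e (\<lambda>s. fst (U s)) t" if t: "0 \<le> t" for t
  proof -
    obtain T where T: "T \<ge> 0" "\<forall>t\<ge>T. F t = 0" "\<forall>t\<ge>T. U t = 0"
    proof -
      obtain T1 T2 where "T1 \<ge> 0" "\<forall>t\<ge>T1. F t = 0" "\<forall>t\<ge>T2. U t = 0" using c by (auto simp: cs_def)
      then show ?thesis by (intro that[of "max T1 T2"]) auto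
    qed
    have "((\<lambda>s. step e (s - t) *\<^sub>R fst (U s) + tent e (s - t) *\<^sub>R F s) has_integral
        step e (T - t) *\<^sub>R F T - step e (0 - t) *\<^sub>R F 0) {0..T}"
    proof (rule fundamental_theorem_of_calculus[where f = "\<lambda>s. step e (s - t) *\<^sub>R F s"])
      fix s assume s: "s \<in> {0..T}"
      show "((\<lambda>s. step e (s - t) *\<^sub>R F s) has_vector_derivative step e (s - t) *\<^sub>R fst (U s) + tent e (s - t) *\<^sub>R F s) (at s within {0..T})"
        using s by (intro has_vector_derivative_scaleR step_shift_derivative(1) has_vector_derivative_within_subset[OF der]) auto
    qed (rule T)
    then have "integral {0..T} (\<lambda>s. step e (s - t) *\<^sub>R fst (U s) + tent e (s - t) *\<^sub>R F s) = 0"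
      using T t e by (simp add: integral_unique step_left)
    moreover have "integral {0..} (\<lambda>s. step e (s - t) *\<^sub>R fst (U s) + tent e (s - t) *\<^sub>R F s)
        = integral {0..T} (\<lambda>s. step e (s - t) *\<^sub>R fst (U s) + tent e (s - t) *\<^sub>R F s)"
      by (rule cs_integral(2)) (use T in \<open>auto intro!: continuous_intros continuous_step continuous_tent cU cF\<close>)
    ultimately have "smooth_primitive e (\<lambda>s. fst (U s)) t + smooth e F t = 0"
      unfolding smooth_def smooth_primitive_def
      using integral_add[OF cs_integrable[OF cs_step_mult[OF cf]] cs_integrable[OF cs_tent_mult[OF c(2)]], of e t e t] by simp
    then show ?thesis by (simp add: eq_neg_iff_add_eq_0 add.commute)
  qed
  have "((\<lambda>t. - smooth_primitive e (\<lambda>s. fst (U s)) t) has_vector_derivative - (- smooth e (\<lambda>s. fst (U s)) t)) (at t within {0..})"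
    by (rule has_vector_derivative_minus[OF has_vector_derivative_at_within[OF smooth_primitive_derivative[OF cf]]])
  then have "(smooth e F has_vector_derivative smooth e (\<lambda>s. fst (U s)) t) (at t within {0..})"
    unfolding minus_minus by (rule has_vector_derivative_transform[rotated 2]) (use t parts in auto)
  then show "(smooth e F has_vector_derivative fst (smooth e U t)) (at t within {0..})"
    using smooth_bounded_linear(1)[OF bounded_linear_fst c(1), of e t] by simp
  have cp: "cs (\<lambda>s. (F s, snd (U s)))"
  proof -
    have "cs (\<lambda>s. 1 *\<^sub>R (F s, 0) + 1 *\<^sub>R (0, snd (U s)))"
      by (rule cs_lincomb[OF cs_mult[OF c(2)] cs_mult[OF c(1)]]) (auto intro!: continuous_intros cU cF simp: zero_prod_def)
    then show ?thesis by simp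
  qed
  have "smooth e (\<lambda>s. (F s, snd (U s))) t \<in> G" unfolding smooth_def
    by (rule integral_in_closed_subspace[OF closed_G subspace_G cs_integrable[OF cs_tent_mult[OF cp]]])
      (use comp in \<open>auto simp: competitor_def simp del: scaleR_Pair intro!: subspace_scale[OF subspace_G]\<close>)
  moreover have "smooth e (\<lambda>s. (F s, snd (U s))) t = (smooth e F t, snd (smooth e U t))"
    using smooth_bounded_linear(1)[OF bounded_linear_fst cp, of e t] smooth_bounded_linear(1)[OF bounded_linear_snd cp, of e t]
      smooth_bounded_linear(1)[OF bounded_linear_snd c(1), of e t] by (simp add: prod_eq_iff)
  ultimately show "(smooth e F t, snd (smooth e U t)) \<in> G" by simp
qed

text \<open>The variation of the energy in the direction of \<open>g\<close> times a difference of two shifted steps is the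
  integrated divergence equation for the smoothed field.\<close>

lemma smooth_euler_lagrange:
  assumes c: "cs U" and t: "0 \<le> t" and h: "0 \<le> h" and e: "0 < e" and gy: "(g, y) \<in> G"
  shows "\<exists>H X. competitor 0 H X \<and> (\<forall>U. cs U \<longrightarrow> energy U X =
     inner (w (smooth e U t) - w (smooth e U (t + h))) g + inner (q (avg h (smooth e U) t)) y)"
proof -
  define \<psi> where "\<psi> s = step e (s - t) - step e (s - (t + h))" for s
  define \<psi>' where "\<psi>' s = tent e (s - t) - tent e (s - (t + h))" for s
  define H where "H s = \<psi> s *\<^sub>R g" for s
  define X where "X s = (\<psi>' s *\<^sub>R g, \<psi> s *\<^sub>R y)" for s
  have out: "\<psi> s = 0" "\<psi>' s = 0" if "s \<ge> t + h + 2 * e" for s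
    using that e h by (auto simp: \<psi>_def \<psi>'_def step_right tent_outside(2))
  have cont: "continuous_on S \<psi>" "continuous_on S \<psi>'" for S
    unfolding \<psi>_def \<psi>'_def by (intro continuous_intros continuous_step continuous_tent)+
  have csX: "cs X" unfolding cs_def X_def
    using t h e out by (auto intro!: continuous_intros cont exI[of _ "t + h + 2 * e"] simp: zero_prod_def)
  moreover have "cs H" unfolding cs_def H_def
    using t h e out by (auto intro!: continuous_intros cont exI[of _ "t + h + 2 * e"])
  moreover have "H 0 = 0" using t h e by (simp add: H_def \<psi>_def step_left)
  moreover have "(H has_vector_derivative fst (X s)) (at s within {0..})" for s
  proof -
    have "(\<psi> has_real_derivative \<psi>' s) (at s within {0..})"
      unfolding \<psi>_def \<psi>'_def by (intro DERIV_diff step_shift_derivative(1))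
    from has_vector_derivative_scaleR[OF this has_vector_derivative_const[of g]]
    show ?thesis by (simp add: H_def[abs_def] X_def)
  qed
  moreover have "(H s, snd (X s)) \<in> G" for s
    using subspace_scale[OF subspace_G gy, of "\<psi> s"] by (simp add: H_def X_def)
  ultimately have "competitor 0 H X" by (auto simp: competitor_def)
  moreover have "energy U X = inner (w (smooth e U t) - w (smooth e U (t + h))) g + inner (q (avg h (smooth e U) t)) y"
    if c: "cs U" for U
  proof -
    have bw: "bounded_linear (\<lambda>u. inner (w u) g)" and bq: "bounded_linear (\<lambda>u. inner (q u) y)"
      by (intro bounded_linear_compose[OF bounded_linear_inner_left] bounded_linear_w bounded_linear_q)+
    have cU: "continuous_on {0..} U" using c by (simp add: cs_def)
    have csw: "cs (\<lambda>s. inner (w (U s)) g)"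
      by (rule cs_mult[OF c]) (auto intro!: bounded_linear.continuous_on[OF bw] cU simp: A_linear)
    have csq: "cs (\<lambda>s. inner (q (U s)) y)"
      by (rule cs_mult[OF c]) (auto intro!: bounded_linear.continuous_on[OF bq] cU simp: A_linear)
    have "energy U X = integral {0..} (\<lambda>s. (tent e (s - t) *\<^sub>R inner (w (U s)) g - tent e (s - (t + h)) *\<^sub>R inner (w (U s)) g)
       + (step e (s - t) *\<^sub>R inner (q (U s)) y - step e (s - (t + h)) *\<^sub>R inner (q (U s)) y))"
      unfolding energy_def X_def \<psi>_def \<psi>'_def by (simp add: inner_prod_def algebra_simps)
    also have "\<dots> = (smooth e (\<lambda>s. inner (w (U s)) g) t - smooth e (\<lambda>s. inner (w (U s)) g) (t + h))
        + (smooth_primitive e (\<lambda>s. inner (q (U s)) y) t - smooth_primitive e (\<lambda>s. inner (q (U s)) y) (t + h))"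
      unfolding smooth_def smooth_primitive_def
      using cs_integrable[OF cs_tent_mult[OF csw, of e]] cs_integrable[OF cs_step_mult[OF csq, of e]]
      by (subst integral_add; (subst integral_diff)?; (intro integrable_diff)?; blast?) (simp add: integral_diff)
    also have "\<dots> = inner (w (smooth e U t)) g - inner (w (smooth e U (t + h))) g +
       (inner (q (smooth_primitive e U t)) y - inner (q (smooth_primitive e U (t + h))) y)"
      using smooth_bounded_linear(1)[OF bw c] smooth_bounded_linear(2)[OF bq c] by simp
    also have "\<dots> = inner (w (smooth e U t) - w (smooth e U (t + h))) g + inner (q (avg h (smooth e U) t)) y"
      using avg_smooth[OF c h, of e t] by (simp add: inner_diff_left A_linear)
    finally show ?thesis .
  qed
  ultimately show ?thesis by blast
qed

text \<open>The initial value is attained up to the smoothing error only, which tends to zero with \<open>e\<close> relative to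
  the mass \<open>e\<^sup>2\<close> of the kernel. This gives density of the initial values, which is all that is used.\<close>

theorem dirichlet_problem:
  assumes fy: "(f, y) \<in> G"
  shows "\<exists>D. \<forall>e>0. \<exists>\<Phi> Z. sol \<Phi> Z \<and> norm (\<Phi> 0 - e\<^sup>2 *\<^sub>R f) \<le> e\<^sup>2 * sqrt (2 * e * D)"
proof -
  obtain F U D where comp: "\<And>m. competitor f (F m) (U m)" and bd: "\<And>m. n2 (U m) \<le> D"
    and cau: "\<And>m l. n2 (\<lambda>t. U m t - U l t) \<le> (2 / \<kappa>) * (inverse (real (Suc m)) + inverse (real (Suc l)))"
    and EL: "\<And>m H X. competitor 0 H X \<Longrightarrow> (energy (U m) X)\<^sup>2 \<le> energy X X * inverse (real (Suc m))"
    using minimizing_sequence[OF fy] by blast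
  have csU: "cs (U m)" and csF: "cs (F m)" for m using comp[of m] by (simp_all add: competitor_def)
  have D0: "0 \<le> D" using n2_nonneg[OF csU[of 0]] bd[of 0] by linarith
  have small: "\<exists>N. \<forall>m\<ge>N. \<forall>l\<ge>N. n2 (\<lambda>t. U m t - U l t) < \<epsilon>" if pos: "0 < \<epsilon>" for \<epsilon>
  proof -
    obtain N where N: "inverse (real (Suc N)) < \<epsilon> * \<kappa> / 4"
      using reals_Archimedean[of "\<epsilon> * \<kappa> / 4"] pos \<kappa>_pos by (meson divide_pos_pos mult_pos_pos zero_less_numeral)
    have "n2 (\<lambda>t. U m t - U l t) < \<epsilon>" if "m \<ge> N" "l \<ge> N" for m l
    proof -
      have "inverse (real (Suc m)) \<le> inverse (real (Suc N))" "inverse (real (Suc l)) \<le> inverse (real (Suc N))"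
        using that by (auto intro!: le_imp_inverse_le)
      then have "inverse (real (Suc m)) + inverse (real (Suc l)) < \<epsilon> * \<kappa> / 2" using N by linarith
      then have "(2 / \<kappa>) * (inverse (real (Suc m)) + inverse (real (Suc l))) < (2 / \<kappa>) * (\<epsilon> * \<kappa> / 2)"
        using \<kappa>_pos by (intro mult_strict_left_mono) auto
      also have "\<dots> = \<epsilon>" using \<kappa>_pos by simp
      finally show ?thesis using cau[of m l] by linarith
    qed
    then show ?thesis by blast
  qed
  have "\<exists>\<Phi> Z. sol \<Phi> Z \<and> norm (\<Phi> 0 - e\<^sup>2 *\<^sub>R f) \<le> e\<^sup>2 * sqrt (2 * e * D)" if e: "0 < e" for e
  proof -
    define Zm where "Zm m = smooth e (U m)" for m
    define Fm where "Fm m = smooth e (F m)" for m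
    have "uniformly_Cauchy_on {0..} Zm"
    proof (rule uniformly_Cauchy_onI)
      fix \<epsilon> :: real assume "0 < \<epsilon>"
      then obtain N where N: "\<forall>m\<ge>N. \<forall>l\<ge>N. n2 (\<lambda>t. U m t - U l t) < \<epsilon>\<^sup>2 / e ^ 3"
        using small[of "\<epsilon>\<^sup>2 / e ^ 3"] e by auto
      have "dist (Zm m t) (Zm l t) < \<epsilon>" if "t \<in> {0..}" "m \<ge> N" "l \<ge> N" for m l t
      proof -
        have "cs (\<lambda>t. U m t - U l t)" using cs_lincomb[OF csU[of m] csU[of l], of 1 "-1"] by simp
        then have "(norm (Zm m t - Zm l t))\<^sup>2 \<le> e ^ 3 * n2 (\<lambda>t. U m t - U l t)"
          unfolding Zm_def smooth_diff[OF csU csU, symmetric] using that(1) by (intro norm_smooth_le e) auto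
        also have "\<dots> < e ^ 3 * (\<epsilon>\<^sup>2 / e ^ 3)" using N that e by (intro mult_strict_left_mono) auto
        also have "\<dots> = \<epsilon>\<^sup>2" using e by simp
        finally show ?thesis unfolding dist_norm by (rule power_less_imp_less_base) (use \<open>0 < \<epsilon>\<close> in simp)
      qed
      then show "\<exists>M. \<forall>x\<in>{0..}. \<forall>m\<ge>M. \<forall>n\<ge>M. dist (Zm m x) (Zm n x) < \<epsilon>" by blast
    qed
    then obtain Z where Z: "uniform_limit {0..} Zm Z sequentially"
      using Cauchy_uniformly_convergent uniformly_convergent_uniform_limit_iff by blast
    have Zcont: "continuous_on {0..} Z"
      by (rule uniform_limit_theorem[OF always_eventually Z]) (auto simp: Zm_def intro!: continuous_smooth csU e)
    have Zpt: "(\<lambda>m. Zm m t) \<longlonglongrightarrow> Z t" if "0 \<le> t" for t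
      by (rule tendsto_uniform_limitI[OF Z]) (use that in simp)
    have Zunif: "\<exists>N. \<forall>m\<ge>N. \<forall>t\<ge>0. norm (Zm m t - Z t) < \<epsilon>" if "0 < \<epsilon>" for \<epsilon>
      using uniform_limitD[OF Z that] unfolding eventually_sequentially dist_norm by auto
    have Fder: "(Fm m has_vector_derivative fst (Zm m t)) (at t within {0..})" if "0 \<le> t" for m t
      unfolding Fm_def Zm_def by (rule smooth_competitor(1)[OF comp that e])
    have FG: "(Fm m t, snd (Zm m t)) \<in> G" if "0 \<le> t" for m t
      unfolding Fm_def Zm_def by (rule smooth_competitor(2)[OF comp that e])
    have "Cauchy (\<lambda>m. Fm m 0)"
    proof (rule metric_CauchyI)
      fix \<epsilon> :: real assume "0 < \<epsilon>"
      define \<delta> where "\<delta> = (\<epsilon> / e\<^sup>2)\<^sup>2 / (2 * e)"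
      have \<delta>: "\<delta> > 0" using e \<open>0 < \<epsilon>\<close> by (simp add: \<delta>_def)
      then obtain N where N: "\<forall>m\<ge>N. \<forall>l\<ge>N. n2 (\<lambda>t. U m t - U l t) < \<delta>" using small by blast
      have "dist (Fm m 0) (Fm l 0) < \<epsilon>" if "m \<ge> N" "l \<ge> N" for m l
      proof -
        have c: "competitor 0 (\<lambda>t. F m t - F l t) (\<lambda>t. U m t - U l t)"
          using competitor_lincomb[OF comp[of m] comp[of l], of 1 "-1"] by simp
        have "norm (Fm m 0 - Fm l 0) \<le> e\<^sup>2 * sqrt (2 * e * n2 (\<lambda>t. U m t - U l t))"
          using smooth_initial_distance[OF c _ e, of 0] smooth_diff[OF csF csF, of e m l 0] by (simp add: Fm_def)
        also have "\<dots> < e\<^sup>2 * sqrt (2 * e * \<delta>)" using N that e by (intro mult_strict_left_mono) auto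
        also have "\<dots> = \<epsilon>" using e \<open>0 < \<epsilon>\<close> by (simp add: \<delta>_def)
        finally show ?thesis by (simp add: dist_norm)
      qed
      then show "\<exists>M. \<forall>m\<ge>M. \<forall>n\<ge>M. dist (Fm m 0) (Fm n 0) < \<epsilon>" by blast
    qed
    then obtain l where l: "(\<lambda>m. Fm m 0) \<longlonglongrightarrow> l" using Cauchy_convergent_iff convergent_def by blast
    have "\<exists>\<Phi>. \<forall>t\<in>{0..}. (\<lambda>m. Fm m t) \<longlonglongrightarrow> \<Phi> t \<and> (\<Phi> has_vector_derivative fst (Z t)) (at t within {0..})"
      unfolding has_vector_derivative_def
    proof (rule has_derivative_sequence[of "{0..}" Fm "\<lambda>m t h. h *\<^sub>R fst (Zm m t)" _ 0 l])
      show "(Fm m has_derivative (\<lambda>h. h *\<^sub>R fst (Zm m t))) (at t within {0..})" if "t \<in> {0..}" for m t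
        using Fder that by (simp add: has_vector_derivative_def)
      show "\<forall>\<^sub>F n in sequentially. \<forall>x\<in>{0..}. \<forall>h. norm (h *\<^sub>R fst (Zm n x) - h *\<^sub>R fst (Z x)) \<le> \<epsilon> * norm h" if pos: "0 < \<epsilon>" for \<epsilon>
      proof -
        obtain N where N: "\<forall>m\<ge>N. \<forall>t\<ge>0. norm (Zm m t - Z t) < \<epsilon>" using Zunif[OF pos] by blast
        have "norm (h *\<^sub>R fst (Zm n x) - h *\<^sub>R fst (Z x)) \<le> \<epsilon> * norm h" if "n \<ge> N" "0 \<le> x" for n x h
        proof -
          have "norm (h *\<^sub>R fst (Zm n x) - h *\<^sub>R fst (Z x)) = \<bar>h\<bar> * norm (fst (Zm n x - Z x))"
            by (simp flip: scaleR_diff_right)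
          also have "\<dots> \<le> \<bar>h\<bar> * \<epsilon>"
          proof (intro mult_left_mono)
            have "norm (Zm n x - Z x) < \<epsilon>" using N that by blast
            then show "norm (fst (Zm n x - Z x)) \<le> \<epsilon>" using norm_fst_le'[of "Zm n x - Z x"] by linarith
          qed simp
          finally show ?thesis by (simp add: mult.commute)
        qed
        then show ?thesis unfolding eventually_sequentially by auto
      qed
    qed (use l in auto)
    then obtain \<Phi> where Fpt: "\<And>t. 0 \<le> t \<Longrightarrow> (\<lambda>m. Fm m t) \<longlonglongrightarrow> \<Phi> t"
      and \<Phi>der: "\<And>t. 0 \<le> t \<Longrightarrow> (\<Phi> has_vector_derivative fst (Z t)) (at t within {0..})" by auto
    have \<Phi>G: "(\<Phi> t, snd (Z t)) \<in> G" if "0 \<le> t" for t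
      by (rule closed_sequentially[OF closed_G, of "\<lambda>m. (Fm m t, snd (Zm m t))"])
        (use FG Fpt Zpt that in \<open>auto intro!: tendsto_intros\<close>)
    have dist: "norm (\<Phi> t - e\<^sup>2 *\<^sub>R f) \<le> e\<^sup>2 * sqrt ((t + 2 * e) * D)" if "0 \<le> t" for t
    proof (rule Lim_bounded)
      show "(\<lambda>m. norm (Fm m t - e\<^sup>2 *\<^sub>R f)) \<longlonglongrightarrow> norm (\<Phi> t - e\<^sup>2 *\<^sub>R f)" by (intro tendsto_intros Fpt that)
      show "\<forall>m\<ge>0. norm (Fm m t - e\<^sup>2 *\<^sub>R f) \<le> e\<^sup>2 * sqrt ((t + 2 * e) * D)"
      proof (intro allI impI)
        fix m
        have "norm (Fm m t - e\<^sup>2 *\<^sub>R f) \<le> e\<^sup>2 * sqrt ((t + 2 * e) * n2 (U m))"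
          unfolding Fm_def by (rule smooth_initial_distance[OF comp that e])
        also have "\<dots> \<le> e\<^sup>2 * sqrt ((t + 2 * e) * D)"
          using that e bd[of m] by (intro mult_left_mono real_sqrt_le_mono) auto
        finally show "norm (Fm m t - e\<^sup>2 *\<^sub>R f) \<le> e\<^sup>2 * sqrt ((t + 2 * e) * D)" .
      qed
    qed
    have growth: "(norm (\<Phi> t))\<^sup>2 \<le> (2 * e ^ 4 * ((norm f)\<^sup>2 + (1 + 2 * e) * D)) * (1 + t)" if "0 \<le> t" for t
    proof -
      have "norm (\<Phi> t) \<le> e\<^sup>2 * sqrt ((t + 2 * e) * D) + e\<^sup>2 * norm f"
        using dist[OF that] norm_triangle_sub[of "\<Phi> t" "e\<^sup>2 *\<^sub>R f"] by simp
      then have "(norm (\<Phi> t))\<^sup>2 \<le> (e\<^sup>2 * sqrt ((t + 2 * e) * D) + e\<^sup>2 * norm f)\<^sup>2" by (rule power_mono) simp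
      also have "\<dots> \<le> 2 * (e\<^sup>2 * sqrt ((t + 2 * e) * D))\<^sup>2 + 2 * (e\<^sup>2 * norm f)\<^sup>2"
      proof -
        have "(x + y)\<^sup>2 \<le> 2 * x\<^sup>2 + 2 * y\<^sup>2" for x y :: real
          using zero_le_power2[of "x - y"] by (simp add: power2_eq_square algebra_simps)
        then show ?thesis by blast
      qed
      also have "\<dots> = 2 * e ^ 4 * ((norm f)\<^sup>2 + (t + 2 * e) * D)"
        using that e D0 by (simp add: power_mult_distrib algebra_simps flip: power_mult)
      also have "\<dots> \<le> 2 * e ^ 4 * ((norm f)\<^sup>2 * (1 + t) + ((1 + 2 * e) * D) * (1 + t))"
      proof (intro mult_left_mono add_mono)
        show "(norm f)\<^sup>2 \<le> (norm f)\<^sup>2 * (1 + t)" using that by (simp add: mult_le_cancel_left1)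
        have "t + 2 * e \<le> (1 + 2 * e) * (1 + t)" using that e by (simp add: algebra_simps)
        then have "(t + 2 * e) * D \<le> ((1 + 2 * e) * (1 + t)) * D" using D0 by (rule mult_right_mono)
        then show "(t + 2 * e) * D \<le> ((1 + 2 * e) * D) * (1 + t)" by (simp add: mult_ac)
      qed auto
      finally show ?thesis by (simp add: algebra_simps)
    qed
    have eq: "inner (w (Z (t + h)) - w (Z t)) g = inner (q (avg h Z t)) y'"
      if t: "0 \<le> t" and h: "0 \<le> h" and gy: "(g, y') \<in> G" for t h g y'
    proof -
      obtain H X where HX: "competitor 0 H X" and enX: "\<And>U. cs U \<Longrightarrow> energy U X =
          inner (w (smooth e U t) - w (smooth e U (t + h))) g + inner (q (avg h (smooth e U) t)) y'"
        using smooth_euler_lagrange[OF csU t h e gy] by blast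
      have "(\<lambda>m. (energy (U m) X)\<^sup>2) \<longlonglongrightarrow> 0"
      proof (rule tendsto_sandwich[OF _ _ tendsto_const])
        have "(\<lambda>m. energy X X * inverse (real (Suc m))) \<longlonglongrightarrow> energy X X * 0"
          by (intro tendsto_intros LIMSEQ_inverse_real_of_nat)
        then show "(\<lambda>m. energy X X * inverse (real (Suc m))) \<longlonglongrightarrow> 0" by simp
      qed (use EL[OF HX] in auto)
      from tendsto_real_sqrt[OF this] have "(\<lambda>m. \<bar>energy (U m) X\<bar>) \<longlonglongrightarrow> 0" by simp
      then have l0: "(\<lambda>m. energy (U m) X) \<longlonglongrightarrow> 0" by (rule tendsto_rabs_zero_cancel)
      have avgl: "(\<lambda>m. avg h (Zm m) t) \<longlonglongrightarrow> avg h Z t"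
      proof (rule LIMSEQ_I)
        fix \<epsilon> :: real assume "0 < \<epsilon>"
        then obtain N where N: "\<forall>m\<ge>N. \<forall>t\<ge>0. norm (Zm m t - Z t) < \<epsilon> / (h + 1)"
          using Zunif[of "\<epsilon> / (h + 1)"] h by auto
        have "norm (avg h (Zm m) t - avg h Z t) < \<epsilon>" if "m \<ge> N" for m
        proof -
          have c: "continuous_on {0..} (Zm m)" unfolding Zm_def by (rule continuous_smooth[OF csU e])
          have "norm (avg h (\<lambda>s. 1 *\<^sub>R Zm m s + (-1) *\<^sub>R Z s) t) \<le> h * (\<epsilon> / (h + 1))"
            using N that t h by (intro norm_avg_le continuous_intros c Zcont) (auto intro!: less_imp_le)
          also have "\<dots> < \<epsilon>" using h \<open>0 < \<epsilon>\<close> by (simp add: field_simps)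
          finally show ?thesis unfolding avg_lincomb[OF c Zcont t] by simp
        qed
        then show "\<exists>no. \<forall>m\<ge>no. norm (avg h (Zm m) t - avg h Z t) < \<epsilon>" by blast
      qed
      have "(\<lambda>m. inner (w (Zm m t) - w (Zm m (t + h))) g + inner (q (avg h (Zm m) t)) y')
        \<longlonglongrightarrow> inner (w (Z t) - w (Z (t + h))) g + inner (q (avg h Z t)) y'"
        by (intro tendsto_intros tendsto_inner avgl Zpt bounded_linear.tendsto[OF bounded_linear_A]) (use t h in auto)
      then have "(\<lambda>m. energy (U m) X) \<longlonglongrightarrow> inner (w (Z t) - w (Z (t + h))) g + inner (q (avg h Z t)) y'"
        unfolding enX[OF csU] Zm_def .
      from LIMSEQ_unique[OF this l0] show ?thesis by (simp add: inner_diff_left)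
    qed
    have lim: "(Z \<longlongrightarrow> 0) at_top"
    proof (rule tendstoI)
      fix \<epsilon> :: real assume "0 < \<epsilon>"
      then obtain N where N: "\<forall>m\<ge>N. \<forall>t\<ge>0. norm (Zm m t - Z t) < \<epsilon>" using Zunif by blast
      obtain T where T: "T \<ge> 0" "\<forall>t\<ge>T. U N t = 0" using csU[of N] by (auto simp: cs_def)
      have "Zm N t = 0" if "t \<ge> T" for t
      proof -
        have "integral {0..} (\<lambda>s. tent e (s - t) *\<^sub>R U N s) = integral {0::real..} (\<lambda>s. 0)"
        proof (rule integral_cong)
          fix s
          show "tent e (s - t) *\<^sub>R U N s = 0"
            using T that tent_outside(1)[OF e, of "s - t"] by (cases "s \<le> t") auto
        qed
        then show ?thesis by (simp add: Zm_def smooth_def)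
      qed
      then have "dist (Z t) 0 < \<epsilon>" if "t \<ge> T" for t
        using N[rule_format, of N t] T that by (simp add: norm_minus_commute)
      then show "eventually (\<lambda>t. dist (Z t) 0 < \<epsilon>) at_top" unfolding eventually_at_top_linorder by blast
    qed
    have "sol \<Phi> Z" unfolding sol_def using Zcont \<Phi>der \<Phi>G eq growth lim by blast
    then show ?thesis using dist[of 0] by (intro exI[of _ \<Phi>] exI[of _ Z]) simp
  qed
  then show ?thesis by blast
qed

end

section \<open>Existence for the Neumann problem\<close>

context first_order_system
begin

text \<open>Solutions with three derivatives: \<open>U\<close> and \<open>V\<close> are again regular solutions, with potentials
  \<open>U\<^sub>0\<close> and \<open>V\<^sub>0\<close>. The bounds by the initial value can thus be applied to \<open>U\<close>
  instead of \<open>\<Phi>\<close>.\<close>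

definition good :: "(real \<Rightarrow> 'a) \<Rightarrow> (real \<Rightarrow> 'a \<times> 'b) \<Rightarrow> (real \<Rightarrow> 'a \<times> 'b) \<Rightarrow> bool" where
  "good \<Phi> U V \<longleftrightarrow> regular \<Phi> U V \<and> (\<exists>\<Phi>' W \<Phi>'' X. regular \<Phi>' V W \<and> regular \<Phi>'' W X \<and>
     (\<forall>t\<ge>0. \<Phi>' t = fst (U t)) \<and> (\<forall>t\<ge>0. \<Phi>'' t = fst (V t)))"

lemma fst_avg:
  assumes "sol \<Phi> U" "0 \<le> h" "0 \<le> t"
  shows "incr h \<Phi> t = fst (avg h U t)"
  using avg_of_derivative[OF solD(3)[OF assms(1)] assms(3,2)]
    avg_bounded_linear[OF bounded_linear_fst solD(1)[OF assms(1)] assms(3), of h] by simp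

text \<open>Each average gains one derivative.\<close>

lemma good_avg:
  assumes "sol \<Phi> Z" "0 \<le> h1" "0 \<le> h2" "0 \<le> h3"
  shows "good (avg h3 (avg h2 (avg h1 \<Phi>))) (avg h3 (avg h2 (avg h1 Z))) (incr h3 (avg h2 (avg h1 Z)))"
proof -
  have r1: "regular (avg h1 \<Phi>) (avg h1 Z) (incr h1 Z)" by (rule regular_avg[OF assms(1,2)])
  have r2: "regular (avg h2 (avg h1 \<Phi>)) (avg h2 (avg h1 Z)) (incr h2 (avg h1 Z))"
    by (rule regular_avg[OF regularD(1)[OF r1] assms(3)])
  have r3: "regular (avg h3 (avg h2 (avg h1 \<Phi>))) (avg h3 (avg h2 (avg h1 Z))) (incr h3 (avg h2 (avg h1 Z)))"
    by (rule regular_avg[OF regularD(1)[OF r2] assms(4)])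
  have "incr h3 (avg h2 (avg h1 \<Phi>)) t = fst (avg h3 (avg h2 (avg h1 Z)) t)" if "0 \<le> t" for t
    by (rule fst_avg[OF regularD(1)[OF r2] assms(4) that])
  moreover have "incr h3 (incr h2 (avg h1 \<Phi>)) t = fst (incr h3 (avg h2 (avg h1 Z)) t)" if "0 \<le> t" for t
    using fst_avg[OF regularD(1)[OF r1] assms(3), of t] fst_avg[OF regularD(1)[OF r1] assms(3), of "t + h3"] that assms(4)
    by (simp add: incr_def[of h3])
  ultimately show ?thesis unfolding good_def
    using r3 regular_incr[OF r2 assms(4)] regular_incr[OF regular_incr[OF r1 assms(3)] assms(4)] by blast
qed

lemma good_lincomb:
  assumes "good \<Phi> U V" "good \<Psi> W X"
  shows "good (\<lambda>t. a *\<^sub>R \<Phi> t + b *\<^sub>R \<Psi> t) (\<lambda>t. a *\<^sub>R U t + b *\<^sub>R W t) (\<lambda>t. a *\<^sub>R V t + b *\<^sub>R X t)"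
proof -
  obtain \<Phi>1 V1 \<Phi>2 V2 where 1: "regular \<Phi>1 V V1" "regular \<Phi>2 V1 V2"
    "\<forall>t\<ge>0. \<Phi>1 t = fst (U t)" "\<forall>t\<ge>0. \<Phi>2 t = fst (V t)" using assms(1) by (auto simp: good_def)
  obtain \<Psi>1 X1 \<Psi>2 X2 where 2: "regular \<Psi>1 X X1" "regular \<Psi>2 X1 X2"
    "\<forall>t\<ge>0. \<Psi>1 t = fst (W t)" "\<forall>t\<ge>0. \<Psi>2 t = fst (X t)" using assms(2) by (auto simp: good_def)
  have "regular (\<lambda>t. a *\<^sub>R \<Phi> t + b *\<^sub>R \<Psi> t) (\<lambda>t. a *\<^sub>R U t + b *\<^sub>R W t) (\<lambda>t. a *\<^sub>R V t + b *\<^sub>R X t)"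
    using assms by (intro regular_lincomb) (auto simp: good_def)
  moreover note regular_lincomb[OF 1(1) 2(1), of a b] regular_lincomb[OF 1(2) 2(2), of a b]
  moreover have "\<forall>t\<ge>0. a *\<^sub>R \<Phi>1 t + b *\<^sub>R \<Psi>1 t = fst (a *\<^sub>R U t + b *\<^sub>R W t)"
    "\<forall>t\<ge>0. a *\<^sub>R \<Phi>2 t + b *\<^sub>R \<Psi>2 t = fst (a *\<^sub>R V t + b *\<^sub>R X t)" using 1 2 by simp_all
  ultimately show ?thesis unfolding good_def by blast
qed

lemma good_shift:
  assumes "good \<Phi> U V" "0 \<le> s"
  shows "good (\<lambda>t. \<Phi> (t + s)) (\<lambda>t. U (t + s)) (\<lambda>t. V (t + s))"
proof -
  obtain \<Phi>1 V1 \<Phi>2 V2 where 1: "regular \<Phi>1 V V1" "regular \<Phi>2 V1 V2"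
    "\<forall>t\<ge>0. \<Phi>1 t = fst (U t)" "\<forall>t\<ge>0. \<Phi>2 t = fst (V t)" using assms(1) by (auto simp: good_def)
  have "regular (\<lambda>t. \<Phi> (t + s)) (\<lambda>t. U (t + s)) (\<lambda>t. V (t + s))"
    using assms by (intro regular_shift) (auto simp: good_def)
  moreover note regular_shift[OF 1(1) assms(2)] regular_shift[OF 1(2) assms(2)]
  moreover have "\<forall>t\<ge>0. \<Phi>1 (t + s) = fst (U (t + s))" "\<forall>t\<ge>0. \<Phi>2 (t + s) = fst (V (t + s))"
    using 1 assms(2) by simp_all
  ultimately show ?thesis unfolding good_def by blast
qed

lemma good_regular: "good \<Phi> U V \<Longrightarrow> regular \<Phi> U V"
  by (simp add: good_def)

subsection \<open>Density of the traces\<close>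

text \<open>Translation invariance of the class and vanishing averages give orthogonality to the initial values of all mild
  solutions, and these are dense by the Dirichlet problem.\<close>

lemma orthogonal_to_potentials:
  assumes orth: "\<And>\<Phi> U V. good \<Phi> U V \<Longrightarrow> inner \<phi> (\<Phi> 0) = 0"
  shows "\<phi> = 0"
proof -
  have orth_sol: "inner \<phi> (\<Phi> 0) = 0" if s: "sol \<Phi> Z" for \<Phi> Z
  proof -
    have o: "inner \<phi> (\<Phi> t) = 0" if "good \<Phi> U V" "0 \<le> t" for \<Phi> U V t
      using orth[OF good_shift[OF that]] by simp
    note cont = solD(2)[OF s]
    have 3: "inner \<phi> (avg h3 (avg h2 (avg h1 \<Phi>)) t) = 0" if "0 \<le> t" "0 < h1" "0 < h2" "0 < h3" for t h1 h2 h3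
      by (rule o[OF good_avg[OF s]]) (use that in auto)
    have 2: "inner \<phi> (avg h2 (avg h1 \<Phi>) t) = 0" if "0 \<le> t" "0 < h1" "0 < h2" for t h1 h2
      by (rule orthogonal_to_averages[OF _ that(1)]) (use that cont 3 in \<open>auto intro!: continuous_avg\<close>)
    have 1: "inner \<phi> (avg h1 \<Phi> t) = 0" if "0 \<le> t" "0 < h1" for t h1
      by (rule orthogonal_to_averages[OF _ that(1)]) (use that cont 2 in \<open>auto intro!: continuous_avg\<close>)
    show ?thesis by (rule orthogonal_to_averages[OF cont]) (use 1 in auto)
  qed
  have "inner \<phi> f = 0" if fy: "(f, y) \<in> G" for f y
  proof -
    obtain D where D: "\<And>e. e > 0 \<Longrightarrow> \<exists>\<Phi> Z. sol \<Phi> Z \<and> norm (\<Phi> 0 - e\<^sup>2 *\<^sub>R f) \<le> e\<^sup>2 * sqrt (2 * e * D)"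
      using dirichlet_problem[OF fy] by blast
    have bound: "\<bar>inner \<phi> f\<bar> \<le> norm \<phi> * sqrt (2 * e * D)" if e: "e > 0" for e
    proof -
      obtain \<Phi> Z where s: "sol \<Phi> Z" "norm (\<Phi> 0 - e\<^sup>2 *\<^sub>R f) \<le> e\<^sup>2 * sqrt (2 * e * D)" using D[OF e] by blast
      have "e\<^sup>2 * \<bar>inner \<phi> f\<bar> = \<bar>inner \<phi> (\<Phi> 0 - e\<^sup>2 *\<^sub>R f)\<bar>"
        using orth_sol[OF s(1)] by (simp add: inner_diff_right abs_mult)
      also have "\<dots> \<le> norm \<phi> * (e\<^sup>2 * sqrt (2 * e * D))"
        using s(2) by (intro order_trans[OF Cauchy_Schwarz_ineq2] mult_left_mono) auto
      finally have "e\<^sup>2 * \<bar>inner \<phi> f\<bar> \<le> e\<^sup>2 * (norm \<phi> * sqrt (2 * e * D))" by (simp add: mult_ac)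
      then show ?thesis by (rule mult_left_le_imp_le) (use e in simp)
    qed
    have "((\<lambda>e. norm \<phi> * sqrt (2 * e * D)) \<longlongrightarrow> norm \<phi> * sqrt (2 * 0 * D)) (at_right 0)"
      by (intro tendsto_intros)
    then have "\<bar>inner \<phi> f\<bar> \<le> norm \<phi> * sqrt (2 * 0 * D)"
      by (rule tendsto_lowerbound) (use bound in \<open>auto simp: eventually_at_right_less eventually_at_filter\<close>)
    then show ?thesis by simp
  qed
  then have "fst ` G \<subseteq> {f. inner \<phi> f = 0}" by auto
  moreover have "closed {f. inner \<phi> f = 0}" by (intro closed_Collect_eq continuous_intros)
  ultimately have "closure (fst ` G) \<subseteq> {f. inner \<phi> f = 0}" by (rule closure_minimal)
  moreover have "\<phi> \<in> closure (fst ` G)" using dense_domain by simp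
  ultimately have "inner \<phi> \<phi> = 0" by blast
  then show ?thesis by simp
qed

text \<open>The range of the adjoint of \<open>\<nabla>\<^sub>x\<close> is dense since \<open>\<nabla>\<^sub>x\<close> is
  injective.\<close>

lemma adjoint_range_dense: "closure {x. \<exists>z. \<forall>p\<in>G. inner x (fst p) = inner z (snd p)} = UNIV"
proof (rule dense_if_orthogonal_trivial)
  show "subspace {x. \<exists>z. \<forall>p\<in>G. inner x (fst p) = inner z (snd p)}"
  proof (rule subspaceI)
    let ?S = "{x. \<exists>z. \<forall>p\<in>G. inner x (fst p) = inner z (snd p)}"
    show "0 \<in> ?S" by (auto intro!: exI[of _ 0])
    show "x + x' \<in> ?S" if xx: "x \<in> ?S" "x' \<in> ?S" for x x'
    proof -
      obtain z z' where "\<forall>p\<in>G. inner x (fst p) = inner z (snd p)" "\<forall>p\<in>G. inner x' (fst p) = inner z' (snd p)"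
        using xx by blast
      then have "\<forall>p\<in>G. inner (x + x') (fst p) = inner (z + z') (snd p)" by (simp add: inner_add_left)
      then show ?thesis by blast
    qed
    show "c *\<^sub>R x \<in> ?S" if xx: "x \<in> ?S" for c x
    proof -
      obtain z where "\<forall>p\<in>G. inner x (fst p) = inner z (snd p)" using xx by blast
      then have "\<forall>p\<in>G. inner (c *\<^sub>R x) (fst p) = inner (c *\<^sub>R z) (snd p)" by simp
      then show ?thesis by blast
    qed
  qed
  fix \<phi> assume orth: "\<And>x. x \<in> {x. \<exists>z. \<forall>p\<in>G. inner x (fst p) = inner z (snd p)} \<Longrightarrow> inner \<phi> x = 0"
  have "(\<phi>, 0) \<in> G"
  proof (rule ccontr)
    assume "(\<phi>, 0) \<notin> G"
    then obtain x z where p: "\<forall>s\<in>G. inner (x, z) s = 0" "inner (x, z) (\<phi>, 0) \<noteq> 0"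
      using closed_subspace_separation[OF closed_G subspace_G] by (metis surj_pair)
    have "\<forall>p\<in>G. inner x (fst p) = inner (- z) (snd p)"
      using p(1) by (auto simp: inner_prod_def add_eq_0_iff)
    then have "inner \<phi> x = 0" using orth by blast
    then show False using p(2) by (simp add: inner_prod_def inner_commute)
  qed
  then show "\<phi> = 0" by (rule injective)
qed

text \<open>If \<open>\<phi>\<close> is orthogonal to the derivative of every potential, then \<open>\<langle>\<phi>, \<Phi>
  t\<rangle>\<close> is constant in \<open>t\<close>. Since \<open>\<Phi>\<close> is bounded and \<open>\<nabla>\<^sub>x
  \<Phi>\<close> tends to zero, \<open>\<Phi>\<close> tends weakly to zero, and the constant is zero.\<close>

lemma orthogonal_to_velocities:
  assumes orth: "\<And>\<Phi> U V. good \<Phi> U V \<Longrightarrow> inner \<phi> (fst (U 0)) = 0"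
  shows "\<phi> = 0"
proof (rule orthogonal_to_potentials)
  fix \<Phi> U V assume good: "good \<Phi> U V"
  note 1 = solD[OF regularD(1)[OF good_regular[OF good]]]
  have "((\<lambda>t. inner \<phi> (\<Phi> t)) has_vector_derivative 0) (at t within {0..})" if "t \<in> {0..}" for t
    using bounded_linear.has_vector_derivative[OF bounded_linear_inner_right 1(3), of t \<phi>] that orth[OF good_shift[OF good], of t] by simp
  then have const: "inner \<phi> (\<Phi> 0) = inner \<phi> (\<Phi> t)" if "0 \<le> t" for t
    using constant_if_derivative_zero[of "{0..}" "\<lambda>t. inner \<phi> (\<Phi> t)" 0 t] that by auto
  obtain K where K: "K \<ge> 0" "\<And>t. 0 \<le> t \<Longrightarrow> norm (\<Phi> t) \<le> K * norm (\<Phi> 0)"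
    using bound_by_initial_value good_regular[OF good] by blast
  have "\<bar>inner \<phi> (\<Phi> 0)\<bar> \<le> e * (K * norm (\<Phi> 0))" if e: "e > 0" for e
  proof -
    have "\<phi> \<in> closure {x. \<exists>z. \<forall>p\<in>G. inner x (fst p) = inner z (snd p)}" using adjoint_range_dense by simp
    then obtain x z where x: "\<forall>p\<in>G. inner x (fst p) = inner z (snd p)" "norm (\<phi> - x) < e"
      using e unfolding closure_approachable dist_norm by (auto simp: norm_minus_commute)
    have *: "\<bar>inner \<phi> (\<Phi> 0)\<bar> \<le> e * (K * norm (\<Phi> 0)) + \<bar>inner z (snd (U t))\<bar>" if t: "0 \<le> t" for t
    proof -
      have "inner \<phi> (\<Phi> 0) = inner (\<phi> - x) (\<Phi> t) + inner z (snd (U t))"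
        using const[OF t] bspec[OF x(1) 1(4)[OF t]] by (simp add: inner_diff_left)
      moreover have "\<bar>inner (\<phi> - x) (\<Phi> t)\<bar> \<le> e * (K * norm (\<Phi> 0))"
        using x(2) K(2)[OF t] e by (intro order_trans[OF Cauchy_Schwarz_ineq2] mult_mono) auto
      ultimately show ?thesis by linarith
    qed
    have "((\<lambda>t. e * (K * norm (\<Phi> 0)) + \<bar>inner z (snd (U t))\<bar>) \<longlongrightarrow> e * (K * norm (\<Phi> 0)) + \<bar>inner z (snd (0 :: 'a \<times> 'b))\<bar>) at_top"
      by (intro tendsto_intros tendsto_inner 1)
    then have "\<bar>inner \<phi> (\<Phi> 0)\<bar> \<le> e * (K * norm (\<Phi> 0)) + \<bar>inner z (snd (0 :: 'a \<times> 'b))\<bar>"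
      by (rule tendsto_lowerbound) (use * in \<open>auto simp: eventually_at_top_linorder\<close>)
    then show ?thesis by simp
  qed
  then have b: "\<bar>inner \<phi> (\<Phi> 0)\<bar> \<le> e * (K * norm (\<Phi> 0))" if "e > 0" for e using that by blast
  have "((\<lambda>e. e * (K * norm (\<Phi> 0))) \<longlongrightarrow> 0 * (K * norm (\<Phi> 0))) (at_right 0)" by (intro tendsto_intros)
  then have "\<bar>inner \<phi> (\<Phi> 0)\<bar> \<le> 0 * (K * norm (\<Phi> 0))"
    by (rule tendsto_lowerbound) (use b in \<open>auto simp: eventually_at_filter\<close>)
  then show "inner \<phi> (\<Phi> 0) = 0" by simp
qed

lemma good_estimate:
  assumes "good \<Phi> U V" "0 \<le> t"
  shows "\<kappa> * norm (U t) \<le> 2 * norm (w (U t))" "\<kappa> * norm (U t) \<le> 2 * M * norm (fst (U t))"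
    "\<kappa> * (norm (U t))\<^sup>2 \<le> 2 * inner (w (U t)) (fst (U t))"
  using rellich_estimate[OF rellich_regular[OF good_regular[OF assms(1)] assms(2)]
    solD(5)[OF regularD(1)[OF good_regular[OF assms(1)]] assms(2)]] by blast+

text \<open>If \<open>\<phi>\<close> is orthogonal to all data \<open>w (U 0)\<close>, choose \<open>U\<^sub>0 0\<close> close to
  \<open>\<phi>\<close>. The Rellich estimate then bounds \<open>\<parallel>U 0\<parallel>\<^sup>2\<close> by \<open>\<langle>w (U
  0), U\<^sub>0 0 - \<phi>\<rangle>\<close>, so that \<open>U 0\<close> and hence \<open>\<phi>\<close> is small.\<close>

lemma conormal_data_dense: "closure {w (U 0) | \<Phi> U V. good \<Phi> U V} = UNIV"
proof (rule dense_if_orthogonal_trivial)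
  obtain \<Phi>0 U0 V0 where g0: "good \<Phi>0 U0 V0"
  proof -
    have "(0, 0) \<in> G" using subspace_0[OF subspace_G] by (simp add: zero_prod_def)
    then obtain \<Phi> Z where "sol \<Phi> Z" using dirichlet_problem[of 0 0] zero_less_one by blast
    from good_avg[OF this, of 1 1 1] show ?thesis using that by simp
  qed
  have sub: "subspace {f U | \<Phi> U V. good \<Phi> U V}"
    if f: "\<And>a b U W. f (\<lambda>t. a *\<^sub>R U t + b *\<^sub>R W t) = a *\<^sub>R f U + b *\<^sub>R f W" for f :: "(real \<Rightarrow> 'a \<times> 'b) \<Rightarrow> 'a"
  proof (rule subspaceI)
    show "0 \<in> {f U | \<Phi> U V. good \<Phi> U V}"
      using good_lincomb[OF g0 g0, of 0 0] f[of 0 U0 0 U0] by force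
    show "x + y \<in> {f U | \<Phi> U V. good \<Phi> U V}" if xy: "x \<in> {f U | \<Phi> U V. good \<Phi> U V}" "y \<in> {f U | \<Phi> U V. good \<Phi> U V}" for x y
    proof -
      obtain \<Phi> U V \<Psi> W X where "good \<Phi> U V" "x = f U" "good \<Psi> W X" "y = f W" using xy by blast
      then show ?thesis using good_lincomb[of \<Phi> U V \<Psi> W X 1 1] f[of 1 U 1 W] by force
    qed
    show "c *\<^sub>R x \<in> {f U | \<Phi> U V. good \<Phi> U V}" if x: "x \<in> {f U | \<Phi> U V. good \<Phi> U V}" for c x
    proof -
      obtain \<Phi> U V where "good \<Phi> U V" "x = f U" using x by blast
      then show ?thesis using good_lincomb[of \<Phi> U V \<Phi> U V c 0] f[of c U 0 U] by force
    qed
  qed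
  show "subspace {w (U 0) | \<Phi> U V. good \<Phi> U V}"
    by (rule sub) (simp add: A_linear)
  fix \<phi> assume orth: "\<And>s. s \<in> {w (U 0) | \<Phi> U V. good \<Phi> U V} \<Longrightarrow> inner \<phi> s = 0"
  have "closure {fst (U 0) | \<Phi> U V. good \<Phi> U V} = UNIV"
  proof (rule dense_if_orthogonal_trivial[OF sub])
    fix \<psi> assume "\<And>s. s \<in> {fst (U 0) | \<Phi> U V. good \<Phi> U V} \<Longrightarrow> inner \<psi> s = 0"
    then show "\<psi> = 0" by (intro orthogonal_to_velocities) blast
  qed simp
  then have \<phi>: "\<phi> \<in> closure {fst (U 0) | \<Phi> U V. good \<Phi> U V}" by simp
  have b: "norm \<phi> \<le> e * (1 + 2 * M / \<kappa>)" if e: "e > 0" for e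
  proof -
    obtain \<Phi> U V where good: "good \<Phi> U V" and close: "norm (fst (U 0) - \<phi>) < e"
      using \<phi> e unfolding closure_approachable dist_norm by blast
    have "inner \<phi> (w (U 0)) = 0" by (rule orth) (use good in blast)
    then have "inner (w (U 0)) \<phi> = 0" by (simp add: inner_commute)
    then have "\<kappa> * (norm (U 0))\<^sup>2 \<le> 2 * inner (w (U 0)) (fst (U 0) - \<phi>)"
      using good_estimate(3)[OF good, of 0] by (simp add: inner_diff_right)
    also have "\<dots> \<le> 2 * (M * norm (U 0) * norm (fst (U 0) - \<phi>))"
      using flux_bound[of "U 0" "fst (U 0) - \<phi>"] by linarith
    also have "\<dots> \<le> 2 * (M * norm (U 0) * e)" using close M_pos by (intro mult_left_mono) auto
    finally have "norm (U 0) * (\<kappa> * norm (U 0)) \<le> norm (U 0) * (2 * M * e)" by (simp add: power2_eq_square mult_ac)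
    then have "\<kappa> * norm (U 0) \<le> 2 * M * e" using M_pos e by (cases "U 0 = 0") auto
    then have "norm (U 0) \<le> 2 * M * e / \<kappa>" using \<kappa>_pos by (simp add: field_simps)
    then have "norm \<phi> \<le> 2 * M * e / \<kappa> + e"
      using close norm_fst_le'[of "U 0"] norm_triangle_ineq4[of "fst (U 0)" "fst (U 0) - \<phi>"] by simp
    then show ?thesis by (simp add: algebra_simps)
  qed
  have "((\<lambda>e. e * (1 + 2 * M / \<kappa>)) \<longlongrightarrow> 0 * (1 + 2 * M / \<kappa>)) (at_right 0)" by (intro tendsto_intros)
  then have "norm \<phi> \<le> 0 * (1 + 2 * M / \<kappa>)"
    by (rule tendsto_lowerbound) (use b in \<open>auto simp: eventually_at_filter\<close>)
  then show "\<phi> = 0" by simp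
qed

text \<open>The Rellich estimate turns the bounds by the Dirichlet datum \<open>U\<^sub>0 0\<close> into bounds by the Neumann
  datum.\<close>

lemma good_bounds:
  "\<exists>C>0. \<forall>\<Phi> U V. good \<Phi> U V \<longrightarrow> (\<forall>t\<ge>0. norm (U t) \<le> C * norm (w (U 0)) \<and> t * norm (V t) \<le> C * norm (w (U 0)))"
proof -
  obtain K where K: "K \<ge> 0" "\<And>\<Phi> U V t. regular \<Phi> U V \<Longrightarrow> 0 \<le> t \<Longrightarrow> norm (\<Phi> t) \<le> K * norm (\<Phi> 0)"
    using bound_by_initial_value by blast
  obtain K' where K': "K' \<ge> 0" "\<And>\<Phi> U V \<Psi> W t. regular \<Phi> U V \<Longrightarrow> regular \<Psi> V W \<Longrightarrow> (\<forall>t\<ge>0. \<Psi> t = fst (U t)) \<Longrightarrow> 0 \<le> t \<Longrightarrow>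
     t * norm (U t) \<le> K' * norm (\<Phi> 0)"
    using derivative_bound_by_initial_value by blast
  define C where "C = (2 * M / \<kappa>) * K * (2 / \<kappa>) + K' * (2 / \<kappa>) + 1"
  have nn: "0 \<le> (2 * M / \<kappa>) * K * (2 / \<kappa>)" "0 \<le> K' * (2 / \<kappa>)" using K(1) K'(1) M_pos \<kappa>_pos by auto
  have "norm (U t) \<le> C * norm (w (U 0)) \<and> t * norm (V t) \<le> C * norm (w (U 0))"
    if good: "good \<Phi> U V" and t: "0 \<le> t" for \<Phi> U V t
  proof -
    obtain \<Phi>1 V1 \<Phi>2 V2 where 1: "regular \<Phi>1 V V1" "regular \<Phi>2 V1 V2"
      "\<forall>t\<ge>0. \<Phi>1 t = fst (U t)" "\<forall>t\<ge>0. \<Phi>2 t = fst (V t)" using good by (auto simp: good_def)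
    have "norm (\<Phi>1 0) \<le> norm (U 0)" using 1(3) norm_fst_le'[of "U 0"] by simp
    also have U0: "norm (U 0) \<le> (2 / \<kappa>) * norm (w (U 0))"
      using good_estimate(1)[OF good, of 0] \<kappa>_pos by (simp add: field_simps)
    finally have P0: "norm (\<Phi>1 0) \<le> (2 / \<kappa>) * norm (w (U 0))" .
    have "norm (U t) \<le> (2 * M / \<kappa>) * norm (fst (U t))"
      using good_estimate(2)[OF good t] \<kappa>_pos by (simp add: field_simps)
    also have "\<dots> \<le> (2 * M / \<kappa>) * (K * ((2 / \<kappa>) * norm (w (U 0))))"
    proof (rule mult_left_mono)
      have "norm (fst (U t)) \<le> K * norm (\<Phi>1 0)" using K(2)[OF 1(1) t] 1(3) t by simp
      also have "\<dots> \<le> K * ((2 / \<kappa>) * norm (w (U 0)))" using P0 K(1) by (rule mult_left_mono)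
      finally show "norm (fst (U t)) \<le> K * ((2 / \<kappa>) * norm (w (U 0)))" .
    qed (use M_pos \<kappa>_pos in simp)
    also have "\<dots> = ((2 * M / \<kappa>) * K * (2 / \<kappa>)) * norm (w (U 0))" by (simp only: mult.assoc)
    also have "\<dots> \<le> C * norm (w (U 0))" using nn by (intro mult_right_mono) (auto simp: C_def)
    finally have a: "norm (U t) \<le> C * norm (w (U 0))" .
    have "t * norm (V t) \<le> K' * norm (\<Phi>1 0)" by (rule K'(2)[OF 1(1,2) 1(4) t])
    also have "\<dots> \<le> K' * ((2 / \<kappa>) * norm (w (U 0)))" using P0 K'(1) by (rule mult_left_mono)
    also have "\<dots> = (K' * (2 / \<kappa>)) * norm (w (U 0))" by (simp only: mult.assoc)
    also have "\<dots> \<le> C * norm (w (U 0))" using nn by (intro mult_right_mono) (auto simp: C_def)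
    finally show ?thesis using a by blast
  qed
  moreover have "C > 0" using nn by (simp add: C_def)
  ultimately show ?thesis by blast
qed

lemma uniformly_convergent_if_controlled:
  fixes X :: "nat \<Rightarrow> real \<Rightarrow> 'c::banach"
  assumes "Cauchy x" "\<And>k l t. t \<in> S \<Longrightarrow> norm (X k t - X l t) \<le> C * norm (x k - x l)" "0 < C"
  shows "\<exists>Y. uniform_limit S X Y sequentially"
proof -
  have "uniformly_Cauchy_on S X"
  proof (rule uniformly_Cauchy_onI)
    fix e :: real assume e: "0 < e"
    obtain N where N: "\<And>k l. k \<ge> N \<Longrightarrow> l \<ge> N \<Longrightarrow> norm (x k - x l) < e / C"
      using assms(1,3) e unfolding Cauchy_def dist_norm by (meson divide_pos_pos)
    have "dist (X k t) (X l t) < e" if "t \<in> S" "k \<ge> N" "l \<ge> N" for k l t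
    proof -
      have "C * norm (x k - x l) < C * (e / C)" using N that assms(3) by (intro mult_strict_left_mono) auto
      then show ?thesis using assms(2)[OF that(1), of k l] assms(3) by (simp add: dist_norm)
    qed
    then show "\<exists>M. \<forall>x\<in>S. \<forall>m\<ge>M. \<forall>n\<ge>M. dist (X m x) (X n x) < e" by blast
  qed
  then show ?thesis using Cauchy_uniformly_convergent uniformly_convergent_uniform_limit_iff by blast
qed

text \<open>Approximate the datum by data of smooth solutions. By \<open>good_bounds\<close> the solutions converge uniformly on
  \<open>[0, \<infinity>)\<close> and their derivatives converge uniformly after multiplication with \<open>t\<close>.\<close>

theorem neumann_exists:
  "\<exists>U V u. (\<forall>t>0. (U has_vector_derivative V t) (at t) \<and> (U t, V t) \<in> flow \<and> snd (U t) \<in> closure (snd ` G)) \<and>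
     continuous_on {0<..} V \<and> (U \<longlongrightarrow> 0) at_top \<and> (U \<longlongrightarrow> u) (at_right 0) \<and> w u = w0"
proof -
  have "w0 \<in> closure {w (U 0) | \<Phi> U V. good \<Phi> U V}" using conormal_data_dense by simp
  then obtain x where x: "\<And>n. x n \<in> {w (U 0) | \<Phi> U V. good \<Phi> U V}" "x \<longlonglongrightarrow> w0"
    unfolding closure_sequential by blast
  have "\<forall>n. \<exists>p. good (fst p) (fst (snd p)) (snd (snd p)) \<and> x n = w (fst (snd p) 0)"
    using x(1) by fastforce
  then obtain p where p: "\<And>n. good (fst (p n)) (fst (snd (p n))) (snd (snd (p n)))" "\<And>n. x n = w (fst (snd (p n)) 0)"
    by metis
  define \<Phi> U V where "\<Phi> n = fst (p n)" and "U n = fst (snd (p n))" and "V n = snd (snd (p n))" for n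
  have good: "good (\<Phi> n) (U n) (V n)" and xn: "x n = w (U n 0)" for n using p by (simp_all add: \<Phi>_def U_def V_def)
  note s = regularD(1)[OF good_regular[OF good]]
  have Cx: "Cauchy x" using x(2) LIMSEQ_imp_Cauchy by blast
  obtain C where C: "C > 0" "\<And>\<Phi> U V t. good \<Phi> U V \<Longrightarrow> 0 \<le> t \<Longrightarrow> norm (U t) \<le> C * norm (w (U 0)) \<and> t * norm (V t) \<le> C * norm (w (U 0))"
    using good_bounds by blast
  have diffs: "norm (U k t - U l t) \<le> C * norm (x k - x l)" "norm (t *\<^sub>R V k t - t *\<^sub>R V l t) \<le> C * norm (x k - x l)"
    if "t \<in> {0..}" for k l t
  proof -
    have wd: "w (U k 0 - U l 0) = x k - x l" by (simp add: xn linear_diff[OF linear_A])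
    have c: "norm (U k t - U l t) \<le> C * norm (w (U k 0 - U l 0)) \<and> t * norm (V k t - V l t) \<le> C * norm (w (U k 0 - U l 0))"
      using C(2)[OF good_lincomb[OF good[of k] good[of l], of 1 "-1"], of t] that by simp
    then show "norm (U k t - U l t) \<le> C * norm (x k - x l)" unfolding wd by blast
    have "norm (t *\<^sub>R V k t - t *\<^sub>R V l t) = t * norm (V k t - V l t)"
      using that unfolding scaleR_diff_right[symmetric] by simp
    then show "norm (t *\<^sub>R V k t - t *\<^sub>R V l t) \<le> C * norm (x k - x l)" using c unfolding wd by simp
  qed
  obtain Y where Y: "uniform_limit {0..} U Y sequentially"
    using uniformly_convergent_if_controlled[of x "{0..}" U C, OF Cx diffs(1) C(1)] by blast
  obtain Q where Q: "uniform_limit {0..} (\<lambda>n t. t *\<^sub>R V n t) Q sequentially"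
    using uniformly_convergent_if_controlled[of x "{0..}" "\<lambda>n t. t *\<^sub>R V n t" C, OF Cx diffs(2) C(1)] by blast
  define V' where "V' t = (1 / t) *\<^sub>R Q t" for t
  have Ypt: "(\<lambda>n. U n t) \<longlonglongrightarrow> Y t" if "0 \<le> t" for t
    by (rule tendsto_uniform_limitI[OF Y]) (use that in simp)
  have Vpt: "(\<lambda>n. V n t) \<longlonglongrightarrow> V' t" if "0 < t" for t
  proof -
    have "(\<lambda>n. t *\<^sub>R V n t) \<longlonglongrightarrow> Q t" by (rule tendsto_uniform_limitI[OF Q]) (use that in simp)
    then have "(\<lambda>n. (1 / t) *\<^sub>R (t *\<^sub>R V n t)) \<longlonglongrightarrow> (1 / t) *\<^sub>R Q t" by (intro tendsto_intros)
    then show ?thesis using that by (simp add: V'_def)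
  qed
  have contV: "continuous_on {0..} (V n)" for n
  proof -
    obtain \<Phi>' W where "regular \<Phi>' (V n) W" using good[of n] unfolding good_def by blast
    then show ?thesis by (rule solD(1)[OF regularD(1)])
  qed
  have Ycont: "continuous_on {0..} Y"
    by (rule uniform_limit_theorem[OF always_eventually Y]) (simp_all add: solD(1)[OF s])
  have Qcont: "continuous_on {0..} Q"
    by (rule uniform_limit_theorem[OF always_eventually Q]) (auto intro!: continuous_intros contV)
  have V'cont: "continuous_on {0<..} V'"
    unfolding V'_def by (intro continuous_intros continuous_on_subset[OF Qcont]) auto
  have Yder: "(Y has_vector_derivative V' t) (at t)" if t: "0 < t" for t
  proof -
    \<comment> \<open>Away from \<open>0\<close> the factor \<open>t\<close> is bounded below, and the derivatives converge uniformly.\<close>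
    define S where "S = {t/2<..}"
    have tS: "t \<in> S" using t by (simp add: S_def)
    have "\<exists>g. \<forall>s\<in>S. (\<lambda>n. U n s) \<longlonglongrightarrow> g s \<and> (g has_derivative (\<lambda>h. h *\<^sub>R V' s)) (at s within S)"
    proof (rule has_derivative_sequence[of S U "\<lambda>n s h. h *\<^sub>R V n s" _ t "Y t"])
      have "S \<subseteq> {0..}" using t by (auto simp: S_def)
      then show "(U n has_derivative (\<lambda>h. h *\<^sub>R V n s)) (at s within S)" if "s \<in> S" for n s
        using has_vector_derivative_within_subset[OF regularD(2)[OF good_regular[OF good]], of s S n] that
        by (auto simp: has_vector_derivative_def)
      show "\<forall>\<^sub>F n in sequentially. \<forall>s\<in>S. \<forall>h. norm (h *\<^sub>R V n s - h *\<^sub>R V' s) \<le> e * norm h" if e: "0 < e" for e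
      proof -
        have "\<forall>\<^sub>F n in sequentially. \<forall>s\<in>{0..}. dist (s *\<^sub>R V n s) (Q s) < e * (t / 2)"
          by (rule uniform_limitD[OF Q]) (use e t in simp)
        then show ?thesis
        proof (rule eventually_mono)
          fix n assume n: "\<forall>s\<in>{0..}. dist (s *\<^sub>R V n s) (Q s) < e * (t / 2)"
          show "\<forall>s\<in>S. \<forall>h. norm (h *\<^sub>R V n s - h *\<^sub>R V' s) \<le> e * norm h"
          proof (intro ballI allI)
            fix s h assume "s \<in> S"
            then have s: "t / 2 < s" "0 < s" using t by (auto simp: S_def)
            have "s * norm (V n s - V' s) = norm (s *\<^sub>R V n s - Q s)"
            proof -
              have "s *\<^sub>R V n s - Q s = s *\<^sub>R (V n s - V' s)" using s by (simp add: V'_def scaleR_diff_right)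
              then show ?thesis using s by simp
            qed
            also have "\<dots> < e * (t / 2)" using n s by (simp add: dist_norm)
            also have "\<dots> \<le> s * e" using s e by (simp add: mult.commute)
            finally have "norm (V n s - V' s) < e" using s by simp
            then show "norm (h *\<^sub>R V n s - h *\<^sub>R V' s) \<le> e * norm h"
              using mult_left_mono[of "norm (V n s - V' s)" e "\<bar>h\<bar>"]
              by (simp add: mult.commute flip: scaleR_diff_right)
          qed
        qed
      qed
    qed (use Ypt t tS in \<open>auto simp: S_def\<close>)
    then obtain g where g: "\<And>s. s \<in> S \<Longrightarrow> (\<lambda>n. U n s) \<longlonglongrightarrow> g s"
      "\<And>s. s \<in> S \<Longrightarrow> (g has_vector_derivative V' s) (at s within S)" by (auto simp: has_vector_derivative_def)
    have "g s = Y s" if "s \<in> S" for s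
      using LIMSEQ_unique[OF g(1)[OF that] Ypt] that t by (auto simp: S_def)
    then have "(Y has_vector_derivative V' t) (at t within S)"
      using has_vector_derivative_transform[OF tS _ g(2)[OF tS], of Y] by simp
    moreover have "at t within S = at t" by (rule at_within_open[OF tS]) (simp add: S_def)
    ultimately show ?thesis by simp
  qed
  have fl: "(Y t, V' t) \<in> flow" if "0 < t" for t
    by (rule closed_sequentially[OF closed_flow, of "\<lambda>n. (U n t, V n t)"])
      (use regularD(3)[OF good_regular[OF good]] Ypt Vpt that in \<open>auto intro!: tendsto_intros\<close>)
  have ran: "snd (Y t) \<in> closure (snd ` G)" if "0 < t" for t
    by (rule closed_sequentially[OF closed_closure, of "\<lambda>n. snd (U n t)"])
      (use solD(5)[OF s] Ypt that in \<open>auto intro!: tendsto_intros\<close>)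
  have lim: "(Y \<longlongrightarrow> 0) at_top"
  proof (rule tendstoI)
    fix e :: real assume e: "0 < e"
    have "\<forall>\<^sub>F n in sequentially. \<forall>s\<in>{0..}. dist (U n s) (Y s) < e / 2" by (rule uniform_limitD[OF Y]) (use e in simp)
    then obtain n where n: "\<forall>s\<in>{0..}. dist (U n s) (Y s) < e / 2" unfolding eventually_sequentially by blast
    have "eventually (\<lambda>t. dist (U n t) 0 < e / 2) at_top" using solD(8)[OF s] e by (intro tendstoD) auto
    then show "eventually (\<lambda>t. dist (Y t) 0 < e) at_top"
      using eventually_ge_at_top[of 0]
    proof eventually_elim
      case (elim t)
      have "dist (U n t) (Y t) < e / 2" using n elim(2) by simp
      then show ?case using elim(1) dist_triangle3[of "Y t" 0 "U n t"] by linarith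
    qed
  qed
  have "(\<lambda>n. w (U n 0)) \<longlonglongrightarrow> w (Y 0)" by (intro bounded_linear.tendsto[OF bounded_linear_w] Ypt) simp
  moreover have "x = (\<lambda>n. w (U n 0))" by (rule ext) (rule xn)
  ultimately have w0: "w (Y 0) = w0" using LIMSEQ_unique x(2) by blast
  show ?thesis
    by (intro exI[of _ Y] exI[of _ V'] exI[of _ "Y 0"] conjI allI impI Yder fl ran V'cont lim
        halfline_continuous_at_right[OF Ycont] w0)
qed

end

section \<open>The Hilbert space of square integrable functions\<close>

lemma L2I:
  assumes "f \<in> borel_measurable lebesgue" "integrable lebesgue (\<lambda>x. (norm (f x))\<^sup>2)"
  shows "f \<in> L2"
  using assms by (simp add: L2_def)

lemma L2D:
  assumes "f \<in> L2"
  shows "f \<in> borel_measurable lebesgue" "integrable lebesgue (\<lambda>x. (norm (f x))\<^sup>2)"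
  using assms by (auto simp: L2_def)

lemma L2_dominated:
  fixes f :: "'a::euclidean_space \<Rightarrow> 'b::euclidean_space" and g :: "'a \<Rightarrow> 'c::euclidean_space"
  assumes "f \<in> L2" "g \<in> borel_measurable lebesgue" "AE x in lebesgue. norm (g x) \<le> C * norm (f x)"
  shows "g \<in> L2"
proof (rule L2I[OF assms(2)])
  show "integrable lebesgue (\<lambda>x. (norm (g x))\<^sup>2)"
  proof (rule Bochner_Integration.integrable_bound)
    show "integrable lebesgue (\<lambda>x. C\<^sup>2 * (norm (f x))\<^sup>2)" using L2D(2)[OF assms(1)] by simp
    show "AE x in lebesgue. norm ((norm (g x))\<^sup>2) \<le> norm (C\<^sup>2 * (norm (f x))\<^sup>2)"
      using assms(3) by eventually_elim (auto simp: power_mult_distrib[symmetric] intro!: power_mono)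
  qed (use assms(2) in measurable)
qed

lemma L2_lincomb:
  assumes "f \<in> L2" "g \<in> L2" shows "(\<lambda>x. a *\<^sub>R f x + b *\<^sub>R g x) \<in> L2"
proof (rule L2I)
  have [measurable]: "f \<in> borel_measurable lebesgue" "g \<in> borel_measurable lebesgue" using assms L2D by auto
  show m: "(\<lambda>x. a *\<^sub>R f x + b *\<^sub>R g x) \<in> borel_measurable lebesgue" by measurable
  show "integrable lebesgue (\<lambda>x. (norm (a *\<^sub>R f x + b *\<^sub>R g x))\<^sup>2)"
  proof (rule Bochner_Integration.integrable_bound)
    show "integrable lebesgue (\<lambda>x. 2 * a\<^sup>2 * (norm (f x))\<^sup>2 + 2 * b\<^sup>2 * (norm (g x))\<^sup>2)"
      using L2D(2)[OF assms(1)] L2D(2)[OF assms(2)] by simp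
    have "(norm (a *\<^sub>R f x + b *\<^sub>R g x))\<^sup>2 \<le> 2 * a\<^sup>2 * (norm (f x))\<^sup>2 + 2 * b\<^sup>2 * (norm (g x))\<^sup>2" for x
    proof -
      have "(norm (a *\<^sub>R f x + b *\<^sub>R g x))\<^sup>2 \<le> (norm (a *\<^sub>R f x) + norm (b *\<^sub>R g x))\<^sup>2"
        by (intro power_mono norm_triangle_ineq) auto
      also have "\<dots> \<le> 2 * (norm (a *\<^sub>R f x))\<^sup>2 + 2 * (norm (b *\<^sub>R g x))\<^sup>2"
        using zero_le_power2[of "norm (a *\<^sub>R f x) - norm (b *\<^sub>R g x)"] by (simp add: power2_eq_square algebra_simps)
      finally show ?thesis by (simp add: power_mult_distrib)
    qed
    then show "AE x in lebesgue. norm ((norm (a *\<^sub>R f x + b *\<^sub>R g x))\<^sup>2)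
        \<le> norm (2 * a\<^sup>2 * (norm (f x))\<^sup>2 + 2 * b\<^sup>2 * (norm (g x))\<^sup>2)"
      by (auto intro!: AE_I2 simp: abs_of_nonneg)
  qed measurable
qed

lemma L2_zero: "(\<lambda>x. 0) \<in> L2"
  by (rule L2I) auto

lemma L2_add: "f \<in> L2 \<Longrightarrow> g \<in> L2 \<Longrightarrow> (\<lambda>x. f x + g x) \<in> L2"
  using L2_lincomb[of f g 1 1] by simp

lemma L2_diff: "f \<in> L2 \<Longrightarrow> g \<in> L2 \<Longrightarrow> (\<lambda>x. f x - g x) \<in> L2"
  using L2_lincomb[of f g 1 "-1"] by simp

lemma L2_scaleR: "f \<in> L2 \<Longrightarrow> (\<lambda>x. a *\<^sub>R f x) \<in> L2"
  using L2_lincomb[of f f a 0] by simp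

lemma L2_bounded_linear:
  fixes h :: "'b::euclidean_space \<Rightarrow> 'c::euclidean_space"
  assumes "bounded_linear h" "f \<in> L2" shows "(\<lambda>x. h (f x)) \<in> L2"
proof -
  obtain C where C: "\<And>x. norm (h x) \<le> C * norm x" using bounded_linear.bounded[OF assms(1)] by (auto simp: mult.commute)
  have [measurable]: "f \<in> borel_measurable lebesgue" using assms L2D by auto
  have [measurable]: "h \<in> borel_measurable borel"
    by (rule borel_measurable_continuous_onI[OF linear_continuous_on[OF assms(1)]])
  show ?thesis by (rule L2_dominated[OF assms(2)]) (auto intro!: AE_I2 C)
qed

lemma L2_mult_integrable:
  assumes "f \<in> L2" "g \<in> L2"
  shows "integrable lebesgue (\<lambda>x. norm (f x) * norm (g x))"
proof (rule Bochner_Integration.integrable_bound)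
  have [measurable]: "f \<in> borel_measurable lebesgue" "g \<in> borel_measurable lebesgue" using assms L2D by auto
  show "integrable lebesgue (\<lambda>x. (norm (f x))\<^sup>2 + (norm (g x))\<^sup>2)"
    using L2D(2)[OF assms(1)] L2D(2)[OF assms(2)] by simp
  show "(\<lambda>x. norm (f x) * norm (g x)) \<in> borel_measurable lebesgue" by measurable
  have "norm (f x) * norm (g x) \<le> (norm (f x))\<^sup>2 + (norm (g x))\<^sup>2" for x
    using zero_le_power2[of "norm (f x) - norm (g x)"] mult_nonneg_nonneg[OF norm_ge_zero norm_ge_zero, of "f x" "g x"]
    unfolding power2_diff by linarith
  then show "AE x in lebesgue. norm (norm (f x) * norm (g x)) \<le> norm ((norm (f x))\<^sup>2 + (norm (g x))\<^sup>2)"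
    by (auto intro!: AE_I2)
qed

lemma L2_product_integrable:
  fixes p :: "'a::euclidean_space \<Rightarrow> 'd::euclidean_space"
  assumes "f \<in> L2" "g \<in> L2" "p \<in> borel_measurable lebesgue" "\<And>x. norm (p x) \<le> C * (norm (f x) * norm (g x))"
  shows "integrable lebesgue p"
  by (rule Bochner_Integration.integrable_bound[OF integrable_mult_right[OF L2_mult_integrable[OF assms(1,2)], of C] assms(3)])
    (auto intro!: AE_I2 order_trans[OF assms(4)])

lemma L2_inner_integrable:
  assumes "f \<in> L2" "g \<in> L2" shows "integrable lebesgue (\<lambda>x. inner (f x) (g x))"
proof -
  have [measurable]: "f \<in> borel_measurable lebesgue" "g \<in> borel_measurable lebesgue" using assms L2D by auto
  show ?thesis
    by (rule L2_product_integrable[OF assms, of _ 1]) (auto simp: Cauchy_Schwarz_ineq2)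
qed

text \<open>The sum of \<open>2\<^sup>k \<parallel>f\<^sub>k\<^sub>+\<^sub>1 - f\<^sub>k\<parallel>\<^sup>2\<close> is integrable,
  hence finite almost everywhere, and bounds the increments by a geometric sequence.\<close>

lemma L2_Cauchy_subsequence:
  fixes f :: "nat \<Rightarrow> 'a::euclidean_space \<Rightarrow> 'b::euclidean_space"
  assumes L2: "\<And>n. f n \<in> L2"
    and fast: "\<And>k. (LINT x|lebesgue. (norm (f (Suc k) x - f k x))\<^sup>2) \<le> (1/8) ^ k"
  shows "AE x in lebesgue. convergent (\<lambda>k. f k x)"
proof -
  have [measurable]: "f n \<in> borel_measurable lebesgue" for n using L2 L2D by auto
  define h where "h k x = (norm (f (Suc k) x - f k x))\<^sup>2" for k x
  have hi: "integrable lebesgue (h k)" for k unfolding h_def by (rule L2D(2)[OF L2_diff[OF L2 L2]])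
  have [measurable]: "h k \<in> borel_measurable lebesgue" for k using hi by auto
  have h0: "0 \<le> h k x" for k x by (simp add: h_def)
  have "(\<integral>\<^sup>+x. ennreal (2 ^ k * h k x) \<partial>lebesgue) \<le> ennreal ((1/4) ^ k)" for k
  proof -
    have "(\<integral>\<^sup>+x. ennreal (2 ^ k * h k x) \<partial>lebesgue) = ennreal (LINT x|lebesgue. 2 ^ k * h k x)"
      by (rule nn_integral_eq_integral) (use hi h0 in auto)
    also have "\<dots> \<le> ennreal (2 ^ k * (1/8) ^ k)"
      using fast[of k] by (intro ennreal_leI) (simp add: h_def)
    also have "2 ^ k * (1/8) ^ k = (1/4 :: real) ^ k" by (simp flip: power_mult_distrib)
    finally show ?thesis .
  qed
  then have "(\<Sum>k. \<integral>\<^sup>+x. ennreal (2 ^ k * h k x) \<partial>lebesgue) \<le> (\<Sum>k. ennreal ((1/4) ^ k))"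
    by (intro suminf_le) auto
  also have "\<dots> = ennreal (\<Sum>k. (1/4) ^ k)" by (rule suminf_ennreal2) auto
  finally have "(\<integral>\<^sup>+x. (\<Sum>k. ennreal (2 ^ k * h k x)) \<partial>lebesgue) < \<infinity>"
    by (subst nn_integral_suminf) (auto simp: less_top[symmetric] top_unique)
  then have "AE x in lebesgue. (\<Sum>k. ennreal (2 ^ k * h k x)) \<noteq> \<infinity>"
    by (intro nn_integral_PInf_AE) auto
  then show ?thesis
  proof eventually_elim
    case (elim x)
    define S where "S = (\<Sum>k. ennreal (2 ^ k * h k x))"
    have "S < \<infinity>" using elim by (simp add: S_def less_top)
    then obtain s where s: "S = ennreal s" "0 \<le> s" by (cases S) auto
    have "h k x \<le> s * (1/2) ^ k" for k
    proof -
      have "ennreal (2 ^ k * h k x) \<le> S" unfolding S_def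
        using sum_le_suminf[of "\<lambda>k. ennreal (2 ^ k * h k x)" "{k}"] by simp
      then have "2 ^ k * h k x \<le> s" using s by (simp add: ennreal_le_iff)
      then show ?thesis by (simp add: field_simps power_divide)
    qed
    then have b: "norm (f (Suc k) x - f k x) \<le> sqrt s * (sqrt (1/2)) ^ k" for k
    proof -
      have "norm (f (Suc k) x - f k x) = sqrt (h k x)" by (simp add: h_def)
      also have "\<dots> \<le> sqrt (s * (1/2) ^ k)" using \<open>\<And>k. h k x \<le> s * (1/2) ^ k\<close> by simp
      finally show ?thesis by (simp add: real_sqrt_mult real_sqrt_power)
    qed
    have "summable (\<lambda>k. sqrt s * (sqrt (1/2)) ^ k)"
      by (intro summable_mult summable_geometric) (simp add: real_sqrt_divide)
    then have "summable (\<lambda>k. f (Suc k) x - f k x)"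
      by (rule summable_comparison_test'[of _ 0]) (use b in auto)
    then have "convergent (\<lambda>n. \<Sum>k<n. f (Suc k) x - f k x)" by (simp add: summable_iff_convergent)
    then have "convergent (\<lambda>n. f n x - f 0 x)" by (simp only: sum_lessThan_telescope[of "\<lambda>k. f k x"])
    then obtain l where "(\<lambda>n. f n x - f 0 x) \<longlonglongrightarrow> l" by (auto simp: convergent_def)
    from tendsto_add[OF this tendsto_const[of "f 0 x"]] show ?case by (auto simp: convergent_def)
  qed
qed

text \<open>Riesz-Fischer: the pointwise limit of a fast subsequence is the limit in \<open>L\<^sup>2\<close> by Fatou.\<close>

lemma L2_complete:
  fixes f :: "nat \<Rightarrow> 'a::euclidean_space \<Rightarrow> 'b::euclidean_space"
  assumes L2: "\<And>n. f n \<in> L2"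
    and cauchy: "\<And>e. 0 < e \<Longrightarrow> \<exists>N. \<forall>m\<ge>N. \<forall>n\<ge>N. (LINT x|lebesgue. (norm (f m x - f n x))\<^sup>2) \<le> e"
  shows "\<exists>g\<in>L2. (\<lambda>n. LINT x|lebesgue. (norm (f n x - g x))\<^sup>2) \<longlonglongrightarrow> 0"
proof -
  have [measurable]: "f n \<in> borel_measurable lebesgue" for n using L2 L2D by auto
  have "\<forall>k. \<exists>N. \<forall>m\<ge>N. \<forall>n\<ge>N. (LINT x|lebesgue. (norm (f m x - f n x))\<^sup>2) \<le> (1/8) ^ k"
    by (intro allI cauchy) simp
  then obtain N where N: "\<And>k m n. m \<ge> N k \<Longrightarrow> n \<ge> N k \<Longrightarrow> (LINT x|lebesgue. (norm (f m x - f n x))\<^sup>2) \<le> (1/8) ^ k"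
    by metis
  define r where "r k = (\<Sum>i\<le>k. N i) + k" for k
  have rN: "r k \<ge> N k" for k unfolding r_def using member_le_sum[of k "{..k}" N] by simp
  have rmono: "r k \<le> r (Suc k)" for k by (simp add: r_def)
  have rk: "r k \<ge> k" for k by (simp add: r_def)
  have "AE x in lebesgue. convergent (\<lambda>k. f (r k) x)"
    by (rule L2_Cauchy_subsequence[OF L2 N]) (use rN rmono in \<open>blast intro: order_trans\<close>)+
  define g where "g x = lim (\<lambda>k. f (r k) x)" for x
  have lim: "AE x in lebesgue. (\<lambda>k. f (r k) x) \<longlonglongrightarrow> g x"
    using \<open>AE x in lebesgue. convergent (\<lambda>k. f (r k) x)\<close>
    by eventually_elim (simp add: g_def convergent_LIMSEQ_iff)
  have [measurable]: "g \<in> borel_measurable lebesgue"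
    unfolding g_def[abs_def] by (rule borel_measurable_lim_metric) measurable
  have nn: "(\<integral>\<^sup>+x. ennreal ((norm (f n x - g x))\<^sup>2) \<partial>lebesgue) \<le> ennreal e"
    if e: "0 < e" and M: "\<And>m. m \<ge> M \<Longrightarrow> (LINT x|lebesgue. (norm (f m x - f n x))\<^sup>2) \<le> e" for e n M
  proof -
    have "(\<integral>\<^sup>+x. ennreal ((norm (f n x - g x))\<^sup>2) \<partial>lebesgue)
        = (\<integral>\<^sup>+x. liminf (\<lambda>k. ennreal ((norm (f n x - f (r k) x))\<^sup>2)) \<partial>lebesgue)"
    proof (rule nn_integral_cong_AE, use lim in eventually_elim)
      case (elim x)
      have "(\<lambda>k. ennreal ((norm (f n x - f (r k) x))\<^sup>2)) \<longlonglongrightarrow> ennreal ((norm (f n x - g x))\<^sup>2)"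
        by (intro tendsto_ennrealI tendsto_intros elim)
      from lim_imp_Liminf[OF _ this] show ?case by simp
    qed
    also have "\<dots> \<le> liminf (\<lambda>k. \<integral>\<^sup>+x. ennreal ((norm (f n x - f (r k) x))\<^sup>2) \<partial>lebesgue)"
      by (rule nn_integral_liminf) measurable
    also have "\<dots> \<le> ennreal e"
    proof (rule Liminf_le)
      show "\<forall>\<^sub>F k in sequentially. (\<integral>\<^sup>+x. ennreal ((norm (f n x - f (r k) x))\<^sup>2) \<partial>lebesgue) \<le> ennreal e"
        using eventually_ge_at_top[of M]
      proof eventually_elim
        case (elim k)
        have "(\<integral>\<^sup>+x. ennreal ((norm (f n x - f (r k) x))\<^sup>2) \<partial>lebesgue)
            = ennreal (LINT x|lebesgue. (norm (f n x - f (r k) x))\<^sup>2)"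
          by (rule nn_integral_eq_integral) (use L2D(2)[OF L2_diff[OF L2 L2]] in auto)
        also have "\<dots> \<le> ennreal e"
          using M[of "r k"] elim rk[of k] by (intro ennreal_leI) (simp add: norm_minus_commute)
        finally show ?case .
      qed
    qed simp
    finally show ?thesis .
  qed
  have gL: "(\<lambda>x. f n x - g x) \<in> L2" if e: "0 < e" and M: "\<And>m. m \<ge> M \<Longrightarrow> (LINT x|lebesgue. (norm (f m x - f n x))\<^sup>2) \<le> e" for e n M
  proof (rule L2I)
    have "(\<integral>\<^sup>+x. ennreal (norm ((norm (f n x - g x))\<^sup>2)) \<partial>lebesgue) < \<infinity>"
      using le_less_trans[OF nn[of e M n, OF e M] ennreal_less_top] by simp
    then show "integrable lebesgue (\<lambda>x. (norm (f n x - g x))\<^sup>2)" by (intro integrableI_bounded) measurable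
  qed measurable
  have small: "(LINT x|lebesgue. (norm (f n x - g x))\<^sup>2) \<le> e"
    if e: "0 < e" and M: "\<And>m. m \<ge> M \<Longrightarrow> (LINT x|lebesgue. (norm (f m x - f n x))\<^sup>2) \<le> e" for e n M
  proof -
    have "ennreal (LINT x|lebesgue. (norm (f n x - g x))\<^sup>2) = (\<integral>\<^sup>+x. ennreal ((norm (f n x - g x))\<^sup>2) \<partial>lebesgue)"
      by (rule nn_integral_eq_integral[symmetric]) (use L2D(2)[OF gL[of e M n, OF e M]] in auto)
    then show ?thesis using nn[of e M n, OF e M] e
      by (metis ennreal_le_iff less_imp_le)
  qed
  have "g \<in> L2"
  proof -
    obtain M where "\<forall>m\<ge>M. \<forall>n\<ge>M. (LINT x|lebesgue. (norm (f m x - f n x))\<^sup>2) \<le> 1" using cauchy[of 1] by auto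
    then have "(\<lambda>x. f M x - g x) \<in> L2" by (intro gL[of 1 M]) auto
    from L2_diff[OF L2[of M] this] show ?thesis by simp
  qed
  moreover have "(\<lambda>n. LINT x|lebesgue. (norm (f n x - g x))\<^sup>2) \<longlonglongrightarrow> 0"
  proof (rule LIMSEQ_I)
    fix e :: real assume "0 < e"
    then obtain M where "\<forall>m\<ge>M. \<forall>n\<ge>M. (LINT x|lebesgue. (norm (f m x - f n x))\<^sup>2) \<le> e / 2" using cauchy[of "e/2"] by auto
    then have "(LINT x|lebesgue. (norm (f n x - g x))\<^sup>2) \<le> e / 2" if "n \<ge> M" for n
      using \<open>0 < e\<close> that by (intro small[of "e/2" M]) auto
    then have "norm ((LINT x|lebesgue. (norm (f n x - g x))\<^sup>2) - 0) < e" if "n \<ge> M" for n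
    proof -
      have "0 \<le> (LINT x|lebesgue. (norm (f n x - g x))\<^sup>2)" by (rule integral_nonneg_AE) simp
      moreover have "(LINT x|lebesgue. (norm (f n x - g x))\<^sup>2) \<le> e / 2"
        using \<open>\<And>n. M \<le> n \<Longrightarrow> (LINT x|lebesgue. (norm (f n x - g x))\<^sup>2) \<le> e / 2\<close>[OF that] .
      ultimately show ?thesis using \<open>0 < e\<close> by simp
    qed
    then show "\<exists>no. \<forall>n\<ge>no. norm ((LINT x|lebesgue. (norm (f n x - g x))\<^sup>2) - 0) < e" by blast
  qed
  ultimately show ?thesis by blast
qed

definition L2_eq :: "('a::euclidean_space \<Rightarrow> 'b::euclidean_space) \<Rightarrow> ('a \<Rightarrow> 'b) \<Rightarrow> bool" where
  "L2_eq f g \<longleftrightarrow> f \<in> L2 \<and> g \<in> L2 \<and> (AE x in lebesgue. f x = g x)"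

lemma part_equivp_L2_eq: "part_equivp L2_eq"
proof (rule part_equivpI)
  show "\<exists>x. L2_eq x x" by (rule exI[of _ "\<lambda>_. 0"]) (simp add: L2_eq_def L2_zero)
  show "symp L2_eq" by (auto intro!: sympI simp: L2_eq_def)
  show "transp L2_eq"
    by (rule transpI) (auto simp: L2_eq_def elim: eventually_elim2)
qed

quotient_type (overloaded) ('a, 'b) l2 = "'a::euclidean_space \<Rightarrow> 'b::euclidean_space" / partial: L2_eq
  morphisms rep cls
  by (rule part_equivp_L2_eq)

lemma rep_L2 [simp]: "rep u \<in> L2"
  using Quotient_rep_reflp[OF Quotient_l2, of u] by (simp add: L2_eq_def)

lemma cls_rep [simp]: "cls (rep u) = u"
  by (rule Quotient_abs_rep[OF Quotient_l2])

lemma cls_eqI: "f \<in> L2 \<Longrightarrow> g \<in> L2 \<Longrightarrow> AE x in lebesgue. f x = g x \<Longrightarrow> cls f = cls g"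
  by (rule Quotient_rel_abs[OF Quotient_l2]) (simp add: L2_eq_def)

lemma rep_cls: "f \<in> L2 \<Longrightarrow> AE x in lebesgue. rep (cls f) x = f x"
  using Quotient_rep_abs[OF Quotient_l2, of f] by (simp add: L2_eq_def)

lemma rep_measurable [measurable]: "rep u \<in> borel_measurable lebesgue"
  by (rule L2D(1)[OF rep_L2])

lemma l2_eqI: "AE x in lebesgue. rep u x = rep v x \<Longrightarrow> u = v"
  using cls_eqI[OF rep_L2 rep_L2, of u v] by simp

instantiation l2 :: (euclidean_space, euclidean_space) real_inner
begin

definition zero_l2 :: "('a, 'b) l2" where "0 = cls (\<lambda>x. 0)"
definition plus_l2 :: "('a, 'b) l2 \<Rightarrow> ('a, 'b) l2 \<Rightarrow> ('a, 'b) l2" where "u + v = cls (\<lambda>x. rep u x + rep v x)"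
definition minus_l2 :: "('a, 'b) l2 \<Rightarrow> ('a, 'b) l2 \<Rightarrow> ('a, 'b) l2" where "u - v = cls (\<lambda>x. rep u x - rep v x)"
definition uminus_l2 :: "('a, 'b) l2 \<Rightarrow> ('a, 'b) l2" where "- u = cls (\<lambda>x. - rep u x)"
definition scaleR_l2 :: "real \<Rightarrow> ('a, 'b) l2 \<Rightarrow> ('a, 'b) l2" where "a *\<^sub>R u = cls (\<lambda>x. a *\<^sub>R rep u x)"
definition inner_l2 :: "('a, 'b) l2 \<Rightarrow> ('a, 'b) l2 \<Rightarrow> real" where "inner u v = (LINT x|lebesgue. inner (rep u x) (rep v x))"
definition norm_l2 :: "('a, 'b) l2 \<Rightarrow> real" where "norm (u :: ('a, 'b) l2) = sqrt (inner u u)"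
definition sgn_l2 :: "('a, 'b) l2 \<Rightarrow> ('a, 'b) l2" where "sgn (u :: ('a, 'b) l2) = inverse (norm u) *\<^sub>R u"
definition dist_l2 :: "('a, 'b) l2 \<Rightarrow> ('a, 'b) l2 \<Rightarrow> real" where "dist (u :: ('a, 'b) l2) v = norm (u - v)"
definition uniformity_l2 :: "(('a, 'b) l2 \<times> ('a, 'b) l2) filter" where
  "uniformity_l2 = (INF e\<in>{0<..}. principal {(u :: ('a, 'b) l2, v). dist u v < e})"
definition open_l2 :: "('a, 'b) l2 set \<Rightarrow> bool" where
  "open (S :: ('a, 'b) l2 set) \<longleftrightarrow> (\<forall>u\<in>S. \<forall>\<^sub>F (u', v) in uniformity. u' = u \<longrightarrow> v \<in> S)"

lemma rep_zero: "AE x in lebesgue. rep (0 :: ('a, 'b) l2) x = 0"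
  unfolding zero_l2_def by (rule rep_cls[OF L2_zero])
lemma rep_add: "AE x in lebesgue. rep (u + v :: ('a, 'b) l2) x = rep u x + rep v x"
  unfolding plus_l2_def by (rule rep_cls) (intro L2_add rep_L2)
lemma rep_diff: "AE x in lebesgue. rep (u - v :: ('a, 'b) l2) x = rep u x - rep v x"
  unfolding minus_l2_def by (rule rep_cls) (intro L2_diff rep_L2)
lemma rep_minus: "AE x in lebesgue. rep (- u :: ('a, 'b) l2) x = - rep u x"
  unfolding uminus_l2_def by (rule rep_cls) (use L2_scaleR[OF rep_L2, of "-1" u] in simp)
lemma rep_scaleR: "AE x in lebesgue. rep (a *\<^sub>R u :: ('a, 'b) l2) x = a *\<^sub>R rep u x"
  unfolding scaleR_l2_def by (rule rep_cls) (intro L2_scaleR rep_L2)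

instance
proof
  fix u v z :: "('a, 'b) l2" and a b :: real
  show "u + v + z = u + (v + z)"
    by (rule l2_eqI) (use rep_add[of u v] rep_add[of "u + v" z] rep_add[of v z] rep_add[of u "v + z"] in eventually_elim, simp)
  show "u + v = v + u"
    by (rule l2_eqI) (use rep_add[of u v] rep_add[of v u] in eventually_elim, simp)
  show "0 + u = u"
    by (rule l2_eqI) (use rep_add[of 0 u] rep_zero in eventually_elim, simp)
  show "- u + u = 0"
    by (rule l2_eqI) (use rep_add[of "- u" u] rep_zero rep_minus[of u] in eventually_elim, simp)
  show "u - v = u + - v"
    by (rule l2_eqI) (use rep_add[of u "- v"] rep_diff[of u v] rep_minus[of v] in eventually_elim, simp)
  show "a *\<^sub>R (u + v) = a *\<^sub>R u + a *\<^sub>R v"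
    by (rule l2_eqI) (use rep_scaleR[of a "u + v"] rep_add[of u v] rep_add[of "a *\<^sub>R u" "a *\<^sub>R v"]
        rep_scaleR[of a u] rep_scaleR[of a v] in eventually_elim, simp add: scaleR_add_right)
  show "(a + b) *\<^sub>R u = a *\<^sub>R u + b *\<^sub>R u"
    by (rule l2_eqI) (use rep_scaleR[of "a + b" u] rep_add[of "a *\<^sub>R u" "b *\<^sub>R u"]
        rep_scaleR[of a u] rep_scaleR[of b u] in eventually_elim, simp add: scaleR_add_left)
  show "a *\<^sub>R b *\<^sub>R u = (a * b) *\<^sub>R u"
    by (rule l2_eqI) (use rep_scaleR[of "a * b" u] rep_scaleR[of a "b *\<^sub>R u"] rep_scaleR[of b u] in eventually_elim, simp)
  show "1 *\<^sub>R u = u"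
    by (rule l2_eqI) (use rep_scaleR[of 1 u] in eventually_elim, simp)
  show "dist u v = norm (u - v)" by (simp add: dist_l2_def)
  show "sgn u = inverse (norm u) *\<^sub>R u" by (simp add: sgn_l2_def)
  show "uniformity = (INF e\<in>{0<..}. principal {(u, v :: ('a, 'b) l2). dist u v < e})" by (simp add: uniformity_l2_def)
  show "open S \<longleftrightarrow> (\<forall>u\<in>S. \<forall>\<^sub>F (u', v) in uniformity. u' = u \<longrightarrow> v \<in> S)" for S :: "('a, 'b) l2 set"
    by (simp add: open_l2_def)
  show "inner u v = inner v u" by (simp add: inner_l2_def inner_commute)
  show "inner (u + v) z = inner u z + inner v z"
  proof -
    have "inner (u + v) z = (LINT x|lebesgue. inner (rep u x) (rep z x) + inner (rep v x) (rep z x))"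
      unfolding inner_l2_def
      by (rule integral_cong_AE) (measurable, use rep_add[of u v] in eventually_elim, simp add: inner_add_left)
    then show ?thesis by (simp add: inner_l2_def L2_inner_integrable)
  qed
  show "inner (a *\<^sub>R u) v = a * inner u v"
  proof -
    have "inner (a *\<^sub>R u) v = (LINT x|lebesgue. a * inner (rep u x) (rep v x))"
      unfolding inner_l2_def
      by (rule integral_cong_AE) (measurable, use rep_scaleR[of a u] in eventually_elim, simp)
    then show ?thesis by (simp add: inner_l2_def)
  qed
  show "0 \<le> inner u u" unfolding inner_l2_def by (rule integral_nonneg_AE) simp
  show "inner u u = 0 \<longleftrightarrow> u = 0"
  proof
    assume "inner u u = 0"
    then have "AE x in lebesgue. inner (rep u x) (rep u x) = 0"
      unfolding inner_l2_def
      by (subst (asm) integral_nonneg_eq_0_iff_AE[OF L2_inner_integrable[OF rep_L2 rep_L2]]) auto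
    then have "AE x in lebesgue. rep u x = rep 0 x" using rep_zero by eventually_elim simp
    then show "u = 0" by (rule l2_eqI)
  next
    assume "u = 0"
    then have "inner u u = (LINT x|(lebesgue::'a measure). 0::real)"
      unfolding inner_l2_def
      by (intro integral_cong_AE) (measurable, use rep_zero in \<open>eventually_elim, simp\<close>)
    then show "inner u u = 0" by simp
  qed
  show "norm u = sqrt (inner u u)" by (simp add: norm_l2_def)
qed

end

lemma inner_cls:
  assumes "f \<in> L2" "g \<in> L2" shows "inner (cls f) (cls g) = (LINT x|lebesgue. inner (f x) (g x))"
proof -
  have [measurable]: "f \<in> borel_measurable lebesgue" "g \<in> borel_measurable lebesgue" using assms L2D by auto
  show ?thesis unfolding inner_l2_def
    by (rule integral_cong_AE) (measurable, use rep_cls[OF assms(1)] rep_cls[OF assms(2)] in eventually_elim, simp)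
qed

lemma norm_cls: "f \<in> L2 \<Longrightarrow> norm (cls f) = L2_norm f"
  unfolding norm_eq_sqrt_inner L2_norm_def by (simp add: inner_cls power2_norm_eq_inner)

lemma norm_l2_square: "(norm u)\<^sup>2 = (LINT x|lebesgue. (norm (rep u x))\<^sup>2)" for u :: "('a::euclidean_space, 'b::euclidean_space) l2"
  unfolding power2_norm_eq_inner by (simp add: inner_l2_def)

lemma cls_lincomb:
  assumes "f \<in> L2" "g \<in> L2"
  shows "cls (\<lambda>x. a *\<^sub>R f x + b *\<^sub>R g x) = a *\<^sub>R cls f + b *\<^sub>R cls g"
proof (rule l2_eqI)
  show "AE x in lebesgue. rep (cls (\<lambda>x. a *\<^sub>R f x + b *\<^sub>R g x)) x = rep (a *\<^sub>R cls f + b *\<^sub>R cls g) x"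
    using rep_cls[OF assms(1)] rep_cls[OF assms(2)] rep_cls[OF L2_lincomb[OF assms], of a b]
      rep_add[of "a *\<^sub>R cls f" "b *\<^sub>R cls g"] rep_scaleR[of a "cls f"] rep_scaleR[of b "cls g"]
    by eventually_elim simp
qed

lemma cls_add: "f \<in> L2 \<Longrightarrow> g \<in> L2 \<Longrightarrow> cls (\<lambda>x. f x + g x) = cls f + cls g"
  using cls_lincomb[of f g 1 1] by simp

lemma cls_diff: "f \<in> L2 \<Longrightarrow> g \<in> L2 \<Longrightarrow> cls (\<lambda>x. f x - g x) = cls f - cls g"
  using cls_lincomb[of f g 1 "-1"] by simp

lemma cls_scaleR: "f \<in> L2 \<Longrightarrow> cls (\<lambda>x. a *\<^sub>R f x) = a *\<^sub>R cls f"
  using cls_lincomb[of f f a 0] by simp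

instance l2 :: (euclidean_space, euclidean_space) banach
proof
  fix X :: "nat \<Rightarrow> ('a, 'b) l2" assume "Cauchy X"
  have nd: "(LINT x|lebesgue. (norm (rep u x - f x))\<^sup>2) = (norm (u - cls f))\<^sup>2" if "f \<in> L2" for u :: "('a, 'b) l2" and f
  proof -
    have [measurable]: "f \<in> borel_measurable lebesgue" using that L2D by auto
    show ?thesis unfolding norm_l2_square
      by (rule integral_cong_AE) (measurable, use rep_diff[of u "cls f"] rep_cls[OF that] in eventually_elim, simp)
  qed
  have "\<exists>g\<in>L2. (\<lambda>n. LINT x|lebesgue. (norm (rep (X n) x - g x))\<^sup>2) \<longlonglongrightarrow> 0"
  proof (rule L2_complete[OF rep_L2])
    fix e :: real assume "0 < e"
    then obtain N where N: "\<forall>m\<ge>N. \<forall>n\<ge>N. norm (X m - X n) < sqrt e"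
      using \<open>Cauchy X\<close> unfolding Cauchy_def dist_norm by (meson real_sqrt_gt_zero)
    have "(LINT x|lebesgue. (norm (rep (X m) x - rep (X n) x))\<^sup>2) \<le> e" if "m \<ge> N" "n \<ge> N" for m n
    proof -
      have "(norm (X m - X n))\<^sup>2 \<le> (sqrt e)\<^sup>2" using N that by (intro power_mono) (auto intro: less_imp_le)
      then show ?thesis using nd[OF rep_L2, of "X m" "X n"] \<open>0 < e\<close> by simp
    qed
    then show "\<exists>N. \<forall>m\<ge>N. \<forall>n\<ge>N. (LINT x|lebesgue. (norm (rep (X m) x - rep (X n) x))\<^sup>2) \<le> e" by blast
  qed
  then obtain g where g: "g \<in> L2" "(\<lambda>n. (norm (X n - cls g))\<^sup>2) \<longlonglongrightarrow> 0" using nd by auto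
  from tendsto_real_sqrt[OF g(2)] have "(\<lambda>n. norm (X n - cls g)) \<longlonglongrightarrow> 0" by simp
  then have "X \<longlonglongrightarrow> cls g" by (simp add: LIM_zero_iff tendsto_norm_zero_iff)
  then show "convergent X" by (auto simp: convergent_def)
qed

section \<open>Smooth functions with compact support\<close>

lemma frechet_derivative_eq: "(f has_derivative f') (at x) \<Longrightarrow> frechet_derivative f (at x) = f'"
  using frechet_derivative_at by metis

lemma differentiable_derivative:
  "f differentiable_on UNIV \<Longrightarrow> (f has_derivative frechet_derivative f (at x)) (at x)"
  by (simp add: differentiable_on_def frechet_derivative_works)

lemma Ck_Suc_derivative: "Ck (Suc k) f \<Longrightarrow> (f has_derivative frechet_derivative f (at x)) (at x)"
  by (simp add: differentiable_derivative)

lemma Ck_SucI: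
  assumes "\<And>x. (f has_derivative f' x) (at x)" "\<And>b. b \<in> Basis \<Longrightarrow> Ck k (\<lambda>x. f' x b)"
  shows "Ck (Suc k) f"
proof -
  have "frechet_derivative f (at x) = f' x" for x by (rule frechet_derivative_eq[OF assms(1)])
  then show ?thesis using assms by (auto simp: differentiable_on_def differentiable_def)
qed

lemma Ck_continuous: "Ck k f \<Longrightarrow> continuous_on UNIV f"
  by (cases k) (auto intro: differentiable_imp_continuous_on)

lemma Ck_pred: "Ck (Suc k) f \<Longrightarrow> Ck k f"
proof (induction k arbitrary: f)
  case 0
  then show ?case using Ck_continuous by (metis Ck.simps(1))
next
  case (Suc k)
  then show ?case by (metis Ck.simps(2))
qed

lemma Ck_const: "Ck k (\<lambda>_. c)"
proof (induction k arbitrary: c)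
  case (Suc k)
  show ?case by (rule Ck_SucI[of _ "\<lambda>x h. 0"]) (auto intro: Suc)
qed auto

lemma Ck_add: "Ck k f \<Longrightarrow> Ck k g \<Longrightarrow> Ck k (\<lambda>x. f x + g x)"
proof (induction k arbitrary: f g)
  case (Suc k)
  note d = Ck_Suc_derivative[OF Suc.prems(1)] Ck_Suc_derivative[OF Suc.prems(2)]
  show ?case
    by (rule Ck_SucI[OF has_derivative_add[OF d]]) (use Suc in auto)
qed (auto intro!: continuous_intros)

lemma Ck_bounded_linear:
  assumes "bounded_linear L" "Ck k f" shows "Ck k (\<lambda>x. L (f x))"
  using assms(2)
proof (induction k arbitrary: f)
  case 0
  then show ?case by (auto intro: bounded_linear.continuous_on[OF assms(1)])
next
  case (Suc k)
  show ?case
    by (rule Ck_SucI[OF bounded_linear.has_derivative[OF assms(1) Ck_Suc_derivative[OF Suc.prems]]])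
      (use Suc in auto)
qed

lemma Ck_sum: "finite I \<Longrightarrow> (\<And>i. i \<in> I \<Longrightarrow> Ck k (f i)) \<Longrightarrow> Ck k (\<lambda>x. \<Sum>i\<in>I. f i x)"
  by (induction I rule: finite_induct) (auto intro: Ck_const Ck_add)

lemma Ck_bilinear:
  assumes "bounded_bilinear prd" "Ck k f" "Ck k g" shows "Ck k (\<lambda>x. prd (f x) (g x))"
  using assms(2,3)
proof (induction k arbitrary: f g)
  case 0
  then show ?case by (auto intro: bounded_bilinear.continuous_on[OF assms(1)])
next
  case (Suc k)
  note d = Ck_Suc_derivative[OF Suc.prems(1)] Ck_Suc_derivative[OF Suc.prems(2)]
  show ?case
    by (rule Ck_SucI[OF bounded_bilinear.FDERIV[OF assms(1) d]])
      (intro Ck_add Suc.IH Ck_pred[OF Suc.prems(1)] Ck_pred[OF Suc.prems(2)]; use Suc.prems in simp)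
qed

lemma Ck_prod:
  fixes f :: "'i \<Rightarrow> 'a::euclidean_space \<Rightarrow> real"
  shows "finite I \<Longrightarrow> (\<And>i. i \<in> I \<Longrightarrow> Ck k (f i)) \<Longrightarrow> Ck k (\<lambda>x. \<Prod>i\<in>I. f i x)"
  by (induction I rule: finite_induct) (auto intro: Ck_const Ck_bilinear[OF bounded_bilinear_mult])

lemma Ck_affine:
  fixes f :: "'c::euclidean_space \<Rightarrow> 'b::real_normed_vector" and L :: "'a::euclidean_space \<Rightarrow> 'c"
  assumes "linear L" "Ck k f" shows "Ck k (\<lambda>x. f (L x + c))"
proof -
  have bl: "bounded_linear L" using assms(1) by (simp add: linear_conv_bounded_linear)
  have cL: "continuous_on UNIV (\<lambda>x. L x + c)" by (intro continuous_intros linear_continuous_on bl)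
  show ?thesis using assms(2)
proof (induction k arbitrary: f)
  case 0
  then show ?case using continuous_on_compose2[OF _ cL, of UNIV f] by simp
next
  case (Suc k)
  have "((\<lambda>x. L x + c) has_derivative L) (at x)" for x
    using has_derivative_add[OF bounded_linear_imp_has_derivative[OF bl] has_derivative_const[of c]] by simp
  from has_derivative_compose[OF this Ck_Suc_derivative[OF Suc.prems]]
  have d: "((\<lambda>x. f (L x + c)) has_derivative (\<lambda>h. frechet_derivative f (at (L x + c)) (L h))) (at x)" for x .
  show ?case
  proof (rule Ck_SucI[OF d])
    fix b :: 'a assume "b \<in> Basis"
    have "frechet_derivative f (at (L x + c)) (L b)
        = (\<Sum>b'\<in>Basis. (L b \<bullet> b') *\<^sub>R frechet_derivative f (at (L x + c)) b')" for x
    proof -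
      have lin: "linear (frechet_derivative f (at (L x + c)))"
        using has_derivative_linear[OF Ck_Suc_derivative[OF Suc.prems]] .
      show ?thesis by (subst euclidean_representation[of "L b", symmetric]) (simp add: linear_sum[OF lin] linear_scale[OF lin])
    qed
    moreover have "Ck k (\<lambda>x. \<Sum>b'\<in>Basis. (L b \<bullet> b') *\<^sub>R frechet_derivative f (at (L x + c)) b')"
      by (intro Ck_sum Ck_bounded_linear[OF bounded_linear_scaleR_right]) (use Suc in auto)
    ultimately show "Ck k (\<lambda>x. frechet_derivative f (at (L x + c)) (L b))" by simp
  qed
qed
qed

text \<open>The functions \<open>x\<^sup>-\<^sup>m exp (- 1 / x)\<close>, extended by zero; the family is closed under
  differentiation, which proves smoothness of \<open>exp (- 1 / x)\<close>.\<close>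

definition flat :: "nat \<Rightarrow> real \<Rightarrow> real" where
  "flat m x = (if x \<le> 0 then 0 else inverse x ^ m * exp (- inverse x))"

lemma flat_tendsto_zero: "(flat m \<longlongrightarrow> 0) (at 0)"
proof (rule filterlim_split_at)
  show "(flat m \<longlongrightarrow> 0) (at_left 0)"
    by (rule tendsto_eventually) (auto simp: flat_def eventually_at_filter)
  have "((\<lambda>x. inverse x ^ m / exp (inverse x)) \<longlongrightarrow> 0) (at_right (0::real))"
    by (rule filterlim_compose[OF tendsto_power_div_exp_0 filterlim_inverse_at_top_right])
  then show "(flat m \<longlongrightarrow> 0) (at_right 0)"
    by (rule Lim_transform_eventually) (auto simp: flat_def eventually_at_filter exp_minus divide_inverse)
qed

lemma flat_derivative: "(flat m has_real_derivative flat (m + 2) x - real m * flat (m + 1) x) (at x)"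
proof -
  consider "x < 0" | "x = 0" | "x > 0" by linarith
  then show ?thesis
  proof cases
    case 1
    have "(flat m has_real_derivative 0) (at x)"
      by (rule has_field_derivative_transform_within[of "\<lambda>_. 0" _ _ _ "- x"]) (use 1 in \<open>auto simp: dist_real_def flat_def\<close>)
    then show ?thesis using 1 by (simp add: flat_def)
  next
    case 2
    have "((\<lambda>h. (flat m (0 + h) - flat m 0) / h) \<longlongrightarrow> 0) (at 0)"
      by (rule Lim_transform_eventually[OF flat_tendsto_zero[of "m + 1"]])
        (auto simp: flat_def eventually_at_filter field_simps)
    then show ?thesis using 2 by (simp add: DERIV_def flat_def)
  next
    case 3
    have "((\<lambda>x. inverse x ^ m * exp (- inverse x)) has_real_derivative
        (real m * (inverse x ^ (m - 1) * (- (inverse x * inverse x)))) * exp (- inverse x)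
        + inverse x ^ m * (exp (- inverse x) * (inverse x * inverse x))) (at x)"
      using 3 by (auto intro!: derivative_eq_intros simp: algebra_simps)
    moreover have "(real m * (inverse x ^ (m - 1) * (- (inverse x * inverse x)))) * exp (- inverse x)
        + inverse x ^ m * (exp (- inverse x) * (inverse x * inverse x)) = flat (m + 2) x - real m * flat (m + 1) x"
      using 3 by (cases m) (auto simp: flat_def algebra_simps)
    ultimately have "((\<lambda>x. inverse x ^ m * exp (- inverse x)) has_real_derivative flat (m + 2) x - real m * flat (m + 1) x) (at x)"
      by simp
    then show ?thesis
      by (rule has_field_derivative_transform_within[of _ _ _ _ x]) (use 3 in \<open>auto simp: dist_real_def flat_def\<close>)
  qed
qed

lemma Ck_flat: "Ck k (flat m)"
proof (induction k arbitrary: m)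
  case 0
  show ?case using DERIV_continuous[OF flat_derivative] by (auto simp: continuous_on_eq_continuous_at)
next
  case (Suc k)
  show ?case
  proof (rule Ck_SucI[OF flat_derivative[unfolded has_field_derivative_def]])
    fix b :: real
    have "Ck k (\<lambda>x. flat (m + 2) x + (- real m) *\<^sub>R flat (m + 1) x)"
      by (intro Ck_add Ck_bounded_linear[OF bounded_linear_scaleR_right] Suc)
    from Ck_bounded_linear[OF bounded_linear_mult_left[of b] this]
    show "Ck k (\<lambda>x. (flat (m + 2) x - real m * flat (m + 1) x) * b)" by simp
  qed
qed

text \<open>Smooth functions that vanish outside \<open>box a b\<close> and tend to its indicator function as \<open>k\<close>
  grows.\<close>

definition bump :: "real \<Rightarrow> 'a::euclidean_space \<Rightarrow> 'a \<Rightarrow> 'a \<Rightarrow> real" where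
  "bump k a b x = (\<Prod>i\<in>Basis. flat 0 (k * ((x - a) \<bullet> i)) * flat 0 (k * ((b - x) \<bullet> i)))"

lemma Ck_bump: "Ck n (bump k a b)"
proof -
  have 1: "Ck n (\<lambda>x. flat 0 (k * ((x - a) \<bullet> i)))" for i
  proof -
    have "Ck n (\<lambda>x. flat 0 (k * (x \<bullet> i) + - (k * (a \<bullet> i))))"
      by (rule Ck_affine[OF _ Ck_flat]) (auto intro!: linearI simp: inner_add_left algebra_simps)
    then show ?thesis by (simp add: inner_diff_left algebra_simps)
  qed
  have 2: "Ck n (\<lambda>x. flat 0 (k * ((b - x) \<bullet> i)))" for i
  proof -
    have "Ck n (\<lambda>x. flat 0 (- (k * (x \<bullet> i)) + k * (b \<bullet> i)))"
      by (rule Ck_affine[OF _ Ck_flat]) (auto intro!: linearI simp: inner_add_left algebra_simps)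
    then show ?thesis by (simp add: inner_diff_left algebra_simps)
  qed
  show ?thesis unfolding bump_def[abs_def]
    by (intro Ck_prod Ck_bilinear[OF bounded_bilinear_mult] 1 2) auto
qed

lemma flat0_bounds: "0 \<le> flat 0 x" "flat 0 x \<le> 1" "0 < x \<Longrightarrow> 0 < flat 0 x" "x \<le> 0 \<Longrightarrow> flat 0 x = 0"
  by (auto simp: flat_def)

lemma bump_bounds: "0 \<le> bump k a b x" "bump k a b x \<le> 1"
  unfolding bump_def by (auto intro!: prod_nonneg prod_le_1 mult_nonneg_nonneg mult_le_one flat0_bounds)

lemma bump_outside: "0 < k \<Longrightarrow> x \<notin> box a b \<Longrightarrow> bump k a b x = 0"
proof -
  assume k: "0 < k" and "x \<notin> box a b"
  then obtain i where i: "i \<in> Basis" "x \<bullet> i \<le> a \<bullet> i \<or> b \<bullet> i \<le> x \<bullet> i" by (auto simp: box_def not_less)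
  then have "k * ((x - a) \<bullet> i) \<le> 0 \<or> k * ((b - x) \<bullet> i) \<le> 0"
    using k by (auto simp: inner_diff_left mult_le_0_iff)
  then have "flat 0 (k * ((x - a) \<bullet> i)) * flat 0 (k * ((b - x) \<bullet> i)) = 0" using flat0_bounds(4) by auto
  then show ?thesis unfolding bump_def using i(1) by (auto simp: prod_zero_iff)
qed

lemma bump_pos: "0 < k \<Longrightarrow> x \<in> box a b \<Longrightarrow> 0 < bump k a b x"
  unfolding bump_def by (intro prod_pos) (auto simp: box_def inner_diff_left intro!: mult_pos_pos flat0_bounds)

lemma bump_tendsto_indicator: "(\<lambda>n. bump (real (Suc n)) a b x) \<longlonglongrightarrow> indicat_real (box a b) x"
proof (cases "x \<in> box a b")
  case False
  then show ?thesis by (simp add: bump_outside)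
next
  case True
  have f: "(\<lambda>n. flat 0 (real (Suc n) * s)) \<longlonglongrightarrow> 1" if s: "0 < s" for s
  proof -
    have "(\<lambda>n. exp (- (inverse (real (Suc n)) * inverse s))) \<longlonglongrightarrow> exp (- (0 * inverse s))"
      by (intro tendsto_intros LIMSEQ_inverse_real_of_nat)
    moreover have "flat 0 (real (Suc n) * s) = exp (- (inverse (real (Suc n)) * inverse s))" for n
      using s by (simp add: flat_def mult_le_0_iff del: of_nat_Suc)
    ultimately show ?thesis by simp
  qed
  have "(\<lambda>n. \<Prod>i\<in>Basis. flat 0 (real (Suc n) * ((x - a) \<bullet> i)) * flat 0 (real (Suc n) * ((b - x) \<bullet> i)))
      \<longlonglongrightarrow> (\<Prod>i\<in>(Basis::'a set). 1 * 1)"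
    by (intro tendsto_prod tendsto_mult f) (use True in \<open>auto simp: box_def inner_diff_left\<close>)
  then show ?thesis using True by (simp add: bump_def)
qed

text \<open>The vector valued analogue of \<open>test_function UNIV\<close>; real kernels for mollification are of this kind,
  too.\<close>

definition test :: "('a::euclidean_space \<Rightarrow> 'b::real_normed_vector) \<Rightarrow> bool" where
  "test f \<longleftrightarrow> (\<forall>k. Ck k f) \<and> (\<exists>K. compact K \<and> (\<forall>x. x \<notin> K \<longrightarrow> f x = 0))"

lemma testE:
  assumes "test f" obtains K where "compact K" "\<And>x. x \<notin> K \<Longrightarrow> f x = 0"
  using assms by (auto simp: test_def)

lemma test_Ck: "test f \<Longrightarrow> Ck k f"
  by (simp add: test_def)

lemma test_continuous: "test f \<Longrightarrow> continuous_on UNIV f"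
  using test_Ck[of f 0] by simp

lemma test_derivative: "test f \<Longrightarrow> (f has_derivative frechet_derivative f (at x)) (at x)"
  by (rule Ck_Suc_derivative[of 0]) (rule test_Ck)

lemma test_function_UNIV_iff: "test_function UNIV \<phi> \<longleftrightarrow> test \<phi>"
  by (auto simp: test_function_def test_def)

lemma test_bump: "0 < k \<Longrightarrow> test (bump k a b)"
  unfolding test_def using bump_outside[of k _ a b] box_subset_cbox[of a b]
  by (intro conjI allI Ck_bump exI[of _ "cbox a b"]) auto

lemma frechet_derivative_zero:
  assumes "open S" "x \<in> S" "\<And>y. y \<in> S \<Longrightarrow> f y = 0"
  shows "frechet_derivative f (at x) = (\<lambda>h. 0)"
proof (rule frechet_derivative_eq)
  show "(f has_derivative (\<lambda>h. 0)) (at x)"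
    by (rule has_derivative_transform_within_open[of "\<lambda>_. 0" _ _ _ S]) (use assms in auto)
qed

lemma test_partial:
  assumes "test f" "b \<in> Basis" shows "test (\<lambda>x. frechet_derivative f (at x) b)"
proof -
  obtain K where K: "compact K" "\<And>x. x \<notin> K \<Longrightarrow> f x = 0" using testE[OF assms(1)] by blast
  have "frechet_derivative f (at x) b = 0" if "x \<notin> K" for x
    using frechet_derivative_zero[of "- K" x f] that K compact_imp_closed by force
  moreover have "Ck k (\<lambda>x. frechet_derivative f (at x) b)" for k
    using test_Ck[OF assms(1), of "Suc k"] assms(2) by simp
  ultimately show ?thesis unfolding test_def using K(1) by blast
qed

lemma test_bounded_linear: "bounded_linear L \<Longrightarrow> test f \<Longrightarrow> test (\<lambda>x. L (f x))"
  unfolding test_def by (metis Ck_bounded_linear linear_0 bounded_linear.linear)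

lemma frechet_derivative_bounded_linear:
  assumes "bounded_linear L" "test f"
  shows "frechet_derivative (\<lambda>x. L (f x)) (at x) b = L (frechet_derivative f (at x) b)"
  using frechet_derivative_eq[OF bounded_linear.has_derivative[OF assms(1) test_derivative[OF assms(2)]]] by metis

lemma test_shift:
  assumes "test f" shows "test (\<lambda>x. f (x - y))"
proof -
  obtain K where K: "compact K" "\<And>x. x \<notin> K \<Longrightarrow> f x = 0" using testE[OF assms] by blast
  have "Ck k (\<lambda>x. f (x - y))" for k
    using Ck_affine[OF linear_ident test_Ck[OF assms], of k "- y"] by simp
  moreover have "compact ((+) y ` K)" by (rule compact_translation[OF K(1)])
  moreover have "f (x - y) = 0" if "x \<notin> (+) y ` K" for x
    using that K(2)[of "x - y"] by force
  ultimately show ?thesis unfolding test_def by blast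
qed

lemma frechet_derivative_shift:
  assumes "test f"
  shows "frechet_derivative (\<lambda>x. f (x - y)) (at x) = frechet_derivative f (at (x - y))"
proof (rule frechet_derivative_eq)
  have "((\<lambda>x. x - y) has_derivative (\<lambda>h. h)) (at x)" by (auto intro!: derivative_eq_intros)
  from has_derivative_compose[OF this test_derivative[OF assms]]
  show "((\<lambda>x. f (x - y)) has_derivative frechet_derivative f (at (x - y))) (at x)" by simp
qed

lemma compactly_supported_L2:
  fixes f :: "'a::euclidean_space \<Rightarrow> 'b::euclidean_space"
  assumes "continuous_on UNIV f" "compact K" "\<And>x. x \<notin> K \<Longrightarrow> f x = 0"
  shows "f \<in> L2"
proof (rule L2I)
  have [measurable]: "f \<in> borel_measurable borel" by (rule borel_measurable_continuous_onI[OF assms(1)])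
  show "f \<in> borel_measurable lebesgue" by (rule measurable_completion) simp
  have "integrable lborel (\<lambda>x. indicat_real K x *\<^sub>R (norm (f x))\<^sup>2)"
    using borel_integrable_compact[OF assms(2), of "\<lambda>x. (norm (f x))\<^sup>2"] assms(1)
    by (simp add: continuous_intros continuous_on_subset indicator_scaleR_eq_if)
  then have "integrable lebesgue (\<lambda>x. indicat_real K x *\<^sub>R (norm (f x))\<^sup>2)"
    by (rule integrable_completion[THEN iffD2, rotated])
      (use borel_compact[OF assms(2)] in measurable)
  then show "integrable lebesgue (\<lambda>x. (norm (f x))\<^sup>2)"
    by (rule back_subst[of "integrable lebesgue"]) (use assms(3) in \<open>auto simp: indicator_def fun_eq_iff\<close>)
qed

lemma test_L2: "test f \<Longrightarrow> f \<in> L2" for f :: "'a::euclidean_space \<Rightarrow> 'b::euclidean_space"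
  using compactly_supported_L2 test_continuous testE by metis

lemma indicator_L2:
  assumes "S \<in> sets lebesgue" "emeasure lebesgue S < \<infinity>"
  shows "indicat_real S \<in> L2"
proof (rule L2I)
  have "(\<lambda>x. (norm (indicat_real S x))\<^sup>2) = indicat_real S" by (auto simp: indicator_def)
  then show "integrable lebesgue (\<lambda>x. (norm (indicat_real S x))\<^sup>2)" using assms by (simp add: integrable_indicator_iff)
qed (use assms in measurable)

lemma sigma_finite_lebesgue: "sigma_finite_measure (lebesgue :: 'a::euclidean_space measure)"
proof
  let ?A = "range (\<lambda>n. box (- (real n *\<^sub>R One)) (real n *\<^sub>R One) :: 'a set)"
  have "countable ?A" "?A \<subseteq> sets lebesgue" by (auto intro: sets_completionI_sets)
  moreover have "\<Union> ?A = space lebesgue" using UN_box_eq_UNIV by simp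
  moreover have "emeasure lebesgue (box a b :: 'a set) \<noteq> \<infinity>" for a b
    using emeasure_bounded_finite[OF bounded_box[of a b]] by auto
  then have "\<forall>a\<in>?A. emeasure lebesgue a \<noteq> \<infinity>" by blast
  ultimately show "\<exists>A. countable A \<and> A \<subseteq> sets lebesgue \<and> \<Union> A = space (lebesgue :: 'a measure) \<and>
      (\<forall>a\<in>A. emeasure lebesgue a \<noteq> \<infinity>)" by (intro exI[of _ ?A] conjI)
qed

text \<open>By dominated convergence \<open>f\<close> has vanishing integral over every box.\<close>

lemma L2_zero_if_orthogonal_to_bumps:
  fixes f :: "'a::euclidean_space \<Rightarrow> 'b::euclidean_space"
  assumes f: "f \<in> L2" and orth: "\<And>k a b. 0 < k \<Longrightarrow> (LINT x|lebesgue. bump k a b x *\<^sub>R f x) = 0"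
  shows "AE x in lebesgue. f x = 0"
proof -
  have [measurable]: "f \<in> borel_measurable lebesgue" using f L2D by auto
  have mb [measurable]: "bump k a b \<in> borel_measurable lebesgue" for k and a b :: 'a
    by (rule measurable_completion) (simp add: borel_measurable_continuous_onI[OF Ck_continuous[OF Ck_bump]])
  have ind: "indicat_real (cbox a b) \<in> L2" for a b :: 'a
    by (rule indicator_L2) (use emeasure_bounded_finite[OF bounded_cbox[of a b]] in \<open>auto intro: sets_completionI_sets\<close>)
  have boxm [measurable]: "box a b \<in> sets lebesgue" for a b :: 'a
    by (rule sets_completionI_sets) simp
  have intg: "integrable lebesgue (\<lambda>x. indicat_real (box a b) x *\<^sub>R f x)" for a b
  proof (rule L2_product_integrable[OF ind[of a b] f, of _ 1])
    show "(\<lambda>x. indicat_real (box a b) x *\<^sub>R f x) \<in> borel_measurable lebesgue"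
      by (intro borel_measurable_scaleR borel_measurable_indicator boxm L2D(1)[OF f])
  qed (use box_subset_cbox[of a b] in \<open>auto simp: indicator_def subset_iff\<close>)
  have box0: "(LINT x|lebesgue. indicat_real (box a b) x *\<^sub>R f x) = 0" for a b
  proof -
    have "(\<lambda>n. LINT x|lebesgue. bump (real (Suc n)) a b x *\<^sub>R f x) \<longlonglongrightarrow> (LINT x|lebesgue. indicat_real (box a b) x *\<^sub>R f x)"
    proof (rule integral_dominated_convergence[where w = "\<lambda>x. norm (indicat_real (cbox a b) x) * norm (f x)"])
      show "integrable lebesgue (\<lambda>x. norm (indicat_real (cbox a b) x) * norm (f x))" by (rule L2_mult_integrable[OF ind f])
      show "AE x in lebesgue. (\<lambda>n. bump (real (Suc n)) a b x *\<^sub>R f x) \<longlonglongrightarrow> indicat_real (box a b) x *\<^sub>R f x"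
        by (intro AE_I2 tendsto_intros bump_tendsto_indicator)
      show "AE x in lebesgue. norm (bump (real (Suc n)) a b x *\<^sub>R f x) \<le> norm (indicat_real (cbox a b) x) * norm (f x)" for n
      proof (rule AE_I2)
        fix x
        show "norm (bump (real (Suc n)) a b x *\<^sub>R f x) \<le> norm (indicat_real (cbox a b) x) * norm (f x)"
          using bump_bounds[of "real (Suc n)" a b x] bump_outside[of "real (Suc n)" x a b] box_subset_cbox[of a b]
          by (cases "x \<in> box a b") (auto intro!: mult_left_le_one_le simp: subset_iff simp del: of_nat_Suc)
      qed
    qed measurable
    then show ?thesis using orth[of "real (Suc n)" a b for n] LIMSEQ_const_iff by (auto dest: LIMSEQ_unique simp del: of_nat_Suc)
  qed
  have AE_box: "AE x in lebesgue. indicat_real (box c d) x *\<^sub>R f x = 0" for c d :: 'a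
  proof -
    define g where "g x = indicat_real (box c d) x *\<^sub>R f x" for x
    have gi: "integrable lebesgue g" unfolding g_def by (rule intg)
    have [measurable]: "g \<in> borel_measurable lebesgue" using gi by auto
    have sgi: "set_integrable lebesgue S g" if "S \<in> sets lebesgue" for S
      unfolding set_integrable_def by (rule integrable_mult_indicator[OF that gi])
    have borel0: "(LINT x:S|lebesgue. g x) = 0" if "S \<in> sets borel" for S
    proof -
      define B where "B = range (\<lambda>(a, b). box a b :: 'a set)"
      have sets_B: "sets borel = sigma_sets UNIV B" unfolding borel_eq_box B_def by (simp add: sets_measure_of)
      then have S: "S \<in> sigma_sets UNIV B" using that by simp
      have lebB: "A \<in> sets lebesgue" if "A \<in> sigma_sets UNIV B" for A
        by (rule sets_completionI_sets) (use that sets_B in simp)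
      have ist: "Int_stable B"
        unfolding B_def Int_stable_def by (auto simp: Int_interval box_Int_box)
      have pow: "B \<subseteq> Pow UNIV" by simp
      from ist pow S show ?thesis
      proof (induction rule: sigma_sets_induct_disjoint)
        case (basic A)
        then obtain a b where A: "A = box a b" by (auto simp: B_def)
        obtain a' b' where ab: "box a b \<inter> box c d = box a' b'" by (auto simp: box_Int_box)
        have "(\<lambda>x. indicat_real A x *\<^sub>R g x) = (\<lambda>x. indicat_real (box a' b') x *\<^sub>R f x)"
          unfolding A g_def ab[symmetric] by (auto simp: indicator_def)
        then show ?case using box0[of a' b'] by (simp add: set_lebesgue_integral_def)
      next
        case empty
        show ?case by (simp add: set_lebesgue_integral_def)
      next
        case (compl A)
        have A: "A \<in> sets lebesgue" by (rule lebB[OF compl(1)])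
        have "(LINT x:(UNIV - A)|lebesgue. g x) = (LINT x|lebesgue. g x - indicat_real A x *\<^sub>R g x)"
          unfolding set_lebesgue_integral_def by (rule Bochner_Integration.integral_cong) (auto simp: indicator_def)
        also have "\<dots> = (LINT x|lebesgue. g x) - (LINT x:A|lebesgue. g x)"
          using gi sgi[OF A] unfolding set_lebesgue_integral_def set_integrable_def by simp
        also have "\<dots> = 0" using box0[of c d] compl(2) by (simp add: g_def)
        finally show ?case .
      next
        case (union A)
        have A: "A i \<in> sets lebesgue" for i using lebB union(2) by blast
        have "(LINT x:(\<Union>i. A i)|lebesgue. g x) = (\<Sum>i. LINT x:(A i)|lebesgue. g x)"
          by (rule lebesgue_integral_countable_add)
            (use A union(1) sgi in \<open>auto simp: disjoint_family_on_def\<close>)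
        then show ?case using union(3) by simp
      qed
    qed
    have "(LINT x:S|lebesgue. g x) = 0" if SL: "S \<in> sets lebesgue" for S
    proof -
      obtain S' N N' where S: "S = S' \<union> N" "N \<subseteq> N'" "N' \<in> null_sets lborel" "S' \<in> sets lborel"
        using SL by (elim sets_completionE)
      have "AE x in lebesgue. x \<notin> N'" using S(3) by (intro AE_completion AE_not_in)
      then have "AE x in lebesgue. indicat_real S x *\<^sub>R g x = indicat_real S' x *\<^sub>R g x"
        by eventually_elim (use S in \<open>auto simp: indicator_def\<close>)
      moreover have SL': "S' \<in> sets lebesgue" using S(4) by simp
      ultimately have "(LINT x:S|lebesgue. g x) = (LINT x:S'|lebesgue. g x)"
        unfolding set_lebesgue_integral_def
        by (intro integral_cong_AE borel_measurable_scaleR borel_measurable_indicator SL SL' borel_measurable_integrable[OF gi])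
      then show ?thesis using borel0[of S'] S(4) by simp
    qed
    from sigma_finite_measure.density_zero[OF sigma_finite_lebesgue gi this] show ?thesis by (simp add: g_def)
  qed
  have "AE x in lebesgue. \<forall>n. indicat_real (box (- (real n *\<^sub>R One)) (real n *\<^sub>R One)) x *\<^sub>R f x = 0"
    unfolding AE_all_countable using AE_box by blast
  then show ?thesis
  proof eventually_elim
    case (elim x)
    have "x \<in> (\<Union>n. box (- (real n *\<^sub>R One)) (real n *\<^sub>R One))" unfolding UN_box_eq_UNIV by simp
    then obtain n where "x \<in> box (- (real n *\<^sub>R One)) (real n *\<^sub>R One)" by blast
    then show ?case using elim[rule_format, of n] by simp
  qed
qed

section \<open>Mollified functions and weak derivatives\<close>

lemma norm_cls_le:
  fixes f :: "'a::euclidean_space \<Rightarrow> 'b::euclidean_space" and g :: "'a \<Rightarrow> 'c::euclidean_space"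
  assumes "f \<in> L2" "g \<in> L2" "0 \<le> c" "\<And>x. norm (f x) \<le> c * norm (g x)"
  shows "norm (cls f) \<le> c * norm (cls g)"
proof -
  have "(LINT x|lebesgue. (norm (f x))\<^sup>2) \<le> (LINT x|lebesgue. c\<^sup>2 * (norm (g x))\<^sup>2)"
  proof (rule integral_mono)
    show "(norm (f x))\<^sup>2 \<le> c\<^sup>2 * (norm (g x))\<^sup>2" for x
      using assms(4)[of x] by (simp add: power_mult_distrib[symmetric] power_mono)
  qed (use L2D(2)[OF assms(1)] L2D(2)[OF assms(2)] in auto)
  then have "L2_norm f \<le> sqrt (c\<^sup>2 * (LINT x|lebesgue. (norm (g x))\<^sup>2))" by (simp add: L2_norm_def)
  also have "\<dots> = c * L2_norm g" using assms(3) by (simp add: real_sqrt_mult L2_norm_def)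
  finally show ?thesis using assms(1,2) by (simp add: norm_cls)
qed

text \<open>The difference quotients converge uniformly with supports in a fixed compact set, hence in
  \<open>L\<^sup>2\<close>.\<close>

lemma L2_curve_derivative:
  fixes \<Phi> \<Phi>' :: "real \<Rightarrow> 'a::euclidean_space \<Rightarrow> 'b::euclidean_space"
  assumes der: "\<And>t x. ((\<lambda>t. \<Phi> t x) has_vector_derivative \<Phi>' t x) (at t)"
    and cont': "continuous_on UNIV (\<lambda>p. \<Phi>' (fst p) (snd p))"
    and cont: "\<And>t. continuous_on UNIV (\<Phi> t)"
    and K: "compact K" and d: "0 < d" and supp: "\<And>t x. \<bar>t - t0\<bar> < d \<Longrightarrow> x \<notin> K \<Longrightarrow> \<Phi> t x = 0"
  shows "((\<lambda>t. cls (\<Phi> t)) has_vector_derivative cls (\<Phi>' t0)) (at t0)"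
proof -
  have contt: "continuous_on UNIV (\<Phi>' t)" for t
    using continuous_on_compose2[OF cont', of UNIV "\<lambda>x. (t, x)"] by (simp add: continuous_on_Pair continuous_on_id)
  have supp': "\<Phi>' t0 x = 0" if "x \<notin> K" for x
  proof -
    have "((\<lambda>t. \<Phi> t x) has_vector_derivative 0) (at t0)"
      by (rule has_vector_derivative_transform_within_open[of "\<lambda>_. 0" _ _ "{t0 - d<..<t0 + d}"])
        (use that supp d in \<open>auto simp: abs_less_iff\<close>)
    then show ?thesis using der[of x t0] vector_derivative_unique_at by blast
  qed
  have L: "\<Phi> t \<in> L2" if "\<bar>t - t0\<bar> < d" for t
    by (rule compactly_supported_L2[OF cont K]) (use supp that in auto)
  have L': "\<Phi>' t0 \<in> L2" by (rule compactly_supported_L2[OF contt K supp'])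
  have IK: "indicat_real K \<in> L2"
  proof (rule indicator_L2)
    have Kb: "K \<in> sets lborel" using borel_compact[OF K] by simp
    then show "K \<in> sets lebesgue" by (rule sets_completionI_sets)
    show "emeasure lebesgue K < \<infinity>" using emeasure_compact_finite[OF K] Kb by simp
  qed
  define C where "C = norm (cls (indicat_real K)) + 1"
  have C: "C > 0" by (simp add: C_def add_nonneg_pos)
  show ?thesis unfolding has_vector_derivative_def has_derivative_at_alt
  proof (intro conjI allI impI)
    show "bounded_linear (\<lambda>h. h *\<^sub>R cls (\<Phi>' t0))" by (rule bounded_linear_scaleR_left)
    fix e :: real assume "0 < e"
    define \<epsilon> where "\<epsilon> = e / C"
    have \<epsilon>: "0 < \<epsilon>" using \<open>0 < e\<close> C by (simp add: \<epsilon>_def)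
    have "uniformly_continuous_on (cball t0 (d/2) \<times> K) (\<lambda>p. \<Phi>' (fst p) (snd p))"
      by (intro compact_uniformly_continuous compact_Times compact_cball K continuous_on_subset[OF cont']) auto
    then obtain \<delta> where \<delta>: "\<delta> > 0" "\<And>p p'. p \<in> cball t0 (d/2) \<times> K \<Longrightarrow> p' \<in> cball t0 (d/2) \<times> K \<Longrightarrow>
        dist p' p < \<delta> \<Longrightarrow> dist (\<Phi>' (fst p') (snd p')) (\<Phi>' (fst p) (snd p)) < \<epsilon>"
      unfolding uniformly_continuous_on_def using \<epsilon> by metis
    have "norm (cls (\<Phi> t) - cls (\<Phi> t0) - (t - t0) *\<^sub>R cls (\<Phi>' t0)) \<le> e * norm (t - t0)"
      if t: "norm (t - t0) < min \<delta> (d/2)" for t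
    proof -
      define r where "r x = \<Phi> t x - \<Phi> t0 x - (t - t0) *\<^sub>R \<Phi>' t0 x" for x
      have td: "\<bar>t - t0\<bar> < d" using t d by simp
      have rL: "r \<in> L2" unfolding r_def[abs_def] using d by (intro L2_diff L2_scaleR L L' td) simp
      have "norm (r x) \<le> (\<epsilon> * \<bar>t - t0\<bar>) * norm (indicat_real K x)" for x
      proof (cases "x \<in> K")
        case False
        then show ?thesis using supp[of t x] supp[of t0 x] supp'[of x] td d by (simp add: r_def)
      next
        case True
        define S where "S = closed_segment t0 t"
        define F where "F s = \<Phi> s x - s *\<^sub>R \<Phi>' t0 x" for s
        have "norm (F t - F t0) \<le> \<epsilon> * norm (t - t0)"
        proof (rule differentiable_bound[of S F "\<lambda>s h. h *\<^sub>R (\<Phi>' s x - \<Phi>' t0 x)"])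
          show "(F has_derivative (\<lambda>h. h *\<^sub>R (\<Phi>' s x - \<Phi>' t0 x))) (at s within S)" for s
          proof -
            have "(F has_vector_derivative (\<Phi>' s x - \<Phi>' t0 x)) (at s)"
              unfolding F_def by (intro has_vector_derivative_diff der)
                (auto intro!: derivative_eq_intros simp: has_vector_derivative_def)
            then show ?thesis using has_vector_derivative_at_within has_vector_derivative_def by blast
          qed
          show "onorm (\<lambda>h. h *\<^sub>R (\<Phi>' s x - \<Phi>' t0 x)) \<le> \<epsilon>" if "s \<in> S" for s
          proof (rule onorm_le)
            have "\<bar>s - t0\<bar> \<le> \<bar>t - t0\<bar>" using that by (auto simp: S_def closed_segment_eq_real_ivl split: if_splits)
            then have "dist s t0 < \<delta>" "dist s t0 \<le> d / 2" using t by (auto simp: dist_real_def)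
            then have "dist (\<Phi>' s x) (\<Phi>' t0 x) < \<epsilon>"
              using \<delta>(2)[of "(t0, x)" "(s, x)"] True d by (simp add: dist_Pair_Pair dist_commute)
            then have n: "norm (\<Phi>' s x - \<Phi>' t0 x) \<le> \<epsilon>" by (simp add: dist_norm)
            show "norm (h *\<^sub>R (\<Phi>' s x - \<Phi>' t0 x)) \<le> \<epsilon> * norm h" for h
              using mult_left_mono[OF n, of "\<bar>h\<bar>"] by (simp add: mult.commute)
          qed
        qed (auto simp: S_def)
        moreover have "r x = F t - F t0" by (simp add: r_def F_def algebra_simps)
        ultimately show ?thesis using True by simp
      qed
      then have "norm (cls r) \<le> (\<epsilon> * \<bar>t - t0\<bar>) * norm (cls (indicat_real K))"
        using \<epsilon> by (intro norm_cls_le rL IK) auto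
      also have "\<dots> \<le> (\<epsilon> * \<bar>t - t0\<bar>) * C" using \<epsilon> by (intro mult_left_mono) (auto simp: C_def)
      also have "\<dots> = e * norm (t - t0)" using C by (simp add: \<epsilon>_def)
      also have "cls r = cls (\<Phi> t) - cls (\<Phi> t0) - (t - t0) *\<^sub>R cls (\<Phi>' t0)"
        unfolding r_def[abs_def] using d L[OF td] L[of t0] L'
        by (simp add: cls_diff cls_scaleR L2_diff L2_scaleR)
      finally show ?thesis .
    qed
    then show "\<exists>\<delta>>0. \<forall>t. norm (t - t0) < \<delta> \<longrightarrow>
        norm (cls (\<Phi> t) - cls (\<Phi> t0) - (t - t0) *\<^sub>R cls (\<Phi>' t0)) \<le> e * norm (t - t0)"
      using \<delta>(1) d by (intro exI[of _ "min \<delta> (d/2)"]) auto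
  qed
qed

lemma translation_derivative:
  fixes \<rho> :: "'a::euclidean_space \<Rightarrow> 'b::euclidean_space"
  assumes "test \<rho>" "i \<in> Basis"
  shows "((\<lambda>s. cls (\<lambda>z. \<rho> (z - (y + s *\<^sub>R i)))) has_vector_derivative
     - cls (\<lambda>z. frechet_derivative \<rho> (at (z - (y + s0 *\<^sub>R i))) i)) (at s0)"
proof -
  obtain K where K: "compact K" "\<And>x. x \<notin> K \<Longrightarrow> \<rho> x = 0" using testE[OF assms(1)] by blast
  define K' where "K' = (\<lambda>p. fst p + (y + snd p *\<^sub>R i)) ` (K \<times> cball s0 1)"
  have cK': "compact K'"
    unfolding K'_def by (intro compact_continuous_image compact_Times K(1) compact_cball continuous_intros)
  have cd: "continuous_on UNIV (\<lambda>x. frechet_derivative \<rho> (at x) i)" by (rule test_continuous[OF test_partial[OF assms]])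
  have "((\<lambda>s. cls (\<lambda>z. \<rho> (z - (y + s *\<^sub>R i)))) has_vector_derivative
     cls (\<lambda>z. - frechet_derivative \<rho> (at (z - (y + s0 *\<^sub>R i))) i)) (at s0)"
  proof (rule L2_curve_derivative[of "\<lambda>s z. \<rho> (z - (y + s *\<^sub>R i))" "\<lambda>s z. - frechet_derivative \<rho> (at (z - (y + s *\<^sub>R i))) i", OF _ _ _ cK' zero_less_one])
    show "((\<lambda>s. \<rho> (z - (y + s *\<^sub>R i))) has_vector_derivative - frechet_derivative \<rho> (at (z - (y + s *\<^sub>R i))) i) (at s)" for s z
    proof -
      have "((\<lambda>s. z - (y + s *\<^sub>R i)) has_derivative (\<lambda>h. - (h *\<^sub>R i))) (at s)"
        by (auto intro!: derivative_eq_intros)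
      from has_derivative_compose[OF this test_derivative[OF assms(1)]]
      have "((\<lambda>s. \<rho> (z - (y + s *\<^sub>R i))) has_derivative (\<lambda>h. frechet_derivative \<rho> (at (z - (y + s *\<^sub>R i))) (- (h *\<^sub>R i)))) (at s)" .
      moreover have "frechet_derivative \<rho> (at x) (- (h *\<^sub>R i)) = h *\<^sub>R (- frechet_derivative \<rho> (at x) i)" for x h
        using has_derivative_linear[OF test_derivative[OF assms(1), of x]] by (simp add: linear_neg linear_scale)
      ultimately show ?thesis by (simp add: has_vector_derivative_def)
    qed
    show "continuous_on UNIV (\<lambda>p. - frechet_derivative \<rho> (at (snd p - (y + fst p *\<^sub>R i))) i)"
      by (intro continuous_intros continuous_on_compose2[OF cd]) auto
    show "continuous_on UNIV (\<lambda>z. \<rho> (z - (y + s *\<^sub>R i)))" for s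
      by (intro continuous_intros continuous_on_compose2[OF test_continuous[OF assms(1)]]) auto
    show "\<rho> (z - (y + s *\<^sub>R i)) = 0" if "\<bar>s - s0\<bar> < 1" "z \<notin> K'" for s z
    proof (rule K(2), rule notI)
      assume "z - (y + s *\<^sub>R i) \<in> K"
      moreover have "s \<in> cball s0 1" using that(1) by (simp add: dist_real_def abs_minus_commute)
      ultimately have "z \<in> K'" unfolding K'_def by (intro image_eqI[of _ _ "(z - (y + s *\<^sub>R i), s)"]) auto
      with that(2) show False by simp
    qed
  qed
  moreover have "cls (\<lambda>z. - frechet_derivative \<rho> (at (z - (y + s0 *\<^sub>R i))) i) = - cls (\<lambda>z. frechet_derivative \<rho> (at (z - (y + s0 *\<^sub>R i))) i)"
    using cls_scaleR[OF test_L2[OF test_shift[OF test_partial[OF assms]]], of "-1" "y + s0 *\<^sub>R i"] by simp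
  ultimately show ?thesis by simp
qed

lemma test_bounded:
  fixes \<rho> :: "'a::euclidean_space \<Rightarrow> real"
  assumes "test \<rho>"
  obtains B C where "0 < B" "0 < C" "\<And>x. \<bar>\<rho> x\<bar> \<le> C" "\<And>x. B < norm x \<Longrightarrow> \<rho> x = 0"
proof -
  obtain K where K: "compact K" "\<And>x. x \<notin> K \<Longrightarrow> \<rho> x = 0" using testE[OF assms] by blast
  obtain B where B: "\<And>x. x \<in> K \<Longrightarrow> norm x \<le> B" using compact_imp_bounded[OF K(1)] by (auto simp: bounded_iff)
  have "compact (\<rho> ` K)" by (rule compact_continuous_image[OF continuous_on_subset[OF test_continuous[OF assms]] K(1)]) auto
  then obtain C where C: "\<And>x. x \<in> K \<Longrightarrow> \<bar>\<rho> x\<bar> \<le> C" using compact_imp_bounded by (fastforce simp: bounded_iff)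
  show ?thesis
  proof (rule that[of "\<bar>B\<bar> + 1" "\<bar>C\<bar> + 1"])
    show "\<bar>\<rho> x\<bar> \<le> \<bar>C\<bar> + 1" for x using C[of x] K(2)[of x] by (cases "x \<in> K") auto
    show "\<rho> x = 0" if "\<bar>B\<bar> + 1 < norm x" for x using B[of x] K(2)[of x] that by (cases "x \<in> K") auto
  qed auto
qed

definition mollify :: "('a::euclidean_space \<Rightarrow> real) \<Rightarrow> ('a \<Rightarrow> real) \<Rightarrow> 'a \<Rightarrow> real" where
  "mollify \<rho> f y = (LINT z|lebesgue. f z * \<rho> (z - y))"

lemma mollify_inner: "f \<in> L2 \<Longrightarrow> test \<rho> \<Longrightarrow> mollify \<rho> f y = inner (cls f) (cls (\<lambda>z. \<rho> (z - y)))"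
  unfolding mollify_def by (subst inner_cls) (auto intro: test_L2 test_shift)

lemma mollify_derivative:
  assumes "f \<in> L2" "test \<rho>" "i \<in> Basis"
  shows "((\<lambda>s. mollify \<rho> f (y + s *\<^sub>R i)) has_real_derivative
     - mollify (\<lambda>x. frechet_derivative \<rho> (at x) i) f (y + s0 *\<^sub>R i)) (at s0)"
proof -
  have "((\<lambda>s. inner (cls f) (cls (\<lambda>z. \<rho> (z - (y + s *\<^sub>R i))))) has_vector_derivative
     inner (cls f) (- cls (\<lambda>z. frechet_derivative \<rho> (at (z - (y + s0 *\<^sub>R i))) i))) (at s0)"
    by (rule bounded_linear.has_vector_derivative[OF bounded_linear_inner_right translation_derivative[OF assms(2,3)]])
  then show ?thesis
    unfolding has_real_derivative_iff_has_vector_derivative mollify_inner[OF assms(1,2)]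
      mollify_inner[OF assms(1) test_partial[OF assms(2,3)]] by simp
qed

lemma mollify_continuous:
  assumes f: "f \<in> L2" and t: "test \<rho>" shows "continuous_on UNIV (mollify \<rho> f)"
proof (unfold continuous_on_sequentially, intro allI ballI impI)
  fix y and Y :: "nat \<Rightarrow> 'a" assume "(\<forall>n. Y n \<in> UNIV) \<and> Y \<longlonglongrightarrow> y"
  then have Y: "Y \<longlonglongrightarrow> y" by simp
  obtain R where R: "\<And>n. norm (Y n) \<le> R" using convergent_imp_bounded[OF Y] by (auto simp: bounded_iff)
  obtain B C where BC: "0 < B" "0 < C" "\<And>x. \<bar>\<rho> x\<bar> \<le> C" "\<And>x. B < norm x \<Longrightarrow> \<rho> x = 0" using test_bounded[OF t] by blast
  have fm: "f \<in> borel_measurable lebesgue" by (rule L2D(1)[OF f])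
  have rm: "(\<lambda>z. \<rho> (z - y)) \<in> borel_measurable lebesgue" for y by (rule L2D(1)[OF test_L2[OF test_shift[OF t]]])
  have ind: "indicat_real (cball 0 (B + R)) \<in> L2"
    by (rule indicator_L2) (use emeasure_bounded_finite[OF bounded_cball] in \<open>auto intro: sets_completionI_sets\<close>)
  show "(mollify \<rho> f \<circ> Y) \<longlonglongrightarrow> mollify \<rho> f y" unfolding o_def mollify_def
  proof (rule integral_dominated_convergence[where w = "\<lambda>z. C * (norm (f z) * norm (indicat_real (cball 0 (B + R)) z))"])
    show "(\<lambda>z. f z * \<rho> (z - y)) \<in> borel_measurable lebesgue" "(\<lambda>z. f z * \<rho> (z - Y n)) \<in> borel_measurable lebesgue" for n
      by (intro borel_measurable_times fm rm)+
    show "integrable lebesgue (\<lambda>z. C * (norm (f z) * norm (indicat_real (cball 0 (B + R)) z)))"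
      by (intro integrable_mult_right L2_mult_integrable f ind)
    have "isCont \<rho> x" for x using test_continuous[OF t] by (simp add: continuous_on_eq_continuous_at)
    then show "AE z in lebesgue. (\<lambda>n. f z * \<rho> (z - Y n)) \<longlonglongrightarrow> f z * \<rho> (z - y)"
      by (intro AE_I2 tendsto_mult tendsto_const isCont_tendsto_compose[of _ \<rho>] tendsto_diff Y)
    show "AE z in lebesgue. norm (f z * \<rho> (z - Y n)) \<le> C * (norm (f z) * norm (indicat_real (cball 0 (B + R)) z))" for n
    proof (rule AE_I2)
      fix z
      show "norm (f z * \<rho> (z - Y n)) \<le> C * (norm (f z) * norm (indicat_real (cball 0 (B + R)) z))"
      proof (cases "norm z \<le> B + R")
        case True
        then show ?thesis using mult_left_mono[OF BC(3)[of "z - Y n"], of "\<bar>f z\<bar>"] by (simp add: abs_mult mult.commute)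
      next
        case False
        then have "B < norm (z - Y n)" using R[of n] norm_triangle_sub[of z "Y n"] by linarith
        then show ?thesis using BC(4) BC(2) by (simp add: zero_le_mult_iff)
      qed
    qed
  qed
qed

text \<open>Cauchy-Schwarz on the support of the translated kernel; the mass of \<open>f\<^sup>2\<close> far away from the origin
  is small.\<close>

lemma mollify_decay:
  fixes f :: "'a::euclidean_space \<Rightarrow> real"
  assumes f: "f \<in> L2" and t: "test \<rho>" and e: "0 < e"
  shows "\<exists>R. \<forall>y. R < norm y \<longrightarrow> \<bar>mollify \<rho> f y\<bar> < e"
proof -
  obtain B C where BC: "0 < B" "0 < C" "\<And>x. \<bar>\<rho> x\<bar> \<le> C" "\<And>x. B < norm x \<Longrightarrow> \<rho> x = 0" using test_bounded[OF t] by blast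
  have fm: "f \<in> borel_measurable lebesgue" by (rule L2D(1)[OF f])
  have ind: "indicat_real (cball y B) \<in> L2" for y :: 'a
    by (rule indicator_L2) (use emeasure_bounded_finite[OF bounded_cball] in \<open>auto intro: sets_completionI_sets\<close>)
  define V where "V = norm (cls (indicat_real (cball (0::'a) B)))"
  have V: "norm (cls (indicat_real (cball y B))) = V" for y :: 'a
  proof -
    have "norm (cls (indicat_real (cball y B))) = sqrt (measure lborel (cball y B))" for y :: 'a
    proof -
      have "(\<lambda>x. (norm (indicat_real (cball y B) x))\<^sup>2) = indicat_real (cball y B)" by (auto simp: indicator_def)
      then show ?thesis unfolding norm_cls[OF ind] L2_norm_def by simp
    qed
    then show ?thesis using BC(1) by (simp add: V_def content_cball)
  qed
  have V0: "0 \<le> V" by (simp add: V_def)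
  define g where "g n z = indicat_real (- cball 0 (real n)) z * f z" for n z
  have setm: "- cball 0 (real n) \<in> sets (lebesgue :: 'a measure)" for n
    by (rule sets_completionI_sets) (auto intro: borel_open)
  have gm: "g n \<in> borel_measurable lebesgue" for n
    unfolding g_def[abs_def] by (intro borel_measurable_times borel_measurable_indicator setm fm)
  have gL: "g n \<in> L2" for n
    by (rule L2_dominated[OF f gm, of _ 1]) (auto simp: g_def indicator_def)
  have "(\<lambda>n. LINT z|lebesgue. (norm (g n z))\<^sup>2) \<longlonglongrightarrow> (LINT z|(lebesgue::'a measure). 0)"
  proof (rule integral_dominated_convergence[where w = "\<lambda>z. (norm (f z))\<^sup>2"])
    show "(\<lambda>z. (norm (g n z))\<^sup>2) \<in> borel_measurable lebesgue" for n by (rule borel_measurable_integrable[OF L2D(2)[OF gL]])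
    show "integrable lebesgue (\<lambda>z. (norm (f z))\<^sup>2)" by (rule L2D(2)[OF f])
    show "AE z in lebesgue. (\<lambda>n. (norm (g n z))\<^sup>2) \<longlonglongrightarrow> 0"
    proof (rule AE_I2, rule tendsto_eventually)
      fix z :: 'a
      show "\<forall>\<^sub>F n in sequentially. (norm (g n z))\<^sup>2 = 0"
        using eventually_ge_at_top[of "nat \<lceil>norm z\<rceil>"] by eventually_elim (simp add: g_def nat_ceiling_le_eq)
    qed
    show "AE z in lebesgue. norm ((norm (g n z))\<^sup>2) \<le> (norm (f z))\<^sup>2" for n
      by (rule AE_I2) (auto simp: g_def indicator_def)
  qed simp
  then have "(\<lambda>n. L2_norm (g n)) \<longlonglongrightarrow> 0" unfolding L2_norm_def using tendsto_real_sqrt by fastforce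
  then have "\<forall>\<^sub>F n in sequentially. L2_norm (g n) < e / (C * (V + 1))"
    by (rule order_tendstoD) (use e BC(2) V0 in auto)
  then obtain n where n: "norm (cls (g n)) < e / (C * (V + 1))" unfolding eventually_sequentially by (auto simp: norm_cls[OF gL])
  have "\<bar>mollify \<rho> f y\<bar> < e" if y: "real n + B < norm y" for y
  proof -
    have rL: "(\<lambda>z. \<rho> (z - y)) \<in> L2" by (rule test_L2[OF test_shift[OF t]])
    have "f z * \<rho> (z - y) = g n z * \<rho> (z - y)" for z
    proof (cases "norm (z - y) \<le> B")
      case True
      then have "real n < norm z" using y norm_triangle_sub[of y z] by (simp add: norm_minus_commute)
      then show ?thesis by (simp add: g_def)
    next
      case False
      then show ?thesis using BC(4) by simp
    qed
    then have "mollify \<rho> f y = (LINT z|lebesgue. g n z * \<rho> (z - y))" by (simp only: mollify_def)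
    then have "mollify \<rho> f y = inner (cls (g n)) (cls (\<lambda>z. \<rho> (z - y)))"
      by (simp add: inner_cls[OF gL rL])
    then have "\<bar>mollify \<rho> f y\<bar> \<le> norm (cls (g n)) * norm (cls (\<lambda>z. \<rho> (z - y)))"
      by (simp add: Cauchy_Schwarz_ineq2)
    also have "norm (cls (\<lambda>z. \<rho> (z - y))) \<le> C * norm (cls (indicat_real (cball y B)))"
    proof (rule norm_cls_le[OF rL ind])
      show "norm (\<rho> (z - y)) \<le> C * norm (indicat_real (cball y B) z)" for z
        using BC(3)[of "z - y"] BC(4)[of "z - y"] by (auto simp: indicator_def dist_norm norm_minus_commute)
    qed (use BC in simp)
    also have "norm (cls (g n)) * (C * norm (cls (indicat_real (cball y B)))) \<le> norm (cls (g n)) * (C * (V + 1))"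
      using BC(2) by (intro mult_left_mono) (auto simp: V)
    also have "\<dots> < e" using n BC(2) V0 by (simp add: pos_less_divide_eq)
    finally show ?thesis by (simp add: mult_left_mono)
  qed
  then show ?thesis by blast
qed

text \<open>A positive value would force a positive maximum, at which all second derivatives are nonpositive.\<close>

lemma maximum_principle:
  fixes m :: "'a::euclidean_space \<Rightarrow> real"
  assumes cont: "continuous_on UNIV m"
    and decay: "\<And>e. 0 < e \<Longrightarrow> \<exists>R. \<forall>y. R < norm y \<longrightarrow> \<bar>m y\<bar> < e"
    and D: "\<And>y i s. i \<in> Basis \<Longrightarrow> ((\<lambda>s. m (y + s *\<^sub>R i)) has_real_derivative D i (y + s *\<^sub>R i)) (at s)"
    and H: "\<And>y i s. i \<in> Basis \<Longrightarrow> ((\<lambda>s. D i (y + s *\<^sub>R i)) has_real_derivative H i (y + s *\<^sub>R i)) (at s)"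
    and eq: "\<And>y. (\<Sum>i\<in>Basis. H i y) = m y"
  shows "m y0 \<le> 0"
proof (rule ccontr)
  assume "\<not> m y0 \<le> 0"
  then have pos: "0 < m y0" by simp
  obtain R where R: "\<And>y. R < norm y \<Longrightarrow> \<bar>m y\<bar> < m y0" using decay[OF pos] by blast
  have y0R: "y0 \<in> cball 0 R" using R[of y0] by force
  obtain y where y: "y \<in> cball 0 R" "\<And>z. z \<in> cball 0 R \<Longrightarrow> m z \<le> m y"
    using continuous_attains_sup[of "cball 0 R" m] y0R continuous_on_subset[OF cont] by (metis compact_cball empty_iff subset_UNIV)
  have max: "m z \<le> m y" for z
  proof (cases "z \<in> cball 0 R")
    case False
    then have "m z < m y0" using R[of z] by (simp add: abs_less_iff)
    then show ?thesis using y(2)[OF y0R] by simp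
  qed (rule y(2))
  have "H i y \<le> 0" if i: "i \<in> Basis" for i
  proof (rule ccontr)
    assume "\<not> H i y \<le> 0"
    then have Hp: "0 < H i y" by simp
    have D0: "D i y = 0"
      using DERIV_local_max[OF D[OF i, of y 0], of 1] max by simp
    obtain d where d: "d > 0" "\<And>h. 0 < h \<Longrightarrow> h < d \<Longrightarrow> D i y < D i (y + h *\<^sub>R i)"
      using DERIV_pos_inc_right[OF H[OF i, of y 0]] Hp by auto
    obtain z where z: "0 < z" "z < d / 2" "m (y + (d/2) *\<^sub>R i) - m (y + 0 *\<^sub>R i) = (d / 2 - 0) * D i (y + z *\<^sub>R i)"
      using MVT2[of 0 "d/2" "\<lambda>s. m (y + s *\<^sub>R i)" "\<lambda>s. D i (y + s *\<^sub>R i)"] D[OF i] d(1) by auto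
    have "0 < D i (y + z *\<^sub>R i)" using d(2)[of z] z D0 by simp
    then have "0 < (d / 2 - 0) * D i (y + z *\<^sub>R i)" using d(1) by simp
    then have "m y < m (y + (d/2) *\<^sub>R i)" unfolding z(3)[symmetric] by simp
    then show False using max[of "y + (d/2) *\<^sub>R i"] by simp
  qed
  then have "m y \<le> 0" unfolding eq[symmetric] by (rule sum_nonpos)
  then show False using pos max[of y0] by simp
qed

text \<open>A mollification \<open>m\<close> of \<open>f\<close> satisfies \<open>\<Delta> m = m\<close> classically and tends to
  zero at infinity, so \<open>m = 0\<close> by the maximum principle applied to \<open>m\<close> and \<open>- m\<close>.\<close>

lemma L2_zero_if_helmholtz:
  fixes f :: "'a::euclidean_space \<Rightarrow> real"
  assumes f: "f \<in> L2"
    and eq: "\<And>\<rho>. test \<rho> \<Longrightarrow> (\<Sum>i\<in>Basis. LINT z|lebesgue. f z * frechet_derivative (\<lambda>x. frechet_derivative \<rho> (at x) i) (at z) i)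
       = (LINT z|lebesgue. f z * \<rho> z)"
  shows "AE z in lebesgue. f z = 0"
proof (rule L2_zero_if_orthogonal_to_bumps[OF f])
  fix k :: real and a b :: 'a assume k: "0 < k"
  define \<rho> where "\<rho> = bump k a b"
  have t: "test \<rho>" unfolding \<rho>_def by (rule test_bump[OF k])
  define m where "m = mollify \<rho> f"
  define D where "D i y = - mollify (\<lambda>x. frechet_derivative \<rho> (at x) i) f y" for i y
  define H where "H i y = mollify (\<lambda>x. frechet_derivative (\<lambda>x. frechet_derivative \<rho> (at x) i) (at x) i) f y" for i y
  have D: "((\<lambda>s. m (y + s *\<^sub>R i)) has_real_derivative D i (y + s *\<^sub>R i)) (at s)" if "i \<in> Basis" for i y s
    unfolding m_def D_def by (rule mollify_derivative[OF f t that])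
  have H: "((\<lambda>s. D i (y + s *\<^sub>R i)) has_real_derivative H i (y + s *\<^sub>R i)) (at s)" if "i \<in> Basis" for i y s
    unfolding H_def D_def using DERIV_minus[OF mollify_derivative[OF f test_partial[OF t that] that]] by simp
  have sumH: "(\<Sum>i\<in>Basis. H i y) = m y" for y
  proof -
    have sh: "frechet_derivative (\<lambda>x. frechet_derivative (\<lambda>z. \<rho> (z - y)) (at x) i) (at z) i
      = frechet_derivative (\<lambda>x. frechet_derivative \<rho> (at x) i) (at (z - y)) i" if "i \<in> Basis" for i z
      unfolding frechet_derivative_shift[OF t] by (simp add: frechet_derivative_shift[OF test_partial[OF t that], of y])
    show ?thesis unfolding H_def m_def mollify_def using eq[OF test_shift[OF t, of y]] by (simp add: sh)
  qed
  have dec: "\<exists>R. \<forall>y. R < norm y \<longrightarrow> \<bar>m y\<bar> < e" if "0 < e" for e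
    unfolding m_def by (rule mollify_decay[OF f t that])
  have cont: "continuous_on UNIV m" unfolding m_def by (rule mollify_continuous[OF f t])
  have "m 0 \<le> 0" by (rule maximum_principle[OF cont dec D H sumH])
  moreover have "- m 0 \<le> 0"
  proof (rule maximum_principle[of "\<lambda>y. - m y" "\<lambda>i y. - D i y" "\<lambda>i y. - H i y"])
    show "continuous_on UNIV (\<lambda>y. - m y)" by (intro continuous_intros cont)
    show "\<exists>R. \<forall>y. R < norm y \<longrightarrow> \<bar>- m y\<bar> < e" if "0 < e" for e using dec[OF that] by simp
  qed (use D H sumH in \<open>auto intro: DERIV_minus simp: sum_negf\<close>)
  ultimately have "m 0 = 0" by simp
  then show "(LINT x|lebesgue. bump k a b x *\<^sub>R f x) = 0"
    by (simp add: m_def mollify_def \<rho>_def mult.commute)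
qed

text \<open>The mollifications are constant along a coordinate line and tend to zero at infinity.\<close>

lemma L2_zero_if_gradient_zero:
  fixes f :: "'a::euclidean_space \<Rightarrow> real"
  assumes f: "f \<in> L2"
    and eq: "\<And>\<rho> i. test \<rho> \<Longrightarrow> i \<in> Basis \<Longrightarrow> (LINT z|lebesgue. f z * frechet_derivative \<rho> (at z) i) = 0"
  shows "AE z in lebesgue. f z = 0"
proof (rule L2_zero_if_orthogonal_to_bumps[OF f])
  fix k :: real and a b :: 'a assume k: "0 < k"
  define \<rho> where "\<rho> = bump k a b"
  have t: "test \<rho>" unfolding \<rho>_def by (rule test_bump[OF k])
  obtain i :: 'a where i: "i \<in> Basis" using nonempty_Basis by blast
  have "mollify (\<lambda>x. frechet_derivative \<rho> (at x) i) f y = 0" for y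
    using eq[OF test_shift[OF t, of y] i] by (simp add: mollify_def frechet_derivative_shift[OF t])
  then have "((\<lambda>s. mollify \<rho> f (0 + s *\<^sub>R i)) has_real_derivative 0) (at s)" for s
    using mollify_derivative[OF f t i, of 0 s] by simp
  then have const: "mollify \<rho> f (s *\<^sub>R i) = mollify \<rho> f 0" for s
    using DERIV_isconst_all[of "\<lambda>s. mollify \<rho> f (0 + s *\<^sub>R i)" s 0] by simp
  have "mollify \<rho> f 0 = 0"
  proof (rule ccontr)
    assume "mollify \<rho> f 0 \<noteq> 0"
    then obtain R where "\<forall>y. R < norm y \<longrightarrow> \<bar>mollify \<rho> f y\<bar> < \<bar>mollify \<rho> f 0\<bar>"
      using mollify_decay[OF f t, of "\<bar>mollify \<rho> f 0\<bar>"] by auto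
    then have "\<bar>mollify \<rho> f ((\<bar>R\<bar> + 1) *\<^sub>R i)\<bar> < \<bar>mollify \<rho> f 0\<bar>" using i by simp
    then show False using const by simp
  qed
  then show "(LINT x|lebesgue. bump k a b x *\<^sub>R f x) = 0"
    by (simp add: mollify_def \<rho>_def mult.commute)
qed

section \<open>The closed gradient operator\<close>

abbreviation part :: "'n \<Rightarrow> (real^'n \<Rightarrow> 'b::real_normed_vector) \<Rightarrow> real^'n \<Rightarrow> 'b" where
  "part j \<psi> \<equiv> (\<lambda>x. frechet_derivative \<psi> (at x) (axis j 1))"

lemma test_part: "test \<psi> \<Longrightarrow> test (part j \<psi>)"
  by (rule test_partial) (auto simp: Basis_vec_def)

text \<open>A scalar test function turned into a vector valued one by a real linear map \<open>L\<close>, as an element of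
  \<open>L\<^sup>2\<close>; \<open>tdiv\<close> is the sum of the corresponding first derivatives.\<close>

definition tvec :: "(complex \<Rightarrow> 'b::euclidean_space) \<Rightarrow> ('a::euclidean_space \<Rightarrow> complex) \<Rightarrow> ('a, 'b) l2" where
  "tvec L \<psi> = cls (\<lambda>x. L (\<psi> x))"

definition tdiv :: "('n \<Rightarrow> complex \<Rightarrow> 'b::euclidean_space) \<Rightarrow> (real^'n \<Rightarrow> complex) \<Rightarrow> (real^'n, 'b) l2" where
  "tdiv L \<psi> = (\<Sum>j\<in>UNIV. tvec (L j) (part j \<psi>))"

text \<open>The unit vectors carry a conjugation: the real inner product with \<open>e0 \<alpha> z\<close> is the real part of the
  complex bilinear product of the \<open>\<alpha>\<close>-th component with \<open>z\<close>, which is the pairing with a complex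
  test function.\<close>

definition e0 :: "'N \<Rightarrow> complex \<Rightarrow> complex^'N" where "e0 \<alpha> z = axis \<alpha> (cnj z)"
definition e1 :: "'n \<Rightarrow> 'N \<Rightarrow> complex \<Rightarrow> (complex^'N)^'n" where "e1 j \<alpha> z = axis j (axis \<alpha> (cnj z))"

lemma bounded_linear_e0: "bounded_linear (e0 \<alpha> :: complex \<Rightarrow> complex^'N)"
  unfolding linear_conv_bounded_linear[symmetric] e0_def
  by (rule linearI) (auto simp: vec_eq_iff axis_def)

lemma bounded_linear_e1: "bounded_linear (e1 j \<alpha> :: complex \<Rightarrow> (complex^'N)^'n)"
  unfolding linear_conv_bounded_linear[symmetric] e1_def
  by (rule linearI) (auto simp: vec_eq_iff axis_def)

lemma Re_mult_inner: "Re (z * c) = inner z (cnj c)"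
  by (simp add: inner_complex_def)

lemma tvec_L2: "bounded_linear L \<Longrightarrow> test \<psi> \<Longrightarrow> (\<lambda>x. L (\<psi> x)) \<in> L2"
  by (rule test_L2[OF test_bounded_linear])

lemma inner_tvec:
  assumes "bounded_linear L" "test \<psi>"
  shows "inner u (tvec L \<psi>) = (LINT x|lebesgue. inner (rep u x) (L (\<psi> x)))"
  using inner_cls[OF rep_L2 tvec_L2[OF assms], of u] by (simp add: tvec_def)

lemma component_integrable:
  fixes f :: "'a::euclidean_space \<Rightarrow> complex^'N"
  assumes "f \<in> L2" "test \<psi>"
  shows "integrable lebesgue (\<lambda>x. f x $ \<alpha> * \<psi> x)"
proof (rule L2_product_integrable[OF assms(1) test_L2[OF assms(2)], of _ 1])
  have "(\<lambda>x. f x $ \<alpha>) \<in> L2" by (rule L2_bounded_linear[OF bounded_linear_vec_nth assms(1)])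
  from L2D(1)[OF this] L2D(1)[OF test_L2[OF assms(2)]]
  show "(\<lambda>x. f x $ \<alpha> * \<psi> x) \<in> borel_measurable lebesgue" by (rule borel_measurable_times)
  show "norm (f x $ \<alpha> * \<psi> x) \<le> 1 * (norm (f x) * norm (\<psi> x))" for x
    using mult_right_mono[OF Finite_Cartesian_Product.norm_nth_le[of "f x" \<alpha>] norm_ge_zero[of "\<psi> x"]] by (simp add: norm_mult)
qed

text \<open>Complex pairings are encoded by two real ones: the imaginary part arises from the test function \<open>- \<i>
  \<psi>\<close>.\<close>

lemma component_integral:
  fixes u :: "('a::euclidean_space, complex^'N) l2"
  assumes "test \<psi>"
  shows "Re (LINT x|lebesgue. rep u x $ \<alpha> * \<psi> x) = inner u (tvec (e0 \<alpha>) \<psi>)"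
    and "Im (LINT x|lebesgue. rep u x $ \<alpha> * \<psi> x) = inner u (tvec (e0 \<alpha>) (\<lambda>x. - \<i> * \<psi> x))"
proof -
  have t': "test (\<lambda>x. - \<i> * \<psi> x)" by (rule test_bounded_linear[OF bounded_linear_mult_right assms])
  have *: "Re (LINT x|lebesgue. rep u x $ \<alpha> * \<psi> x) = inner u (tvec (e0 \<alpha>) \<psi>)" if "test \<psi>" for \<psi>
  proof -
    have "Re (LINT x|lebesgue. rep u x $ \<alpha> * \<psi> x) = (LINT x|lebesgue. Re (rep u x $ \<alpha> * \<psi> x))"
      by (rule Bochner_Integration.integral_bounded_linear[OF bounded_linear_Re component_integrable[OF rep_L2 that], symmetric])
    then show ?thesis unfolding inner_tvec[OF bounded_linear_e0 that] by (simp only: Re_mult_inner e0_def inner_axis)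
  qed
  show "Re (LINT x|lebesgue. rep u x $ \<alpha> * \<psi> x) = inner u (tvec (e0 \<alpha>) \<psi>)" by (rule *[OF assms])
  have "(LINT x|lebesgue. rep u x $ \<alpha> * (- \<i> * \<psi> x)) = - \<i> * (LINT x|lebesgue. rep u x $ \<alpha> * \<psi> x)"
    by (subst Bochner_Integration.integral_mult_right[OF component_integrable[OF rep_L2 assms], symmetric]) (simp add: mult_ac)
  then have "Re (LINT x|lebesgue. rep u x $ \<alpha> * (- \<i> * \<psi> x)) = Im (LINT x|lebesgue. rep u x $ \<alpha> * \<psi> x)" by simp
  then show "Im (LINT x|lebesgue. rep u x $ \<alpha> * \<psi> x) = inner u (tvec (e0 \<alpha>) (\<lambda>x. - \<i> * \<psi> x))"
    using *[OF t'] by simp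
qed

definition pr :: "'n \<Rightarrow> (real^'n, (complex^'N)^'n) l2 \<Rightarrow> (real^'n, complex^'N) l2" where
  "pr j y = cls (\<lambda>x. rep y x $ j)"

lemma pr_L2: "(\<lambda>x. rep y x $ j) \<in> L2"
  by (rule L2_bounded_linear[OF bounded_linear_vec_nth rep_L2])

lemma rep_pr: "AE x in lebesgue. rep (pr j y) x = rep y x $ j"
  unfolding pr_def by (rule rep_cls[OF pr_L2])

lemma inner_e1: "test \<psi> \<Longrightarrow> inner y (tvec (e1 j \<alpha>) \<psi>) = inner (pr j y) (tvec (e0 \<alpha>) \<psi>)"
  using inner_cls[OF pr_L2 tvec_L2[OF bounded_linear_e0, of \<psi> \<alpha>], of y j]
  by (simp add: inner_tvec bounded_linear_e1 tvec_def[of "e0 \<alpha>"] pr_def e0_def e1_def inner_axis)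

lemma part_mult: "test \<psi> \<Longrightarrow> part j (\<lambda>x. c * \<psi> x) = (\<lambda>x. c * part j \<psi> x)" for \<psi> :: "real^'n \<Rightarrow> complex"
  using frechet_derivative_bounded_linear[OF bounded_linear_mult_right, of \<psi> c] by blast

lemma L2_locally_integrable: assumes "f \<in> L2" shows "locally_integrable f"
  unfolding locally_integrable_def set_integrable_def
proof (intro allI impI)
  fix K :: "'a set" assume K: "compact K"
  then have Kb: "K \<in> sets lborel" using borel_compact by simp
  then have Km: "K \<in> sets lebesgue" by (rule sets_completionI_sets)
  have "indicat_real K \<in> L2"
    by (rule indicator_L2[OF Km]) (use emeasure_compact_finite[OF K] Kb in simp)
  then show "integrable lebesgue (\<lambda>x. indicat_real K x *\<^sub>R f x)"
    by (rule L2_product_integrable[OF _ assms, of _ _ 1])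
      (auto intro!: borel_measurable_scaleR borel_measurable_indicator Km L2D(1)[OF assms])
qed

lemma weak_gradient_iff:
  fixes g :: "(real^'n, complex^'N) l2"
  shows "weak_gradient (rep g) (rep y) \<longleftrightarrow>
    (\<forall>\<psi> j \<alpha>. test \<psi> \<longrightarrow> inner g (tvec (e0 \<alpha>) (part j \<psi>)) = - inner y (tvec (e1 j \<alpha>) \<psi>))" (is "?l \<longleftrightarrow> ?r")
proof -
  have prI: "(LINT x|lebesgue. rep y x $ j $ \<alpha> * \<psi> x) = (LINT x|lebesgue. rep (pr j y) x $ \<alpha> * \<psi> x)" if "test \<psi>" for \<psi> j \<alpha>
  proof (rule integral_cong_AE)
    have "(\<lambda>x. rep y x $ j $ \<alpha>) \<in> L2" by (rule L2_bounded_linear[OF bounded_linear_vec_nth pr_L2])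
    from L2D(1)[OF this] L2D(1)[OF test_L2[OF that]]
    show "(\<lambda>x. rep y x $ j $ \<alpha> * \<psi> x) \<in> borel_measurable lebesgue" by (rule borel_measurable_times)
    show "(\<lambda>x. rep (pr j y) x $ \<alpha> * \<psi> x) \<in> borel_measurable lebesgue"
      by (rule borel_measurable_integrable[OF component_integrable[OF rep_L2 that]])
    show "AE x in lebesgue. rep y x $ j $ \<alpha> * \<psi> x = rep (pr j y) x $ \<alpha> * \<psi> x" using rep_pr[of j y] by eventually_elim simp
  qed
  have l: "?l \<longleftrightarrow> (\<forall>\<psi> j \<alpha>. test \<psi> \<longrightarrow> (LINT x|lebesgue. rep g x $ \<alpha> * part j \<psi> x) = - (LINT x|lebesgue. rep (pr j y) x $ \<alpha> * \<psi> x))"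
    unfolding weak_gradient_def test_function_UNIV_iff using prI by (auto simp: L2_locally_integrable)
  show ?thesis
  proof
    assume ?l
    then have *: "\<And>\<psi> j \<alpha>. test \<psi> \<Longrightarrow> (LINT x|lebesgue. rep g x $ \<alpha> * part j \<psi> x) = - (LINT x|lebesgue. rep (pr j y) x $ \<alpha> * \<psi> x)"
      using l by blast
    show ?r
    proof (intro allI impI)
      fix \<psi> :: "real^'n \<Rightarrow> complex" and j \<alpha> assume t: "test \<psi>"
      show "inner g (tvec (e0 \<alpha>) (part j \<psi>)) = - inner y (tvec (e1 j \<alpha>) \<psi>)"
        using arg_cong[OF *[OF t, of \<alpha> j], of Re] component_integral(1)[OF test_part[OF t], of g \<alpha> j]
          component_integral(1)[OF t, of "pr j y" \<alpha>] by (simp add: inner_e1[OF t])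
    qed
  next
    assume r: ?r
    show ?l unfolding l
    proof (intro allI impI complex_eqI)
      fix \<psi> :: "real^'n \<Rightarrow> complex" and j \<alpha> assume t: "test \<psi>"
      have t': "test (\<lambda>x. - \<i> * \<psi> x)" by (rule test_bounded_linear[OF bounded_linear_mult_right t])
      show "Re (LINT x|lebesgue. rep g x $ \<alpha> * part j \<psi> x) = Re (- (LINT x|lebesgue. rep (pr j y) x $ \<alpha> * \<psi> x))"
        using r t component_integral(1)[OF test_part[OF t], of g \<alpha> j]
          component_integral(1)[OF t, of "pr j y" \<alpha>] by (simp add: inner_e1[OF t])
      have "inner g (tvec (e0 \<alpha>) (part j (\<lambda>x. - \<i> * \<psi> x))) = - inner y (tvec (e1 j \<alpha>) (\<lambda>x. - \<i> * \<psi> x))"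
        using r t' by blast
      then show "Im (LINT x|lebesgue. rep g x $ \<alpha> * part j \<psi> x) = Im (- (LINT x|lebesgue. rep (pr j y) x $ \<alpha> * \<psi> x))"
        unfolding part_mult[OF t] inner_e1[OF t']
        using component_integral(2)[OF test_part[OF t], of g \<alpha> j] component_integral(2)[OF t, of "pr j y" \<alpha>] by simp
    qed
  qed
qed

definition grad_graph :: "((real^'n, complex^'N) l2 \<times> (real^'n, (complex^'N)^'n) l2) set" where
  "grad_graph = {(g, y). weak_gradient (rep g) (rep y)}"

lemma grad_graph_iff:
  "(g, y) \<in> grad_graph \<longleftrightarrow>
    (\<forall>\<psi> j \<alpha>. test \<psi> \<longrightarrow> inner g (tvec (e0 \<alpha>) (part j \<psi>)) = - inner y (tvec (e1 j \<alpha>) \<psi>))"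
  unfolding grad_graph_def by (simp add: weak_gradient_iff)

lemma grad_graphD: "(g, y) \<in> grad_graph \<Longrightarrow> test \<psi> \<Longrightarrow> inner g (tvec (e0 \<alpha>) (part j \<psi>)) = - inner y (tvec (e1 j \<alpha>) \<psi>)"
  by (simp add: grad_graph_iff)

lemma grad_graph_INT:
  "grad_graph = (\<Inter>(\<psi>, j, \<alpha>)\<in>{(\<psi>, j, \<alpha>). test \<psi>}. {p. inner p (tvec (e0 \<alpha>) (part j \<psi>), tvec (e1 j \<alpha>) \<psi>) = 0})"
  by (auto simp: grad_graph_iff inner_prod_def eq_neg_iff_add_eq_0)

text \<open>An intersection of hyperplanes orthogonal to test data is closed.\<close>

lemma closed_grad_graph: "closed grad_graph"
  unfolding grad_graph_INT by (intro closed_INT ballI) (auto intro!: closed_Collect_eq continuous_intros)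

lemma subspace_grad_graph: "subspace grad_graph"
  unfolding grad_graph_INT by (intro subspace_Inter) (auto simp: subspace_def inner_add_left)

text \<open>Integration by parts for two test functions follows from the invariance of the inner product
  under simultaneous translation.\<close>

lemma inner_translation_invariant:
  fixes \<phi> \<psi> :: "'a::euclidean_space \<Rightarrow> 'b::euclidean_space"
  assumes "test \<phi>" "test \<psi>"
  shows "inner (cls (\<lambda>z. \<phi> (z - y))) (cls (\<lambda>z. \<psi> (z - y))) = inner (cls \<phi>) (cls \<psi>)"
proof -
  define k where "k x = inner (\<phi> x) (\<psi> x)" for x
  have "continuous_on UNIV k" unfolding k_def by (intro continuous_intros test_continuous assms)
  then have [measurable]: "k \<in> borel_measurable borel" by (rule borel_measurable_continuous_onI)
  have "inner (cls (\<lambda>z. \<phi> (z - y))) (cls (\<lambda>z. \<psi> (z - y))) = (LINT z|lebesgue. k (- y + z))"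
    by (subst inner_cls) (auto intro!: test_L2 test_shift assms simp: k_def)
  also have "\<dots> = (LINT z|lborel. k (- y + z))" by (rule integral_completion) measurable
  also have "\<dots> = (LINT z|distr lborel borel ((+) (- y)). k z)" by (subst integral_distr) auto
  also have "\<dots> = (LINT z|lebesgue. k z)" unfolding lborel_distr_plus by (rule integral_completion[symmetric]) simp
  also have "\<dots> = inner (cls \<phi>) (cls \<psi>)" by (simp add: inner_cls test_L2 assms k_def)
  finally show ?thesis .
qed

lemma integration_by_parts:
  fixes \<phi> \<psi> :: "real^'n \<Rightarrow> 'b::euclidean_space"
  assumes t: "test \<phi>" "test \<psi>"
  shows "inner (cls \<phi>) (cls (part j \<psi>)) = - inner (cls (part j \<phi>)) (cls \<psi>)"
proof -
  have i: "axis j 1 \<in> (Basis :: (real^'n) set)" by (auto simp: Basis_vec_def)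
  have "((\<lambda>s. inner (cls (\<lambda>z. \<phi> (z - (0 + s *\<^sub>R axis j 1)))) (cls (\<lambda>z. \<psi> (z - (0 + s *\<^sub>R axis j 1))))) has_vector_derivative
     inner (cls (\<lambda>z. \<phi> (z - (0 + 0 *\<^sub>R axis j 1)))) (- cls (\<lambda>z. frechet_derivative \<psi> (at (z - (0 + 0 *\<^sub>R axis j 1))) (axis j 1)))
     + inner (- cls (\<lambda>z. frechet_derivative \<phi> (at (z - (0 + 0 *\<^sub>R axis j 1))) (axis j 1))) (cls (\<lambda>z. \<psi> (z - (0 + 0 *\<^sub>R axis j 1))))) (at 0)"
    by (intro bounded_bilinear.has_vector_derivative[OF bounded_bilinear_inner] translation_derivative t i)
  then have "((\<lambda>s::real. inner (cls \<phi>) (cls \<psi>)) has_vector_derivative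
     - inner (cls \<phi>) (cls (part j \<psi>)) - inner (cls (part j \<phi>)) (cls \<psi>)) (at 0)"
    unfolding inner_translation_invariant[OF t] by simp
  then have "- inner (cls \<phi>) (cls (part j \<psi>)) - inner (cls (part j \<phi>)) (cls \<psi>) = 0"
    using vector_derivative_unique_at has_vector_derivative_const by blast
  then show ?thesis by simp
qed

lemma part_tvec: "bounded_linear L \<Longrightarrow> test \<psi> \<Longrightarrow> part j (\<lambda>x. L (\<psi> x)) = (\<lambda>x. L (part j \<psi> x))"
  by (simp add: frechet_derivative_bounded_linear)

text \<open>For test functions the classical gradient is the weak one, by \<open>integration_by_parts\<close>.\<close>

lemma test_in_grad_graph:
  fixes \<phi> :: "real^'n \<Rightarrow> complex" and \<alpha> :: "'N::finite"
  assumes t: "test \<phi>"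
  shows "(tvec (e0 \<alpha>) \<phi>, tdiv (\<lambda>j. e1 j \<alpha>) \<phi>) \<in> grad_graph"
  unfolding grad_graph_iff
proof (intro allI impI)
  fix \<psi> :: "real^'n \<Rightarrow> complex" and j and \<beta> :: 'N assume t': "test \<psi>"
  note tl = test_bounded_linear[OF bounded_linear_e0]
  have pp: "pr j (tvec (e1 k \<alpha>) (part k \<phi>)) = (if k = j then tvec (e0 \<alpha>) (part j \<phi>) else 0)" for k
  proof (rule l2_eqI)
    have L: "(\<lambda>x. e1 k \<alpha> (part k \<phi> x)) \<in> L2" by (rule tvec_L2[OF bounded_linear_e1 test_part[OF t]])
    have L0: "(\<lambda>x. e0 \<alpha> (part j \<phi> x)) \<in> L2" by (rule tvec_L2[OF bounded_linear_e0 test_part[OF t]])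
    show "AE x in lebesgue. rep (pr j (tvec (e1 k \<alpha>) (part k \<phi>))) x = rep (if k = j then tvec (e0 \<alpha>) (part j \<phi>) else 0) x"
      using rep_pr[of j "tvec (e1 k \<alpha>) (part k \<phi>)"] rep_cls[OF L] rep_cls[OF L0] rep_zero
      by eventually_elim (auto simp: tvec_def e1_def e0_def axis_def)
  qed
  have "inner (tdiv (\<lambda>j. e1 j \<alpha>) \<phi>) (tvec (e1 j \<beta>) \<psi>) = (\<Sum>k\<in>UNIV. inner (tvec (e1 k \<alpha>) (part k \<phi>)) (tvec (e1 j \<beta>) \<psi>))"
    by (simp add: tdiv_def inner_sum_left)
  also have "\<dots> = (\<Sum>k\<in>UNIV. if k = j then inner (tvec (e0 \<alpha>) (part j \<phi>)) (tvec (e0 \<beta>) \<psi>) else 0)"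
    by (rule sum.cong) (auto simp: inner_e1[OF t'] pp)
  also have "\<dots> = inner (tvec (e0 \<alpha>) (part j \<phi>)) (tvec (e0 \<beta>) \<psi>)" by simp
  finally have "inner (tdiv (\<lambda>j. e1 j \<alpha>) \<phi>) (tvec (e1 j \<beta>) \<psi>) = inner (tvec (e0 \<alpha>) (part j \<phi>)) (tvec (e0 \<beta>) \<psi>)" .
  moreover have "inner (tvec (e0 \<alpha>) \<phi>) (tvec (e0 \<beta>) (part j \<psi>)) = - inner (tvec (e0 \<alpha>) (part j \<phi>)) (tvec (e0 \<beta>) \<psi>)"
    using integration_by_parts[OF tl[OF t, of \<alpha>] tl[OF t', of \<beta>], of j]
    by (simp add: tvec_def part_tvec[OF bounded_linear_e0 t] part_tvec[OF bounded_linear_e0 t'])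
  ultimately show "inner (tvec (e0 \<alpha>) \<phi>) (tvec (e0 \<beta>) (part j \<psi>)) = - inner (tdiv (\<lambda>j. e1 j \<alpha>) \<phi>) (tvec (e1 j \<beta>) \<psi>)"
    by simp
qed

lemma complex_test: "test \<rho> \<Longrightarrow> test (\<lambda>x. c * complex_of_real (\<rho> x))" for \<rho> :: "'a::euclidean_space \<Rightarrow> real"
  by (rule test_bounded_linear[OF bounded_linear_compose[OF bounded_linear_mult_right bounded_linear_of_real]])

lemma part_complex: "test \<rho> \<Longrightarrow> part j (\<lambda>x. c * complex_of_real (\<rho> x)) = (\<lambda>x. c * complex_of_real (part j \<rho> x))" for \<rho> :: "real^'n \<Rightarrow> real"
  using frechet_derivative_bounded_linear[OF bounded_linear_compose[OF bounded_linear_mult_right bounded_linear_of_real], of \<rho> c]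
  by (simp add: o_def)

lemma L2_scalar: "(\<lambda>x. Re (rep u x $ \<alpha> * c)) \<in> L2" for u :: "('a::euclidean_space, complex^'N) l2"
  by (rule L2_bounded_linear[OF bounded_linear_compose[OF bounded_linear_Re bounded_linear_compose[OF bounded_linear_mult_left bounded_linear_vec_nth]] rep_L2])

lemma inner_scalar_test:
  fixes u :: "('a::euclidean_space, complex^'N) l2" and \<rho> :: "'a \<Rightarrow> real"
  assumes "test \<rho>"
  shows "inner u (tvec (e0 \<alpha>) (\<lambda>x. c * complex_of_real (\<rho> x))) = (LINT x|lebesgue. Re (rep u x $ \<alpha> * c) * \<rho> x)"
  unfolding inner_tvec[OF bounded_linear_e0 complex_test[OF assms]]
  by (rule Bochner_Integration.integral_cong) (simp_all add: e0_def inner_axis inner_complex_def algebra_simps)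

lemma l2_zeroI:
  fixes u :: "('a::euclidean_space, complex^'N) l2"
  assumes "\<And>\<alpha> c. AE x in lebesgue. Re (rep u x $ \<alpha> * c) = 0"
  shows "u = 0"
proof (rule l2_eqI)
  have "AE x in lebesgue. \<forall>\<alpha>\<in>UNIV. Re (rep u x $ \<alpha> * 1) = 0 \<and> Re (rep u x $ \<alpha> * (- \<i>)) = 0"
    using assms[of _ 1] assms[of _ "- \<i>"] by (intro AE_finite_allI) (auto simp del: mult_1_right)
  moreover have "AE x in lebesgue. rep (0 :: ('a, complex^'N) l2) x = 0" by (rule rep_zero)
  ultimately show "AE x in lebesgue. rep u x = rep 0 x"
    by eventually_elim (simp add: vec_eq_iff complex_eq_iff)
qed

lemma zero_if_orthogonal_to_tests:
  fixes u :: "('a::euclidean_space, complex^'N) l2"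
  assumes "\<And>\<psi> \<alpha>. test \<psi> \<Longrightarrow> inner u (tvec (e0 \<alpha>) \<psi>) = 0"
  shows "u = 0"
proof (rule l2_zeroI)
  fix \<alpha> c
  show "AE x in lebesgue. Re (rep u x $ \<alpha> * c) = 0"
  proof (rule L2_zero_if_orthogonal_to_bumps[OF L2_scalar])
    fix k :: real and a b :: 'a assume "0 < k"
    from assms[OF complex_test[OF test_bump[OF this]], of \<alpha> c a b] inner_scalar_test[OF test_bump[OF \<open>0 < k\<close>], of u \<alpha> c a b]
    show "(LINT x|lebesgue. bump k a b x *\<^sub>R Re (rep u x $ \<alpha> * c)) = 0" by (simp add: mult.commute)
  qed
qed

lemma zero_if_components_zero:
  fixes y :: "(real^'n, (complex^'N)^'n) l2"
  assumes a: "\<And>j. pr j y = 0" shows "y = 0"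
proof (rule l2_eqI)
  have z: "AE x in lebesgue. rep (0 :: (real^'n, complex^'N) l2) x = 0" by (rule rep_zero)
  have "AE x in lebesgue. rep y x $ j = 0" for j using rep_pr[of j y] z by eventually_elim (simp add: a)
  then have "AE x in lebesgue. \<forall>j\<in>UNIV. rep y x $ j = 0" by (intro AE_finite_allI) auto
  moreover have "AE x in lebesgue. rep (0 :: (real^'n, (complex^'N)^'n) l2) x = 0" by (rule rep_zero)
  ultimately show "AE x in lebesgue. rep y x = rep 0 x" by eventually_elim (simp add: vec_eq_iff)
qed

lemma sum_Basis_axis: "(\<Sum>i\<in>(Basis :: (real^'n) set). F i) = (\<Sum>j\<in>UNIV. F (axis j 1))"
proof -
  have B: "(Basis :: (real^'n) set) = range (\<lambda>j. axis j 1)" by (auto simp: Basis_vec_def)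
  have inj: "inj (\<lambda>j. axis j (1::real) :: real^'n)" by (auto simp: inj_def axis_eq_axis)
  show ?thesis unfolding B by (subst sum.reindex[OF inj]) (simp add: o_def)
qed

lemma grad_graph_scalar:
  assumes G: "(g, y) \<in> grad_graph" and t: "test \<rho>"
  shows "(LINT x|lebesgue. Re (rep g x $ \<alpha> * c) * part j \<rho> x) = - (LINT x|lebesgue. Re (rep (pr j y) x $ \<alpha> * c) * \<rho> x)"
  using grad_graphD[OF G complex_test[OF t, of c], where \<alpha> = \<alpha> and j = j]
  unfolding part_complex[OF t] inner_e1[OF complex_test[OF t]] inner_scalar_test[OF t] inner_scalar_test[OF test_part[OF t]] .

lemma grad_graph_injective:
  fixes g :: "(real^'n, complex^'N) l2"
  assumes G: "(g, 0) \<in> grad_graph" shows "g = 0"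
proof (rule l2_zeroI, rule L2_zero_if_gradient_zero[OF L2_scalar])
  fix \<alpha> c and \<rho> :: "real^'n \<Rightarrow> real" and i :: "real^'n" assume t: "test \<rho>" and "i \<in> Basis"
  then obtain j where i: "i = axis j 1" by (auto simp: Basis_vec_def)
  show "(LINT z|lebesgue. Re (rep g z $ \<alpha> * c) * frechet_derivative \<rho> (at z) i) = 0"
    using grad_graphD[OF G complex_test[OF t, of c], where \<alpha> = \<alpha> and j = j]
    unfolding part_complex[OF t] inner_scalar_test[OF test_part[OF t]] i by simp
qed

text \<open>A pair in the graph orthogonal to all pairs \<open>(\<phi>, \<nabla> \<phi>)\<close> satisfies \<open>\<Delta> g =
  g\<close> in the sense of distributions.\<close>

lemma grad_graph_core:
  fixes g :: "(real^'n, complex^'N) l2"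
  assumes G: "(g, y) \<in> grad_graph"
    and orth: "\<And>\<phi> \<alpha>. test \<phi> \<Longrightarrow> inner g (tvec (e0 \<alpha>) \<phi>) + inner y (tdiv (\<lambda>j. e1 j \<alpha>) \<phi>) = 0"
  shows "g = 0 \<and> y = 0"
proof -
  have "g = 0"
  proof (rule l2_zeroI, rule L2_zero_if_helmholtz[OF L2_scalar])
    fix \<alpha> c and \<rho> :: "real^'n \<Rightarrow> real" assume t: "test \<rho>"
    have "inner y (tdiv (\<lambda>j. e1 j \<alpha>) (\<lambda>x. c * complex_of_real (\<rho> x)))
       = (\<Sum>j\<in>UNIV. LINT x|lebesgue. Re (rep (pr j y) x $ \<alpha> * c) * part j \<rho> x)"
      unfolding tdiv_def inner_sum_right part_complex[OF t]
      by (rule sum.cong) (auto simp: inner_e1[OF complex_test[OF test_part[OF t]]] inner_scalar_test[OF test_part[OF t]])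
    then have "(LINT x|lebesgue. Re (rep g x $ \<alpha> * c) * \<rho> x) = - (\<Sum>j\<in>UNIV. LINT x|lebesgue. Re (rep (pr j y) x $ \<alpha> * c) * part j \<rho> x)"
      using orth[OF complex_test[OF t, of c], of \<alpha>] by (simp add: inner_scalar_test[OF t])
    also have "\<dots> = (\<Sum>j\<in>UNIV. LINT x|lebesgue. Re (rep g x $ \<alpha> * c) * part j (part j \<rho>) x)"
      unfolding grad_graph_scalar[OF G test_part[OF t]] by (simp add: sum_negf)
    finally show "(\<Sum>i\<in>Basis. LINT z|lebesgue. Re (rep g z $ \<alpha> * c) * frechet_derivative (\<lambda>x. frechet_derivative \<rho> (at x) i) (at z) i)
       = (LINT z|lebesgue. Re (rep g z $ \<alpha> * c) * \<rho> z)" by (simp add: sum_Basis_axis)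
  qed
  moreover have "y = 0"
  proof (rule zero_if_components_zero, rule zero_if_orthogonal_to_tests)
    fix j and \<psi> :: "real^'n \<Rightarrow> complex" and \<alpha> :: 'N assume t: "test \<psi>"
    show "inner (pr j y) (tvec (e0 \<alpha>) \<psi>) = 0"
      using grad_graphD[OF G t, of \<alpha> j] \<open>g = 0\<close> by (simp add: inner_e1[OF t])
  qed
  ultimately show ?thesis by blast
qed

text \<open>The test functions are a core of the gradient: the orthogonal complement, within the graph, of the closed span of the
  test pairs is trivial. A divergence equation known for test functions thus holds for all pairs in the graph.\<close>

lemma grad_graph_extend:
  fixes a :: "(real^'n, complex^'N) l2"
  assumes eq: "\<And>\<phi> \<alpha>. test \<phi> \<Longrightarrow> inner a (tvec (e0 \<alpha>) \<phi>) = inner b (tdiv (\<lambda>j. e1 j \<alpha>) \<phi>)"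
    and G: "(g, y) \<in> grad_graph"
  shows "inner a g = inner b y"
proof -
  define T where "T = closure (span {(tvec (e0 \<alpha>) \<phi>, tdiv (\<lambda>j. e1 j \<alpha>) \<phi>) | \<phi> (\<alpha>::'N). test \<phi>} :: ((real^'n, complex^'N) l2 \<times> _) set)"
  have T: "closed T" "subspace T" unfolding T_def by (auto intro: subspace_closure' subspace_span)
  have base: "(tvec (e0 \<alpha>) \<phi>, tdiv (\<lambda>j. e1 j \<alpha>) \<phi>) \<in> T" if "test \<phi>" for \<phi> \<alpha>
    unfolding T_def by (rule subsetD[OF closure_subset], rule span_base) (use that in blast)
  have TG: "T \<subseteq> grad_graph"
    unfolding T_def
    by (intro closure_minimal span_minimal closed_grad_graph subspace_grad_graph)
      (auto intro: test_in_grad_graph)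
  have Teq: "inner (a, - b) p = 0" if "p \<in> T" for p
  proof -
    have "T \<subseteq> {p. inner (a, - b) p = 0}"
      unfolding T_def using eq
      by (intro closure_minimal span_minimal closed_Collect_eq continuous_intros)
        (auto simp: subspace_def inner_add_right inner_prod_def)
    then show ?thesis using that by blast
  qed
  obtain z where z: "z \<in> T" "\<forall>v\<in>T. inner ((g, y) - z) v = 0" using closed_subspace_projection[OF T] by blast
  have "(g, y) - z \<in> grad_graph" using subspace_diff[OF subspace_grad_graph G] TG z(1) by blast
  then have "(g - fst z, y - snd z) \<in> grad_graph" by (simp add: minus_prod_def)
  moreover have "inner (g - fst z) (tvec (e0 \<alpha>) \<phi>) + inner (y - snd z) (tdiv (\<lambda>j. e1 j \<alpha>) \<phi>) = 0" if "test \<phi>" for \<phi> \<alpha>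
    using z(2) base[OF that, of \<alpha>] by (force simp: inner_prod_def)
  ultimately have "g = fst z" "y = snd z" using grad_graph_core by (metis eq_iff_diff_eq_0)+
  then have "(g, y) \<in> T" using z(1) by simp
  from Teq[OF this] show ?thesis by (simp add: inner_prod_def)
qed

lemma grad_graph_dense: "closure (fst ` (grad_graph :: ((real^'n, complex^'N) l2 \<times> _) set)) = UNIV"
proof (rule dense_if_orthogonal_trivial)
  show "subspace (fst ` (grad_graph :: ((real^'n, complex^'N) l2 \<times> _) set))"
    by (rule linear_subspace_image[OF bounded_linear.linear[OF bounded_linear_fst] subspace_grad_graph])
  fix u assume "\<And>s. s \<in> fst ` (grad_graph :: ((real^'n, complex^'N) l2 \<times> _) set) \<Longrightarrow> inner u s = 0"
  then show "u = 0" using test_in_grad_graph by (intro zero_if_orthogonal_to_tests) force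
qed

text \<open>Gradients are curl free. Differentiating the weak gradient relation along translates of the test
  function shows this without interchanging second derivatives.\<close>

lemma grad_graph_curl:
  fixes y :: "(real^'n, (complex^'N)^'n) l2"
  assumes y: "y \<in> closure (snd ` grad_graph)" and t: "test \<phi>"
  shows "inner y (tvec (e1 j \<alpha>) (part i \<phi>)) = inner y (tvec (e1 i \<alpha>) (part j \<phi>))"
proof -
  have "inner y (tvec (e1 j \<alpha>) (part i \<phi>)) = inner y (tvec (e1 i \<alpha>) (part j \<phi>))"
    if G: "(g, y) \<in> grad_graph" for g :: "(real^'n, complex^'N) l2" and y
  proof -
    have i: "axis i 1 \<in> (Basis :: (real^'n) set)" by (auto simp: Basis_vec_def)
    have e: "inner y (tvec (e1 j \<alpha>) (\<lambda>z. \<phi> (z - (0 + s *\<^sub>R axis i 1))))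
        = - inner g (tvec (e0 \<alpha>) (\<lambda>z. part j \<phi> (z - (0 + s *\<^sub>R axis i 1))))" for s
      using grad_graphD[OF G test_shift[OF t, of "0 + s *\<^sub>R axis i 1"], of \<alpha> j]
      by (simp add: frechet_derivative_shift[OF t])
    note d1 = translation_derivative[OF test_bounded_linear[OF bounded_linear_e1[of j \<alpha>] t] i, of 0 0]
    note d2 = translation_derivative[OF test_bounded_linear[OF bounded_linear_e0[of \<alpha>] test_part[OF t, of j]] i, of 0 0]
    have "((\<lambda>s. inner y (tvec (e1 j \<alpha>) (\<lambda>z. \<phi> (z - (0 + s *\<^sub>R axis i 1))))) has_vector_derivative
        inner y (- tvec (e1 j \<alpha>) (part i \<phi>))) (at 0)"
      using bounded_linear.has_vector_derivative[OF bounded_linear_inner_right d1, of y]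
      by (simp add: tvec_def frechet_derivative_bounded_linear[OF bounded_linear_e1 t])
    moreover have "((\<lambda>s. - inner g (tvec (e0 \<alpha>) (\<lambda>z. part j \<phi> (z - (0 + s *\<^sub>R axis i 1))))) has_vector_derivative
        - inner g (- tvec (e0 \<alpha>) (part i (part j \<phi>)))) (at 0)"
      using has_vector_derivative_minus[OF bounded_linear.has_vector_derivative[OF bounded_linear_inner_right d2, of g]]
      by (simp add: tvec_def frechet_derivative_bounded_linear[OF bounded_linear_e0 test_part[OF t]])
    ultimately have "inner y (- tvec (e1 j \<alpha>) (part i \<phi>)) = - inner g (- tvec (e0 \<alpha>) (part i (part j \<phi>)))"
      unfolding e using vector_derivative_unique_at by blast
    then have "inner y (tvec (e1 j \<alpha>) (part i \<phi>)) = - inner g (tvec (e0 \<alpha>) (part i (part j \<phi>)))" by simp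
    also have "\<dots> = inner y (tvec (e1 i \<alpha>) (part j \<phi>))" using grad_graphD[OF G test_part[OF t, of j], where \<alpha> = \<alpha> and j = i] by simp
    finally show ?thesis .
  qed
  then have "snd ` grad_graph \<subseteq> {y. inner y (tvec (e1 j \<alpha>) (part i \<phi>)) = inner y (tvec (e1 i \<alpha>) (part j \<phi>))}" by auto
  then have "closure (snd ` grad_graph) \<subseteq> {y. inner y (tvec (e1 j \<alpha>) (part i \<phi>)) = inner y (tvec (e1 i \<alpha>) (part j \<phi>))}"
    by (intro closure_minimal closed_Collect_eq continuous_intros)
  then show ?thesis using y by blast
qed

section \<open>Distributional evolution equations on the half-space\<close>

abbreviation slice :: "(real \<times> 'a \<Rightarrow> complex) \<Rightarrow> real \<Rightarrow> 'a \<Rightarrow> complex" where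
  "slice \<phi> t \<equiv> (\<lambda>x. \<phi> (t, x))"

definition dir :: "'n option \<Rightarrow> real \<times> (real^'n)" where
  "dir i = (case i of None \<Rightarrow> (1, 0) | Some j \<Rightarrow> (0, axis j 1))"

abbreviation pd :: "'n option \<Rightarrow> (real \<times> (real^'n) \<Rightarrow> complex) \<Rightarrow> real \<times> (real^'n) \<Rightarrow> complex" where
  "pd i \<phi> \<equiv> (\<lambda>p. frechet_derivative \<phi> (at p) (dir i))"

lemma pderiv_tx_slice: "pderiv_tx i \<phi> t = slice (pd i \<phi>) t"
  by (rule ext) (simp add: pderiv_tx_def dir_def split: option.split)

lemma dir_Basis: "dir i \<in> Basis"
  by (auto simp: dir_def Basis_prod_def Basis_vec_def split: option.split)

lemma test_pd: "test \<phi> \<Longrightarrow> test (pd i \<phi>)"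
  by (rule test_partial[OF _ dir_Basis])

lemma half_space_test: "test_function half_space \<phi> \<Longrightarrow> test \<phi>"
  by (auto simp: test_function_def test_def)

text \<open>The projection of the support to the \<open>t\<close>-axis is compact in \<open>(0, \<infinity>)\<close>. The interval
  is chosen larger than this projection, so that the derivatives vanish outside it as well.\<close>

lemma half_space_support:
  fixes \<phi> :: "real \<times> (real^'n) \<Rightarrow> complex"
  assumes "test_function half_space \<phi>"
  obtains a b where "0 < a" "a < b" "\<And>t x. t \<notin> {a<..<b} \<Longrightarrow> \<phi> (t, x) = 0"
    "\<And>i t x. t \<notin> {a<..<b} \<Longrightarrow> pd i \<phi> (t, x) = 0"
proof -
  obtain K where K: "compact K" "K \<subseteq> half_space" "\<And>z. z \<notin> K \<Longrightarrow> \<phi> z = 0"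
    using assms by (auto simp: test_function_def)
  show ?thesis
  proof (cases "K = {}")
    case True
    then have "\<phi> = (\<lambda>z. 0)" using K(3) by auto
    then show ?thesis by (intro that[of 1 2]) (auto simp: frechet_derivative_eq[OF has_derivative_const])
  next
    case False
    have cK: "compact (fst ` K)" by (rule compact_continuous_image[OF continuous_on_fst[OF continuous_on_id] K(1)])
    obtain l where l: "l \<in> fst ` K" "\<forall>t\<in>fst ` K. l \<le> t" using compact_attains_inf[OF cK] False by auto
    obtain u where u: "u \<in> fst ` K" "\<forall>t\<in>fst ` K. t \<le> u" using compact_attains_sup[OF cK] False by auto
    have "0 < l" using l(1) K(2) by (auto simp: half_space_def)
    moreover have "l \<le> u" using l u by blast
    ultimately show ?thesis
    proof (intro that[of "l/2" "u+1"])
      fix t x assume "t \<notin> {l/2<..<u+1}"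
      then have tK: "t \<notin> fst ` K" using l(2) u(2) \<open>0 < l\<close> by force
      then show "\<phi> (t, x) = 0" using K(3) by force
      have "frechet_derivative \<phi> (at (t, x)) = (\<lambda>h. 0)"
        by (rule frechet_derivative_zero[of "- K"]) (use tK K(3) compact_imp_closed[OF K(1)] in force)+
      then show "pd i \<phi> (t, x) = 0" for i by simp
    qed auto
  qed
qed

lemma half_space_pd:
  assumes "test_function half_space \<phi>" shows "test_function half_space (pd i \<phi>)"
proof -
  obtain K where K: "compact K" "K \<subseteq> half_space" "\<And>z. z \<notin> K \<Longrightarrow> \<phi> z = 0"
    using assms by (auto simp: test_function_def)
  have "pd i \<phi> z = 0" if "z \<notin> K" for z
    using frechet_derivative_zero[of "- K" z \<phi>] that K compact_imp_closed by force
  then show ?thesis using K test_Ck[OF test_pd[OF half_space_test[OF assms]]] by (auto simp: test_function_def)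
qed

lemma half_space_mult:
  assumes "test_function half_space \<phi>" shows "test_function half_space (\<lambda>p. c * \<phi> p)"
  using assms Ck_bounded_linear[OF bounded_linear_mult_right[of c], of _ \<phi>] unfolding test_function_def
  by (metis mult_zero_right)

lemma pd_mult: "test \<phi> \<Longrightarrow> pd i (\<lambda>p. c * \<phi> p) = (\<lambda>p. c * pd i \<phi> p)"
  using frechet_derivative_bounded_linear[OF bounded_linear_mult_right, of \<phi> c] by blast

lemma slice_test:
  fixes \<phi> :: "real \<times> (real^'n) \<Rightarrow> complex"
  assumes "test \<phi>" shows "test (slice \<phi> t)"
proof -
  obtain K where K: "compact K" "\<And>x. x \<notin> K \<Longrightarrow> \<phi> x = 0" using testE[OF assms] by blast
  have lin: "linear (\<lambda>x::real^'n. (0::real, x))" by (rule linearI) auto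
  have "Ck k (slice \<phi> t)" for k
    using Ck_affine[OF lin test_Ck[OF assms], of k "(t, 0)"] by simp
  moreover have "compact (snd ` K)"
    by (rule compact_continuous_image[OF continuous_on_snd[OF continuous_on_id] K(1)])
  moreover have "\<phi> (t, x) = 0" if "x \<notin> snd ` K" for x using that K(2)[of "(t, x)"] by force
  ultimately show ?thesis unfolding test_def by blast
qed

lemma part_slice:
  fixes \<phi> :: "real \<times> (real^'n) \<Rightarrow> complex"
  assumes "test \<phi>" shows "part j (slice \<phi> t) = slice (pd (Some j) \<phi>) t"
proof
  fix x :: "real^'n"
  have "((\<lambda>x. (t, x)) has_derivative (\<lambda>h. (0, h))) (at x)" by (auto intro!: derivative_eq_intros)
  from has_derivative_compose[of "\<lambda>x::real^'n. (t, x)" "\<lambda>h. (0, h)" x UNIV \<phi>, OF this test_derivative[OF assms]]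
  have "frechet_derivative (slice \<phi> t) (at x) = (\<lambda>h. frechet_derivative \<phi> (at (t, x)) (0, h))"
    by (intro frechet_derivative_eq)
  then show "part j (slice \<phi> t) x = slice (pd (Some j) \<phi>) t x" by (simp add: dir_def)
qed

abbreviation tv :: "'N \<Rightarrow> ('a::euclidean_space \<Rightarrow> complex) \<Rightarrow> ('a, complex^'N) l2" where
  "tv \<alpha> \<equiv> tvec (e0 \<alpha>)"

lemma slice_curve:
  fixes \<phi> :: "real \<times> (real^'n) \<Rightarrow> complex"
  assumes t: "test \<phi>"
  shows "((\<lambda>t. tv \<alpha> (slice \<phi> t)) has_vector_derivative tv \<alpha> (slice (pd None \<phi>) t0)) (at t0)"
proof -
  obtain K where K: "compact K" "\<And>x. x \<notin> K \<Longrightarrow> \<phi> x = 0" using testE[OF t] by blast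
  note bl = bounded_linear_e0[of \<alpha>]
  have cpd: "continuous_on UNIV (\<lambda>p. e0 \<alpha> (pd None \<phi> p))"
    by (rule bounded_linear.continuous_on[OF bl test_continuous[OF test_pd[OF t]]])
  have c: "continuous_on UNIV (\<lambda>p. e0 \<alpha> (\<phi> p))"
    by (rule bounded_linear.continuous_on[OF bl test_continuous[OF t]])
  show ?thesis unfolding tvec_def
  proof (rule L2_curve_derivative[of "\<lambda>t x. e0 \<alpha> (\<phi> (t, x))" "\<lambda>t x. e0 \<alpha> (pd None \<phi> (t, x))" "snd ` K" 1])
    show "((\<lambda>t. e0 \<alpha> (\<phi> (t, x))) has_vector_derivative e0 \<alpha> (pd None \<phi> (t, x))) (at t)" for t x
    proof (rule bounded_linear.has_vector_derivative[OF bl])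
      have "((\<lambda>t. (t, x)) has_derivative (\<lambda>h. (h, 0))) (at t)" by (auto intro!: derivative_eq_intros)
      from has_derivative_compose[of "\<lambda>t. (t, x)" "\<lambda>h::real. (h, 0::real^'n)" t UNIV \<phi>, OF this test_derivative[OF assms]]
      have d: "((\<lambda>t. \<phi> (t, x)) has_derivative (\<lambda>h. frechet_derivative \<phi> (at (t, x)) (h, 0))) (at t)" .
      have "frechet_derivative \<phi> (at (t, x)) (h, 0) = h *\<^sub>R pd None \<phi> (t, x)" for h
        using linear_scale[OF has_derivative_linear[OF test_derivative[OF t, of "(t, x)"]], of h "(1, 0)"]
        by (simp add: dir_def)
      with d show "((\<lambda>t. \<phi> (t, x)) has_vector_derivative pd None \<phi> (t, x)) (at t)" by (simp add: has_vector_derivative_def)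
    qed
    show "continuous_on UNIV (\<lambda>p. e0 \<alpha> (pd None \<phi> (fst p, snd p)))" using cpd by simp
    show "continuous_on UNIV (\<lambda>x. e0 \<alpha> (\<phi> (t, x)))" for t
      by (rule continuous_on_compose2[OF c]) (auto intro!: continuous_intros)
    show "compact (snd ` K)"
      by (rule compact_continuous_image[OF continuous_on_snd[OF continuous_on_id] K(1)])
    show "e0 \<alpha> (\<phi> (t, x)) = 0" if "x \<notin> snd ` K" for t x
      using that K(2)[of "(t, x)"] linear_0[OF bounded_linear.linear[OF bl]] by force
  qed simp
qed

lemma slice_curve_continuous:
  fixes \<phi> :: "real \<times> (real^'n) \<Rightarrow> complex"
  shows "test \<phi> \<Longrightarrow> continuous_on S (\<lambda>t. tv \<alpha> (slice \<phi> t))"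
  by (rule continuous_at_imp_continuous_on) (auto intro!: has_vector_derivative_continuous slice_curve)

lemma time_integral:
  fixes c :: "real \<Rightarrow> 'b::euclidean_space"
  assumes "0 < a" "continuous_on {a..b} c" "\<And>t. 0 < t \<Longrightarrow> t \<notin> {a<..<b} \<Longrightarrow> c t = 0"
  shows "set_integrable lebesgue {0<..} c" "(LINT t:{0<..}|lebesgue. c t) = integral {a..b} c"
proof -
  have e: "indicat_real {0<..} t *\<^sub>R c t = indicat_real {a..b} t *\<^sub>R c t" for t
    using assms(1) assms(3)[of t] by (auto simp: indicator_def)
  have i: "set_integrable lebesgue {a..b} c" by (rule absolutely_integrable_continuous_real[OF assms(2)])
  then show "set_integrable lebesgue {0<..} c" unfolding set_integrable_def e .
  show "(LINT t:{0<..}|lebesgue. c t) = integral {a..b} c"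
    using set_lebesgue_integral_eq_integral(2)[OF i] unfolding set_lebesgue_integral_def e .
qed

text \<open>The real part of the distribution given by the curve \<open>X\<close>, applied to \<open>\<psi>\<close>, in the
  component \<open>\<alpha>\<close>.\<close>

definition RI :: "'N \<Rightarrow> (real \<Rightarrow> (real^'n, complex^'N) l2) \<Rightarrow> (real \<times> (real^'n) \<Rightarrow> complex) \<Rightarrow> real" where
  "RI \<alpha> X \<psi> = (LINT t:{0<..}|lebesgue. inner (X t) (tv \<alpha> (slice \<psi> t)))"

lemma tvec_zero: "tv \<alpha> (\<lambda>x. 0) = 0"
  using linear_0[OF bounded_linear.linear[OF bounded_linear_e0[of \<alpha>]]] cls_scaleR[of "\<lambda>x. 0" 0] by (simp add: tvec_def L2_zero)

lemma pairing_integrable: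
  assumes X: "continuous_on {0<..} X" and t: "test_function half_space \<psi>"
  shows "set_integrable lebesgue {0<..} (\<lambda>t. inner (X t) (tv \<alpha> (slice \<psi> t)))"
proof -
  obtain a b where ab: "0 < a" "a < b" "\<And>t x. t \<notin> {a<..<b} \<Longrightarrow> \<psi> (t, x) = 0"
    by (rule half_space_support[OF t], rule that)
  have "continuous_on {a..b} X" by (rule continuous_on_subset[OF X]) (use ab in auto)
  from continuous_on_inner[OF this slice_curve_continuous[OF half_space_test[OF t]]]
  show ?thesis
    by (rule time_integral(1)[OF ab(1)]) (simp add: ab(3) tvec_zero)
qed

text \<open>Integration by parts in \<open>t\<close> moves the derivative from the test function to \<open>X\<close>. For the
  converse, products of a bump function in \<open>t\<close> and a test function in \<open>x\<close> localise the continuous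
  function of \<open>t\<close> that has to vanish. The divergence equation and the curl equations with one index \<open>0\<close>
  are all of this form, with different \<open>X\<close> and \<open>Z\<close>.\<close>

lemma weak_evolution:
  fixes X X' :: "real \<Rightarrow> (real^'n, complex^'N) l2" and Z :: "'n \<Rightarrow> real \<Rightarrow> (real^'n, complex^'N) l2"
  assumes der: "\<And>t. 0 < t \<Longrightarrow> (X has_vector_derivative X' t) (at t)"
    and cX': "continuous_on {0<..} X'" and cZ: "\<And>j. continuous_on {0<..} (Z j)"
  shows "(\<forall>\<phi>. test_function half_space \<phi> \<longrightarrow> RI \<alpha> X (pd None \<phi>) + (\<Sum>j\<in>UNIV. RI \<alpha> (Z j) (pd (Some j) \<phi>)) = 0) \<longleftrightarrow>
    (\<forall>t>0. \<forall>\<psi>. test \<psi> \<longrightarrow> inner (X' t) (tv \<alpha> \<psi>) = (\<Sum>j\<in>UNIV. inner (Z j t) (tv \<alpha> (part j \<psi>))))"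
    (is "?weak \<longleftrightarrow> ?strong")
proof -
  have cX: "continuous_on {0<..} X"
    by (rule continuous_at_imp_continuous_on) (auto intro: has_vector_derivative_continuous der)
  define k where "k \<psi> t = (\<Sum>j\<in>UNIV. inner (Z j t) (tv \<alpha> (part j \<psi>))) - inner (X' t) (tv \<alpha> \<psi>)" for \<psi> t
  define B where "B \<phi> t = inner (X t) (tv \<alpha> (slice (pd None \<phi>) t)) + (\<Sum>j\<in>UNIV. inner (Z j t) (tv \<alpha> (slice (pd (Some j) \<phi>) t)))" for \<phi> t
  have RI_B: "RI \<alpha> X (pd None \<phi>) + (\<Sum>j\<in>UNIV. RI \<alpha> (Z j) (pd (Some j) \<phi>)) = (LINT t:{0<..}|lebesgue. B \<phi> t)"
    if t: "test_function half_space \<phi>" for \<phi>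
  proof -
    have "integrable lebesgue (\<lambda>x. indicat_real {0<..} x *\<^sub>R inner (X x) (tv \<alpha> (slice (pd None \<phi>) x)))"
      "integrable lebesgue (\<lambda>x. indicat_real {0<..} x *\<^sub>R inner (Z j x) (tv \<alpha> (slice (pd (Some j) \<phi>) x)))" for j
      using pairing_integrable[OF cX half_space_pd[OF t]] pairing_integrable[OF cZ half_space_pd[OF t]]
      unfolding set_integrable_def by blast+
    then show ?thesis
      unfolding RI_def B_def set_lebesgue_integral_def scaleR_add_right scaleR_sum_right
      by (simp only: Bochner_Integration.integral_add Bochner_Integration.integral_sum Bochner_Integration.integrable_sum)
  qed
  have B_k: "(LINT t:{0<..}|lebesgue. B \<phi> t) = integral {a..b} (\<lambda>t. k (slice \<phi> t) t)"
    if t: "test_function half_space \<phi>" and ab: "0 < a" "a < b" "\<And>t x. t \<notin> {a<..<b} \<Longrightarrow> \<phi> (t, x) = 0"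
      "\<And>i t x. t \<notin> {a<..<b} \<Longrightarrow> pd i \<phi> (t, x) = 0" for \<phi> a b
  proof -
    note T = half_space_test[OF t]
    have d: "((\<lambda>t. inner (X t) (tv \<alpha> (slice \<phi> t))) has_vector_derivative
        inner (X t) (tv \<alpha> (slice (pd None \<phi>) t)) + inner (X' t) (tv \<alpha> (slice \<phi> t))) (at t within {a..b})" if "t \<in> {a..b}" for t
      by (rule has_vector_derivative_at_within)
        (intro bounded_bilinear.has_vector_derivative[OF bounded_bilinear_inner] slice_curve T der, use that ab in auto)
    have i0: "((\<lambda>t. inner (X t) (tv \<alpha> (slice (pd None \<phi>) t)) + inner (X' t) (tv \<alpha> (slice \<phi> t))) has_integral
        inner (X b) (tv \<alpha> (slice \<phi> b)) - inner (X a) (tv \<alpha> (slice \<phi> a))) {a..b}"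
      by (rule fundamental_theorem_of_calculus[OF _ d]) (use ab in auto)
    have z: "tv \<alpha> (slice \<phi> b) = 0" "tv \<alpha> (slice \<phi> a) = 0" using ab by (simp_all add: tvec_zero)
    have ck: "continuous_on {a..b} (\<lambda>t. k (slice \<phi> t) t)"
      unfolding k_def part_slice[OF T]
      by (intro continuous_on_diff continuous_on_sum continuous_on_inner slice_curve_continuous test_pd T
          continuous_on_subset[OF cX'] continuous_on_subset[OF cZ]) (use ab in auto)
    have "((\<lambda>t. (inner (X t) (tv \<alpha> (slice (pd None \<phi>) t)) + inner (X' t) (tv \<alpha> (slice \<phi> t))) + k (slice \<phi> t) t) has_integral
        0 + integral {a..b} (\<lambda>t. k (slice \<phi> t) t)) {a..b}"
      using i0 unfolding z by (intro has_integral_add integrable_integral integrable_continuous_interval ck) simp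
    moreover have "(\<lambda>t. (inner (X t) (tv \<alpha> (slice (pd None \<phi>) t)) + inner (X' t) (tv \<alpha> (slice \<phi> t))) + k (slice \<phi> t) t) = B \<phi>"
      by (rule ext) (simp add: B_def k_def part_slice[OF T])
    ultimately have hi: "(B \<phi> has_integral integral {a..b} (\<lambda>t. k (slice \<phi> t) t)) {a..b}" by simp
    have cB: "continuous_on {a..b} (B \<phi>)"
      unfolding B_def
      by (intro continuous_on_add continuous_on_sum continuous_on_inner slice_curve_continuous test_pd T
          continuous_on_subset[OF cX] continuous_on_subset[OF cZ]) (use ab in auto)
    have "B \<phi> t = 0" if "t \<notin> {a<..<b}" for t using ab(4)[OF that] by (simp add: B_def tvec_zero)
    then have "(LINT t:{0<..}|lebesgue. B \<phi> t) = integral {a..b} (B \<phi>)" by (intro time_integral(2)[OF ab(1) cB])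
    then show ?thesis using hi by (simp add: integral_unique)
  qed
  show ?thesis
  proof
    assume strong: ?strong
    show ?weak
    proof (intro allI impI)
      fix \<phi> assume t: "test_function half_space (\<phi> :: real \<times> (real^'n) \<Rightarrow> complex)"
      obtain a b where ab: "0 < a" "a < b" "\<And>t x. t \<notin> {a<..<b} \<Longrightarrow> \<phi> (t, x) = 0"
        "\<And>i t x. t \<notin> {a<..<b} \<Longrightarrow> pd i \<phi> (t, x) = 0"
        by (rule half_space_support[OF t], rule that)
      have "integral {a..b} (\<lambda>t. k (slice \<phi> t) t) = integral {a..b} (\<lambda>t. 0)"
        by (rule integral_cong) (use strong ab slice_test[OF half_space_test[OF t]] in \<open>simp add: k_def\<close>)
      then show "RI \<alpha> X (pd None \<phi>) + (\<Sum>j\<in>UNIV. RI \<alpha> (Z j) (pd (Some j) \<phi>)) = 0"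
        using RI_B[OF t] B_k[OF t ab] by simp
    qed
  next
    assume weak: ?weak
    show ?strong
    proof (intro allI impI)
      fix t1 :: real and \<psi> :: "real^'n \<Rightarrow> complex" assume t1: "0 < t1" and t: "test \<psi>"
      have ck: "continuous_on {0<..} (k \<psi>)" unfolding k_def
        by (intro continuous_on_diff continuous_on_sum continuous_on_inner cX' cZ continuous_on_const)
      have "k \<psi> t1 = 0"
      proof (rule ccontr)
        assume nz: "k \<psi> t1 \<noteq> 0"
        define s where "s = sgn (k \<psi> t1)"
        have "isCont (\<lambda>t. s * k \<psi> t) t1"
          using ck t1 by (intro continuous_intros) (auto simp: continuous_on_eq_continuous_at)
        then have "((\<lambda>t. s * k \<psi> t) \<longlongrightarrow> s * k \<psi> t1) (nhds t1)"
          unfolding isCont_def by (subst (asm) tendsto_at_iff_tendsto_nhds)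
        moreover have "0 < s * k \<psi> t1" using nz by (auto simp: s_def sgn_if)
        ultimately have "\<forall>\<^sub>F t in nhds t1. 0 < s * k \<psi> t"
          by (rule order_tendstoD(1))
        then obtain d where d: "d > 0" "\<And>t. dist t t1 < d \<Longrightarrow> 0 < s * k \<psi> t" unfolding eventually_nhds_metric by blast
        define \<epsilon> where "\<epsilon> = min d t1 / 2"
        have \<epsilon>: "0 < \<epsilon>" "\<epsilon> < d" "\<epsilon> < t1" using d(1) t1 by (auto simp: \<epsilon>_def)
        define a b where "a = (t1 - \<epsilon>) / 2" and "b = t1 + \<epsilon> + 1"
        have ab: "0 < a" "a < b" "t1 \<in> box a b" using \<epsilon> by (auto simp: a_def b_def)
        \<comment> \<open>On the support of \<open>\<beta>\<close> the function \<open>k \<psi>\<close> keeps its sign \<open>s\<close>.\<close>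
        define \<beta> where "\<beta> = bump 1 (t1 - \<epsilon>) (t1 + \<epsilon>)"
        define \<phi> where "\<phi> p = complex_of_real (\<beta> (fst p)) * \<psi> (snd p)" for p :: "real \<times> (real^'n)"
        obtain K where K: "compact K" "\<And>x. x \<notin> K \<Longrightarrow> \<psi> x = 0" using testE[OF t] by blast
        have \<beta>0: "\<beta> t = 0" if "t \<notin> {t1 - \<epsilon><..<t1 + \<epsilon>}" for t using bump_outside[of 1 t "t1 - \<epsilon>" "t1 + \<epsilon>"] that by (simp add: \<beta>_def)
        have "Ck n \<phi>" for n
        proof -
          have "Ck n (\<lambda>p::real \<times> (real^'n). \<beta> (fst p + 0))" unfolding \<beta>_def
            by (rule Ck_affine[OF bounded_linear.linear[OF bounded_linear_fst] Ck_bump])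
          moreover have "Ck n (\<lambda>p::real \<times> (real^'n). \<psi> (snd p + 0))"
            by (rule Ck_affine[OF bounded_linear.linear[OF bounded_linear_snd] test_Ck[OF t]])
          ultimately show ?thesis unfolding \<phi>_def
            by (intro Ck_bilinear[OF bounded_bilinear_mult] Ck_bounded_linear[OF bounded_linear_of_real]) simp_all
        qed
        moreover have "compact ({t1-\<epsilon>..t1+\<epsilon>} \<times> K)" by (intro compact_Times K compact_Icc)
        moreover have "{t1-\<epsilon>..t1+\<epsilon>} \<times> K \<subseteq> half_space" using \<epsilon> by (auto simp: half_space_def)
        moreover have "\<phi> z = 0" if "z \<notin> {t1-\<epsilon>..t1+\<epsilon>} \<times> K" for z
          using that \<beta>0[of "fst z"] K(2)[of "snd z"] by (cases z) (auto simp: \<phi>_def)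
        ultimately have tf: "test_function half_space \<phi>" unfolding test_function_def by blast
        have \<phi>0: "\<phi> (t, x) = 0" if "t \<notin> {t1-\<epsilon><..<t1+\<epsilon>}" for t x using \<beta>0[OF that] by (simp add: \<phi>_def)
        have out: "t \<notin> {t1-\<epsilon><..<t1+\<epsilon>}" if "t \<notin> {a<..<b}" for t using that \<epsilon> by (auto simp: a_def b_def)
        have pd\<phi>0: "pd i \<phi> (t, x) = 0" if "t \<notin> {a<..<b}" for i t x
        proof -
          have "open ((- {t1-\<epsilon>..t1+\<epsilon>}) \<times> (UNIV :: (real^'n) set))" by (intro open_Times) auto
          moreover have "(t, x) \<in> (- {t1-\<epsilon>..t1+\<epsilon>}) \<times> (UNIV :: (real^'n) set)" using that \<epsilon> by (auto simp: a_def b_def)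
          ultimately have "frechet_derivative \<phi> (at (t, x)) = (\<lambda>h. 0)"
            by (rule frechet_derivative_zero) (use \<phi>0 in force)
          then show ?thesis by simp
        qed
        have kk: "k (slice \<phi> t) t = \<beta> t * k \<psi> t" for t
        proof -
          have tvs: "tv \<alpha> (\<lambda>x. complex_of_real c * \<eta> x) = c *\<^sub>R tv \<alpha> \<eta>" if "test \<eta>" for c :: real and \<eta> :: "real^'n \<Rightarrow> complex"
            using cls_scaleR[OF tvec_L2[OF bounded_linear_e0 that], of c \<alpha>] linear_scale[OF bounded_linear.linear[OF bounded_linear_e0[of \<alpha>]]]
            by (simp add: tvec_def scaleR_conv_of_real[symmetric])
          have "slice \<phi> t = (\<lambda>x. complex_of_real (\<beta> t) * \<psi> x)" by (simp add: \<phi>_def)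
          then show ?thesis
            unfolding k_def by (simp add: part_mult[OF t] tvs t test_part[OF t] right_diff_distrib sum_distrib_left)
        qed
        have "integral {a..b} (\<lambda>t. \<beta> t * k \<psi> t) = 0"
          using weak[rule_format, OF tf] RI_B[OF tf] B_k[OF tf ab(1,2) \<phi>0[OF out] pd\<phi>0] unfolding kk by simp
        have c\<beta>: "continuous_on S \<beta>" for S unfolding \<beta>_def using continuous_on_subset[OF Ck_continuous[OF Ck_bump]] by blast
        have c: "continuous_on (cbox a b) (\<lambda>t. \<beta> t * (s * k \<psi> t))"
          unfolding cbox_interval by (intro continuous_intros c\<beta> continuous_on_subset[OF ck]) (use ab in auto)
        have "integral {a..b} (\<lambda>t. \<beta> t * (s * k \<psi> t)) = s * integral {a..b} (\<lambda>t. \<beta> t * k \<psi> t)"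
          by (subst integral_mult_right[symmetric]) (simp add: mult_ac)
        then have "((\<lambda>t. \<beta> t * (s * k \<psi> t)) has_integral 0) (cbox a b)"
          using integrable_integral[OF integrable_continuous[OF c]] \<open>integral {a..b} (\<lambda>t. \<beta> t * k \<psi> t) = 0\<close> by simp
        moreover have "0 \<le> \<beta> t * (s * k \<psi> t)" if "t \<in> box a b" for t
        proof (cases "t \<in> {t1-\<epsilon><..<t1+\<epsilon>}")
          case True
          then have "0 < s * k \<psi> t" using \<epsilon> by (intro d(2)) (auto simp: dist_real_def)
          then show ?thesis using bump_bounds(1)[of 1 "t1 - \<epsilon>" "t1 + \<epsilon>" t] by (simp add: \<beta>_def)
        next
          case False
          then show ?thesis using \<beta>0[OF False] by simp
        qed
        ultimately have "\<beta> t1 * (s * k \<psi> t1) = 0"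
          using has_integral_0_cbox_imp_0[OF c] ab(3) box_subset_cbox[of a b] by blast
        moreover have "0 < \<beta> t1" unfolding \<beta>_def by (rule bump_pos) (use \<epsilon> in auto)
        ultimately show False using d(2)[of t1] d(1) by auto
      qed
      then show "inner (X' t1) (tv \<alpha> \<psi>) = (\<Sum>j\<in>UNIV. inner (Z j t1) (tv \<alpha> (part j \<psi>)))" by (simp add: k_def)
    qed
  qed
qed

section \<open>Fields on the half-space as curves in a Hilbert space\<close>

lemma sum_option: "(\<Sum>i\<in>UNIV. f i) = f None + (\<Sum>j\<in>UNIV. f (Some j))" for f :: "'n::finite option \<Rightarrow> 'b::comm_monoid_add"
  by (simp add: UNIV_option_conv sum.reindex)

definition tail :: "(complex^'N)^('n option) \<Rightarrow> (complex^'N)^'n" where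
  "tail v = (\<chi> j. v $ Some j)"

lemma join_nth [simp]: "join f G $ None = f" "join f G $ Some j = G $ j" "tail (join f G) = G"
  by (simp_all add: join_def tail_def)

lemma join_tail [simp]: "join (v $ None) (tail v) = v"
  by (simp add: vec_eq_iff join_def tail_def split: option.split)

lemma bounded_linear_tail: "bounded_linear tail"
  unfolding linear_conv_bounded_linear[symmetric]
  by (rule linearI) (auto simp: tail_def vec_eq_iff)

lemma join_split: "join f G = join f 0 + join 0 G"
  by (simp add: vec_eq_iff join_def split: option.split)

lemma bounded_linear_join: "bounded_linear (\<lambda>f. join f 0)" "bounded_linear (\<lambda>G. join 0 G)"
  unfolding linear_conv_bounded_linear[symmetric]
  by (rule linearI; auto simp: join_def vec_eq_iff split: option.split)+

lemma inner_head_tail: "inner u v = inner (u $ None) (v $ None) + inner (tail u) (tail v)"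
  for u v :: "(complex^'N)^('n::finite option)"
  by (simp add: inner_vec_def[of u v] sum_option) (simp add: tail_def inner_vec_def[of "vec_lambda _"])

text \<open>The passage from functions on \<open>R\<^sup>n\<close> to the product Hilbert space of normal and tangential parts;
  \<open>unpack\<close> chooses representatives.\<close>

definition pack :: "(real^'n \<Rightarrow> (complex^'N)^('n option)) \<Rightarrow> (real^'n, complex^'N) l2 \<times> (real^'n, (complex^'N)^'n) l2" where
  "pack F = (cls (\<lambda>x. F x $ None), cls (\<lambda>x. tail (F x)))"

definition unpack :: "(real^'n, complex^'N) l2 \<times> (real^'n, (complex^'N)^'n) l2 \<Rightarrow> real^'n \<Rightarrow> (complex^'N)^('n option)" where
  "unpack u x = join (rep (fst u) x) (rep (snd u) x)"

lemma head_L2: "F \<in> L2 \<Longrightarrow> (\<lambda>x. F x $ i) \<in> L2"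
  and tail_L2: "H \<in> L2 \<Longrightarrow> (\<lambda>x. tail (H x)) \<in> L2"
  by (rule L2_bounded_linear[OF bounded_linear_vec_nth], assumption) (rule L2_bounded_linear[OF bounded_linear_tail])

lemma unpack_L2 [simp]: "unpack u \<in> L2"
proof -
  have "(\<lambda>x. join (rep (fst u) x) 0 + join 0 (rep (snd u) x)) \<in> L2"
    by (intro L2_add L2_bounded_linear[OF bounded_linear_join(1)] L2_bounded_linear[OF bounded_linear_join(2)] rep_L2)
  then show ?thesis by (simp add: unpack_def[abs_def] join_split[symmetric])
qed

lemma pack_unpack [simp]: "pack (unpack u) = u"
  by (simp add: pack_def unpack_def prod_eq_iff)

lemma unpack_pack:
  assumes "F \<in> L2" shows "AE x in lebesgue. unpack (pack F) x = F x"
  using rep_cls[OF head_L2[OF assms, of None]] rep_cls[OF tail_L2[OF assms]]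
  by eventually_elim (simp add: unpack_def pack_def)

lemma pack_cong: "F \<in> L2 \<Longrightarrow> H \<in> L2 \<Longrightarrow> AE x in lebesgue. F x = H x \<Longrightarrow> pack F = pack H"
  unfolding pack_def by (auto intro!: cls_eqI head_L2 tail_L2 elim: eventually_mono)

lemma inner_pack:
  assumes F: "F \<in> L2" and H: "H \<in> L2"
  shows "inner (pack F) (pack H) = (LINT x|lebesgue. inner (F x) (H x))"
proof -
  have "inner (pack F) (pack H) = (LINT x|lebesgue. inner (F x $ None) (H x $ None)) + (LINT x|lebesgue. inner (tail (F x)) (tail (H x)))"
    unfolding pack_def inner_prod_def fst_conv snd_conv
    by (simp only: inner_cls[OF head_L2[OF F] head_L2[OF H]] inner_cls[OF tail_L2[OF F] tail_L2[OF H]])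
  also have "\<dots> = (LINT x|lebesgue. inner (F x) (H x))"
    unfolding inner_head_tail[where ?'n='a]
    by (rule Bochner_Integration.integral_add[symmetric]) (intro L2_inner_integrable head_L2 tail_L2 F H)+
  finally show ?thesis .
qed

lemma norm_pack:
  assumes "F \<in> L2" shows "norm (pack F) = L2_norm F"
  using inner_pack[OF assms assms] by (simp only: norm_eq_sqrt_inner[of "pack F"] L2_norm_def power2_norm_eq_inner)

lemma pack_lincomb: "F \<in> L2 \<Longrightarrow> H \<in> L2 \<Longrightarrow> pack (\<lambda>x. a *\<^sub>R F x + b *\<^sub>R H x) = a *\<^sub>R pack F + b *\<^sub>R pack H"
  by (simp add: pack_def cls_lincomb[OF head_L2 head_L2] cls_lincomb[OF tail_L2 tail_L2]
      linear_add[OF bounded_linear.linear[OF bounded_linear_tail]] linear_scale[OF bounded_linear.linear[OF bounded_linear_tail]])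

lemma pack_diff: "F \<in> L2 \<Longrightarrow> H \<in> L2 \<Longrightarrow> pack (\<lambda>x. F x - H x) = pack F - pack H"
  using pack_lincomb[of F H 1 "-1"] by simp

lemma pack_scaleR: "F \<in> L2 \<Longrightarrow> pack (\<lambda>x. a *\<^sub>R F x) = a *\<^sub>R pack F"
  using pack_lincomb[of F F a 0] by simp

text \<open>\<open>pack\<close> is a linear isometry, up to null sets, so that difference quotients and continuity may be computed
  on either side.\<close>

lemma C1_L2_iff:
  "C1_L2 U \<longleftrightarrow> (\<forall>t>0. U t \<in> L2) \<and>
    (\<exists>V. (\<forall>t>0. ((\<lambda>t. pack (U t)) has_vector_derivative V t) (at t)) \<and> continuous_on {0<..} V)"
proof -
  have diff: "((\<lambda>h. L2_norm (\<lambda>x. (U (t + h) x - U t x) /\<^sub>R h - U' t x)) \<longlongrightarrow> 0) (at 0) \<longleftrightarrow>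
      ((\<lambda>t. pack (U t)) has_vector_derivative pack (U' t)) (at t)" (is "?l \<longleftrightarrow> ?r")
    if L: "\<forall>t>0. U t \<in> L2 \<and> U' t \<in> L2" and t: "0 < t" for t :: real and U'
  proof -
    have e: "\<forall>\<^sub>F h in at 0. norm (pack (U (t + h)) - pack (U t) - h *\<^sub>R pack (U' t)) / norm h
        = L2_norm (\<lambda>x. (U (t + h) x - U t x) /\<^sub>R h - U' t x)"
      unfolding eventually_at
    proof (intro exI[of _ t] conjI ballI impI)
      fix h :: real assume h: "h \<noteq> 0 \<and> dist h 0 < t"
      have L': "U (t + h) \<in> L2" "U t \<in> L2" "U' t \<in> L2" using L t h by (auto simp: dist_real_def)
      have "L2_norm (\<lambda>x. (U (t + h) x - U t x) /\<^sub>R h - U' t x) = norm ((pack (U (t + h)) - pack (U t)) /\<^sub>R h - pack (U' t))"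
        using L' by (simp add: norm_pack[symmetric] pack_diff pack_scaleR L2_diff L2_scaleR)
      also have "(pack (U (t + h)) - pack (U t)) /\<^sub>R h - pack (U' t) = (pack (U (t + h)) - pack (U t) - h *\<^sub>R pack (U' t)) /\<^sub>R h"
        using h by (simp add: scaleR_diff_right)
      also have "norm \<dots> = norm (pack (U (t + h)) - pack (U t) - h *\<^sub>R pack (U' t)) / norm h"
        by (simp add: divide_inverse mult.commute)
      finally show "norm (pack (U (t + h)) - pack (U t) - h *\<^sub>R pack (U' t)) / norm h
        = L2_norm (\<lambda>x. (U (t + h) x - U t x) /\<^sub>R h - U' t x)" by simp
    qed (use t in auto)
    have "?r \<longleftrightarrow> (\<lambda>h. norm (pack (U (t + h)) - pack (U t) - h *\<^sub>R pack (U' t)) / norm h) \<midarrow>0\<rightarrow> 0"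
      by (simp add: has_vector_derivative_def has_derivative_at bounded_linear_scaleR_left)
    also have "\<dots> \<longleftrightarrow> ?l" by (rule tendsto_cong[OF e])
    finally show ?thesis by simp
  qed
  have cont: "((\<lambda>s. L2_norm (\<lambda>x. U' s x - U' t x)) \<longlongrightarrow> 0) (at t) \<longleftrightarrow> isCont (\<lambda>t. pack (U' t)) t"
    if L: "\<forall>t>0. U' t \<in> L2" and t: "0 < t" for t :: real and U' :: "real \<Rightarrow> real^'n \<Rightarrow> (complex^'N)^('n option)"
  proof -
    have e: "\<forall>\<^sub>F s in at t. norm (pack (U' s) - pack (U' t)) = L2_norm (\<lambda>x. U' s x - U' t x)"
      unfolding eventually_at
    proof (intro exI[of _ t] conjI ballI impI)
      fix s assume "s \<noteq> t \<and> dist s t < t"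
      then have "0 < s" by (auto simp: dist_real_def)
      then show "norm (pack (U' s) - pack (U' t)) = L2_norm (\<lambda>x. U' s x - U' t x)"
        using L t by (simp add: norm_pack[symmetric] pack_diff L2_diff)
    qed (use t in auto)
    have "isCont (\<lambda>t. pack (U' t)) t \<longleftrightarrow> ((\<lambda>s. norm (pack (U' s) - pack (U' t))) \<longlongrightarrow> 0) (at t)"
      unfolding isCont_def tendsto_norm_zero_iff by (rule LIM_zero_iff[symmetric])
    also have "\<dots> \<longleftrightarrow> ((\<lambda>s. L2_norm (\<lambda>x. U' s x - U' t x)) \<longlongrightarrow> 0) (at t)" by (rule tendsto_cong[OF e])
    finally show ?thesis by simp
  qed
  show ?thesis
  proof
    assume "C1_L2 U"
    then obtain U' where U': "\<forall>t>0. U t \<in> L2 \<and> U' t \<in> L2"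
      "\<forall>t>0. ((\<lambda>h. L2_norm (\<lambda>x. (U (t + h) x - U t x) /\<^sub>R h - U' t x)) \<longlongrightarrow> 0) (at 0)"
      "\<forall>t>0. ((\<lambda>s. L2_norm (\<lambda>x. U' s x - U' t x)) \<longlongrightarrow> 0) (at t)" unfolding C1_L2_def by blast
    have "((\<lambda>t. pack (U t)) has_vector_derivative pack (U' t)) (at t)" if t: "0 < t" for t
      unfolding diff[OF U'(1) t, symmetric] using U'(2) t by blast
    moreover have "isCont (\<lambda>t. pack (U' t)) t" if t: "0 < t" for t
      using cont[of U', OF _ t] U'(1,3) t by simp
    then have "continuous_on {0<..} (\<lambda>t. pack (U' t))"
      by (auto simp: continuous_on_eq_continuous_at)
    ultimately show "(\<forall>t>0. U t \<in> L2) \<and> (\<exists>V. (\<forall>t>0. ((\<lambda>t. pack (U t)) has_vector_derivative V t) (at t)) \<and> continuous_on {0<..} V)"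
      using U'(1) by (intro conjI exI[of _ "\<lambda>t. pack (U' t)"]) simp_all
  next
    assume "(\<forall>t>0. U t \<in> L2) \<and> (\<exists>V. (\<forall>t>0. ((\<lambda>t. pack (U t)) has_vector_derivative V t) (at t)) \<and> continuous_on {0<..} V)"
    then obtain V where V: "\<forall>t>0. U t \<in> L2" "\<forall>t>0. ((\<lambda>t. pack (U t)) has_vector_derivative V t) (at t)" "continuous_on {0<..} V"
      by blast
    have L: "\<forall>t>0. U t \<in> L2 \<and> unpack (V t) \<in> L2" using V(1) by simp
    have "isCont V t" if "0 < t" for t using V(3) that by (auto simp: continuous_on_eq_continuous_at)
    then have c: "\<forall>t>0. ((\<lambda>s. L2_norm (\<lambda>x. unpack (V s) x - unpack (V t) x)) \<longlongrightarrow> 0) (at t)"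
      using cont[of "\<lambda>t. unpack (V t)"] by simp
    have "\<forall>t>0. ((\<lambda>h. L2_norm (\<lambda>x. (U (t + h) x - U t x) /\<^sub>R h - unpack (V t) x)) \<longlongrightarrow> 0) (at 0)"
    proof (intro allI impI)
      fix t :: real assume t: "0 < t"
      show "((\<lambda>h. L2_norm (\<lambda>x. (U (t + h) x - U t x) /\<^sub>R h - unpack (V t) x)) \<longlongrightarrow> 0) (at 0)"
        unfolding diff[OF L t] pack_unpack using V(2) t by simp
    qed
    with L c show "C1_L2 U" unfolding C1_L2_def by (intro exI[of _ "\<lambda>t. unpack (V t)"]) simp
  qed
qed

section \<open>The coefficients as an operator\<close>

lemma hermitian_Re: "Re (hermitian u v) = inner u v"
  by (simp add: hermitian_def inner_vec_def inner_complex_def)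

lemma bounded_bilinear_hermitian: "bounded_bilinear (hermitian :: (complex^'N)^'i \<Rightarrow> _)"
  unfolding bilinear_conv_bounded_bilinear[symmetric] bilinear_def
  by (auto intro!: linearI simp: hermitian_def sum.distrib algebra_simps scaleR_sum_right)

lemma bounded_bilinear_block_mult: "bounded_bilinear (block_mult :: ((complex^'N^'N)^'i)^'i \<Rightarrow> _)"
  unfolding bilinear_conv_bounded_bilinear[symmetric] bilinear_def
  by (auto intro!: linearI simp: block_mult_def matrix_vector_mult_def vec_eq_iff sum.distrib algebra_simps scaleR_sum_right)

lemma block_mult_measurable:
  assumes "A \<in> borel_measurable lebesgue" "F \<in> borel_measurable lebesgue"
  shows "(\<lambda>x. block_mult (A x) (F x)) \<in> borel_measurable lebesgue"
  by (rule borel_measurable_continuous_Pair[OF assms])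
    (intro bounded_bilinear.continuous_on[OF bounded_bilinear_block_mult] continuous_intros)

lemma Linfty_block_bound:
  fixes A :: "real^'n \<Rightarrow> ((complex^'N^'N)^'i)^'i"
  assumes "A \<in> Linfty"
  obtains K where "0 < K" "AE x in lebesgue. \<forall>u. norm (block_mult (A x) u) \<le> K * norm u"
proof -
  obtain C where C: "AE x in lebesgue. norm (A x) \<le> C" using assms by (auto simp: Linfty_def)
  obtain B where B: "0 < B" "\<And>M u. norm (block_mult M u :: (complex^'N)^'i) \<le> norm M * norm u * B"
    using bounded_bilinear.pos_bounded[OF bounded_bilinear_block_mult] by blast
  show ?thesis
  proof (rule that[of "(\<bar>C\<bar> + 1) * B"])
    show "0 < (\<bar>C\<bar> + 1) * B" using B(1) by (simp add: add_nonneg_pos)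
    show "AE x in lebesgue. \<forall>u. norm (block_mult (A x) u) \<le> (\<bar>C\<bar> + 1) * B * norm u"
      using C
    proof eventually_elim
      fix x assume x: "norm (A x) \<le> C"
      show "\<forall>u. norm (block_mult (A x) u) \<le> (\<bar>C\<bar> + 1) * B * norm u"
      proof
        fix u
        have "norm (block_mult (A x) u) \<le> norm (A x) * norm u * B" by (rule B(2))
        also have "\<dots> \<le> (\<bar>C\<bar> + 1) * norm u * B" using x B(1) by (intro mult_right_mono) auto
        finally show "norm (block_mult (A x) u) \<le> (\<bar>C\<bar> + 1) * B * norm u" by (simp add: mult_ac)
      qed
    qed
  qed
qed

lemma block_L2:
  fixes A :: "real^'n \<Rightarrow> ((complex^'N^'N)^'i)^'i"
  assumes A: "A \<in> Linfty" and F: "F \<in> L2"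
  shows "(\<lambda>x. block_mult (A x) (F x)) \<in> L2"
proof -
  obtain K where "0 < K" and K: "AE x in lebesgue. \<forall>u. norm (block_mult (A x) u) \<le> K * norm u"
    by (rule Linfty_block_bound[OF A], rule that)
  from K have "AE x in lebesgue. norm (block_mult (A x) (F x)) \<le> K * norm (F x)" by eventually_elim blast
  moreover have "A \<in> borel_measurable lebesgue" using A by (simp add: Linfty_def)
  ultimately show ?thesis by (intro L2_dominated[OF F] block_mult_measurable L2D(1)[OF F])
qed

definition mult_op where "mult_op A u = pack (\<lambda>x. block_mult (A x) (unpack u x))"

lemma mult_op_pack:
  assumes "A \<in> Linfty" "F \<in> L2" shows "mult_op A (pack F) = pack (\<lambda>x. block_mult (A x) (F x))"
  unfolding mult_op_def
  by (rule pack_cong) (use unpack_pack[OF assms(2)] in \<open>auto intro!: block_L2 assms elim: eventually_mono\<close>)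

lemma linear_mult_op:
  assumes A: "A \<in> Linfty" shows "linear (mult_op A)"
proof -
  note bb = bounded_bilinear_block_mult
  have lc: "mult_op A (a *\<^sub>R u + b *\<^sub>R v) = a *\<^sub>R mult_op A u + b *\<^sub>R mult_op A v" for a b u v
  proof -
    have "mult_op A (a *\<^sub>R u + b *\<^sub>R v) = mult_op A (pack (\<lambda>x. a *\<^sub>R unpack u x + b *\<^sub>R unpack v x))"
      by (simp add: pack_lincomb)
    also have "\<dots> = pack (\<lambda>x. block_mult (A x) (a *\<^sub>R unpack u x + b *\<^sub>R unpack v x))"
      by (rule mult_op_pack[OF A L2_lincomb]) simp_all
    also have "\<dots> = pack (\<lambda>x. a *\<^sub>R block_mult (A x) (unpack u x) + b *\<^sub>R block_mult (A x) (unpack v x))"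
      by (simp add: bounded_bilinear.add_right[OF bb] bounded_bilinear.scaleR_right[OF bb])
    also have "\<dots> = a *\<^sub>R mult_op A u + b *\<^sub>R mult_op A v"
      unfolding mult_op_def by (rule pack_lincomb) (simp_all add: block_L2 A)
    finally show ?thesis .
  qed
  show ?thesis using lc[of 1 _ 1] lc[of _ _ 0 0] by (intro linearI) simp_all
qed

lemma mult_op_bound:
  assumes A: "A \<in> Linfty"
  obtains K where "0 < K" "\<And>u. norm (mult_op A u) \<le> K * norm u"
proof -
  obtain K where K: "0 < K" "AE x in lebesgue. \<forall>u. norm (block_mult (A x) u) \<le> K * norm u"
    by (rule Linfty_block_bound[OF A], rule that)
  have "norm (mult_op A u) \<le> K * norm u" for u
  proof -
    let ?F = "\<lambda>x. block_mult (A x) (unpack u x)"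
    have sq: "AE x in lebesgue. (norm (?F x))\<^sup>2 \<le> K\<^sup>2 * (norm (unpack u x))\<^sup>2"
      using K(2)
    proof eventually_elim
      fix x assume "\<forall>u. norm (block_mult (A x) u) \<le> K * norm u"
      then have "(norm (?F x))\<^sup>2 \<le> (K * norm (unpack u x))\<^sup>2" by (intro power_mono) auto
      then show "(norm (?F x))\<^sup>2 \<le> K\<^sup>2 * (norm (unpack u x))\<^sup>2" by (simp add: power_mult_distrib)
    qed
    have "(LINT x|lebesgue. (norm (?F x))\<^sup>2) \<le> (LINT x|lebesgue. K\<^sup>2 * (norm (unpack u x))\<^sup>2)"
      by (rule integral_mono_AE[OF L2D(2)[OF block_L2[OF A unpack_L2]] Bochner_Integration.integrable_mult_right[OF L2D(2)[OF unpack_L2]] sq])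
    then have "L2_norm ?F \<le> sqrt (K\<^sup>2 * (LINT x|lebesgue. (norm (unpack u x))\<^sup>2))"
      by (simp add: L2_norm_def)
    also have "\<dots> = K * L2_norm (unpack u)" using K(1) by (simp add: L2_norm_def real_sqrt_mult)
    finally show ?thesis
      using norm_pack[OF block_L2[OF A unpack_L2], of u] norm_pack[OF unpack_L2, of u] by (simp add: mult_op_def)
  qed
  with K(1) show ?thesis by (rule that)
qed

lemma mult_op_self_adjoint:
  assumes A: "A \<in> Linfty" and sa: "AE x in lebesgue. self_adjoint_block (A x)"
  shows "inner (mult_op A u) v = inner u (mult_op A v)"
proof -
  have "inner (mult_op A u) v = (LINT x|lebesgue. inner (block_mult (A x) (unpack u x)) (unpack v x))"
    using inner_pack[OF block_L2[OF A unpack_L2] unpack_L2, of u v] by (simp add: mult_op_def)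
  also have "\<dots> = (LINT x|lebesgue. inner (unpack u x) (block_mult (A x) (unpack v x)))"
  proof (rule integral_cong_AE)
    show "AE x in lebesgue. inner (block_mult (A x) (unpack u x)) (unpack v x) = inner (unpack u x) (block_mult (A x) (unpack v x))"
      using sa by eventually_elim (simp add: self_adjoint_block_def hermitian_Re[symmetric])
  qed (intro borel_measurable_integrable L2_inner_integrable block_L2 A unpack_L2)+
  also have "\<dots> = inner u (mult_op A v)"
    using inner_pack[OF unpack_L2 block_L2[OF A unpack_L2], of u v] by (simp add: mult_op_def)
  finally show ?thesis .
qed

lemma mult_op_inner:
  assumes A: "A \<in> Linfty"
  shows "inner (mult_op A u) u = Re (L2_inner (\<lambda>x. block_mult (A x) (unpack u x)) (unpack u))"
proof -
  obtain C where C: "\<And>u v. norm (hermitian u (v :: (complex^'b)^('a option))) \<le> norm u * norm v * C"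
    using bounded_bilinear.pos_bounded[OF bounded_bilinear_hermitian] by blast
  have "integrable lebesgue (\<lambda>x. hermitian (block_mult (A x) (unpack u x)) (unpack u x))"
  proof (rule L2_product_integrable[OF block_L2[OF A unpack_L2] unpack_L2])
    show "(\<lambda>x. hermitian (block_mult (A x) (unpack u x)) (unpack u x)) \<in> borel_measurable lebesgue"
      by (rule borel_measurable_continuous_Pair[OF L2D(1)[OF block_L2[OF A unpack_L2]] L2D(1)[OF unpack_L2]])
        (intro bounded_bilinear.continuous_on[OF bounded_bilinear_hermitian] continuous_intros)
    show "norm (hermitian (block_mult (A x) (unpack u x)) (unpack u x)) \<le> C * (norm (block_mult (A x) (unpack u x)) * norm (unpack u x))" for x
      using C[of "block_mult (A x) (unpack u x)" "unpack u x"] by (simp add: mult_ac)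
  qed
  then have "Re (L2_inner (\<lambda>x. block_mult (A x) (unpack u x)) (unpack u)) = (LINT x|lebesgue. inner (block_mult (A x) (unpack u x)) (unpack u x))"
    unfolding L2_inner_def by (subst integral_Re[symmetric]) (simp_all add: hermitian_Re)
  then show ?thesis
    using inner_pack[OF block_L2[OF A unpack_L2] unpack_L2, of u u] by (simp add: mult_op_def)
qed

text \<open>The hypothesis on \<open>A\<close> is stated for gradients of functions in the homogeneous space, and is used here for
  gradients of functions in \<open>L\<^sup>2\<close>.\<close>

lemma first_order_system_mult_op:
  fixes A :: "real^'n \<Rightarrow> ((complex^'N^'N)^('n option))^('n option)"
  assumes A: "A \<in> Linfty" and \<kappa>: "0 < \<kappa>" and sa: "AE x in lebesgue. self_adjoint_block (A x)"
    and coercive: "\<forall>f\<in>L2. \<forall>g\<in>Hdot1. \<forall>Dg. weak_gradient g Dg \<longrightarrow>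
      Re (L2_inner (\<lambda>x. block_mult (A x) (join (f x) (Dg x))) (\<lambda>x. join (f x) (Dg x)))
        \<ge> \<kappa> * ((L2_norm f)\<^sup>2 + (L2_norm Dg)\<^sup>2)"
  obtains M where "first_order_system grad_graph (mult_op A) \<kappa> M"
proof -
  obtain M where M: "0 < M" "\<And>u. norm (mult_op A u) \<le> M * norm u" by (rule mult_op_bound[OF A], rule that)
  have "first_order_system grad_graph (mult_op A) \<kappa> M"
  proof (rule first_order_system.intro)
    show "closed (grad_graph :: ((real^'n, complex^'N) l2 \<times> _) set)" by (rule closed_grad_graph)
    show "subspace (grad_graph :: ((real^'n, complex^'N) l2 \<times> _) set)" by (rule subspace_grad_graph)
    show "closure (fst ` (grad_graph :: ((real^'n, complex^'N) l2 \<times> _) set)) = UNIV" by (rule grad_graph_dense)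
    show "x = 0" if "(x, 0) \<in> grad_graph" for x :: "(real^'n, complex^'N) l2" using that by (rule grad_graph_injective)
    show "linear (mult_op A)" by (rule linear_mult_op[OF A])
    show "norm (mult_op A u) \<le> M * norm u" for u by (rule M(2))
    show "0 < M" by (rule M(1))
    show "inner (mult_op A u) v = inner u (mult_op A v)" for u v by (rule mult_op_self_adjoint[OF A sa])
    show "0 < \<kappa>" by (rule \<kappa>)
    show "\<kappa> * (norm (x, y))\<^sup>2 \<le> inner (mult_op A (x, y)) (x, y)" if G: "(g, y) \<in> grad_graph"
      for g x :: "(real^'n, complex^'N) l2" and y
    proof -
      have wg: "weak_gradient (rep g) (rep y)" using G by (simp add: grad_graph_def)
      then have "rep g \<in> Hdot1" using rep_L2 by (auto simp: Hdot1_def)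
      then have "\<kappa> * ((L2_norm (rep x))\<^sup>2 + (L2_norm (rep y))\<^sup>2)
          \<le> Re (L2_inner (\<lambda>z. block_mult (A z) (unpack (x, y) z)) (unpack (x, y)))"
        using coercive rep_L2 wg by (simp add: unpack_def[abs_def])
      moreover have "(norm (x, y))\<^sup>2 = (L2_norm (rep x))\<^sup>2 + (L2_norm (rep y))\<^sup>2"
        by (simp add: norm_Pair norm_cls[symmetric])
      ultimately show ?thesis by (simp add: mult_op_inner[OF A])
    qed
  qed
  then show ?thesis by (rule that)
qed

section \<open>The differential equations in terms of the flow relation\<close>

text \<open>The components \<open>U\<^sub>0, U\<^sub>1, \<dots>, U\<^sub>n\<close> of a field, as elements of
  \<open>L\<^sup>2(R\<^sup>n, C\<^sup>N)\<close>.\<close>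

definition component :: "'n option \<Rightarrow> (real^'n, complex^'N) l2 \<times> (real^'n, (complex^'N)^'n) l2 \<Rightarrow> (real^'n, complex^'N) l2" where
  "component i u = (case i of None \<Rightarrow> fst u | Some j \<Rightarrow> pr j (snd u))"

lemma component_simps [simp]: "component None u = fst u" "component (Some j) u = pr j (snd u)"
  by (simp_all add: component_def)

lemma component_pack:
  assumes F: "F \<in> L2" shows "component i (pack F) = cls (\<lambda>x. F x $ i)"
proof (cases i)
  case (Some j)
  have "cls (\<lambda>x. rep (cls (\<lambda>x. tail (F x))) x $ j) = cls (\<lambda>x. F x $ Some j)"
    by (rule cls_eqI[OF pr_L2 head_L2[OF F]])
      (use rep_cls[OF tail_L2[OF F]] in \<open>auto simp: tail_def elim!: eventually_mono\<close>)
  then show ?thesis by (simp add: Some pack_def pr_def)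
qed (simp add: pack_def)

lemma bounded_linear_pr: "bounded_linear (pr j :: (real^'n, (complex^'N)^'n) l2 \<Rightarrow> _)"
proof (rule bounded_linear_intro[where K = 1])
  fix y z :: "(real^'n, (complex^'N)^'n) l2" and a :: real
  show "pr j (y + z) = pr j y + pr j z"
    unfolding pr_def cls_add[OF pr_L2 pr_L2, symmetric]
    by (rule cls_eqI[OF pr_L2 L2_add[OF pr_L2 pr_L2]]) (use rep_add[of y z] in \<open>auto elim!: eventually_mono\<close>)
  show "pr j (a *\<^sub>R y) = a *\<^sub>R pr j y"
    unfolding pr_def cls_scaleR[OF pr_L2, symmetric]
    by (rule cls_eqI[OF pr_L2 L2_scaleR[OF pr_L2]]) (use rep_scaleR[of a y] in \<open>auto elim!: eventually_mono\<close>)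
  have "norm (cls (\<lambda>x. rep y x $ j)) \<le> 1 * norm (cls (rep y))"
    by (rule norm_cls_le[OF pr_L2 rep_L2]) (simp_all add: Finite_Cartesian_Product.norm_nth_le)
  then show "norm (pr j y) \<le> norm y * 1" by (simp add: pr_def)
qed

lemma bounded_linear_component: "bounded_linear (component i)"
  by (cases i) (simp_all add: component_def[abs_def] bounded_linear_fst
      bounded_linear_compose[OF bounded_linear_pr bounded_linear_snd])

lemma space_pairing:
  assumes F: "F \<in> L2" and t: "test \<psi>"
  shows "(LINT x|lebesgue. F x $ i $ \<alpha> * \<psi> x)
    = Complex (inner (component i (pack F)) (tv \<alpha> \<psi>)) (inner (component i (pack F)) (tv \<alpha> (\<lambda>x. - \<i> * \<psi> x)))"
proof -
  have "AE x in lebesgue. rep (component i (pack F)) x = F x $ i"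
    unfolding component_pack[OF F] by (rule rep_cls[OF head_L2[OF F]])
  then have "AE x in lebesgue. F x $ i $ \<alpha> * \<psi> x = rep (component i (pack F)) x $ \<alpha> * \<psi> x" by eventually_elim simp
  then have "(LINT x|lebesgue. F x $ i $ \<alpha> * \<psi> x) = (LINT x|lebesgue. rep (component i (pack F)) x $ \<alpha> * \<psi> x)"
    by (intro integral_cong_AE borel_measurable_integrable component_integrable[OF head_L2[OF F] t] component_integrable[OF rep_L2 t])
  then show ?thesis by (simp add: complex_eq_iff component_integral[OF t])
qed

lemma Complex_set_integral:
  assumes "set_integrable M S a" "set_integrable M S b"
  shows "set_integrable M S (\<lambda>t. Complex (a t) (b t))"
    "(LINT t:S|M. Complex (a t) (b t)) = Complex (LINT t:S|M. a t) (LINT t:S|M. b t)"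
proof -
  let ?a = "\<lambda>t. indicat_real S t *\<^sub>R a t" and ?b = "\<lambda>t. indicat_real S t *\<^sub>R b t"
  have i: "integrable M ?a" "integrable M ?b" using assms by (simp_all add: set_integrable_def)
  have e: "indicat_real S t *\<^sub>R Complex (a t) (b t) = complex_of_real (?a t) + \<i> * complex_of_real (?b t)" for t
    by (simp add: complex_eq_iff)
  have j: "integrable M (\<lambda>t. complex_of_real (?a t))" "integrable M (\<lambda>t. \<i> * complex_of_real (?b t))"
    by (rule integrable_of_real[OF i(1)], rule Bochner_Integration.integrable_mult_right[OF integrable_of_real[OF i(2)]])
  show "set_integrable M S (\<lambda>t. Complex (a t) (b t))"
    unfolding set_integrable_def e by (rule Bochner_Integration.integrable_add[OF j])
  have "(LINT t|M. complex_of_real (?a t) + \<i> * complex_of_real (?b t))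
      = complex_of_real (LINT t|M. ?a t) + \<i> * complex_of_real (LINT t|M. ?b t)"
    unfolding Bochner_Integration.integral_add[OF j] Bochner_Integration.integral_mult_right_zero integral_complex_of_real ..
  then show "(LINT t:S|M. Complex (a t) (b t)) = Complex (LINT t:S|M. a t) (LINT t:S|M. b t)"
    unfolding set_lebesgue_integral_def e by (simp add: complex_eq_iff)
qed

text \<open>The real and the imaginary part of the complex pairing are the real pairings with \<open>\<phi>\<close> and with
  \<open>- \<i> \<phi>\<close>. Both are test functions, so that the complex equations reduce to real ones.\<close>

lemma half_space_pairing:
  fixes F :: "real \<Rightarrow> real^'n \<Rightarrow> (complex^'N)^('n option)"
  assumes F: "\<forall>t>0. F t \<in> L2" and c: "continuous_on {0<..} (\<lambda>t. pack (F t))" and t: "test_function half_space \<phi>"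
  shows "set_integrable lebesgue {0<..} (\<lambda>t. LINT x|lebesgue. F t x $ i $ \<alpha> * pderiv_tx j \<phi> t x)" (is ?A)
    "(LINT t:{0<..}|lebesgue. LINT x|lebesgue. F t x $ i $ \<alpha> * pderiv_tx j \<phi> t x)
      = Complex (RI \<alpha> (\<lambda>t. component i (pack (F t))) (pd j \<phi>)) (RI \<alpha> (\<lambda>t. component i (pack (F t))) (pd j (\<lambda>p. - \<i> * \<phi> p)))" (is ?B)
proof -
  let ?X = "\<lambda>t. component i (pack (F t))"
  note T = half_space_test[OF t]
  have cX: "continuous_on {0<..} ?X" by (rule bounded_linear.continuous_on[OF bounded_linear_component c])
  let ?a = "\<lambda>t. inner (?X t) (tv \<alpha> (slice (pd j \<phi>) t))" and ?b = "\<lambda>t. inner (?X t) (tv \<alpha> (slice (pd j (\<lambda>p. - \<i> * \<phi> p)) t))"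
  have e: "(LINT x|lebesgue. F t x $ i $ \<alpha> * pderiv_tx j \<phi> t x) = Complex (?a t) (?b t)" if "0 < t" for t
    unfolding pderiv_tx_slice fun_cong[OF pd_mult[OF T]] by (rule space_pairing[OF F[rule_format, OF that] slice_test[OF test_pd[OF T]]])
  have a: "set_integrable lebesgue {0<..} ?a" by (rule pairing_integrable[OF cX half_space_pd[OF t]])
  have b: "set_integrable lebesgue {0<..} ?b" by (rule pairing_integrable[OF cX half_space_pd[OF half_space_mult[OF t]]])
  have "indicat_real {0<..} t *\<^sub>R (LINT x|lebesgue. F t x $ i $ \<alpha> * pderiv_tx j \<phi> t x) = indicat_real {0<..} t *\<^sub>R Complex (?a t) (?b t)" for t
    using e[of t] by (cases "0 < t") simp_all
  note ee = ext[OF this]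
  show ?A unfolding set_integrable_def ee using Complex_set_integral(1)[OF a b] by (simp only: set_integrable_def)
  show ?B unfolding set_lebesgue_integral_def ee
    using Complex_set_integral(2)[OF a b] by (simp only: set_lebesgue_integral_def RI_def)
qed

lemma curl_free_iff:
  fixes U :: "real \<Rightarrow> real^'n \<Rightarrow> (complex^'N)^('n option)"
  assumes F: "\<forall>t>0. U t \<in> L2" and c: "continuous_on {0<..} (\<lambda>t. pack (U t))"
  shows "curl_free U \<longleftrightarrow> (\<forall>\<phi> i j \<alpha>. test_function half_space \<phi> \<longrightarrow>
    RI \<alpha> (\<lambda>t. component j (pack (U t))) (pd i \<phi>) = RI \<alpha> (\<lambda>t. component i (pack (U t))) (pd j \<phi>))" (is "_ \<longleftrightarrow> ?r")
proof
  assume "curl_free U"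
  then show ?r unfolding curl_free_def by (simp add: half_space_pairing(2)[where F=U, OF F c])
next
  assume r: ?r
  show "curl_free U" unfolding curl_free_def
  proof (intro allI impI)
    fix \<phi> :: "real \<times> (real^'n) \<Rightarrow> complex" and i j :: "'n option" and \<alpha> :: 'N
    assume t: "test_function half_space \<phi>"
    show "(LINT t:{0<..}|lebesgue. LINT x|lebesgue. U t x $ j $ \<alpha> * pderiv_tx i \<phi> t x)
      = (LINT t:{0<..}|lebesgue. LINT x|lebesgue. U t x $ i $ \<alpha> * pderiv_tx j \<phi> t x)"
      unfolding half_space_pairing(2)[where F=U, OF F c t]
      using r[rule_format, OF t] r[rule_format, OF half_space_mult[OF t]] by (simp only:)
  qed
qed

lemma div_free_iff:
  fixes W :: "real \<Rightarrow> real^'n \<Rightarrow> (complex^'N)^('n option)"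
  assumes F: "\<forall>t>0. W t \<in> L2" and c: "continuous_on {0<..} (\<lambda>t. pack (W t))"
  shows "div_free W \<longleftrightarrow> (\<forall>\<phi> \<alpha>. test_function half_space \<phi> \<longrightarrow>
    (\<Sum>i\<in>UNIV. RI \<alpha> (\<lambda>t. component i (pack (W t))) (pd i \<phi>)) = 0)" (is "_ \<longleftrightarrow> ?r")
proof -
  have *: "(LINT t:{0<..}|lebesgue. LINT x|lebesgue. (\<Sum>i\<in>UNIV. W t x $ i $ \<alpha> * pderiv_tx i \<phi> t x))
      = Complex (\<Sum>i\<in>UNIV. RI \<alpha> (\<lambda>t. component i (pack (W t))) (pd i \<phi>))
          (\<Sum>i\<in>UNIV. RI \<alpha> (\<lambda>t. component i (pack (W t))) (pd i (\<lambda>p. - \<i> * \<phi> p)))"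
    if t: "test_function half_space \<phi>" for \<phi> \<alpha>
  proof -
    have "indicat_real {0<..} t *\<^sub>R (LINT x|lebesgue. (\<Sum>i\<in>UNIV. W t x $ i $ \<alpha> * pderiv_tx i \<phi> t x))
        = (\<Sum>i\<in>UNIV. indicat_real {0<..} t *\<^sub>R (LINT x|lebesgue. W t x $ i $ \<alpha> * pderiv_tx i \<phi> t x))" for t
    proof (cases "0 < t")
      case True
      have "integrable lebesgue (\<lambda>x. W t x $ i $ \<alpha> * pderiv_tx i \<phi> t x)" for i
        unfolding pderiv_tx_slice
        by (rule component_integrable[OF head_L2[OF F[rule_format, OF True]] slice_test[OF test_pd[OF half_space_test[OF t]]]])
      then show ?thesis by (simp add: Bochner_Integration.integral_sum True)
    qed simp
    note e = ext[OF this]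
    have "(LINT t:{0<..}|lebesgue. LINT x|lebesgue. (\<Sum>i\<in>UNIV. W t x $ i $ \<alpha> * pderiv_tx i \<phi> t x))
        = (\<Sum>i\<in>UNIV. LINT t:{0<..}|lebesgue. LINT x|lebesgue. W t x $ i $ \<alpha> * pderiv_tx i \<phi> t x)"
      unfolding set_lebesgue_integral_def e
      by (rule Bochner_Integration.integral_sum) (use half_space_pairing(1)[where F=W, OF F c t] in \<open>simp only: set_integrable_def\<close>)
    then show ?thesis unfolding half_space_pairing(2)[where F=W, OF F c t] by (simp add: complex_eq_iff)
  qed
  show ?thesis
  proof
    assume d: "div_free W"
    show ?r
    proof (intro allI impI)
      fix \<phi> :: "real \<times> (real^'n) \<Rightarrow> complex" and \<alpha> :: 'N assume t: "test_function half_space \<phi>"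
      have "Complex (\<Sum>i\<in>UNIV. RI \<alpha> (\<lambda>t. component i (pack (W t))) (pd i \<phi>))
          (\<Sum>i\<in>UNIV. RI \<alpha> (\<lambda>t. component i (pack (W t))) (pd i (\<lambda>p. - \<i> * \<phi> p))) = 0"
        unfolding *[OF t, symmetric] using d t unfolding div_free_def by blast
      then show "(\<Sum>i\<in>UNIV. RI \<alpha> (\<lambda>t. component i (pack (W t))) (pd i \<phi>)) = 0" by (simp add: complex_eq_iff)
    qed
  next
    assume r: ?r
    show "div_free W" unfolding div_free_def
    proof (intro allI impI)
      fix \<phi> :: "real \<times> (real^'n) \<Rightarrow> complex" and \<alpha> :: 'N assume t: "test_function half_space \<phi>"
      show "(LINT t:{0<..}|lebesgue. LINT x|lebesgue. (\<Sum>i\<in>UNIV. W t x $ i $ \<alpha> * pderiv_tx i \<phi> t x)) = 0"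
        unfolding *[OF t] using r[rule_format, OF t] r[rule_format, OF half_space_mult[OF t, of "- \<i>"]] by (simp only: complex_eq_iff complex.sel zero_complex.sel)
    qed
  qed
qed

lemma RI_cong: "(\<And>t. 0 < t \<Longrightarrow> inner (X t) (tv \<alpha> (slice \<phi> t)) = inner (Y t) (tv \<alpha> (slice \<psi> t))) \<Longrightarrow> RI \<alpha> X \<phi> = RI \<alpha> Y \<psi>"
  unfolding RI_def by (rule set_lebesgue_integral_cong) auto

lemma RI_minus: "RI \<alpha> (\<lambda>t. - X t) \<phi> = - RI \<alpha> X \<phi>"
  by (simp add: RI_def set_lebesgue_integral_def)

lemma RI_zero: "RI \<alpha> (\<lambda>t. 0) \<phi> = 0"
  by (simp add: RI_def set_lebesgue_integral_def)

text \<open>\<open>weak_evolution\<close> with \<open>X = (T P)\<^sub>0\<close> and \<open>Z\<close> the tangential part of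
  \<open>T P\<close>; \<open>grad_graph_extend\<close> replaces test functions by arbitrary pairs in the graph.\<close>

lemma divergence_equation:
  fixes P V :: "real \<Rightarrow> (real^'n, complex^'N) l2 \<times> (real^'n, (complex^'N)^'n) l2"
  assumes der: "\<And>t. 0 < t \<Longrightarrow> (P has_vector_derivative V t) (at t)" and cV: "continuous_on {0<..} V"
    and T: "bounded_linear (T :: (real^'n, complex^'N) l2 \<times> (real^'n, (complex^'N)^'n) l2 \<Rightarrow> (real^'n, complex^'N) l2 \<times> (real^'n, (complex^'N)^'n) l2)"
  shows "(\<forall>\<phi> \<alpha>. test_function half_space \<phi> \<longrightarrow> (\<Sum>i\<in>UNIV. RI \<alpha> (\<lambda>t. component i (T (P t))) (pd i \<phi>)) = 0) \<longleftrightarrow>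
    (\<forall>t>0. \<forall>(g, y)\<in>grad_graph. inner (fst (T (V t))) g = inner (snd (T (P t))) y)" (is "?weak \<longleftrightarrow> ?strong")
proof -
  have cP: "continuous_on {0<..} P"
    by (rule continuous_at_imp_continuous_on) (auto intro: has_vector_derivative_continuous der)
  have d: "((\<lambda>t. fst (T (P t))) has_vector_derivative fst (T (V t))) (at t)" if "0 < t" for t
    by (rule bounded_linear.has_vector_derivative[OF bounded_linear_compose[OF bounded_linear_fst T] der[OF that]])
  have c1: "continuous_on {0<..} (\<lambda>t. fst (T (V t)))"
    by (rule continuous_on_fst[OF bounded_linear.continuous_on[OF T cV]])
  have c2: "continuous_on {0<..} (\<lambda>t. pr j (snd (T (P t))))" for j
    by (rule bounded_linear.continuous_on[OF bounded_linear_pr continuous_on_snd[OF bounded_linear.continuous_on[OF T cP]]])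
  have div: "(\<Sum>j\<in>UNIV. inner (pr j y) (tv \<alpha> (part j \<psi>))) = inner y (tdiv (\<lambda>j. e1 j \<alpha>) \<psi>)" if "test \<psi>"
    for y :: "(real^'n, (complex^'N)^'n) l2" and \<alpha> \<psi>
    by (simp add: tdiv_def inner_sum_right inner_e1[OF test_part[OF that]])
  have "?weak \<longleftrightarrow> (\<forall>\<alpha>. \<forall>t>0. \<forall>\<psi>. test \<psi> \<longrightarrow> inner (fst (T (V t))) (tv \<alpha> \<psi>) = inner (snd (T (P t))) (tdiv (\<lambda>j. e1 j \<alpha>) \<psi>))"
  proof -
    have eq: "(\<forall>t>0. \<forall>\<psi>. test \<psi> \<longrightarrow> inner (fst (T (V t))) (tv \<alpha> \<psi>) = (\<Sum>j\<in>UNIV. inner (pr j (snd (T (P t)))) (tv \<alpha> (part j \<psi>)))) \<longleftrightarrow>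
      (\<forall>t>0. \<forall>\<psi>. test \<psi> \<longrightarrow> inner (fst (T (V t))) (tv \<alpha> \<psi>) = inner (snd (T (P t))) (tdiv (\<lambda>j. e1 j \<alpha>) \<psi>))" for \<alpha>
      by (intro all_cong1 imp_cong refl, subst div, assumption, rule refl)
    have "(\<forall>\<phi>. test_function half_space \<phi> \<longrightarrow> (\<Sum>i\<in>UNIV. RI \<alpha> (\<lambda>t. component i (T (P t))) (pd i \<phi>)) = 0) \<longleftrightarrow>
      (\<forall>t>0. \<forall>\<psi>. test \<psi> \<longrightarrow> inner (fst (T (V t))) (tv \<alpha> \<psi>) = inner (snd (T (P t))) (tdiv (\<lambda>j. e1 j \<alpha>) \<psi>))" for \<alpha>
      using weak_evolution[of "\<lambda>t. fst (T (P t))" "\<lambda>t. fst (T (V t))" "\<lambda>j t. pr j (snd (T (P t)))" \<alpha>, OF d c1 c2]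
      by (simp only: sum_option component_simps eq)
    from this[symmetric] show ?thesis by (simp only:) blast
  qed
  also have "\<dots> \<longleftrightarrow> ?strong"
  proof
    assume l: "\<forall>\<alpha>. \<forall>t>0. \<forall>\<psi>. test \<psi> \<longrightarrow> inner (fst (T (V t))) (tv \<alpha> \<psi>) = inner (snd (T (P t))) (tdiv (\<lambda>j. e1 j \<alpha>) \<psi>)"
    show ?strong
    proof (intro allI impI ballI)
      fix t :: real and z assume t: "0 < t" and z: "z \<in> (grad_graph :: ((real^'n, complex^'N) l2 \<times> _) set)"
      have "inner (fst (T (V t))) (fst z) = inner (snd (T (P t))) (snd z)"
        by (rule grad_graph_extend[of _ _ "fst z" "snd z"]) (use l t z in simp_all)
      then show "case z of (g, y) \<Rightarrow> inner (fst (T (V t))) g = inner (snd (T (P t))) y" by (simp add: case_prod_unfold)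
    qed
  next
    assume s: ?strong
    show "\<forall>\<alpha>. \<forall>t>0. \<forall>\<psi>. test \<psi> \<longrightarrow> inner (fst (T (V t))) (tv \<alpha> \<psi>) = inner (snd (T (P t))) (tdiv (\<lambda>j. e1 j \<alpha>) \<psi>)"
    proof (intro allI impI)
      fix \<alpha> :: 'N and t :: real and \<psi> :: "real^'n \<Rightarrow> complex" assume t: "0 < t" and "test \<psi>"
      from s[rule_format, OF t test_in_grad_graph[OF this(2), of \<alpha>]]
      show "inner (fst (T (V t))) (tv \<alpha> \<psi>) = inner (snd (T (P t))) (tdiv (\<lambda>j. e1 j \<alpha>) \<psi>)" by simp
    qed
  qed
  finally show ?thesis .
qed

text \<open>\<open>weak_evolution\<close> with \<open>X = P\<^sub>k\<close>; the only nonzero \<open>Z\<close> is \<open>-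
  P\<^sub>0\<close> at the index \<open>k\<close>. The resulting identity is the definition of the weak gradient.\<close>

lemma normal_curl_equation:
  fixes P V :: "real \<Rightarrow> (real^'n, complex^'N) l2 \<times> (real^'n, (complex^'N)^'n) l2"
  assumes der: "\<And>t. 0 < t \<Longrightarrow> (P has_vector_derivative V t) (at t)" and cV: "continuous_on {0<..} V"
  shows "(\<forall>\<phi> k \<alpha>. test_function half_space \<phi> \<longrightarrow>
      RI \<alpha> (\<lambda>t. pr k (snd (P t))) (pd None \<phi>) = RI \<alpha> (\<lambda>t. fst (P t)) (pd (Some k) \<phi>)) \<longleftrightarrow>
    (\<forall>t>0. (fst (P t), snd (V t)) \<in> grad_graph)" (is "?weak \<longleftrightarrow> ?strong")
proof -
  have cP: "continuous_on {0<..} P"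
    by (rule continuous_at_imp_continuous_on) (auto intro: has_vector_derivative_continuous der)
  define Z where "Z k j t = (if j = k then - fst (P t) else 0)" for k j :: 'n and t
  have d: "((\<lambda>t. pr k (snd (P t))) has_vector_derivative pr k (snd (V t))) (at t)" if "0 < t" for t k
    by (rule bounded_linear.has_vector_derivative[OF bounded_linear_compose[OF bounded_linear_pr bounded_linear_snd] der[OF that]])
  have c1: "continuous_on {0<..} (\<lambda>t. pr k (snd (V t)))" for k
    by (rule bounded_linear.continuous_on[OF bounded_linear_pr continuous_on_snd[OF cV]])
  have c2: "continuous_on {0<..} (Z k j)" for k j
    by (cases "j = k") (simp_all add: Z_def[abs_def] continuous_on_minus[OF continuous_on_fst[OF cP]])
  have s1: "(\<Sum>j\<in>UNIV. RI \<alpha> (Z k j) (pd (Some j) \<phi>)) = - RI \<alpha> (\<lambda>t. fst (P t)) (pd (Some k) \<phi>)" for \<alpha> k \<phi>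
  proof -
    have "RI \<alpha> (Z k j) (pd (Some j) \<phi>) = (if j = k then - RI \<alpha> (\<lambda>t. fst (P t)) (pd (Some k) \<phi>) else 0)" for j
      by (simp add: Z_def[abs_def] RI_minus RI_zero)
    then show ?thesis by simp
  qed
  have s2: "(\<Sum>j\<in>UNIV. inner (Z k j t) (tv \<alpha> (part j \<psi>))) = - inner (fst (P t)) (tv \<alpha> (part k \<psi>))" for \<alpha> k \<psi> t
  proof -
    have "inner (Z k j t) (tv \<alpha> (part j \<psi>)) = (if j = k then - inner (fst (P t)) (tv \<alpha> (part k \<psi>)) else 0)" for j
      by (simp add: Z_def)
    then show ?thesis by simp
  qed
  have "?weak \<longleftrightarrow> (\<forall>k \<alpha>. \<forall>t>0. \<forall>\<psi>. test \<psi> \<longrightarrow> inner (pr k (snd (V t))) (tv \<alpha> \<psi>) = - inner (fst (P t)) (tv \<alpha> (part k \<psi>)))"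
  proof -
    have "(\<forall>\<phi>. test_function half_space \<phi> \<longrightarrow>
        RI \<alpha> (\<lambda>t. pr k (snd (P t))) (pd None \<phi>) = RI \<alpha> (\<lambda>t. fst (P t)) (pd (Some k) \<phi>)) \<longleftrightarrow>
      (\<forall>t>0. \<forall>\<psi>. test \<psi> \<longrightarrow> inner (pr k (snd (V t))) (tv \<alpha> \<psi>) = - inner (fst (P t)) (tv \<alpha> (part k \<psi>)))" for k \<alpha>
      using weak_evolution[of "\<lambda>t. pr k (snd (P t))" "\<lambda>t. pr k (snd (V t))" "Z k" \<alpha>, OF d c1 c2] unfolding s1 s2 by simp
    from this[symmetric] show ?thesis by (simp only:) blast
  qed
  also have "\<dots> \<longleftrightarrow> ?strong"
    unfolding grad_graph_iff by (auto simp: inner_e1 minus_equation_iff)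
  finally show ?thesis .
qed

text \<open>No \<open>t\<close>-derivative occurs, so it suffices that gradients are curl free at each time.\<close>

lemma tangential_curl_equation:
  fixes P :: "real \<Rightarrow> (real^'n, complex^'N) l2 \<times> (real^'n, (complex^'N)^'n) l2"
  assumes t: "test_function half_space \<phi>" and P: "\<And>t. 0 < t \<Longrightarrow> snd (P t) \<in> closure (snd ` grad_graph)"
  shows "RI \<alpha> (\<lambda>t. pr j (snd (P t))) (pd (Some i) \<phi>) = RI \<alpha> (\<lambda>t. pr i (snd (P t))) (pd (Some j) \<phi>)"
proof (rule RI_cong)
  fix s :: real assume s: "0 < s"
  have sl: "test (slice \<phi> s)" by (rule slice_test[OF half_space_test[OF t]])
  show "inner (pr j (snd (P s))) (tv \<alpha> (slice (pd (Some i) \<phi>) s)) = inner (pr i (snd (P s))) (tv \<alpha> (slice (pd (Some j) \<phi>) s))"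
    using grad_graph_curl[OF P[OF s] sl, of j \<alpha> i]
    by (simp only: part_slice[OF half_space_test[OF t]] inner_e1[OF slice_test[OF test_pd[OF half_space_test[OF t]]]])
qed

text \<open>The component of \<open>P\<close> orthogonal to \<open>S\<close> has derivative zero and tends to zero at infinity.
  This recovers \<open>U\<^sub>1 t\<close> in the closed range of the gradient from the equation for its derivative.\<close>

lemma range_of_gradient_invariant:
  fixes P V :: "real \<Rightarrow> 'b::{real_inner,banach}"
  assumes der: "\<And>t. 0 < t \<Longrightarrow> (P has_vector_derivative V t) (at t)"
    and S: "closed S" "subspace S" "\<And>t. 0 < t \<Longrightarrow> V t \<in> S" and lim: "(P \<longlongrightarrow> 0) at_top" and t: "0 < t"
  shows "P t \<in> S"
proof -
  obtain z where "z \<in> S" and "\<forall>v\<in>S. inner (P t - z) v = 0"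
    using closed_subspace_projection[OF S(1,2), of "P t"] by blast
  then have z: "z \<in> S" "\<And>v. v \<in> S \<Longrightarrow> inner (P t - z) v = 0" by blast+
  define n where "n = P t - z"
  have "((\<lambda>s. inner n (P s)) has_vector_derivative 0) (at s within {0<..})" if s: "s \<in> {0<..}" for s
  proof -
    have "((\<lambda>s. inner n (P s)) has_vector_derivative inner n (V s)) (at s within {0<..})"
      by (rule has_vector_derivative_at_within, rule bounded_linear.has_vector_derivative[OF bounded_linear_inner_right])
        (use s der in simp)
    then show ?thesis using z(2)[OF S(3)[of s]] s by (simp add: n_def)
  qed
  then have const: "inner n (P t) = inner n (P T)" if "t \<le> T" for T
    using that t by (intro constant_if_derivative_zero[where f = "\<lambda>s. inner n (P s)" and S = "{0<..}"]) auto
  have "\<forall>\<^sub>F T in at_top. inner n (P T) = inner n (P t)"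
    unfolding eventually_at_top_linorder by (intro exI[of _ t] allI impI) (rule const[symmetric])
  then have "((\<lambda>T. inner n (P T)) \<longlongrightarrow> inner n (P t)) at_top" by (rule tendsto_eventually)
  moreover have "((\<lambda>T. inner n (P T)) \<longlongrightarrow> inner n 0) at_top" by (rule tendsto_inner[OF tendsto_const lim])
  ultimately have "inner n (P t) = inner n 0" by (intro tendsto_unique[OF trivial_limit_at_top_linorder])
  moreover have "inner n z = 0" using z by (simp add: n_def)
  ultimately have "inner n n = 0" by (simp add: n_def inner_diff_right)
  then have "P t = z" by (simp add: n_def)
  then show ?thesis using z(1) by simp
qed

section \<open>Well-posedness\<close>

lemma divergence_iff:
  fixes U :: "real \<Rightarrow> real^'n \<Rightarrow> (complex^'N)^('n option)"
  assumes A: "A \<in> Linfty" and L: "\<forall>t>0. U t \<in> L2"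
    and der: "\<And>t. 0 < t \<Longrightarrow> ((\<lambda>t. pack (U t)) has_vector_derivative V t) (at t)" and cV: "continuous_on {0<..} V"
  shows "div_free (\<lambda>t x. block_mult (A x) (U t x)) \<longleftrightarrow>
    (\<forall>t>0. \<forall>(g, y)\<in>grad_graph. inner (fst (mult_op A (V t))) g = inner (snd (mult_op A (pack (U t)))) y)"
proof -
  obtain K where K: "\<And>u. norm (mult_op A u) \<le> K * norm u" by (rule mult_op_bound[OF A], rule that)
  have bl: "bounded_linear (mult_op A)"
    using linear_mult_op[OF A] K by (intro bounded_linear.intro bounded_linear_axioms.intro exI[of _ K]) (simp_all add: mult.commute)
  let ?W = "\<lambda>t x. block_mult (A x) (U t x)"
  have W: "\<forall>t>0. ?W t \<in> L2" using block_L2[OF A] L by blast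
  have e: "pack (?W t) = mult_op A (pack (U t))" if "0 < t" for t
    using mult_op_pack[OF A L[rule_format, OF that]] by simp
  have "continuous_on {0<..} (\<lambda>t. pack (U t))"
    by (rule continuous_at_imp_continuous_on) (auto intro: has_vector_derivative_continuous der)
  from bounded_linear.continuous_on[OF bl this]
  have "continuous_on {0<..} (\<lambda>t. pack (?W t))" by (rule continuous_on_eq) (simp add: e)
  note iff = div_free_iff[OF W this]
  have "RI \<alpha> (\<lambda>t. component i (pack (?W t))) \<psi> = RI \<alpha> (\<lambda>t. component i (mult_op A (pack (U t)))) \<psi>" for \<alpha> i \<psi>
    by (rule RI_cong) (simp add: e)
  then show ?thesis
    using divergence_equation[OF der cV bl] by (simp only: iff)
qed

lemma curl_iff:
  fixes U :: "real \<Rightarrow> real^'n \<Rightarrow> (complex^'N)^('n option)"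
  assumes L: "\<forall>t>0. U t \<in> L2"
    and der: "\<And>t. 0 < t \<Longrightarrow> ((\<lambda>t. pack (U t)) has_vector_derivative V t) (at t)" and cV: "continuous_on {0<..} V"
    and lim: "((\<lambda>t. pack (U t)) \<longlongrightarrow> 0) at_top"
  shows "curl_free U \<longleftrightarrow> (\<forall>t>0. (fst (pack (U t)), snd (V t)) \<in> grad_graph)" (is "_ \<longleftrightarrow> ?flow")
    and "curl_free U \<Longrightarrow> 0 < t \<Longrightarrow> snd (pack (U t)) \<in> closure (snd ` grad_graph)"
proof -
  let ?P = "\<lambda>t. pack (U t)"
  have "continuous_on {0<..} ?P"
    by (rule continuous_at_imp_continuous_on) (auto intro: has_vector_derivative_continuous der)
  note iff = curl_free_iff[OF L this]
  have normal: "(\<forall>\<phi> k \<alpha>. test_function half_space \<phi> \<longrightarrow>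
      RI \<alpha> (\<lambda>t. pr k (snd (?P t))) (pd None \<phi>) = RI \<alpha> (\<lambda>t. fst (?P t)) (pd (Some k) \<phi>)) \<longleftrightarrow> ?flow"
    by (rule normal_curl_equation[OF der cV])
  have ran: "snd (?P t) \<in> closure (snd ` grad_graph)" if fl: ?flow and t: "0 < t" for t
  proof (rule range_of_gradient_invariant[where P = "\<lambda>t. snd (?P t)" and V = "\<lambda>t. snd (V t)"])
    show "((\<lambda>t. snd (?P t)) has_vector_derivative snd (V t)) (at t)" if "0 < t" for t
      by (rule bounded_linear.has_vector_derivative[OF bounded_linear_snd der[OF that]])
    have "subspace (snd ` (grad_graph :: ((real^'n, complex^'N) l2 \<times> _) set))"
      by (rule linear_subspace_image[OF bounded_linear.linear[OF bounded_linear_snd] subspace_grad_graph])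
    then show "subspace (closure (snd ` (grad_graph :: ((real^'n, complex^'N) l2 \<times> _) set)))" by (rule subspace_closure')
    show "snd (V t) \<in> closure (snd ` grad_graph)" if "0 < t" for t
      using fl[rule_format, OF that] closure_subset[of "snd ` grad_graph"] by force
    show "((\<lambda>t. snd (?P t)) \<longlongrightarrow> 0) at_top" using tendsto_snd[OF lim] by simp
  qed (use t in auto)
  have d1: ?flow if c: "curl_free U"
    unfolding normal[symmetric]
  proof (intro allI impI)
    fix \<phi> :: "real \<times> (real^'n) \<Rightarrow> complex" and k and \<alpha> :: 'N assume "test_function half_space \<phi>"
    then show "RI \<alpha> (\<lambda>t. pr k (snd (?P t))) (pd None \<phi>) = RI \<alpha> (\<lambda>t. fst (?P t)) (pd (Some k) \<phi>)"
      using c[unfolded iff, rule_format, of \<phi> \<alpha> "Some k" None] by simp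
  qed
  have d2: "curl_free U" if fl: ?flow
    unfolding iff
  proof (intro allI impI)
    fix \<phi> :: "real \<times> (real^'n) \<Rightarrow> complex" and i j :: "'n option" and \<alpha> :: 'N
    assume t: "test_function half_space \<phi>"
    have n: "RI \<alpha> (\<lambda>t. pr k (snd (?P t))) (pd None \<phi>) = RI \<alpha> (\<lambda>t. fst (?P t)) (pd (Some k) \<phi>)" for k
      using fl t unfolding normal[symmetric] by blast
    show "RI \<alpha> (\<lambda>t. component j (?P t)) (pd i \<phi>) = RI \<alpha> (\<lambda>t. component i (?P t)) (pd j \<phi>)"
      by (cases i; cases j) (simp_all add: n tangential_curl_equation[OF t ran[OF fl]])
  qed
  show "curl_free U \<longleftrightarrow> ?flow" using d1 d2 by blast
  show "curl_free U \<Longrightarrow> 0 < t \<Longrightarrow> snd (pack (U t)) \<in> closure (snd ` grad_graph)" using ran d1 by blast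
qed

lemma trace_iff:
  assumes A: "A \<in> Linfty" and u: "u \<in> L2" and w: "w \<in> L2"
  shows "(AE x in lebesgue. block_mult (A x) (u x) $ None = w x) \<longleftrightarrow> fst (mult_op A (pack u)) = cls w"
proof -
  let ?F = "\<lambda>x. block_mult (A x) (u x)"
  have L: "(\<lambda>x. ?F x $ None) \<in> L2" by (rule head_L2[OF block_L2[OF A u]])
  have e: "fst (mult_op A (pack u)) = cls (\<lambda>x. ?F x $ None)"
    using component_pack[OF block_L2[OF A u], of None] by (simp add: mult_op_pack[OF A u])
  show ?thesis
  proof
    assume "AE x in lebesgue. ?F x $ None = w x"
    then show "fst (mult_op A (pack u)) = cls w" unfolding e by (rule cls_eqI[OF L w])
  next
    assume "fst (mult_op A (pack u)) = cls w"
    then have "cls (\<lambda>x. ?F x $ None) = cls w" using e by simp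
    with rep_cls[OF L] have "AE x in lebesgue. rep (cls w) x = ?F x $ None" by simp
    with rep_cls[OF w] show "AE x in lebesgue. ?F x $ None = w x" by eventually_elim simp
  qed
qed

lemma limit_iff:
  assumes L: "\<forall>t>0. U t \<in> L2" and u: "u \<in> L2" and F: "\<forall>\<^sub>F t in F. 0 < t"
  shows "((\<lambda>t. L2_norm (\<lambda>x. U t x - u x)) \<longlongrightarrow> 0) F \<longleftrightarrow> ((\<lambda>t. pack (U t)) \<longlongrightarrow> pack u) F"
proof -
  have "\<forall>\<^sub>F t in F. norm (pack (U t) - pack u) = L2_norm (\<lambda>x. U t x - u x)"
    using F by eventually_elim (use L u in \<open>simp add: norm_pack[symmetric] pack_diff L2_diff\<close>)
  from tendsto_cong[OF this, of 0] show ?thesis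
    by (simp add: tendsto_norm_zero_iff LIM_zero_iff)
qed

text \<open>The Neumann problem and the abstract evolution agree: equations, limits and boundary condition are translated
  separately.\<close>

lemma neumann_solution_iff:
  fixes A :: "real^'n \<Rightarrow> ((complex^'N^'N)^('n option))^('n option)"
  assumes A: "A \<in> Linfty" and w: "w \<in> L2" and S: "first_order_system grad_graph (mult_op A) \<kappa> M"
  shows "neumann_solution A w U \<longleftrightarrow> (\<forall>t>0. U t \<in> L2) \<and> (\<exists>V u.
    (\<forall>t>0. ((\<lambda>t. pack (U t)) has_vector_derivative V t) (at t) \<and>
      (pack (U t), V t) \<in> first_order_system.flow grad_graph (mult_op A) \<and>
      snd (pack (U t)) \<in> closure (snd ` grad_graph)) \<and>
    continuous_on {0<..} V \<and> ((\<lambda>t. pack (U t)) \<longlongrightarrow> 0) at_top \<and>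
    ((\<lambda>t. pack (U t)) \<longlongrightarrow> u) (at_right 0) \<and> fst (mult_op A u) = cls w)" (is "_ \<longleftrightarrow> ?L \<and> (\<exists>V u. ?r V u)")
proof -
  interpret first_order_system grad_graph "mult_op A" \<kappa> M by (rule S)
  have zero: "pack (\<lambda>x. 0 :: (complex^'N)^('n option)) = 0"
    using pack_scaleR[OF L2_zero, of 0] by simp
  have top: "((\<lambda>t. L2_norm (U t)) \<longlongrightarrow> 0) at_top \<longleftrightarrow> ((\<lambda>t. pack (U t)) \<longlongrightarrow> 0) at_top" if ?L
    using limit_iff[OF that L2_zero eventually_gt_at_top[of 0]] by (simp add: zero)
  have right: "((\<lambda>t. L2_norm (\<lambda>x. U t x - u x)) \<longlongrightarrow> 0) (at_right 0) \<longleftrightarrow> ((\<lambda>t. pack (U t)) \<longlongrightarrow> pack u) (at_right 0)"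
    if ?L "u \<in> L2" for u
    by (rule limit_iff[OF that]) (simp add: eventually_at_filter)
  show ?thesis
  proof
    assume s: "neumann_solution A w U"
    then obtain V where L: ?L and der: "\<And>t. 0 < t \<Longrightarrow> ((\<lambda>t. pack (U t)) has_vector_derivative V t) (at t)"
      and cV: "continuous_on {0<..} V"
      unfolding neumann_solution_def C1_L2_iff by blast
    obtain u where u: "u \<in> L2" "((\<lambda>t. L2_norm (\<lambda>x. U t x - u x)) \<longlongrightarrow> 0) (at_right 0)"
      "AE x in lebesgue. block_mult (A x) (u x) $ None = w x" using s unfolding neumann_solution_def by blast
    have div: "div_free (\<lambda>t x. block_mult (A x) (U t x))" and curl: "curl_free U"
      and "((\<lambda>t. L2_norm (U t)) \<longlongrightarrow> 0) at_top" using s unfolding neumann_solution_def by blast+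
    from this(3) have lim: "((\<lambda>t. pack (U t)) \<longlongrightarrow> 0) at_top" using top[OF L] by simp
    have "?r V (pack u)"
    proof (intro conjI allI impI)
      fix t :: real assume t: "0 < t"
      show "((\<lambda>t. pack (U t)) has_vector_derivative V t) (at t)" by (rule der[OF t])
      show "(pack (U t), V t) \<in> flow"
        using divergence_iff[OF A L der cV] div curl_iff(1)[OF L der cV lim] curl t by (simp add: flow_def)
      show "snd (pack (U t)) \<in> closure (snd ` grad_graph)" by (rule curl_iff(2)[OF L der cV lim curl t])
    next
      show "((\<lambda>t. pack (U t)) \<longlongrightarrow> pack u) (at_right 0)" using right[OF L u(1)] u(2) by simp
      show "fst (mult_op A (pack u)) = cls w" using trace_iff[OF A u(1) w] u(3) by simp
    qed (fact cV lim)+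
    then have "\<exists>V u. ?r V u" by (intro exI)
    with L show "?L \<and> (\<exists>V u. ?r V u)" by (rule conjI)
  next
    assume "?L \<and> (\<exists>V u. ?r V u)"
    then have L: ?L and "\<exists>V u. ?r V u" by (rule conjunct1, rule conjunct2)
    from this(2) obtain V u where r: "?r V u" by (elim exE) (rule that)
    have der: "((\<lambda>t. pack (U t)) has_vector_derivative V t) (at t)" if "0 < t" for t using r that by simp
    have cV: "continuous_on {0<..} V" and lim: "((\<lambda>t. pack (U t)) \<longlongrightarrow> 0) at_top"
      and lim0: "((\<lambda>t. pack (U t)) \<longlongrightarrow> u) (at_right 0)" and tr: "fst (mult_op A u) = cls w" using r by simp_all
    have fl: "(pack (U t), V t) \<in> flow" if "0 < t" for t using r that by simp
    show "neumann_solution A w U" unfolding neumann_solution_def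
    proof (intro conjI)
      show "C1_L2 U" unfolding C1_L2_iff using L der cV by (intro conjI exI[of _ V]) simp_all
      show "div_free (\<lambda>t x. block_mult (A x) (U t x))"
        using divergence_iff[OF A L der cV] fl by (simp add: flow_def)
      show "curl_free U" using curl_iff(1)[OF L der cV lim] fl by (simp add: flow_def)
      show "((\<lambda>t. L2_norm (U t)) \<longlongrightarrow> 0) at_top" using top[OF L] lim by simp
      show "\<exists>u\<in>L2. ((\<lambda>t. L2_norm (\<lambda>x. U t x - u x)) \<longlongrightarrow> 0) (at_right 0) \<and>
        (AE x in lebesgue. block_mult (A x) (u x) $ None = w x)"
        using right[OF L unpack_L2, of u] trace_iff[OF A unpack_L2 w, of u] lim0 tr
        by (intro bexI[of _ "unpack u"]) simp_all
    qed
  qed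
qed

theorem proposition8p1:
  fixes A :: "real^'n \<Rightarrow> ((complex^'N^'N)^('n option))^('n option)"
  assumes "A \<in> Linfty"
    and "\<exists>\<kappa>>0. \<forall>f\<in>L2. \<forall>g\<in>Hdot1. \<forall>Dg. weak_gradient g Dg \<longrightarrow>
      Re (L2_inner (\<lambda>x. block_mult (A x) (join (f x) (Dg x))) (\<lambda>x. join (f x) (Dg x)))
        \<ge> \<kappa> * ((L2_norm f)\<^sup>2 + (L2_norm Dg)\<^sup>2)"
    and "AE x in lebesgue. self_adjoint_block (A x)"
  shows "neumann_well_posed A"
proof -
  obtain \<kappa> where \<kappa>: "0 < \<kappa>" "\<forall>f\<in>L2. \<forall>g\<in>Hdot1. \<forall>Dg. weak_gradient g Dg \<longrightarrow>
      Re (L2_inner (\<lambda>x. block_mult (A x) (join (f x) (Dg x))) (\<lambda>x. join (f x) (Dg x)))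
        \<ge> \<kappa> * ((L2_norm f)\<^sup>2 + (L2_norm Dg)\<^sup>2)"
    using assms(2) by (elim exE conjE) (rule that)
  obtain M where S: "first_order_system grad_graph (mult_op A) \<kappa> M"
    by (rule first_order_system_mult_op[OF assms(1) \<kappa>(1) assms(3) \<kappa>(2)], rule that)
  interpret first_order_system grad_graph "mult_op A" \<kappa> M by (rule S)
  show ?thesis unfolding neumann_well_posed_def
  proof (intro ballI conjI allI impI)
    fix w :: "real^'n \<Rightarrow> complex^'N" assume w: "w \<in> L2"
    note iff = neumann_solution_iff[OF assms(1) w S]
    obtain U V u where U: "\<forall>t>0. (U has_vector_derivative V t) (at t) \<and> (U t, V t) \<in> flow \<and> snd (U t) \<in> closure (snd ` grad_graph)"
      "continuous_on {0<..} V" "(U \<longlongrightarrow> 0) at_top" "(U \<longlongrightarrow> u) (at_right 0)" "fst (mult_op A u) = cls w"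
      using neumann_exists[of "cls w"] by (elim exE conjE) (rule that)
    have "neumann_solution A w (\<lambda>t. unpack (U t))"
      unfolding iff pack_unpack using U by (intro conjI exI[of _ V] exI[of _ u]) simp_all
    then show "\<exists>U. neumann_solution A w U" by (rule exI[of "neumann_solution A w"])
  next
    fix w :: "real^'n \<Rightarrow> complex^'N" and U1 U2 and t :: real
    assume w: "w \<in> L2" and sol: "neumann_solution A w U1 \<and> neumann_solution A w U2" and t: "0 < t"
    note iff = neumann_solution_iff[OF assms(1) w S]
    obtain V1 u1 where 1: "\<forall>t>0. U1 t \<in> L2" "\<forall>t>0. ((\<lambda>t. pack (U1 t)) has_vector_derivative V1 t) (at t) \<and>
        (pack (U1 t), V1 t) \<in> flow \<and> snd (pack (U1 t)) \<in> closure (snd ` grad_graph)"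
      "((\<lambda>t. pack (U1 t)) \<longlongrightarrow> 0) at_top" "((\<lambda>t. pack (U1 t)) \<longlongrightarrow> u1) (at_right 0)" "fst (mult_op A u1) = cls w"
      using sol unfolding iff by (elim conjE exE) (rule that)
    obtain V2 u2 where 2: "\<forall>t>0. U2 t \<in> L2" "\<forall>t>0. ((\<lambda>t. pack (U2 t)) has_vector_derivative V2 t) (at t) \<and>
        (pack (U2 t), V2 t) \<in> flow \<and> snd (pack (U2 t)) \<in> closure (snd ` grad_graph)"
      "((\<lambda>t. pack (U2 t)) \<longlongrightarrow> 0) at_top" "((\<lambda>t. pack (U2 t)) \<longlongrightarrow> u2) (at_right 0)" "fst (mult_op A u2) = cls w"
      using sol unfolding iff by (elim conjE exE) (rule that)
    have sub: "subspace (closure (snd ` (grad_graph :: ((real^'n, complex^'N) l2 \<times> _) set)))"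
      by (intro subspace_closure' linear_subspace_image[OF bounded_linear.linear[OF bounded_linear_snd] subspace_grad_graph])
    have "pack (U1 t) - pack (U2 t) = 0"
    proof (rule neumann_unique[where U = "\<lambda>t. pack (U1 t) - pack (U2 t)" and V = "\<lambda>t. V1 t - V2 t" and u = "u1 - u2"])
      fix t :: real assume t: "0 < t"
      show "((\<lambda>t. pack (U1 t) - pack (U2 t)) has_vector_derivative V1 t - V2 t) (at t)"
        using 1(2) 2(2) t by (intro has_vector_derivative_diff) simp_all
      show "(pack (U1 t) - pack (U2 t), V1 t - V2 t) \<in> flow" using 1(2) 2(2) t by (intro flow_diff) simp_all
      show "snd (pack (U1 t) - pack (U2 t)) \<in> closure (snd ` grad_graph)"
        unfolding snd_diff using 1(2) 2(2) t by (intro subspace_diff[OF sub]) simp_all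
    next
      show "((\<lambda>t. pack (U1 t) - pack (U2 t)) \<longlongrightarrow> u1 - u2) (at_right 0)" by (rule tendsto_diff[OF 1(4) 2(4)])
      show "((\<lambda>t. pack (U1 t) - pack (U2 t)) \<longlongrightarrow> 0) at_top" using tendsto_diff[OF 1(3) 2(3)] by simp
      show "fst (mult_op A (u1 - u2)) = 0" by (simp add: linear_diff[OF linear_A] 1(5) 2(5))
    qed (rule t)
    then have "pack (U1 t) = pack (U2 t)" by simp
    with unpack_pack[of "U1 t"] 1(1) t have "AE x in lebesgue. unpack (pack (U2 t)) x = U1 t x" by simp
    moreover have "AE x in lebesgue. unpack (pack (U2 t)) x = U2 t x" by (rule unpack_pack) (use 2(1) t in simp)
    ultimately show "AE x in lebesgue. U1 t x = U2 t x" by eventually_elim simp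
  qed
qed

end
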